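(* Let $c>0$ be a fixed real number and, for $x\ge 1$, let $$S_{d,c}(x)=\sum_{1\le n\leq x^{1/c}} d\!\left(\left[\frac{x}{n^c}\right]\right).$$ Define $$\theta_c=\begin{cases}\dfrac{2c+2}{2c^2+5c+2}, & 0<c<\dfrac{2}{3},\\[2mm] \dfrac{5}{5c+6}, & c\geq \dfrac{2}{3},\end{cases}$$ (equivalently $\theta_c=\max\{(2c+2)/(2c^2+5c+2),\,5/(5c+6)\}$). Then for every $\varepsilon>0$, $$S_{d,c}(x)=x^{1/c}\sum_{k\geq1}d(k)\left(\frac{1}{k^{1/c}}-\frac{1}{(k+1)^{1/c}}\right)+O_{\varepsilon,c}\!\left(x^{\theta_c+\varepsilon}\right)$$ as $x\to\infty$, where the implied constant depends only on $\varepsilon$ and $c$.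
   Context: $d(n)$ denotes the number of positive divisors of the positive integer $n$, and $[t]$ denotes the integer part (floor) of the real number $t$. The series $\sum_{k\ge1} d(k)\bigl(k^{-1/c}-(k+1)^{-1/c}\bigr)$ converges and defines a constant depending only on $c$. The notation $f=O_{\varepsilon,c}(g)$ means $|f|\le Cg$ for a constant $C$ depending only on $\varepsilon$ and $c$. *)

theory Defs
  imports "HOL-Analysis.Analysis" "HOL-Library.Landau_Symbols"
begin

definition divisor_count :: "nat \<Rightarrow> nat" where
  "divisor_count n = card {m. m dvd n \<and> m > 0}"

definition S_dc :: "real \<Rightarrow> real \<Rightarrow> real" where
  "S_dc c x = (\<Sum>n\<in>{n::nat. 1 \<le> n \<and> real n \<le> x powr (1/c)}.
                  real (divisor_count (nat \<lfloor>x / real n powr c\<rfloor>)))"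

definition theta_c :: "real \<Rightarrow> real" where
  "theta_c c = (if c < 2/3 then (2*c+2) / (2*c^2 + 5*c + 2) else 5 / (5*c+6))"

definition const_dc :: "real \<Rightarrow> real" where
  "const_dc c = (\<Sum>k. real (divisor_count (Suc k)) *
                    (1 / real (Suc k) powr (1/c) - 1 / real (Suc k + 1) powr (1/c)))"

end

theory Submission
 imports Defs "HOL-Computational_Algebra.Primes"
begin

text \<open>
 Write \<open>F k = (x / k) powr (1/c)\<close> and \<open>N = x powr theta_c c\<close>. The \<open>n\<close> with floor value \<open>k\<close> lie in
 \<open>(F (k+1), F k]\<close>, so up to \<open>O(N x\<^sup>\<epsilon>)\<close> the error term is a sum of \<open>d(k) (\<psi>(F (k+1)) - \<psi>(F k))\<close> over
 \<open>k <= x / N\<^sup>c\<close>. On a dyadic range \<open>k ~ K\<close> the function \<open>\<psi>\<close> is replaced by \<open>K / N\<close> harmonics, and it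
 suffices to bound the sum of \<open>d(k) e(h F k)\<close> by about \<open>\<surd>K max(K, X)\<^sup>1\<^sup>/\<^sup>3\<close>, where \<open>X = h F K\<close>.
 Opening \<open>d(k)\<close> gives a sum over \<open>k = a b\<close> of a monomial phase in two variables. The region is cut
 into boxes on which the coordinates vary by a small proportion. On each box a two-dimensional Weyl shift
 produces differenced phases whose Hessian determinant is an explicit binary quadratic form
 in the shift. Where it is not too small, summation by parts over the lattice saves the full factor;
 the few shifts near its two zero lines are handled by the second derivative test in one variable.
\<close>

section \<open>Exponential sums in one variable\<close>

text \<open>The target for a dyadic range is \<open>sqrt K * g\<close> with
  \<open>g = max(K, X)^(1/3)\<close>. Boxes have relative side \<open>w = B / g^2\<close> and Weyl
  shifts relative length \<open>\<rho> = c * g^2 / X\<close>. Then the increments of the phase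
  differenced by a shift and once more inside the box, of order \<open>X * \<rho> * w / B\<close>,
  stay below 1/2, so that no stationary phase expansion enters, and \<open>X <= g^3\<close> makes
  the zero shift cost no more than the others. Requiring \<open>sqrt K * g <= N\<close> for all
  frequencies up to \<open>K / N\<close> produces the exponent: at the upper end
  \<open>K = x / N^c\<close> the condition \<open>K^(5/6) <= N\<close> is
  \<open>5 <= \<theta> * (5 * c + 6)\<close>. The obstacle is that for every \<open>ga > 0\<close>
  the determinant of the differenced Hessian vanishes on two real lines. On these lines the pure
  second derivative in \<open>b\<close> still has full size, which is why a one-variable estimate
  remains available exactly where the two-dimensional one fails. All constants depend on
  \<open>ga = 1 / c\<close> only, hence the uniformity in \<open>x\<close>.\<close>

definition ee :: "real => complex" where "ee t = cis (2 * pi * t)"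

lemma ee_add: "ee (s + t) = ee s * ee t"
 by (simp add: ee_def cis_mult algebra_simps)

lemma ee_diff: "ee (s - t) = ee s * cnj (ee t)"
 by (simp add: ee_def cis_mult cis_cnj algebra_simps)

lemma norm_ee [simp]: "norm (ee t) = 1"
 by (simp add: ee_def)

lemma ee_0 [simp]: "ee 0 = 1" by (simp add: ee_def)

lemma ee_of_int [simp]: "ee (of_int k) = 1"
 by (simp add: ee_def complex_eq_iff cos_int_2pin sin_int_2pin)

lemma ee_add_int: "ee (t + of_int k) = ee t" by (simp add: ee_add)

lemma ee_minus: "ee (- t) = cnj (ee t)" by (simp add: ee_def cis_cnj)

lemma norm_ee_minus_one: "norm (ee t - 1) = 2 * \<bar>sin (pi * t)\<bar>"
proof -
 have "(norm (ee t - 1))\<^sup>2 = (cos (2*(pi*t)) - 1)\<^sup>2 + (sin (2*(pi*t)))\<^sup>2"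
  by (simp add: cmod_power2 ee_def mult.assoc)
 also have "... = 4 * (sin (pi*t))\<^sup>2 * ((sin (pi*t))\<^sup>2 + (cos (pi*t))\<^sup>2)"
  by (simp only: cos_double_sin sin_double) algebra
 also have "... = (2 * \<bar>sin (pi * t)\<bar>)\<^sup>2" by (simp add: power_mult_distrib)
 finally show ?thesis by (rule power2_eq_imp_eq) auto
qed

lemma norm_ee_diff_le: "norm (ee s - ee t) <= 2 * pi * \<bar>s - t\<bar>"
proof -
 have "ee s - ee t = ee t * (ee (s - t) - 1)"
  using ee_add[of t "s - t"] by (simp add: algebra_simps)
 then have "norm (ee s - ee t) = 2 * \<bar>sin (pi * (s - t))\<bar>"
  by (simp add: norm_mult norm_ee_minus_one)
 also have "... <= 2 * \<bar>pi * (s - t)\<bar>" using abs_sin_x_le_abs_x[of "pi*(s-t)"] by simp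
 finally show ?thesis by (simp add: abs_mult)
qed

text \<open>Jordan's inequality: on \<open>[0, pi/2]\<close> the concave sine lies above its
  chord.\<close>

lemma sin_ge_two_over_pi:
 assumes "0 <= x" "x <= pi/2" shows "sin x >= 2 / pi * x"
proof -
 have "convex_on {0..pi/2} (\<lambda>x. - sin x)"
  by (rule f''_ge0_imp_convex[of _ _ "\<lambda>x. - cos x" "\<lambda>x. sin x"])
    (auto intro!: derivative_eq_intros sin_ge_zero)
 then have "- sin ((1 - 2*x/pi) *\<^sub>R 0 + (2*x/pi) *\<^sub>R (pi/2)) <= (1-2*x/pi) * (- sin 0) + (2*x/pi) * (- sin (pi/2))"
  by (rule convex_onD) (use assms in \<open>auto simp: field_simps\<close>)
 then show ?thesis by simp
qed

lemma norm_ee_minus_one_ge: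
 assumes "\<bar>t\<bar> <= 1/2" shows "norm (ee t - 1) >= 4 * \<bar>t\<bar>"
proof -
 have "sin (pi * \<bar>t\<bar>) >= 2 / pi * (pi * \<bar>t\<bar>)"
  by (rule sin_ge_two_over_pi) (use assms in auto)
 moreover have "\<bar>sin (pi * t)\<bar> = \<bar>sin (pi * \<bar>t\<bar>)\<bar>" by (cases "t >= 0") auto
 ultimately show ?thesis unfolding norm_ee_minus_one by auto
qed

lemma sin_pi_ge:
 assumes "\<theta> <= d" "d <= 1 - \<theta>" "0 < \<theta>" shows "sin (pi * d) >= 2 * \<theta>"
proof (cases "d <= 1/2")
 case True
 have "sin (pi * d) >= 2 / pi * (pi * d)"
  by (rule sin_ge_two_over_pi) (use assms True in auto)
 then show ?thesis using assms by simp
next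
 case False
 have "sin (pi * (1-d)) >= 2 / pi * (pi * (1-d))"
  by (rule sin_ge_two_over_pi) (use assms False in auto)
 moreover have "sin (pi * (1-d)) = sin (pi * d)" using sin_pi_minus[of "pi*d"] by (simp add: algebra_simps)
 ultimately show ?thesis using assms by simp
qed

text \<open>The real part of \<open>1 / (ee d - 1)\<close> is constant, so these coefficients vary
  only through a cotangent. For monotone \<open>d\<close> inside \<open>(0, 1)\<close> their total
  variation therefore telescopes.\<close>

lemma inverse_ee_minus_one:
 assumes "sin (pi * d) \<noteq> 0"
 shows "1 / (ee d - 1) = Complex (-1/2) (- (cos (pi*d) / sin (pi*d)) / 2)"
proof -
 have nz: "ee d - 1 \<noteq> 0" using assms norm_ee_minus_one[of d] by auto
 have s: "ee d = Complex ((cos (pi*d))\<^sup>2 - (sin (pi*d))\<^sup>2) (2 * sin (pi*d) * cos (pi*d))"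
  using cos_double[of "pi*d"] sin_double[of "pi*d"]
  by (simp add: ee_def complex_eq_iff mult.assoc)
 have t: "(sin (pi*d))\<^sup>2 + (cos (pi*d))\<^sup>2 = 1" by simp
 have "Complex (-1/2) (- (cos (pi*d) / sin (pi*d)) / 2) * (ee d - 1) = 1"
 proof -
  define S C where "S = sin (pi*d)" and "C = cos (pi*d)"
  have S: "S \<noteq> 0" "S*S + C*C = 1" using assms t by (auto simp: S_def C_def power2_eq_square)
  have "(-1/2) * (C^2 - S^2 - 1) - (- (C / S) / 2) * (2 * S * C) = 1"
   "(-1/2) * (2 * S * C) + (- (C / S) / 2) * (C^2 - S^2 - 1) = 0"
   using S by (simp_all add: field_simps power2_eq_square) algebra+
  then show ?thesis unfolding s S_def[symmetric] C_def[symmetric] by (simp add: complex_eq_iff)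
 qed
 then show ?thesis using nz by (simp add: field_simps)
qed

lemma sum_by_parts_telescope:
 fixes t e :: "nat => 'a::comm_ring_1"
 shows "(\<Sum>n<Suc N. t n * (e (Suc n) - e n)) = t N * e (Suc N) - t 0 * e 0 - (\<Sum>n<N. e (Suc n) * (t (Suc n) - t n))"
 by (induction N) (auto simp: algebra_simps)

text \<open>Kusmin-Landau inequality. With \<open>t n = 1 / (ee (d n) - 1)\<close> each term equals
  \<open>t n * (ee (x (Suc n)) - ee (x n))\<close>; summation by parts leaves two end terms and the
  variation of \<open>t\<close>, which is half that of a monotone cotangent. The increments are
  controlled up to \<open>x N\<close>, one place past the last summand.\<close>

lemma kusmin_landau_nat:
 fixes x :: "nat => real" and k :: int
 assumes \<theta>: "\<theta> > 0"
  and D: "\<And>n. n < N ==> \<theta> <= x (Suc n) - x n - k \<and> x (Suc n) - x n - k <= 1 - \<theta>"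
  and mono: "\<And>n. Suc n < N ==> x (Suc n) - x n <= x (Suc (Suc n)) - x (Suc n)"
 shows "norm (\<Sum>n<N. ee (x n)) <= 1 / \<theta>"
proof (cases N)
 case 0 then show ?thesis using \<theta> by simp
next
 case (Suc M)
 define d where "d n = x (Suc n) - x n - k" for n
 define t where "t n = 1 / (ee (d n) - 1)" for n
 define c where "c n = cos (pi * d n) / sin (pi * d n)" for n
 have s: "sin (pi * d n) >= 2 * \<theta>" if "n <= M" for n
  using sin_pi_ge[of \<theta> "d n"] D[of n] that Suc \<theta> by (auto simp: d_def)
 have s0: "sin (pi * d n) > 0" if "n <= M" for n using s[OF that] \<theta> by linarith
 have teq: "t n = Complex (-1/2) (- c n / 2)" if "n <= M" for n
  using inverse_ee_minus_one[of "d n"] s0[OF that] by (simp add: t_def c_def)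
 have nz: "ee (d n) \<noteq> 1" if "n <= M" for n
  using s0[OF that] norm_ee_minus_one[of "d n"] by auto
 have nt: "norm (t n) <= 1 / (4 * \<theta>)" if "n <= M" for n
 proof -
  have "norm (ee (d n) - 1) >= 4 * \<theta>" unfolding norm_ee_minus_one using s[OF that] \<theta> by simp
  then show ?thesis unfolding t_def norm_divide using \<theta> by (simp add: frac_le)
 qed
 have cb: "\<bar>c n\<bar> <= 1 / (2 * \<theta>)" if "n <= M" for n
  unfolding c_def abs_divide using s[OF that] \<theta> by (intro frac_le) auto
 have cm: "c (Suc n) <= c n" if "Suc n <= M" for n
 proof -
  have a: "d n <= d (Suc n)" using mono[of n] that Suc by (auto simp: d_def)
  have b: "d (Suc n) <= 1" "d n >= 0" using D[of n] D[of "Suc n"] that Suc \<theta> by (auto simp: d_def)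
  have "sin (pi * d (Suc n) - pi * d n) >= 0"
   using a b by (intro sin_ge_zero) (auto simp flip: right_diff_distrib)
  then have "sin (pi * d (Suc n)) * cos (pi * d n) >= cos (pi * d (Suc n)) * sin (pi * d n)"
   by (simp add: sin_diff)
  then show ?thesis unfolding c_def using s0[of n] s0[of "Suc n"] that by (simp add: field_simps)
 qed
 have step: "ee (x n) = t n * (ee (x (Suc n)) - ee (x n))" if "n <= M" for n
 proof -
  have "x (Suc n) = (x n + d n) + of_int k" by (simp add: d_def)
  then have "ee (x (Suc n)) = ee (x n) * ee (d n)" using ee_add_int ee_add by metis
  then show ?thesis using nz[OF that] by (simp add: t_def field_simps)
 qed
 have "(\<Sum>n<N. ee (x n)) = (\<Sum>n<Suc M. t n * (ee (x (Suc n)) - ee (x n)))"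
  unfolding Suc by (rule sum.cong) (use step in auto)
 also have "... = t M * ee (x (Suc M)) - t 0 * ee (x 0) - (\<Sum>n<M. ee (x (Suc n)) * (t (Suc n) - t n))"
  by (rule sum_by_parts_telescope)
 also have "norm ... <= norm (t M) + norm (t 0) + (\<Sum>n<M. norm (t (Suc n) - t n))"
 proof -
  have "norm (\<Sum>n<M. ee (x (Suc n)) * (t (Suc n) - t n)) <= (\<Sum>n<M. norm (t (Suc n) - t n))"
   by (rule order.trans[OF norm_sum]) (simp add: norm_mult)
  moreover have "norm (p - q - r) <= norm p + norm q + norm r" for p q r :: complex
   using norm_triangle_ineq4[of "p - q" r] norm_triangle_ineq4[of p q] by linarith
  from this[of "t M * ee (x (Suc M))" "t 0 * ee (x 0)"]
  have "norm (t M * ee (x (Suc M)) - t 0 * ee (x 0) - (\<Sum>n<M. ee (x (Suc n)) * (t (Suc n) - t n)))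
   <= norm (t M) + norm (t 0) + norm (\<Sum>n<M. ee (x (Suc n)) * (t (Suc n) - t n))"
   by (simp add: norm_mult)
  ultimately show ?thesis by linarith
 qed
 also have "(\<Sum>n<M. norm (t (Suc n) - t n)) = (\<Sum>n<M. (c n - c (Suc n)) / 2)"
 proof (rule sum.cong)
  fix n assume n: "n \<in> {..<M}"
  then have "t (Suc n) - t n = Complex 0 ((c n - c (Suc n)) / 2)"
   by (simp add: teq complex_eq_iff field_simps)
  then show "norm (t (Suc n) - t n) = (c n - c (Suc n)) / 2"
   using cm[of n] n by (simp add: cmod_def)
 qed simp
 also have "... = (c 0 - c M) / 2"
  by (simp add: sum_divide_distrib[symmetric] sum_lessThan_telescope'[of c])
 also have "norm (t M) + norm (t 0) + (c 0 - c M)/2 <= 1/(4*\<theta>) + 1/(4*\<theta>) + (1/(2*\<theta>) + 1/(2*\<theta>))/2"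
  using nt[of M] nt[of 0] cb[of M] cb[of 0] by (intro add_mono) (auto simp: abs_le_iff)
 also have "... = 1 / \<theta>" using \<theta> by (simp add: field_simps)
 finally show ?thesis by simp
qed

lemma sum_int_atLeastAtMost_nat:
 fixes f :: "int => 'a::comm_monoid_add"
 shows "(\<Sum>n\<in>{i..j}. f n) = (\<Sum>n<nat (j - i + 1). f (i + int n))"
proof (rule sum.reindex_bij_witness[of _ "\<lambda>n. i + int n" "\<lambda>n. nat (n - i)"])
qed auto

lemma kusmin_landau:
 fixes x :: "int => real" and k :: int
 assumes \<theta>: "\<theta> > 0"
  and D: "\<And>n. i <= n ==> n <= j ==> \<theta> <= x (n+1) - x n - k \<and> x (n+1) - x n - k <= 1 - \<theta>"
  and mono: "\<And>n. i <= n ==> n < j ==> x (n+1) - x n <= x (n+2) - x (n+1)"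
 shows "norm (\<Sum>n\<in>{i..j}. ee (x n)) <= 1 / \<theta>"
 unfolding sum_int_atLeastAtMost_nat
proof (rule kusmin_landau_nat[where k = k, OF \<theta>])
 fix n assume "n < nat (j - i + 1)"
 then show "\<theta> <= x (i + int (Suc n)) - x (i + int n) - k \<and> x (i + int (Suc n)) - x (i + int n) - k <= 1 - \<theta>"
  using D[of "i + int n"] by (auto simp: algebra_simps)
next
 fix n assume "Suc n < nat (j - i + 1)"
 then show "x (i + int (Suc n)) - x (i + int n) <= x (i + int (Suc (Suc n))) - x (i + int (Suc n))"
  using mono[of "i + int n"] by (auto simp: algebra_simps)
qed

lemma card_int_set_spread:
 fixes S :: "int set"
 assumes "finite S" "\<delta> >= 0" "\<And>m n. m \<in> S ==> n \<in> S ==> m <= n ==> real_of_int (n - m) <= \<delta>"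
 shows "real (card S) <= \<delta> + 1"
proof (cases "S = {}")
 case False
 have "Max S - Min S <= \<lfloor>\<delta>\<rfloor>" using assms(3)[of "Min S" "Max S"] assms(1) False
  by (simp add: le_floor_iff)
 have "S \<subseteq> {Min S..Max S}" using assms(1) by auto
 then have "card S <= card {Min S..Max S}" by (rule card_mono[rotated]) simp
 also have "... = nat (Max S - Min S + 1)" by simp
 finally have "card S <= nat (Max S - Min S + 1)" .
 moreover have "Min S <= Max S" using assms(1) False by simp
 ultimately have "real (card S) <= real_of_int (Max S - Min S + 1)" by linarith
 then show ?thesis using assms(3)[of "Min S" "Max S"] assms(1) False by simp
qed (use assms in auto)

lemma int_convex_set_interval:
 fixes S :: "int set"
 assumes "finite S" "S \<noteq> {}" "\<And>m n l. m \<in> S ==> n \<in> S ==> m <= l ==> l <= n ==> l \<in> S"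
 shows "S = {Min S..Max S}"
proof -
 have "Min S \<in> S" "Max S \<in> S" using assms(1,2) by auto
 then have "l \<in> S" if "Min S <= l" "l <= Max S" for l using assms(3) that by blast
 moreover have "S \<subseteq> {Min S..Max S}" using assms(1) by auto
 ultimately show ?thesis by auto
qed

text \<open>Van der Corput's second derivative test, phrased with second differences. The increments
  \<open>d n\<close> grow at a rate between \<open>\<mu>\<close> and \<open>h * \<mu>\<close>; the
  range is split by the integer part of \<open>d n\<close>, which takes about
  \<open>h * \<mu> * M\<close> values. Within one class \<open>d n\<close> is close to an integer
  for few \<open>n\<close> only, and the Kusmin-Landau inequality handles the others.\<close>

lemma second_difference_test:
 fixes x :: "int => real"
 assumes l: "\<mu> > 0" and h: "h >= 1"
  and D: "\<And>n. a <= n ==> n <= b ==> \<mu> <= x (n+2) - 2 * x (n+1) + x n \<and> x (n+2) - 2 * x (n+1) + x n <= h * \<mu>"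
  and len: "of_int (b - a + 1) <= M" "M >= 0"
 shows "norm (\<Sum>n\<in>{a..b}. ee (x n)) <= 8 * h * (M * sqrt \<mu> + 1 / sqrt \<mu>)"
proof (cases "a <= b \<and> \<mu> <= 1/16")
 case False
 show ?thesis
 proof (cases "a <= b")
  case True
  then have "\<mu> > 1/16" using False by simp
  then have "sqrt \<mu> >= 1/4" using real_sqrt_le_mono[of "1/16" \<mu>] by (simp add: real_sqrt_divide)
  have "norm (\<Sum>n\<in>{a..b}. ee (x n)) <= (\<Sum>n\<in>{a..b}. 1)" by (rule order.trans[OF norm_sum]) simp
  also have "... <= M" using True len by simp
  also have "M = M * 1" by simp
  also have "... <= M * (8 * h * sqrt \<mu>)"
  proof (rule mult_left_mono)
   have "1 * (1/4) <= h * sqrt \<mu>" using h \<open>sqrt \<mu> >= 1/4\<close> by (intro mult_mono) auto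
   then show "1 <= 8 * h * sqrt \<mu>" by simp
  qed (use len in auto)
  also have "... = 8 * h * (M * sqrt \<mu>)" by simp
  also have "... <= 8 * h * (M * sqrt \<mu> + 1 / sqrt \<mu>)" using h l by (intro mult_left_mono) auto
  finally show ?thesis .
 next
  case False then show ?thesis using l h len by simp
 qed
next
 case True
 define d where "d n = x (n+1) - x n" for n
 \<comment> \<open>This choice balances the two losses in a class: about
   \<open>\<theta> / \<mu>\<close> terms with \<open>d n\<close> within \<open>\<theta>\<close> of
   an integer, and \<open>1 / \<theta>\<close> from the rest.\<close>
 define \<theta> where "\<theta> = sqrt \<mu>"
 have th: "\<theta> > 0" "\<theta> * \<theta> = \<mu>" "\<theta> <= 1/4"
  using l True real_sqrt_le_mono[of \<mu> "1/16"] by (auto simp: \<theta>_def real_sqrt_divide)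
 have up: "d n + \<mu> * of_int m <= d (n + m)" "d (n+m) <= d n + h * \<mu> * of_int m"
  if "a <= n" "n + m <= b + 1" "m >= 0" for n m
 proof -
  have "d n + \<mu> * of_int m <= d (n + m) \<and> d (n+m) <= d n + h * \<mu> * of_int m"
   using \<open>m >= 0\<close> \<open>n + m <= b + 1\<close>
  proof (induction m rule: int_ge_induct)
   case (step m)
   then have "d n + \<mu> * of_int m <= d (n + m) \<and> d (n+m) <= d n + h * \<mu> * of_int m" by simp
   moreover have "\<mu> <= d (n+m+1) - d (n+m)" "d (n+m+1) - d (n+m) <= h * \<mu>"
    using D[of "n+m"] step that by (auto simp: d_def add_ac)
   ultimately show ?case by (simp add: algebra_simps)
  qed simp
  then show "d n + \<mu> * of_int m <= d (n + m)" "d (n+m) <= d n + h * \<mu> * of_int m" by auto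
 qed
 have mono: "d m <= d n" if "a <= m" "m <= n" "n <= b + 1" for m n
  using up(1)[of m "n - m"] that l by (smt (verit) mult_nonneg_nonneg of_int_nonneg)
 define G where "G k = {n\<in>{a..b}. \<lfloor>d n\<rfloor> = k}" for k
 have spread: "real (card {n\<in>{a..b}. u <= d n \<and> d n <= v}) <= (v - u)/\<mu> + 1" if "u <= v" for u v
 proof (rule card_int_set_spread)
  show "real_of_int (n - m) <= (v-u)/\<mu>" if "m \<in> {n\<in>{a..b}. u <= d n \<and> d n <= v}" "n \<in> {n\<in>{a..b}. u <= d n \<and> d n <= v}" "m <= n" for m n
  proof -
   have "\<mu> * real_of_int (n - m) <= v - u" using up(1)[of m "n - m"] that by auto
   then show ?thesis using l by (simp add: field_simps)
  qed
  show "finite {n\<in>{a..b}. u <= d n \<and> d n <= v}" by (rule finite_subset[of _ "{a..b}"]) auto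
 qed (use l that in auto)
 have Gb: "norm (\<Sum>n\<in>G k. ee (x n)) <= 4 / \<theta>" for k
 proof -
  define L where "L = {n\<in>{a..b}. of_int k <= d n \<and> d n <= of_int k + \<theta>}"
  define R where "R = {n\<in>{a..b}. of_int k + 1 - \<theta> <= d n \<and> d n <= of_int k + 1}"
  define I where "I = {n\<in>{a..b}. of_int k + \<theta> <= d n \<and> d n <= of_int k + 1 - \<theta>}"
  have fin: "finite I" "finite (G k)" "finite L" "finite R"
   by (auto simp: I_def G_def L_def R_def intro: finite_subset[of _ "{a..b}"])
  have split: "G k = I \<union> (G k - I)" using th by (auto simp: G_def I_def floor_eq_iff)
  have "(\<Sum>n\<in>G k. ee (x n)) = (\<Sum>n\<in>I. ee (x n)) + (\<Sum>n\<in>G k - I. ee (x n))"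
   by (subst split, rule sum.union_disjoint) (use fin in auto)
  then have 1: "norm (\<Sum>n\<in>G k. ee (x n)) <= norm (\<Sum>n\<in>I. ee (x n)) + norm (\<Sum>n\<in>G k - I. ee (x n))"
   by (simp add: norm_triangle_ineq)
  have "norm (\<Sum>n\<in>G k - I. ee (x n)) <= (\<Sum>n\<in>G k - I. 1)" by (rule order.trans[OF norm_sum]) simp
  also have "... = real (card (G k - I))" by simp
  also have "... <= real (card (L \<union> R))"
   by (intro of_nat_mono card_mono) (use fin in \<open>auto simp: G_def I_def L_def R_def floor_eq_iff\<close>)
  also have "... <= real (card L) + real (card R)"
   using card_Un_le[of L R] by linarith
  also have "... <= (\<theta>/\<mu> + 1) + (\<theta>/\<mu> + 1)"
   using spread[of k "k+\<theta>"] spread[of "k + 1 - \<theta>" "k+1"] th by (auto simp: L_def R_def)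
  also have "\<theta> / \<mu> = 1 / \<theta>" using th l by (simp add: field_simps)
  finally have 2: "norm (\<Sum>n\<in>G k - I. ee (x n)) <= 2 / \<theta> + 2" by simp
  have 3: "norm (\<Sum>n\<in>I. ee (x n)) <= 1 / \<theta>"
  proof (cases "I = {}")
   case False
   note \<open>finite I\<close>
   have Ieq: "I = {Min I..Max I}"
   proof (rule int_convex_set_interval[OF \<open>finite I\<close> False])
    fix m n l assume "m \<in> I" "n \<in> I" "m <= l" "l <= n"
    then show "l \<in> I" using mono[of m l] mono[of l n] by (auto simp: I_def)
   qed
   have mem: "n \<in> I" if "Min I <= n" "n <= Max I" for n
    by (subst Ieq) (use that in auto)
   have "norm (\<Sum>n\<in>{Min I..Max I}. ee (x n)) <= 1 / \<theta>"
   proof (rule kusmin_landau[where k = k])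
    fix n assume "Min I <= n" "n <= Max I"
    then show "\<theta> <= x (n+1) - x n - k \<and> x (n+1) - x n - k <= 1 - \<theta>"
     using mem[of n] by (auto simp: I_def d_def)
   next
    fix n assume "Min I <= n" "n < Max I"
    then show "x (n+1) - x n <= x (n+2) - x (n+1)"
     using mem[of n] mono[of n "n+1"] by (auto simp: I_def d_def add_ac)
   qed (use th in auto)
   then show ?thesis by (subst Ieq)
  qed (use th in auto)
  have "2 <= 1 / \<theta>" using th by (simp add: field_simps)
  then show ?thesis using 1 2 3 by (simp add: field_simps)
 qed
 define I where "I = {\<lfloor>d a\<rfloor>..\<lfloor>d b\<rfloor>}"
 have "(\<Sum>n\<in>{a..b}. ee (x n)) = (\<Sum>k\<in>I. \<Sum>n\<in>{n\<in>{a..b}. \<lfloor>d n\<rfloor> = k}. ee (x n))"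
 proof (rule sum.group[symmetric])
  show "(\<lambda>n. \<lfloor>d n\<rfloor>) ` {a..b} \<subseteq> I" unfolding I_def
   using mono by (auto intro!: floor_mono)
 qed (auto simp: I_def)
 then have "norm (\<Sum>n\<in>{a..b}. ee (x n)) <= (\<Sum>k\<in>I. norm (\<Sum>n\<in>G k. ee (x n)))"
  by (simp add: G_def norm_sum)
 also have "... <= (\<Sum>k\<in>I. 4/\<theta>)" by (intro sum_mono Gb)
 also have "... = of_int (\<lfloor>d b\<rfloor> - \<lfloor>d a\<rfloor> + 1) * (4/\<theta>)"
 proof -
  have "\<lfloor>d a\<rfloor> <= \<lfloor>d b\<rfloor>" using mono[of a b] True by (intro floor_mono) auto
  then show ?thesis by (simp add: I_def)
 qed
 also have "... <= (h * \<mu> * M + 2) * (4/\<theta>)"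
 proof (intro mult_right_mono)
  have "d b <= d a + h * \<mu> * of_int (b - a)" using up(2)[of a "b - a"] True by simp
  also have "h * \<mu> * of_int (b - a) <= h * \<mu> * M" using len h l by (intro mult_left_mono) auto
  finally show "of_int (\<lfloor>d b\<rfloor> - \<lfloor>d a\<rfloor> + 1) <= h * \<mu> * M + 2" by linarith
 qed (use th in auto)
 also have "... = 4 * h * M * \<theta> + 8 / \<theta>" using th by (simp add: field_simps flip: th(2))
 also have "... <= 8 * h * (M * sqrt \<mu> + 1 / sqrt \<mu>)"
 proof -
  have "8 / \<theta> <= 8 * h / \<theta>" using h th by (intro divide_right_mono) auto
  moreover have "4 * h * M * \<theta> <= 8 * h * M * \<theta>" using h len th by (intro mult_right_mono) auto
  ultimately show ?thesis by (simp add: \<theta>_def[symmetric] algebra_simps)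
 qed
 finally show ?thesis .
qed

lemma second_difference_test_abs:
 fixes x :: "int => real"
 assumes l: "\<mu> > 0" and h: "h >= 1" and s: "s = 1 \<or> s = -1"
  and D: "\<And>n. a <= n ==> n <= b ==> \<mu> <= s * (x (n+2) - 2 * x (n+1) + x n) \<and> s * (x (n+2) - 2 * x (n+1) + x n) <= h * \<mu>"
  and len: "of_int (b - a + 1) <= M" "M >= 0"
 shows "norm (\<Sum>n\<in>{a..b}. ee (x n)) <= 8 * h * (M * sqrt \<mu> + 1 / sqrt \<mu>)"
proof (cases "s = 1")
 case True then show ?thesis using second_difference_test[of \<mu> h a b x M] assms by auto
next
 case False
 then have "s = -1" using s by simp
 have "norm (\<Sum>n\<in>{a..b}. ee (- x n)) <= 8 * h * (M * sqrt \<mu> + 1 / sqrt \<mu>)"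
  by (rule second_difference_test[OF l h]) (use D len \<open>s = -1\<close> in \<open>auto simp: algebra_simps\<close>)
 moreover have "(\<Sum>n\<in>{a..b}. ee (- x n)) = cnj (\<Sum>n\<in>{a..b}. ee (x n))" by (simp add: ee_minus)
 ultimately show ?thesis by (simp del: cnj_sum)
qed

section \<open>The divisor bound\<close>

lemma divisor_count_prime_power_mult:
 assumes p: "prime p" and m: "m > 0"
 shows "divisor_count (p ^ e * m) <= (e + 1) * divisor_count m"
proof -
 let ?D = "\<lambda>n::nat. {d. d dvd n \<and> d > 0}"
 have "?D (p ^ e * m) \<subseteq> (\<lambda>(i, y). p ^ i * y) ` ({..e} \<times> ?D m)"
 proof
  fix d assume d: "d \<in> ?D (p ^ e * m)"
  then obtain b c where bc: "d = b * c" "b dvd p ^ e" "c dvd m" using division_decomp[of d "p ^ e" m] by auto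
  obtain i where "i <= e" "b = p ^ i" using divides_primepow_nat[OF p] bc(2) by auto
  then show "d \<in> (\<lambda>(i, y). p ^ i * y) ` ({..e} \<times> ?D m)" using bc d by (intro image_eqI[of _ _ "(i, c)"]) auto
 qed
 then have "card (?D (p ^ e * m)) <= card ((\<lambda>(i, y). p ^ i * y) ` ({..e} \<times> ?D m))"
  using m by (intro card_mono) auto
 also have "... <= card ({..e} \<times> ?D m)" using m by (intro card_image_le) auto
 finally show ?thesis by (simp add: divisor_count_def card_cartesian_product)
qed

text \<open>Prime powers are removed one prime at a time. If \<open>p > Q\<close>, then
  \<open>k + 1 <= 2 ^ k <= (p ^ k) powr \<epsilon>\<close> without loss; each of the boundedly many
  smaller primes costs one factor \<open>C\<close>. Hence the induction carries
  \<open>C ^ s n\<close>, where \<open>s n\<close> counts the small primes dividing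
  \<open>n\<close>.\<close>

lemma divisor_count_le_powr:
 fixes \<epsilon> :: real
 assumes e: "\<epsilon> > 0"
 obtains C where "C > 0" "\<And>n. n > 0 ==> real (divisor_count n) <= C * real n powr \<epsilon>"
proof -
 define Q where "Q = nat \<lceil>2 powr (1 / \<epsilon>)\<rceil>"
 define a where "a = \<epsilon> * ln 2"
 define C where "C = 1 / a + 1"
 have a: "a > 0" using e by (simp add: a_def)
 have C1: "C >= 1" using a by (simp add: C_def)
 define s where "s n = card {p\<in>{..Q}. prime p \<and> p dvd n}" for n :: nat
 have step1: "real k + 1 <= C * (real p ^ k) powr \<epsilon>" if p: "prime p" for p k :: nat
 proof -
  have "real k + 1 <= C * (1 + real k * a)" using a by (simp add: C_def field_simps)
  also have "1 + real k * a <= exp (real k * a)" by (rule exp_ge_add_one_self)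
  also have "exp (real k * a) = (2 ^ k) powr \<epsilon>" by (simp add: powr_def a_def ln_realpow mult_ac)
  also have "... <= (real p ^ k) powr \<epsilon>" using prime_ge_2_nat[OF p] e by (intro powr_mono2 power_mono) auto
  finally show ?thesis using C1 by simp
 qed
 have step2: "real k + 1 <= (real p ^ k) powr \<epsilon>" if p: "p > Q" for p k :: nat
 proof -
  have "real k + 1 <= 2 ^ k" by (induction k) auto
  also have "(2::real) ^ k = ((2 powr (1 / \<epsilon>)) ^ k) powr \<epsilon>" using e by (simp add: powr_powr powr_power powr_realpow)
  also have "... <= (real p ^ k) powr \<epsilon>"
  proof (intro powr_mono2 power_mono)
   show "2 powr (1 / \<epsilon>) <= real p" using p unfolding Q_def by linarith
  qed (use e in auto)
  finally show ?thesis .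
 qed
 have main: "real (divisor_count n) <= C ^ s n * real n powr \<epsilon>" if "n > 0" for n
  using that
 proof (induction n rule: less_induct)
  case (less n)
  show ?case
  proof (cases "n = 1")
   case True
   have "{m::nat. m dvd 1 \<and> m > 0} = {1}" by auto
   then show ?thesis using True C1 by (simp add: divisor_count_def)
  next
   case False
   then obtain p where p: "prime p" "p dvd n" using prime_factor_nat by auto
   obtain k m where km: "n = p ^ k * m" "\<not> p dvd m" 
    using multiplicity_decompose'[of n p] p less.prems by (metis not_gr_zero not_prime_unit)
   have k0: "k > 0" using km p by (cases k) auto
   have m0: "m > 0" using km less.prems by (cases m) auto
   have "1 < p ^ k" using prime_gt_1_nat[OF p(1)] k0 by (intro one_less_power)
   then have mn: "m < n" using m0 km by simp
   have "real (divisor_count n) <= (real k + 1) * real (divisor_count m)"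
    using divisor_count_prime_power_mult[OF p(1) m0, of k] unfolding km(1) by (metis of_nat_1 of_nat_add of_nat_le_iff of_nat_mult)
   also have "... <= (real k + 1) * (C ^ s m * real m powr \<epsilon>)"
    using less.IH[OF mn m0] by (intro mult_left_mono) auto
   also have "... <= C ^ s n * ((real p ^ k) powr \<epsilon> * real m powr \<epsilon>)"
   proof (cases "p <= Q")
    case True
    have "{q\<in>{..Q}. prime q \<and> q dvd m} \<subset> {q\<in>{..Q}. prime q \<and> q dvd n}"
     using km p True by auto
    then have "s m < s n" unfolding s_def by (intro psubset_card_mono) auto
    then have "C ^ Suc (s m) <= C ^ s n" using C1 by (intro power_increasing) auto
    then have "(real k + 1) * (C ^ s m * real m powr \<epsilon>) <= (C * (real p ^ k) powr \<epsilon>) * (C ^ s m * real m powr \<epsilon>)"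
     using step1[OF p(1), of k] C1 by (intro mult_right_mono) auto
    also have "... = C ^ Suc (s m) * ((real p ^ k) powr \<epsilon> * real m powr \<epsilon>)" by simp
    also have "... <= C ^ s n * ((real p ^ k) powr \<epsilon> * real m powr \<epsilon>)"
     using \<open>C ^ Suc (s m) <= C ^ s n\<close> by (intro mult_right_mono) auto
    finally show ?thesis .
   next
    case False
    have "{q\<in>{..Q}. prime q \<and> q dvd m} \<subseteq> {q\<in>{..Q}. prime q \<and> q dvd n}" using km by auto
    then have "s m <= s n" unfolding s_def by (intro card_mono) auto
    then have "C ^ s m <= C ^ s n" using C1 by (intro power_increasing) auto
    then have "(real k + 1) * (C ^ s m * real m powr \<epsilon>) <= (real p ^ k) powr \<epsilon> * (C ^ s n * real m powr \<epsilon>)"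
     using step2[of p k] False C1 by (intro mult_mono) auto
    then show ?thesis by (simp add: mult_ac)
   qed
   also have "(real p ^ k) powr \<epsilon> * real m powr \<epsilon> = real n powr \<epsilon>" by (simp add: km powr_mult)
   finally show ?thesis .
  qed
 qed
 have "real (divisor_count n) <= C ^ (Q + 1) * real n powr \<epsilon>" if "n > 0" for n
 proof -
  have "s n <= card {..Q}" unfolding s_def by (intro card_mono) auto
  then have "C ^ s n <= C ^ (Q + 1)" using C1 by (intro power_increasing) auto
  then show ?thesis using main[OF that] by (meson mult_right_mono order.trans powr_ge_zero)
 qed
 moreover have "C ^ (Q + 1) > 0" using C1 by (intro zero_less_power) auto
 ultimately show ?thesis using that by blast
qed

section \<open>Fourier approximation of the fractional part\<close>

definition psi :: "real => real" where "psi t = frac t - 1/2"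

text \<open>Partial sum of the Fourier series of \<open>1/2 - frac t\<close>, that is of
  \<open>- psi t\<close>; hence the truncation error is the sum, not the difference, of
  \<open>psi\<close> and \<open>psi_partial\<close>.\<close>

definition psi_partial :: "nat => real => real" where
 "psi_partial H t = (\<Sum>h\<in>{1..H}. sin (2 * pi * real h * t) / (pi * real h))"

lemma psi_partial_add_int: "psi_partial H (t + of_int k) = psi_partial H t"
proof -
 have "sin (2 * pi * real h * (t + of_int k)) = sin (2 * pi * real h * t)" for h
 proof -
  have "2 * pi * real h * (t + of_int k) = 2 * pi * real h * t + 2 * pi * of_int (int h * k)" by (simp add: algebra_simps)
  moreover have "sin (2 * pi * of_int (int h * k)) = 0" "cos (2 * pi * of_int (int h * k)) = 1"
   by (rule sin_int_2pin, rule cos_int_2pin)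
  ultimately show ?thesis by (simp only: sin_add)
 qed
 then show ?thesis by (simp add: psi_partial_def)
qed

lemma dirichlet_kernel: "sin (pi * t) * (1 + 2 * (\<Sum>h\<in>{1..H}. cos (2 * pi * real h * t))) = sin ((2 * real H + 1) * pi * t)"
proof (induction H)
 case (Suc H)
 have "sin ((2 * real (Suc H) + 1) * pi * t) - sin ((2 * real H + 1) * pi * t) = 2 * sin (pi * t) * cos (2 * pi * real (Suc H) * t)"
  by (subst sin_diff_sin) (simp add: algebra_simps add_divide_distrib)
 then show ?case using Suc by (simp add: algebra_simps)
qed (simp add: mult.commute)

lemma psi_partial_has_derivative:
 "((\<lambda>t. 1/2 - t - psi_partial H t) has_real_derivative - 1 - 2 * (\<Sum>h\<in>{1..H}. cos (2 * pi * real h * t))) (at t)"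
proof -
 have "((\<lambda>t. psi_partial H t) has_real_derivative (\<Sum>h\<in>{1..H}. 2 * cos (2 * pi * real h * t))) (at t)"
  unfolding psi_partial_def
  by (rule DERIV_sum) (auto intro!: derivative_eq_intros)
 then show ?thesis by (auto intro!: derivative_eq_intros simp: sum_distrib_left)
qed

lemma psi_partial_half: "psi_partial H (1/2) = 0"
 unfolding psi_partial_def by (intro sum.neutral) (auto simp: sin_npi2 mult.commute)

text \<open>The derivative of the error is minus a Dirichlet kernel, and one integration by parts
  would give the decay. Monotonicity replaces the integrals: \<open>G\<close> is the boundary term
  of that integration by parts, and the derivative of \<open>E\<close> dominates that of
  \<open>r - G\<close>. So \<open>r - G - E\<close> increases, \<open>r - G + E\<close> decreases,
  and \<open>r\<close> and \<open>G\<close> vanish at \<open>1/2\<close>.\<close>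

lemma psi_partial_error_half:
 assumes t: "0 < t" "t <= 1/2"
 shows "\<bar>1/2 - t - psi_partial H t\<bar> <= 2 / ((2 * real H + 1) * pi * sin (pi * t))"
proof -
 define N where "N = (2 * real H + 1) * pi"
 define r where "r t = 1/2 - t - psi_partial H t" for t
 define G where "G t = cos (N * t) / (N * sin (pi * t))" for t
 define E where "E t = 1 / (N * sin (pi * t))" for t
 have N: "N > 0" by (simp add: N_def add_nonneg_pos)
 have sp: "sin (pi * x) > 0" if "t <= x" "x <= 1/2" for x
  using t that by (intro sin_gt_zero) auto
 have cp: "cos (pi * x) >= 0" if "t <= x" "x <= 1/2" for x
 proof -
  have "pi * x <= pi * (1/2)" "0 <= pi * x" using t that by (auto intro: mult_left_mono)
  moreover have "- (pi / 2) <= 0" by simp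
  ultimately show ?thesis by (intro cos_ge_zero) linarith+
 qed
 have r': "(r has_real_derivative - sin (N * x) / sin (pi * x)) (at x)" if "t <= x" "x <= 1/2" for x
 proof -
  have "sin (N * x) = sin (pi * x) * (1 + 2 * (\<Sum>h\<in>{1..H}. cos (2 * pi * real h * x)))"
   unfolding N_def by (rule dirichlet_kernel[symmetric])
  then have "- sin (N * x) / sin (pi * x) = - 1 - 2 * (\<Sum>h\<in>{1..H}. cos (2 * pi * real h * x))"
   using sp[OF that] by simp
  then show ?thesis using psi_partial_has_derivative[of H x] unfolding r_def by simp
 qed
 have G': "(G has_real_derivative - sin (N * x) / sin (pi * x) - pi * cos (N * x) * cos (pi * x) / (N * (sin (pi * x))\<^sup>2)) (at x)" if "t <= x" "x <= 1/2" for x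
  unfolding G_def using sp[OF that] N
  by (auto intro!: derivative_eq_intros simp: power2_eq_square divide_simps) (simp add: algebra_simps)
 have E': "(E has_real_derivative - pi * cos (pi * x) / (N * (sin (pi * x))\<^sup>2)) (at x)" if "t <= x" "x <= 1/2" for x
  unfolding E_def using sp[OF that] N
  by (auto intro!: derivative_eq_intros simp: power2_eq_square divide_simps)
 have cb: "\<bar>pi * cos (N * x) * cos (pi * x) / (N * (sin (pi * x))\<^sup>2)\<bar> <= pi * cos (pi * x) / (N * (sin (pi * x))\<^sup>2)" if "t <= x" "x <= 1/2" for x
 proof -
  have "\<bar>cos (N * x)\<bar> * (pi * cos (pi * x) / (N * (sin (pi * x))\<^sup>2)) <= 1 * (pi * cos (pi * x) / (N * (sin (pi * x))\<^sup>2))"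
   using cp[OF that] N by (intro mult_right_mono) auto
  then show ?thesis using cp[OF that] N by (simp add: abs_mult mult_ac)
 qed
 have 1: "r t - G t - E t <= r (1/2) - G (1/2) - E (1/2)"
 proof (rule DERIV_nonneg_imp_nondecreasing[OF t(2)])
  fix x assume x: "t <= x" "x <= 1/2"
  show "\<exists>y. ((\<lambda>x. r x - G x - E x) has_real_derivative y) (at x) \<and> 0 <= y"
   by (intro exI, rule conjI[OF DERIV_diff[OF DERIV_diff[OF r'[OF x] G'[OF x]] E'[OF x]]]) (use cb[OF x] in linarith)
 qed
 have 2: "r (1/2) - G (1/2) + E (1/2) <= r t - G t + E t"
 proof (rule DERIV_nonpos_imp_nonincreasing[OF t(2)])
  fix x assume x: "t <= x" "x <= 1/2"
  show "\<exists>y. ((\<lambda>x. r x - G x + E x) has_real_derivative y) (at x) \<and> y <= 0"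
   by (intro exI, rule conjI[OF DERIV_add[OF DERIV_diff[OF r'[OF x] G'[OF x]] E'[OF x]]]) (use cb[OF x] in linarith)
 qed
 have "r (1/2) = 0" by (simp add: r_def psi_partial_half)
 moreover have "G (1/2) = 0"
 proof -
  have N2: "N * (1/2) = real H * pi + pi / 2" by (simp add: N_def algebra_simps)
  have "cos (N * (1/2)) = 0" unfolding N2 by (simp add: cos_add)
  then show ?thesis by (simp add: G_def)
 qed
 moreover have "E (1/2) > 0" using N by (simp add: E_def)
 moreover have "\<bar>G t\<bar> <= E t"
  using sp[of t] t N by (simp add: G_def E_def abs_mult divide_right_mono)
 ultimately have "\<bar>r t\<bar> <= 2 * E t" using 1 2 by linarith
 then show ?thesis by (simp add: r_def E_def N_def)
qed

lemma psi_partial_trivial: "\<bar>psi_partial H t\<bar> <= 2 * real H * \<bar>t\<bar>"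
proof -
 have "\<bar>psi_partial H t\<bar> <= (\<Sum>h\<in>{1..H}. 2 * \<bar>t\<bar>)"
  unfolding psi_partial_def
 proof (rule order.trans[OF sum_abs], rule sum_mono)
  fix h assume h: "h \<in> {1..H}"
  have "\<bar>sin (2 * pi * real h * t)\<bar> / (pi * real h) <= \<bar>2 * pi * real h * t\<bar> / (pi * real h)"
   by (intro divide_right_mono abs_sin_x_le_abs_x) simp
  then have "\<bar>sin (2 * pi * real h * t) / (pi * real h)\<bar> <= \<bar>2 * pi * real h * t\<bar> / (pi * real h)"
   by (simp only: abs_divide abs_mult abs_of_nat abs_of_pos[OF pi_gt_zero])
  also have "... = 2 * \<bar>t\<bar>" using h by (simp add: abs_mult)
  finally show "\<bar>sin (2 * pi * real h * t) / (pi * real h)\<bar> <= 2 * \<bar>t\<bar>" .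
 qed
 then show ?thesis by simp
qed

section \<open>Fejer kernels and the truncation error of the Fourier series\<close>

definition fejer :: "nat => real => real" where
 "fejer N t = (norm (\<Sum>n<N. ee (real n * t)))\<^sup>2 / real N"

lemma fejer_nonneg: "fejer N t >= 0" by (simp add: fejer_def)

lemma fejer_add_int: "fejer N (t + of_int k) = fejer N t"
proof -
 have "ee (real n * (t + of_int k)) = ee (real n * t)" for n
  using ee_add_int[of "real n * t" "int n * k"] by (simp add: algebra_simps)
 then show ?thesis by (simp add: fejer_def)
qed

lemma fejer_minus: "fejer N (- t) = fejer N t"
proof -
 have "(\<Sum>n<N. ee (real n * - t)) = cnj (\<Sum>n<N. ee (real n * t))" by (simp add: ee_minus)
 then show ?thesis by (simp only: fejer_def complex_mod_cnj)
qed

text \<open>All \<open>N\<close> terms have arguments within \<open>pi / 3\<close> of the positive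
  real axis, so each contributes at least \<open>1/2\<close> to the real part.\<close>

lemma fejer_ge:
 assumes t: "\<bar>t\<bar> * real N <= 1/8" and N: "N >= 1"
 shows "real N / 4 <= fejer N t"
proof -
 have "real N * (1/2) <= Re (\<Sum>n<N. ee (real n * t))"
 proof -
  have "1/2 <= Re (ee (real n * t))" if "n < N" for n
  proof -
   have "real n * \<bar>t\<bar> <= real N * \<bar>t\<bar>" using that by (intro mult_right_mono) auto
   then have "2 * pi * (real n * \<bar>t\<bar>) <= 2 * pi * (1/8)" using t by (intro mult_left_mono) (auto simp: mult.commute)
   then have le: "2 * pi * (real n * \<bar>t\<bar>) <= pi / 3" by simp
   have "cos (pi/3) <= cos (2 * pi * (real n * \<bar>t\<bar>))"
    by (rule cos_monotone_0_pi_le) (use le in auto)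
   moreover have "cos (2 * pi * (real n * \<bar>t\<bar>)) = cos (2 * pi * (real n * t))" by (cases "t >= 0") (auto simp: abs_if)
   ultimately show ?thesis by (simp add: ee_def cos_60)
  qed
  then have "(\<Sum>n<N. 1/2) <= (\<Sum>n<N. Re (ee (real n * t)))" by (intro sum_mono) auto
  then show ?thesis by (simp add: Re_sum)
 qed
 also have "... <= norm (\<Sum>n<N. ee (real n * t))" by (rule complex_Re_le_cmod)
 finally have "(real N * (1/2))\<^sup>2 <= (norm (\<Sum>n<N. ee (real n * t)))\<^sup>2" by (intro power_mono) auto
 then show ?thesis using N by (simp add: fejer_def field_simps power2_eq_square)
qed

text \<open>Expanding the square turns the kernel into the frequencies \<open>n - m\<close>. For
  fixed \<open>n\<close> each frequency occurs at most once, and the sum over \<open>n\<close>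
  cancels the factor \<open>1 / N\<close>. Frequency 0 yields the total weight; opposite frequencies
  have conjugate sums because the weights are real.\<close>

lemma fejer_weighted_sum:
 fixes w y :: "'a => real"
 assumes w: "\<And>i. i \<in> I ==> w i >= 0" and N: "N >= 1"
 shows "(\<Sum>i\<in>I. w i * fejer N (y i)) <= (\<Sum>i\<in>I. w i) + 2 * (\<Sum>h\<in>{1..N}. norm (\<Sum>i\<in>I. of_real (w i) * ee (real h * y i)))"
proof -
 define S where "S h = (\<Sum>i\<in>I. of_real (w i) * ee (of_int h * y i))" for h :: int
 have Sm: "norm (S (- h)) = norm (S h)" for h
 proof -
  have "S (- h) = cnj (S h)" by (simp add: S_def ee_minus)
  then show ?thesis by (simp only: complex_mod_cnj)
 qed
 have "of_real (\<Sum>i\<in>I. w i * fejer N (y i)) * of_nat N = (\<Sum>n<N. \<Sum>m<N. S (int n - int m))"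
 proof -
  have "(\<Sum>i\<in>I. w i * fejer N (y i)) * real N = (\<Sum>i\<in>I. w i * (norm (\<Sum>n<N. ee (real n * y i)))\<^sup>2)"
   unfolding sum_distrib_right using N by (intro sum.cong refl) (simp add: fejer_def)
  from arg_cong[OF this, of complex_of_real]
  have "of_real (\<Sum>i\<in>I. w i * fejer N (y i)) * of_nat N = (\<Sum>i\<in>I. complex_of_real (w i) * of_real ((norm (\<Sum>n<N. ee (real n * y i)))\<^sup>2))"
   by (simp only: of_real_mult of_real_of_nat_eq of_real_sum)
  also have "... = (\<Sum>i\<in>I. \<Sum>n<N. \<Sum>m<N. of_real (w i) * ee (of_int (int n - int m) * y i))"
  proof (rule sum.cong[OF refl])
   fix i
   have "of_real ((norm (\<Sum>n<N. ee (real n * y i)))\<^sup>2) = (\<Sum>n<N. ee (real n * y i)) * cnj (\<Sum>n<N. ee (real n * y i))"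
    by (rule complex_norm_square)
   also have "... = (\<Sum>n<N. \<Sum>m<N. ee (of_int (int n - int m) * y i))"
    by (simp add: sum_product left_diff_distrib ee_diff)
   finally show "of_real (w i) * of_real ((norm (\<Sum>n<N. ee (real n * y i)))\<^sup>2) = (\<Sum>n<N. \<Sum>m<N. of_real (w i) * ee (of_int (int n - int m) * y i))"
    by (simp add: sum_distrib_left)
  qed
  also have "... = (\<Sum>n<N. \<Sum>m<N. S (int n - int m))"
   unfolding S_def by (rule trans[OF sum.swap], rule sum.cong[OF refl], rule sum.swap)
  finally show ?thesis .
 qed
 then have "norm (of_real (\<Sum>i\<in>I. w i * fejer N (y i)) * of_nat N :: complex) <= (\<Sum>n<N. \<Sum>m<N. norm (S (int n - int m)))"
  by (simp only:) (rule sum_norm_le[OF norm_sum])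
 moreover have "(\<Sum>m<N. norm (S (int n - int m))) <= norm (S 0) + 2 * (\<Sum>h\<in>{1..N}. norm (S (int h)))" if n: "n < N" for n
 proof -
  have "(\<Sum>m<N. norm (S (int n - int m))) = (\<Sum>h\<in>(\<lambda>m. int n - int m) ` {..<N}. norm (S h))"
   by (subst sum.reindex) (auto simp: inj_on_def)
  also have "... <= (\<Sum>h\<in>{0} \<union> (int ` {1..N} \<union> (\<lambda>h. - int h) ` {1..N}). norm (S h))"
  proof (rule sum_mono2)
   show "(\<lambda>m. int n - int m) ` {..<N} \<subseteq> {0} \<union> (int ` {1..N} \<union> (\<lambda>h. - int h) ` {1..N})"
   proof
    fix z assume "z \<in> (\<lambda>m. int n - int m) ` {..<N}"
    then obtain m where m: "m < N" "z = int n - int m" by auto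
    consider "z = 0" | "z > 0" | "z < 0" by linarith
    then show "z \<in> {0} \<union> (int ` {1..N} \<union> (\<lambda>h. - int h) ` {1..N})"
    proof cases
     case 2
     then have "z = int (nat z)" "nat z \<in> {1..N}" using m n by auto
     then show ?thesis by blast
    next
     case 3
     then have "z = - int (nat (- z))" "nat (- z) \<in> {1..N}" using m n by auto
     then show ?thesis by blast
    qed simp
   qed
  qed auto
  also have "... <= norm (S 0) + ((\<Sum>h\<in>int ` {1..N}. norm (S h)) + (\<Sum>h\<in>(\<lambda>h. - int h) ` {1..N}. norm (S h)))"
   by (subst sum.union_disjoint; (subst sum.union_disjoint)?) auto
  also have "... = norm (S 0) + 2 * (\<Sum>h\<in>{1..N}. norm (S (int h)))"
   by (subst sum.reindex, force simp: inj_on_def, subst sum.reindex, force simp: inj_on_def) (simp add: Sm)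
  finally show ?thesis .
 qed
 ultimately have fin: "norm (of_real (\<Sum>i\<in>I. w i * fejer N (y i)) * of_nat N :: complex) <= (\<Sum>n<N. norm (S 0) + 2 * (\<Sum>h\<in>{1..N}. norm (S (int h))))"
  by (meson lessThan_iff order.trans sum_mono)
 have "norm (of_real (\<Sum>i\<in>I. w i * fejer N (y i)) * of_nat N :: complex) = (\<Sum>i\<in>I. w i * fejer N (y i)) * real N"
 proof -
  have "(\<Sum>i\<in>I. w i * fejer N (y i)) >= 0" using w fejer_nonneg by (intro sum_nonneg mult_nonneg_nonneg)
  then show ?thesis unfolding norm_mult norm_of_real norm_of_nat by simp
 qed
 then have "(\<Sum>i\<in>I. w i * fejer N (y i)) <= norm (S 0) + 2 * (\<Sum>h\<in>{1..N}. norm (S (int h)))"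
  using fin N by (simp add: mult.commute)
 moreover have "norm (S 0) <= (\<Sum>i\<in>I. w i)"
 proof -
  have "norm (S 0) = \<bar>\<Sum>i\<in>I. w i\<bar>" by (simp add: S_def flip: of_real_sum)
  then show ?thesis using w by (simp add: sum_nonneg)
 qed
 ultimately show ?thesis by (simp add: S_def)
qed

text \<open>The error \<open>min 1 (1 / (H \<bar>t\<bar>))\<close> of a partial sum of the Fourier series of \<open>psi\<close> is majorised by
 the Fejer kernels of dyadic lengths.\<close>

lemma psi_error_half:
 assumes t: "0 < t" "t <= 1/2"
 shows "\<bar>1/2 - t - psi_partial (2 ^ J) t\<bar> <= 11 / 2 ^ J * (\<Sum>j\<in>{..J}. fejer (2 ^ j) t)"
proof -
 define H where "H = (2::nat) ^ J"
 have H: "H >= 1" by (simp add: H_def)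
 have single: "fejer (2 ^ j) t <= (\<Sum>j\<in>{..J}. fejer (2 ^ j) t)" if "j <= J" for j
  using that by (intro member_le_sum) (auto simp: fejer_nonneg)
 show ?thesis
 \<comment> \<open>Near 0 the kernel of full length is at least \<open>H / 4\<close> and absorbs the
   bounded error; further out the error is at most \<open>1 / (6 * H * t)\<close>, and a kernel of
   length about \<open>1 / t\<close> absorbs it.\<close>
 proof (cases "t * real H <= 1/8")
  case True
  have "\<bar>1/2 - t - psi_partial H t\<bar> <= 1/2 + 2 * real H * \<bar>t\<bar>" using psi_partial_trivial[of H t] t by linarith
  also have "... <= 3/4" using True t by (simp add: mult.commute)
  also have "... <= 11 / real H * (real H / 4)" using H by simp
  also have "... <= 11 / real H * fejer H t" using H True t by (intro mult_left_mono fejer_ge) auto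
  also have "... <= 11 / real H * (\<Sum>j\<in>{..J}. fejer (2 ^ j) t)" using single[of J] H by (intro mult_left_mono) (auto simp: H_def)
  finally show ?thesis by (simp add: H_def)
 next
  case False
  have "sin (pi * t) >= 2 * t"
   using sin_ge_two_over_pi[of "pi * t"] t by (simp add: mult.commute)
  then have "1 / sin (pi * t) <= 1 / (2 * t)" using t by (intro divide_left_mono mult_pos_pos sin_gt_zero) auto
  have "(6 * real H) * (2 * t) <= ((2 * real H + 1) * pi) * sin (pi * t)"
  proof (rule mult_mono)
   have "2 * real H * 3 <= (2 * real H + 1) * pi" using pi_gt3 by (intro mult_mono) auto
   then show "6 * real H <= (2 * real H + 1) * pi" by simp
  qed (use \<open>sin (pi * t) >= 2 * t\<close> t in auto)
  then have "2 / (((2 * real H + 1) * pi) * sin (pi * t)) <= 2 / ((6 * real H) * (2 * t))"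
   using H t by (intro divide_left_mono mult_pos_pos sin_gt_zero) (auto simp: add_pos_pos)
  then have E: "\<bar>1/2 - t - psi_partial H t\<bar> <= 1 / (6 * real H) * (1 / t)"
   using psi_partial_error_half[OF t, of H] by (simp add: mult_ac)
  \<comment> \<open>The witness is 0 if \<open>t > 1/8\<close>, and otherwise a \<open>j\<close>
    with \<open>t * 2 ^ j <= 1/8 < t * 2 ^ Suc j\<close>: then \<open>2 ^ j > 1 / (16 * t)\<close>,
    and the kernel is at least a quarter of it.\<close>
  have "\<exists>j\<le>J. 1 / t <= 64 * fejer (2 ^ j) t"
  proof (cases "t > 1/8")
   case True
   have "1 / t <= 1 / (1/8)" using True by (intro divide_left_mono) auto
   then have "1 / t <= 64 * fejer (2 ^ 0) t" by (simp add: fejer_def)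
   then show ?thesis by blast
  next
   case t8: False
   define P where "P j \<longleftrightarrow> t * 2 ^ j <= 1/8" for j :: nat
   have "P 0" using t8 by (simp add: P_def)
   moreover have "\<not> P J" using False by (simp add: P_def H_def)
   ultimately have "\<exists>j<J. P j \<and> \<not> P (Suc j)"
   proof -
    have "\<exists>j<n. P j \<and> \<not> P (Suc j)" if "\<not> P n" for n
     using that
    proof (induction n)
     case (Suc n)
     show ?case
     proof (cases "P n")
      case False then show ?thesis using Suc.IH less_SucI by blast
     qed (use Suc.prems in blast)
    qed (use \<open>P 0\<close> in simp)
    then show ?thesis using \<open>\<not> P J\<close> by blast
   qed
   then obtain j where j: "j < J" "P j" "\<not> P (Suc j)" by blast
   have "1 / t <= 64 * (real (2 ^ j) / 4)" using j t unfolding P_def by (simp add: field_simps)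
   also have "... <= 64 * fejer (2 ^ j) t" using j t unfolding P_def by (intro mult_left_mono fejer_ge) auto
   finally show ?thesis using j by (intro exI[of _ j]) auto
  qed
  then obtain j where j: "j <= J" "1 / t <= 64 * fejer (2 ^ j) t" by blast
  have "1 / (6 * real H) * (1 / t) <= 1 / (6 * real H) * (66 * (\<Sum>j\<in>{..J}. fejer (2 ^ j) t))"
  proof (intro mult_left_mono)
   have "0 <= (\<Sum>j\<in>{..J}. fejer (2 ^ j) t)" by (intro sum_nonneg) (simp add: fejer_nonneg)
   then show "1 / t <= 66 * (\<Sum>j\<in>{..J}. fejer (2 ^ j) t)" using j(2) single[OF j(1)] by linarith
  qed simp
  then show ?thesis using E by (simp add: H_def)
 qed
qed

lemma psi_partial_minus: "psi_partial H (- t) = - psi_partial H t"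
 by (simp add: psi_partial_def sum_negf)

text \<open>At integers \<open>psi\<close> equals \<open>- 1/2\<close> while every partial sum is 0;
  there the kernel of full length is at least \<open>2 ^ J / 4\<close> and absorbs the jump.
  Elsewhere periodicity and oddness reduce to the half period.\<close>

lemma psi_error:
 "\<bar>psi t + psi_partial (2 ^ J) t\<bar> <= 11 / 2 ^ J * (\<Sum>j\<in>{..J}. fejer (2 ^ j) t)"
proof -
 define s where "s = frac t"
 have t: "t = s + of_int \<lfloor>t\<rfloor>" by (simp add: s_def frac_def)
 have s: "0 <= s" "s < 1" by (simp_all add: s_def frac_lt_1)
 have red: "psi t = s - 1/2" "psi_partial (2 ^ J) t = psi_partial (2 ^ J) s" "fejer N t = fejer N s" for N
  using psi_partial_add_int[of _ s "\<lfloor>t\<rfloor>"] fejer_add_int[of _ s "\<lfloor>t\<rfloor>"] t by (simp_all add: psi_def s_def)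
 consider "s = 0" | "0 < s" "s <= 1/2" | "1/2 < s" "s < 1" using s by linarith
 then show ?thesis
 proof cases
  case 1
  have "2 ^ J / 4 <= fejer (2 ^ J) 0" using fejer_ge[of 0 "2 ^ J"] by simp
  then have "11 / 2 ^ J * (2 ^ J / 4) <= 11 / 2 ^ J * fejer (2 ^ J) 0" by (intro mult_left_mono) auto
  moreover have "11 / 2 ^ J * (2 ^ J / 4) = (11 / 4 :: real)" by simp
  ultimately have "1/2 <= 11 / 2 ^ J * fejer (2 ^ J) 0" by linarith
  also have "... <= 11 / 2 ^ J * (\<Sum>j\<in>{..J}. fejer (2 ^ j) 0)"
   by (intro mult_left_mono member_le_sum) (auto simp: fejer_nonneg)
  finally show ?thesis using 1 by (simp only: red) (simp add: psi_partial_def)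
 next
  case 2
  have "\<bar>s - 1/2 + psi_partial (2 ^ J) s\<bar> = \<bar>1/2 - s - psi_partial (2 ^ J) s\<bar>" by linarith
  then show ?thesis using psi_error_half[OF 2, of J] by (simp only: red)
 next
  case 3
  have m: "psi_partial (2 ^ J) (1 - s) = - psi_partial (2 ^ J) s" "fejer N (1 - s) = fejer N s" for N
   using psi_partial_add_int[of "2 ^ J" "- s" 1] fejer_add_int[of N "- s" 1] by (simp_all add: psi_partial_minus fejer_minus)
  have "\<bar>1/2 - (1 - s) - psi_partial (2 ^ J) (1 - s)\<bar> <= 11 / 2 ^ J * (\<Sum>j\<in>{..J}. fejer (2 ^ j) (1 - s))"
   using 3 by (intro psi_error_half) auto
  then show ?thesis unfolding m red by (simp add: algebra_simps)
 qed
qed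

text \<open>The partial sum contributes the frequencies \<open>h\<close> with weight
  \<open>1 / h\<close>. The Fejer majorants contribute them with weight
  \<open>1 / 2 ^ J <= 1 / h\<close>, together with the total weight divided by \<open>2 ^ J\<close>;
  the number \<open>J + 1\<close> of dyadic lengths is the price for using majorants.\<close>

lemma sum_psi_bound:
 fixes w y :: "'a => real"
 assumes w: "\<And>i. i \<in> I ==> w i >= 0"
 shows "\<bar>\<Sum>i\<in>I. w i * psi (y i)\<bar> <= 23 * (real J + 1) * ((\<Sum>i\<in>I. w i) / 2 ^ J
   + (\<Sum>h\<in>{1..2 ^ J}. norm (\<Sum>i\<in>I. of_real (w i) * ee (real h * y i)) / real h))"
proof -
 define H where "H = (2::nat) ^ J"
 define W where "W h = norm (\<Sum>i\<in>I. of_real (w i) * ee (real h * y i))" for h :: nat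
 define T where "T = (\<Sum>h\<in>{1..H}. W h / real h)"
 have H: "real H >= 1" by (simp add: H_def)
 have T0: "T >= 0" unfolding T_def W_def by (intro sum_nonneg) auto
 have W0: "(\<Sum>i\<in>I. w i) >= 0" using w by (intro sum_nonneg)
 have part: "\<bar>\<Sum>i\<in>I. w i * psi_partial H (y i)\<bar> <= T"
 proof -
  have "(\<Sum>i\<in>I. w i * psi_partial H (y i)) = (\<Sum>h\<in>{1..H}. Im (\<Sum>i\<in>I. of_real (w i) * ee (real h * y i)) / (pi * real h))"
   unfolding psi_partial_def sum_distrib_left
   by (subst sum.swap) (simp add: ee_def sum_divide_distrib mult_ac)
  then have "\<bar>\<Sum>i\<in>I. w i * psi_partial H (y i)\<bar> <= (\<Sum>h\<in>{1..H}. \<bar>Im (\<Sum>i\<in>I. of_real (w i) * ee (real h * y i)) / (pi * real h)\<bar>)"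
   by (simp only: sum_abs)
  also have "... <= T" unfolding T_def
  proof (rule sum_mono)
   fix h assume h: "h \<in> {1..H}"
   have "\<bar>Im (\<Sum>i\<in>I. of_real (w i) * ee (real h * y i))\<bar> / (pi * real h) <= W h / (1 * real h)"
    unfolding W_def using h pi_gt3 by (intro frac_le abs_Im_le_cmod mult_right_mono) auto
   then show "\<bar>Im (\<Sum>i\<in>I. of_real (w i) * ee (real h * y i)) / (pi * real h)\<bar> <= W h / real h"
    by (simp add: abs_divide abs_mult)
  qed
  finally show ?thesis .
 qed
 have WT: "(\<Sum>h\<in>{1..2 ^ j}. W h) <= real H * T" if "j <= J" for j
 proof -
  have "(\<Sum>h\<in>{1..2 ^ j}. W h) <= (\<Sum>h\<in>{1..H}. W h)"
   using that unfolding W_def H_def by (intro sum_mono2) (auto intro: order.trans[OF _ power_increasing])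
  also have "... <= (\<Sum>h\<in>{1..H}. real H * (W h / real h))"
  proof (rule sum_mono)
   fix h assume h: "h \<in> {1..H}"
   have "real h * (W h / real h) <= real H * (W h / real h)" using h by (intro mult_right_mono) (auto simp: W_def)
   then show "W h <= real H * (W h / real h)" using h by simp
  qed
  finally show ?thesis by (simp add: T_def sum_distrib_left)
 qed
 have err: "\<bar>\<Sum>i\<in>I. w i * (psi (y i) + psi_partial H (y i))\<bar> <= 11 / real H * ((real J + 1) * ((\<Sum>i\<in>I. w i) + 2 * (real H * T)))"
 proof -
  have "\<bar>\<Sum>i\<in>I. w i * (psi (y i) + psi_partial H (y i))\<bar> <= (\<Sum>i\<in>I. w i * (11 / real H * (\<Sum>j\<in>{..J}. fejer (2 ^ j) (y i))))"
  proof (rule order.trans[OF sum_abs], rule sum_mono)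
   fix i assume "i \<in> I"
   then show "\<bar>w i * (psi (y i) + psi_partial H (y i))\<bar> <= w i * (11 / real H * (\<Sum>j\<in>{..J}. fejer (2 ^ j) (y i)))"
    unfolding abs_mult H_def of_nat_power of_nat_numeral using psi_error[of "y i" J] w by (intro mult_mono) auto
  qed
  also have "... = 11 / real H * (\<Sum>j\<in>{..J}. \<Sum>i\<in>I. w i * fejer (2 ^ j) (y i))"
   by (subst sum.swap) (simp add: sum_distrib_left mult_ac)
  also have "... <= 11 / real H * (\<Sum>j\<in>{..J}. (\<Sum>i\<in>I. w i) + 2 * (real H * T))"
  proof (intro mult_left_mono sum_mono)
   fix j assume "j \<in> {..J}"
   then have "j <= J" by simp
   have "(\<Sum>i\<in>I. w i * fejer (2 ^ j) (y i)) <= (\<Sum>i\<in>I. w i) + 2 * (\<Sum>h\<in>{1..2 ^ j}. norm (\<Sum>i\<in>I. of_real (w i) * ee (real h * y i)))"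
    by (rule fejer_weighted_sum) (auto simp: w)
   then show "(\<Sum>i\<in>I. w i * fejer (2 ^ j) (y i)) <= (\<Sum>i\<in>I. w i) + 2 * (real H * T)"
    using WT[OF \<open>j <= J\<close>] by (simp only: W_def)
  qed simp
  finally show ?thesis by (simp add: add.commute)
 qed
 have eq: "(\<Sum>i\<in>I. w i * psi (y i)) = (\<Sum>i\<in>I. w i * (psi (y i) + psi_partial H (y i))) - (\<Sum>i\<in>I. w i * psi_partial H (y i))"
  by (simp add: distrib_left sum.distrib)
 have e2: "11 / real H * ((real J + 1) * ((\<Sum>i\<in>I. w i) + 2 * (real H * T))) = (real J + 1) * (11 * ((\<Sum>i\<in>I. w i) / real H) + 22 * T)"
  using H by (simp add: field_simps)
 have "\<bar>\<Sum>i\<in>I. w i * psi (y i)\<bar> <= (real J + 1) * (11 * ((\<Sum>i\<in>I. w i) / real H) + 22 * T) + T"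
  using err part unfolding eq e2 by linarith
 also have "... <= (real J + 1) * (23 * ((\<Sum>i\<in>I. w i) / real H) + 22 * T) + (real J + 1) * T"
  using T0 W0 H by (intro add_mono mult_left_mono mult_right_mono) (auto simp: mult_le_cancel_right1)
 also have "... = 23 * (real J + 1) * ((\<Sum>i\<in>I. w i) / real H + T)" by (simp add: algebra_simps add_divide_distrib)
 finally show ?thesis by (simp add: H_def T_def W_def)
qed

section \<open>Summation by parts with smooth weights\<close>

lemma sum_by_parts_int:
 fixes f E :: "int => complex"
 assumes "i - 1 <= j"
 shows "(\<Sum>n\<in>{i..j}. f n * (E (n+1) - E n)) = f j * E (j+1) - f (i-1) * E i - (\<Sum>n\<in>{i..j}. (f n - f (n-1)) * E n)"
 using assms
proof (induction j rule: int_ge_induct)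
 case (step j)
 have "{i..j+1} = insert (j+1) {i..j}" using step.hyps by auto
 then show ?case using step by (simp add: algebra_simps)
qed simp

text \<open>After factoring out \<open>ee q\<close>, the symmetric part
  \<open>ee s - 2 + ee (- s)\<close> has norm equal to the square of \<open>norm (ee s - 1)\<close>;
  the remainder measures how far \<open>p\<close>, \<open>q\<close>, \<open>r\<close> are from an
  arithmetic progression.\<close>

lemma norm_ee_second_difference:
 "norm (ee p - 2 * ee q + ee r) <= 2 * pi * \<bar>p - 2*q + r\<bar> + 4 * pi^2 * (p - q)^2"
proof -
 define s where "s = p - q"
 have 1: "ee p = ee q * ee s" "ee r = ee q * ee (r - q)"
  by (simp_all add: s_def flip: ee_add)
 have "ee p - 2 * ee q + ee r = ee q * ((ee s - 2 + ee (-s)) + (ee (r - q) - ee (-s)))"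
  by (simp add: 1 algebra_simps)
 then have "norm (ee p - 2 * ee q + ee r) = norm ((ee s - 2 + ee (-s)) + (ee (r - q) - ee (-s)))"
  by (simp add: norm_mult)
 also have "... <= norm (ee s - 2 + ee (-s)) + norm (ee (r - q) - ee (-s))" by (rule norm_triangle_ineq)
 also have "norm (ee (r - q) - ee (-s)) <= 2 * pi * \<bar>p - 2*q + r\<bar>"
  using norm_ee_diff_le[of "r - q" "-s"] by (simp add: s_def algebra_simps)
 also have "norm (ee s - 2 + ee (-s)) <= 4 * pi^2 * (p - q)^2"
 proof -
  have "ee s - 2 + ee (-s) = - ((ee s - 1) * cnj (ee s - 1))"
  proof -
   have "ee s * cnj (ee s) = 1" by (simp flip: ee_diff)
   then show ?thesis by (simp add: ee_minus algebra_simps)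
  qed
  then have "norm (ee s - 2 + ee (-s)) = (norm (ee s - 1))^2" by (simp add: norm_mult power2_eq_square del: complex_cnj_diff)
  also have "... <= (2 * pi * \<bar>s\<bar>)^2" using norm_ee_diff_le[of s 0] by (intro power_mono) auto
  finally show ?thesis by (simp add: s_def power_mult_distrib)
 qed
 finally show ?thesis by simp
qed

text \<open>Summing by parts twice gains a factor \<open>(M \<mu>)\<^sup>2\<close> over the trivial bound; the
 weight must vanish smoothly at the ends.\<close>

lemma smooth_sum_bound:
 fixes u x :: "int => real" and N :: int
 defines "M \<equiv> real_of_int N" and "d \<equiv> (\<lambda>n. x (n+1) - x n)"
 assumes N: "N >= 1" and c: "c >= 1" and mu: "\<mu> > 0"
  and u0: "\<And>n. n < 0 \<or> n > N ==> u n = 0"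
  and u1: "\<And>n. \<bar>u n\<bar> <= 1"
  and u2: "\<And>n. \<bar>u (n+1) - u n\<bar> <= c / M"
  and u3: "\<And>n. \<bar>u (n+2) - 2 * u (n+1) + u n\<bar> <= c / M^2"
  and d1: "\<And>n. -2 <= n ==> n <= N + 2 ==> \<mu> <= \<bar>d n\<bar> \<and> \<bar>d n\<bar> <= 1/2"
  and d2: "\<And>n. -2 <= n ==> n <= N + 1 ==> \<bar>d (n+1) - d n\<bar> <= c * \<mu> / M"
  and d3: "\<And>n. -2 <= n ==> n <= N ==> \<bar>d (n+2) - 2 * d (n+1) + d n\<bar> <= c * \<mu> / M^2"
 shows "norm (\<Sum>n\<in>{0..N}. of_real (u n) * ee (x n)) <= 8 * c^2 / (M * \<mu>^2)"
proof -
 have M: "M >= 1" using N by (simp add: M_def)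
 define E where "E n = ee (x n)" for n
 define a where "a n = ee (d n)" for n
 define t where "t n = 1 / (a n - 1)" for n
 \<comment> \<open>\<open>v\<close> holds the coefficients for the first summation by parts,
   \<open>w\<close> their differences, and \<open>y\<close> the coefficients for the second
   one.\<close>
 define v where "v n = of_real (u n) * t n" for n
 define w where "w n = v n - v (n-1)" for n
 define y where "y n = w n * t n" for n
 have muh: "\<mu> <= 1/2" using d1[of 0] N by auto
 have na: "norm (a n - 1) >= 4 * \<mu>" if "-2 <= n" "n <= N + 2" for n
  using norm_ee_minus_one_ge[of "d n"] d1[OF that] by (auto simp: a_def)
 have anz: "a n \<noteq> 1" if "-2 <= n" "n <= N + 2" for n using na[OF that] mu by auto
 have nt: "norm (t n) <= 1 / (4*\<mu>)" if "-2 <= n" "n <= N + 2" for n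
  unfolding t_def norm_divide using na[OF that] mu by (simp add: frac_le)
 have step: "E n = t n * (E (n+1) - E n)" if "-2 <= n" "n <= N + 2" for n
 proof -
  have "E (n+1) = E n * a n" by (simp add: E_def a_def d_def flip: ee_add)
  then show ?thesis using anz[OF that] by (simp add: t_def field_simps)
 qed
 have da: "norm (a (n+1) - a n) <= 2 * pi * (c * \<mu> / M)" if "-2 <= n" "n <= N + 1" for n
  unfolding a_def by (rule order.trans[OF norm_ee_diff_le], rule mult_left_mono) (use d2[OF that] in auto)
 have dteq: "t (n+1) - t n = - (a (n+1) - a n) * (t (n+1) * t n)" if "-2 <= n" "n <= N + 1" for n
  using anz[of n] anz[of "n+1"] that by (simp add: t_def field_simps)
 have tt: "norm (t (n+1) * t n) <= 1/(16*\<mu>^2)" if "-2 <= n" "n <= N + 1" for n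
 proof -
  have "norm (t (n+1)) * norm (t n) <= (1/(4*\<mu>)) * (1/(4*\<mu>))"
   using nt[of n] nt[of "n+1"] that mu by (intro mult_mono) auto
  then show ?thesis by (simp add: norm_mult power2_eq_square)
 qed
 have pi4: "pi <= 3.2" using pi_less_4 pi_approx by simp
 have dt: "norm (t (n+1) - t n) <= c / (2 * M * \<mu>)" if "-2 <= n" "n <= N + 1" for n
 proof -
  have "norm (t (n+1) - t n) <= (2 * pi * (c * \<mu> / M)) * (1/(16*\<mu>^2))"
   unfolding dteq[OF that] norm_mult norm_minus_cancel
   by (intro mult_mono da[OF that] tt[OF that, unfolded norm_mult]) (use c M mu in auto)
  also have "... = (pi/4) * (c / (2 * M * \<mu>))" using M mu by (simp add: field_simps power2_eq_square)
  also have "... <= 1 * (c / (2 * M * \<mu>))" using pi4 c M mu by (intro mult_right_mono) auto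
  finally show ?thesis by simp
 qed
 have dda: "norm (a (n+2) - 2 * a (n+1) + a n) <= 28 * c^2 * \<mu> / M^2" if "-2 <= n" "n <= N" for n
 proof -
  have "norm (a (n+2) - 2 * a (n+1) + a n) <= 2 * pi * \<bar>d (n+2) - 2 * d (n+1) + d n\<bar> + 4 * pi^2 * (d (n+2) - d (n+1))^2"
   unfolding a_def by (rule norm_ee_second_difference)
  also have "(d (n+2) - d (n+1))^2 <= (c * \<mu> / M)^2"
  proof -
   have "\<bar>d (n+2) - d (n+1)\<bar> <= c * \<mu> / M" using d2[of "n+1"] that by (simp add: add.assoc)
   then have "\<bar>d (n+2) - d (n+1)\<bar>^2 <= (c * \<mu> / M)^2" by (intro power_mono) auto
   then show ?thesis by simp
  qed
  also have "2 * pi * \<bar>d (n+2) - 2 * d (n+1) + d n\<bar> + 4 * pi^2 * (c * \<mu> / M)^2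
    <= 2 * 3.2 * (c * (c * \<mu>) / M^2) + 4 * 3.2^2 * (c^2 * \<mu> * (1/2) / M^2)"
  proof (intro add_mono mult_mono)
   have "c * \<mu> <= c * (c * \<mu>)" using c mu by (simp add: mult_le_cancel_left1)
   then have "c * \<mu> / M^2 <= c * (c * \<mu>) / M^2" by (intro divide_right_mono) auto
   then show "\<bar>d (n+2) - 2 * d (n+1) + d n\<bar> <= c * (c * \<mu>) / M^2" using d3[OF that] by linarith
   have "\<mu> * \<mu> <= \<mu> * (1/2)" using muh mu by (intro mult_left_mono) auto
   then show "(c * \<mu> / M)^2 <= c^2 * \<mu> * (1/2) / M^2"
    using mult_left_mono[OF \<open>\<mu> * \<mu> <= \<mu> * (1/2)\<close>, of "c^2/M^2"] by (simp add: power_divide power_mult_distrib power2_eq_square[of \<mu>])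
   show "pi^2 <= 3.2^2" by (intro power_mono pi4) auto
  qed (use pi4 in auto)
  also have "... = 26.88 * (c^2 * \<mu> / M^2)" by (simp add: power2_eq_square field_simps)
  also have "... <= 28 * (c^2 * \<mu> / M^2)" using mu by (intro mult_right_mono) auto
  finally show ?thesis by simp
 qed
 have ddt: "norm (t (n+2) - 2 * t (n+1) + t n) <= 4 * c^2 / (M^2 * \<mu>)" if "-2 <= n" "n <= N" for n
 proof -
  have e1: "t (n+2) - t (n+1) = - (a (n+2) - a (n+1)) * (t (n+2) * t (n+1))"
   using dteq[of "n+1"] that by (simp add: add.assoc)
  have e0: "t (n+1) - t n = - (a (n+1) - a n) * (t (n+1) * t n)" using dteq[of n] that by simp
  have "t (n+2) - 2 * t (n+1) + t n = (t (n+2) - t (n+1)) - (t (n+1) - t n)" by simp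
  also have "... = - ((a (n+2) - 2 * a (n+1) + a n) * (t (n+2) * t (n+1))) - (a (n+1) - a n) * (t (n+1) * ((t (n+2) - t (n+1)) + (t (n+1) - t n)))"
   unfolding e1 e0 by (subst e1[symmetric], subst e0[symmetric]) (simp add: algebra_simps)
  finally have eq: "norm (t (n+2) - 2 * t (n+1) + t n) <=
    norm (a (n+2) - 2 * a (n+1) + a n) * norm (t (n+2) * t (n+1)) + norm (a (n+1) - a n) * (norm (t (n+1)) * norm ((t (n+2) - t (n+1)) + (t (n+1) - t n)))"
   using norm_triangle_ineq4[of "- ((a (n+2) - 2 * a (n+1) + a n) * (t (n+2) * t (n+1)))" "(a (n+1) - a n) * (t (n+1) * ((t (n+2) - t (n+1)) + (t (n+1) - t n)))"]
   by (simp only: norm_mult norm_minus_cancel)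
  also have "... <= (28 * c^2 * \<mu> / M^2) * (1/(16*\<mu>^2)) + (2 * pi * (c * \<mu> / M)) * ((1/(4*\<mu>)) * (c / (2 * M * \<mu>) + c / (2 * M * \<mu>)))"
  proof (intro add_mono mult_mono dda da)
   show "norm (t (n+2) * t (n+1)) <= 1/(16*\<mu>^2)" using tt[of "n+1"] that by (simp add: add.assoc)
   show "norm (t (n+1)) <= 1/(4*\<mu>)" using nt[of "n+1"] that by simp
   show "norm ((t (n+2) - t (n+1)) + (t (n+1) - t n)) <= c / (2 * M * \<mu>) + c / (2 * M * \<mu>)"
    by (rule order.trans[OF norm_triangle_ineq], rule add_mono)
      (use dt[of n] dt[of "n+1"] that in \<open>auto simp: add.assoc\<close>)
  qed (use that c M mu in auto)
  also have "... = (28/16 + pi/2) * (c^2 / (M^2 * \<mu>))" using M mu by (simp add: field_simps power2_eq_square)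
  also have "... <= 4 * (c^2 / (M^2 * \<mu>))" using pi4 mu by (intro mult_right_mono) auto
  finally show ?thesis by simp
 qed
 have nw: "norm (w (n+1)) <= c / (M * \<mu>)" if "-2 <= n" "n <= N + 1" for n
 proof -
  have "w (n+1) = of_real (u (n+1) - u n) * t (n+1) + of_real (u n) * (t (n+1) - t n)"
   by (simp add: w_def v_def algebra_simps)
  also have "norm ... <= norm (of_real (u (n+1) - u n) * t (n+1)) + norm (of_real (u n) * (t (n+1) - t n))"
   by (rule norm_triangle_ineq)
  also have "... <= (c/M) * (1/(4*\<mu>)) + 1 * (c / (2 * M * \<mu>))"
   unfolding norm_mult norm_of_real
   by (intro add_mono mult_mono u1 u2) (use dt[of n] nt[of "n+1"] that c M mu in auto)
  also have "... <= c / (M * \<mu>)" using c M mu by (simp add: field_simps)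
  finally show ?thesis .
 qed
 have dw: "norm (w (n+2) - w (n+1)) <= 6 * c^2 / (M^2 * \<mu>)" if "-2 <= n" "n <= N" for n
 proof -
  have eq: "w (n+2) - w (n+1) = of_real (u (n+2) - 2 * u (n+1) + u n) * t (n+2)
   + (2 * of_real (u (n+1) - u n) * (t (n+2) - t (n+1)) + of_real (u n) * (t (n+2) - 2 * t (n+1) + t n))"
   by (simp add: w_def v_def algebra_simps)
  have "norm (w (n+2) - w (n+1)) <= norm (of_real (u (n+2) - 2 * u (n+1) + u n) * t (n+2))
   + (norm (2 * of_real (u (n+1) - u n) * (t (n+2) - t (n+1))) + norm (of_real (u n) * (t (n+2) - 2 * t (n+1) + t n)))"
   unfolding eq by (rule order.trans[OF norm_triangle_ineq], rule add_left_mono, rule norm_triangle_ineq)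
  also have "... <= (c/M^2) * (1/(4*\<mu>)) + ((2 * (c/M)) * (c / (2 * M * \<mu>)) + 1 * (4 * c^2 / (M^2 * \<mu>)))"
  proof -
   have "norm (t (n+2) - t (n+1)) <= c / (2 * M * \<mu>)" using dt[of "n+1"] that by (simp add: add.assoc)
   moreover have "norm (t (n+2)) <= 1/(4*\<mu>)" using nt that by simp
   ultimately show ?thesis
    unfolding norm_mult norm_of_real
    by (intro add_mono mult_mono u1 u2 u3 ddt) (use that c M mu u2[of n] in auto)
  qed
  also have "... = (c/4 + 5 * c^2) * (1 / (M^2 * \<mu>))" using M mu by (simp add: field_simps power2_eq_square)
  also have "... <= (6 * c^2) * (1 / (M^2 * \<mu>))"
  proof (rule mult_right_mono)
   have "c * 1 <= c * c" using c by (intro mult_left_mono) auto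
   then show "c/4 + 5 * c^2 <= 6 * c^2" by (simp add: power2_eq_square) (use c in linarith)
  qed (use mu in auto)
  finally show ?thesis by simp
 qed
 have dy: "norm (y n - y (n-1)) <= 2 * c^2 / (M^2 * \<mu>^2)" if "0 <= n" "n <= N + 2" for n
 proof -
  have "y n - y (n-1) = (w n - w (n-1)) * t n + w (n-1) * (t n - t (n-1))"
   by (simp add: y_def algebra_simps)
  also have "norm ... <= norm ((w n - w (n-1)) * t n) + norm (w (n-1) * (t n - t (n-1)))"
   by (rule norm_triangle_ineq)
  also have "... <= (6 * c^2 / (M^2 * \<mu>)) * (1/(4*\<mu>)) + (c / (M * \<mu>)) * (c / (2 * M * \<mu>))"
   unfolding norm_mult
  proof (intro add_mono mult_mono nt)
   show "norm (w n - w (n-1)) <= 6 * c^2 / (M^2 * \<mu>)" using dw[of "n-2"] that by simp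
   show "norm (w (n-1)) <= c / (M * \<mu>)" using nw[of "n-2"] that by simp
   show "norm (t n - t (n-1)) <= c / (2 * M * \<mu>)" using dt[of "n-1"] that by simp
  qed (use that c M mu in auto)
  also have "... = 2 * c^2 / (M^2 * \<mu>^2)" using M mu by (simp add: field_simps power2_eq_square)
  finally show ?thesis .
 qed
 \<comment> \<open>The range is extended by two places on which the weight vanishes. Then
   \<open>v\<close> and \<open>y\<close> vanish at \<open>N + 2\<close> and at \<open>- 1\<close>,
   so neither summation by parts leaves a boundary term.\<close>
 have "(\<Sum>n\<in>{0..N}. of_real (u n) * ee (x n)) = (\<Sum>n\<in>{0..N+2}. of_real (u n) * ee (x n))"
  by (rule sum.mono_neutral_left) (auto simp: u0)
 also have "... = (\<Sum>n\<in>{0..N+2}. v n * (E (n+1) - E n))"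
  by (rule sum.cong) (use step in \<open>auto simp: v_def E_def\<close>)
 also have "... = v (N+2) * E (N+2+1) - v (0-1) * E 0 - (\<Sum>n\<in>{0..N+2}. (v n - v (n-1)) * E n)"
  using N by (intro sum_by_parts_int) auto
 also have "... = - (\<Sum>n\<in>{0..N+2}. w n * E n)" by (simp add: v_def u0 w_def)
 also have "(\<Sum>n\<in>{0..N+2}. w n * E n) = (\<Sum>n\<in>{0..N+2}. y n * (E (n+1) - E n))"
  by (rule sum.cong) (use step in \<open>auto simp: y_def\<close>)
 also have "... = y (N+2) * E (N+2+1) - y (0-1) * E 0 - (\<Sum>n\<in>{0..N+2}. (y n - y (n-1)) * E n)"
  using N by (intro sum_by_parts_int) auto
 also have "... = - (\<Sum>n\<in>{0..N+2}. (y n - y (n-1)) * E n)" by (simp add: v_def u0 w_def y_def)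
 finally have "norm (\<Sum>n\<in>{0..N}. of_real (u n) * ee (x n)) <= (\<Sum>n\<in>{0..N+2}. norm (y n - y (n-1)))"
  using norm_sum[of "\<lambda>n. (y n - y (n-1)) * E n" "{0..N+2}"] by (simp add: norm_mult E_def)
 also have "... <= (\<Sum>n\<in>{0..N+2}. 2 * c^2 / (M^2 * \<mu>^2))" by (rule sum_mono) (use dy in auto)
 also have "... = (M + 3) * (2 * c^2 / (M^2 * \<mu>^2))" using N by (simp add: M_def)
 also have "... <= (4 * M) * (2 * c^2 / (M^2 * \<mu>^2))" using M by (intro mult_right_mono) auto
 also have "... = 8 * c^2 / (M * \<mu>^2)" using M mu by (simp add: field_simps power2_eq_square)
 finally show ?thesis .
qed

section \<open>The smooth cut-off and harmonic sums\<close>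

definition bump :: "real => real" where
 "bump t = (sin (pi * max 0 (min 1 t)))\<^sup>2"

lemma bump_bounds: "0 <= bump t" "bump t <= 1"
 by (auto simp: bump_def abs_square_le_1)

lemma bump_outside: "t <= 0 \<or> t >= 1 ==> bump t = 0"
 by (auto simp: bump_def max_def min_def)

lemma bump_inside: "0 <= t ==> t <= 1 ==> bump t = (1 - cos (2 * pi * t)) / 2"
 by (simp add: bump_def mult.assoc cos_double_sin)

lemma abs_cos_diff_le: "\<bar>cos a - cos b\<bar> <= \<bar>a - b\<bar>" for a b :: real
proof -
 have "\<bar>cos a - cos b\<bar> = 2 * \<bar>sin ((a+b)/2)\<bar> * \<bar>sin ((b-a)/2)\<bar>"
  by (simp add: cos_diff_cos abs_mult)
 also have "... <= 2 * 1 * \<bar>(b-a)/2\<bar>"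
  by (intro mult_mono abs_sin_x_le_abs_x) auto
 finally show ?thesis by simp
qed

lemma bump_lipschitz: "\<bar>bump s - bump t\<bar> <= pi * \<bar>s - t\<bar>"
proof -
 define k where "k = (\<lambda>t::real. max 0 (min 1 t))"
 have b: "bump t = (1 - cos (2 * pi * k t)) / 2" for t
  by (simp add: bump_def k_def mult.assoc cos_double_sin)
 have "bump s - bump t = (cos (2 * pi * k t) - cos (2 * pi * k s)) / 2" unfolding b by (simp add: diff_divide_distrib)
 then have "\<bar>bump s - bump t\<bar> = \<bar>cos (2 * pi * k t) - cos (2 * pi * k s)\<bar> / 2"
  by (metis abs_divide abs_numeral)
 also have "... <= \<bar>2 * pi * k t - 2 * pi * k s\<bar> / 2" by (intro divide_right_mono abs_cos_diff_le) auto
 also have "... = pi * \<bar>k t - k s\<bar>" by (simp add: abs_mult flip: right_diff_distrib)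
 also have "\<bar>k t - k s\<bar> <= \<bar>s - t\<bar>" by (auto simp: k_def max_def min_def)
 finally show ?thesis by simp
qed

lemma bump_le_square: "bump t <= (pi * t)\<^sup>2" "bump t <= (pi * (1 - t))\<^sup>2"
proof -
 have *: "(sin y)\<^sup>2 <= y^2" for y :: real
  using abs_sin_x_le_abs_x[of y] by (simp add: abs_le_square_iff)
 show "bump t <= (pi * t)\<^sup>2"
  using *[of "pi * t"] bump_outside[of t] by (cases "0 <= t \<and> t <= 1") (auto simp: bump_def)
 have "(sin (pi * t))\<^sup>2 = (sin (pi * (1 - t)))\<^sup>2"
  using sin_pi_minus[of "pi*t"] by (simp add: algebra_simps)
 then show "bump t <= (pi * (1 - t))\<^sup>2"
  using *[of "pi * (1-t)"] bump_outside[of t] by (cases "0 <= t \<and> t <= 1") (auto simp: bump_def)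
qed

text \<open>If all three points lie in \<open>[0, 1]\<close>, this is the addition theorem for the
  cosine. If they straddle an end, each value is already of order \<open>h^2\<close>, because
  \<open>bump\<close> vanishes to second order at both ends. This is the reason for a squared sine:
  two summations by parts need second differences of order \<open>h^2\<close>.\<close>

lemma bump_second_difference:
 assumes "h >= 0"
 shows "\<bar>bump (t + 2*h) - 2 * bump (t + h) + bump t\<bar> <= 12 * pi^2 * h^2"
proof (cases "0 <= t \<and> t + 2*h <= 1")
 case True
 have e: "bump (t + 2*h) = (1 - cos (2*pi*(t+h) + 2*pi*h)) / 2" "bump (t+h) = (1 - cos (2*pi*(t+h))) / 2"
   "bump t = (1 - cos (2*pi*(t+h) - 2*pi*h)) / 2"
  using True assms by (simp_all add: bump_inside algebra_simps)
 have "bump (t + 2*h) - 2 * bump (t + h) + bump t =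
   - (cos (2*pi*(t+h) + 2*pi*h) - 2 * cos (2*pi*(t+h)) + cos (2*pi*(t+h) - 2*pi*h)) / 2"
  unfolding e by (simp add: field_simps)
 also have "... = cos (2*pi*(t+h)) * (1 - cos (2*pi*h))"
  unfolding cos_add[of "2*pi*(t+h)"] cos_diff[of "2*pi*(t+h)"] by (simp add: right_diff_distrib)
 finally have "\<bar>bump (t + 2*h) - 2 * bump (t + h) + bump t\<bar> = \<bar>cos (2*pi*(t+h))\<bar> * \<bar>1 - cos (2*pi*h)\<bar>"
  by (simp add: abs_mult)
 also have "... <= 1 * \<bar>1 - cos (2*pi*h)\<bar>" by (intro mult_right_mono) auto
 also have "\<bar>1 - cos (2*pi*h)\<bar> = 2 * (sin (pi*h))\<^sup>2"
  by (simp add: mult.assoc cos_double_sin)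
 also have "... <= 2 * (pi*h)\<^sup>2"
  using abs_sin_x_le_abs_x[of "pi*h"] by (simp add: abs_le_square_iff)
 also have "... <= 12 * pi^2 * h^2" by (simp add: power_mult_distrib)
 finally show ?thesis by simp
next
 case False
 have *: "bump s <= 4 * pi^2 * h^2" if "t <= s" "s <= t + 2*h" for s
 proof (cases "0 <= s \<and> s <= 1")
  case True
  have "(s >= 0 \<and> s <= 2*h) \<or> (1 - s >= 0 \<and> 1 - s <= 2*h)" using that True False by auto
  then have "(pi * s)\<^sup>2 <= (pi * (2*h))\<^sup>2 \<or> (pi * (1 - s))\<^sup>2 <= (pi * (2*h))\<^sup>2"
   by (auto intro!: power_mono mult_left_mono)
  then have "bump s <= (pi * (2*h))\<^sup>2"
   using order.trans[OF bump_le_square(1)[of s]] order.trans[OF bump_le_square(2)[of s]] by blast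
  then show ?thesis by (simp add: power_mult_distrib)
 next
  case False then show ?thesis using bump_outside[of s] by auto
 qed
 have "bump t <= 4 * pi^2 * h^2" "bump (t+h) <= 4 * pi^2 * h^2" "bump (t+2*h) <= 4 * pi^2 * h^2"
  using * assms by auto
 then show ?thesis using bump_bounds[of t] bump_bounds[of "t+h"] bump_bounds[of "t+2*h"]
  by (simp add: abs_le_iff)
qed

lemma bump_ge_half: assumes "1/4 <= t" "t <= 3/4" shows "bump t >= 1/2"
proof -
 have "cos (2*pi*t) <= 0"
 proof -
  have "cos (2*pi*t - pi) >= 0"
   by (rule cos_ge_zero) (use assms in \<open>auto simp: field_simps\<close>)
  then show ?thesis by (simp add: cos_diff)
 qed
 then show ?thesis using assms by (simp add: bump_inside)
qed

lemma ln_Suc_ge: "1 / (real n + 1) <= ln (real n + 1) - ln (real n)" if "n >= 1" for n :: nat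
proof -
 have "ln (real n / (real n + 1)) <= real n / (real n + 1) - 1"
  using that by (intro ln_le_minus_one) auto
 then show ?thesis using that by (simp add: ln_div field_simps)
qed

lemma sum_inverse_le_ln: "1 <= n ==> (\<Sum>k\<in>{1..n}. 1 / real k) <= 1 + ln (real n)"
proof (induction n rule: dec_induct)
 case (step n)
 have "(\<Sum>k\<in>{1..Suc n}. 1 / real k) = (\<Sum>k\<in>{1..n}. 1 / real k) + 1 / (real n + 1)" using step by (simp add: add.commute)
 then show ?case using step ln_Suc_ge[of n] by (simp add: add.commute)
qed simp

lemma sum_inverse_int: "1 <= M ==> (\<Sum>k\<in>{1..M}. 1 / real_of_int k) <= 1 + ln (real_of_int M)"
proof -
 assume "1 <= M"
 have "(\<Sum>k\<in>{1..M}. 1 / real_of_int k) = (\<Sum>k\<in>{1..nat M}. 1 / real k)"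
  by (rule sum.reindex_bij_witness[of _ int nat]) auto
 then show ?thesis using sum_inverse_le_ln[of "nat M"] \<open>1 <= M\<close> by simp
qed

section \<open>Completion and Weyl shifts\<close>

lemma norm_sum_abel:
 fixes a :: "int => real" and z :: "int => complex"
 assumes "i <= j" "B >= 0"
  and S: "\<And>l. i <= l ==> l <= j ==> norm (\<Sum>n\<in>{i..l}. z n) <= B"
  and A: "\<bar>a j\<bar> <= A"
  and d: "\<And>n. i <= n ==> n < j ==> \<bar>a (n+1) - a n\<bar> <= \<delta>"
 shows "norm (\<Sum>n\<in>{i..j}. of_real (a n) * z n) <= (A + of_int (j - i) * \<delta>) * B"
proof -
 define Z where "Z l = (\<Sum>n\<in>{i..l}. z n)" for l
 have eq: "(\<Sum>n\<in>{i..j}. of_real (a n) * z n) = of_real (a j) * Z j - (\<Sum>n\<in>{i..<j}. of_real (a (n+1) - a n) * Z n)"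
  using \<open>i <= j\<close>
 proof (induction j rule: int_ge_induct)
  case (step j)
  have s: "{i..j+1} = insert (j+1) {i..j}" "{i..<j+1} = insert j {i..<j}" using step.hyps by auto
  have "Z (j+1) = z (j+1) + Z j" unfolding Z_def s by simp
  then show ?case unfolding s using step by (simp add: algebra_simps)
 qed (simp add: Z_def)
 have "norm (\<Sum>n\<in>{i..<j}. of_real (a (n+1) - a n) * Z n) <= (\<Sum>n\<in>{i..<j}. \<delta> * B)"
 proof (rule sum_norm_le)
  fix n assume n: "n \<in> {i..<j}"
  have "\<bar>a (n+1) - a n\<bar> * norm (Z n) <= \<delta> * B"
   by (rule mult_mono) (use d[of n] S[of n] n in \<open>auto simp: Z_def\<close>)
  then show "norm (of_real (a (n+1) - a n) * Z n) <= \<delta> * B" by (simp only: norm_mult norm_of_real)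
 qed
 also have "... = of_int (j - i) * \<delta> * B" using \<open>i <= j\<close> by simp
 finally have 1: "norm (\<Sum>n\<in>{i..<j}. of_real (a (n+1) - a n) * Z n) <= of_int (j - i) * \<delta> * B" .
 have 2: "norm (of_real (a j) * Z j) <= A * B"
  unfolding norm_mult using A S[of j] \<open>i <= j\<close> \<open>B >= 0\<close> by (intro mult_mono) (auto simp: Z_def)
 show ?thesis unfolding eq
  using norm_triangle_ineq4[of "of_real (a j) * Z j"] 1 2 by (smt (verit) distrib_right)
qed

lemma ee_power: "ee t ^ n = ee (real n * t)"
 by (induction n) (auto simp: ee_add algebra_simps)

lemma sum_ee_orthogonal:
 fixes M d :: int
 assumes "M >= 1"
 shows "(\<Sum>k\<in>{0..<M}. ee (of_int k * of_int d / of_int M)) = (if M dvd d then of_int M else 0)"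
proof (cases "M dvd d")
 case True
 then obtain e where e: "d = M * e" by auto
 have "ee (of_int k * of_int d / of_int M) = 1" for k
 proof -
  have "of_int k * of_int d / of_int M = real_of_int (k * e)" using assms e by simp
  then show ?thesis by (metis ee_of_int)
 qed
 then show ?thesis using True assms by simp
next
 case False
 define z where "z = ee (of_int d / of_int M)"
 have "z \<noteq> 1"
 proof
  assume "z = 1"
  then have "sin (pi * (of_int d / of_int M)) = 0" using norm_ee_minus_one[of "of_int d / of_int M"] by (simp add: z_def)
  then obtain i :: int where "pi * (of_int d / of_int M) = of_int i * pi" by (auto simp: sin_zero_iff_int2)
  then have "real_of_int d = of_int (i * M)" using assms by (simp add: field_simps)
  then have "d = i * M" by (simp only: of_int_eq_iff)
  then show False using False by simp
 qed
 have "(\<Sum>k\<in>{0..<M}. ee (of_int k * of_int d / of_int M)) = (\<Sum>k<nat M. z ^ k)"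
  by (rule sum.reindex_bij_witness[of _ int nat]) (auto simp: z_def ee_power)
 also have "... = (z ^ nat M - 1) / (z - 1)" using \<open>z \<noteq> 1\<close> by (simp add: geometric_sum)
 also have "z ^ nat M = 1" using assms by (simp add: z_def ee_power)
 finally show ?thesis using False by simp
qed

text \<open>On the middle half the weight is at least \<open>1/2\<close>, so the sharp sum is the
  weighted one multiplied by the indicator of \<open>{i..j}\<close> over the weight. That factor is
  expanded into additive characters modulo \<open>M\<close>. Its coefficients \<open>c k\<close> are
  of order \<open>M / k + M / (M - k)\<close>, whose sum costs one logarithm, and the characters are
  absorbed into the uniform twist \<open>\<theta>\<close>.\<close>

lemma completion:
 fixes F :: "int => complex"
 assumes M: "M >= 1" and I: "real_of_int M / 4 <= of_int i" "real_of_int j <= 3 * of_int M / 4"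
  and B: "\<And>\<theta>. norm (\<Sum>n\<in>{0..M}. of_real (bump (of_int n / of_int M)) * ee (\<theta> * of_int n) * F n) <= B"
 shows "norm (\<Sum>n\<in>{i..j}. F n) <= 34 * (1 + ln (of_int M)) * B"
proof (cases "i <= j")
 case False
 have "B >= 0" using B[of 0] norm_ge_zero order.trans by blast
 then show ?thesis using False M by simp
next
 case True
 have B0: "B >= 0" using B[of 0] norm_ge_zero order.trans by blast
 have Mr: "real_of_int M >= 1" using M by simp
 define W where "W n = bump (of_int n / of_int M)" for n :: int
 have W: "W n >= 1/2" if "i <= n" "n <= j" for n
  unfolding W_def by (rule bump_ge_half) (use that I Mr in \<open>auto simp: field_simps\<close>)
 have ij: "0 <= i" "j < M" using I Mr by linarith+
 define c where "c k = (\<Sum>n\<in>{i..j}. of_real (1 / W n) * ee (- (of_int k * of_int n / of_int M)))" for k :: int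
 define T where "T k = (\<Sum>n\<in>{0..M}. of_real (W n) * ee (of_int k / of_int M * of_int n) * F n)" for k :: int
 have key: "of_int M * (\<Sum>n\<in>{i..j}. F n) = (\<Sum>k\<in>{0..<M}. c k * T k)"
 proof -
  have "(\<Sum>k\<in>{0..<M}. c k * T k) = (\<Sum>k\<in>{0..<M}. \<Sum>n\<in>{i..j}. \<Sum>m\<in>{0..M}. of_real (1 / W n) * of_real (W m) * F m * ee (of_int k * of_int (m - n) / of_int M))"
   unfolding c_def T_def sum_product
   by (intro sum.cong refl) (simp add: diff_divide_distrib algebra_simps flip: ee_add)
  also have "... = (\<Sum>n\<in>{i..j}. \<Sum>m\<in>{0..M}. \<Sum>k\<in>{0..<M}. of_real (1 / W n) * of_real (W m) * F m * ee (of_int k * of_int (m - n) / of_int M))"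
   by (rule trans[OF sum.swap], rule sum.cong[OF refl], rule sum.swap)
  also have "... = (\<Sum>n\<in>{i..j}. \<Sum>m\<in>{0..M}. of_real (1 / W n) * of_real (W m) * F m * (if M dvd m - n then of_int M else 0))"
   by (simp only: sum_distrib_left[symmetric] sum_ee_orthogonal[OF M])
  also have "... = (\<Sum>n\<in>{i..j}. F n * of_int M)"
  proof (rule sum.cong)
   fix n assume n: "n \<in> {i..j}"
   have "(\<Sum>m\<in>{0..M}. of_real (1 / W n) * of_real (W m) * F m * (if M dvd m - n then of_int M else 0))
     = (\<Sum>m\<in>{0..M}. if m = n then F n * of_int M else 0)"
   proof (rule sum.cong)
    fix m assume m: "m \<in> {0..M}"
    consider "m = n" | "m = M" "m \<noteq> n" | "m \<noteq> n" "m < M" using m by force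
    then show "of_real (1 / W n) * of_real (W m) * F m * (if M dvd m - n then of_int M else 0) = (if m = n then F n * of_int M else 0)"
    proof cases
     case 1 then show ?thesis using W[of n] n by simp
    next
     case 2 then show ?thesis using Mr by (simp add: W_def bump_outside)
    next
     case 3
     have "\<not> M dvd m - n"
     proof
      assume "M dvd m - n"
      then have "\<bar>M\<bar> <= \<bar>m - n\<bar>" using 3 by (intro dvd_imp_le_int) auto
      then show False using 3 m n ij by auto
     qed
     then show ?thesis using 3 by simp
    qed
   qed simp
   also have "... = F n * of_int M" using n ij by simp
   finally show "(\<Sum>m\<in>{0..M}. of_real (1 / W n) * of_real (W m) * F m * (if M dvd m - n then of_int M else 0)) = F n * of_int M" .
  qed simp
  finally show ?thesis by (simp add: sum_distrib_right[symmetric] mult.commute)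
 qed
 have T: "norm (T k) <= B" for k using B[of "of_int k / of_int M"] by (simp add: T_def W_def)
 have inv2: "\<bar>1 / W n\<bar> <= 2" if "i <= n" "n <= j" for n using W[OF that] by (simp add: field_simps)
 have c0: "norm (c 0) <= 4 * of_int M"
 proof -
  have "norm (c 0) <= (\<Sum>n\<in>{i..j}. 2)" unfolding c_def
   by (rule sum_norm_le) (use inv2 in \<open>auto simp: norm_mult norm_divide\<close>)
  also have "... <= 4 * of_int M" using True ij by simp
  finally show ?thesis .
 qed
 have ck: "norm (c k) <= 15 * (of_int M / of_int k + of_int M / of_int (M - k))" if k: "1 <= k" "k < M" for k
 proof -
  define \<theta> :: real where "\<theta> = min (of_int k / of_int M) (1 - of_int k / of_int M)"
  have "real_of_int k / of_int M > 0" "real_of_int k / of_int M < 1" using k Mr by (auto simp: field_simps)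
  then have th: "\<theta> > 0" by (simp add: \<theta>_def)
  have "norm (c k) <= (2 + of_int (j - i) * (4 * pi / of_int M)) * (1/\<theta>)"
   unfolding c_def
  proof (rule norm_sum_abel)
   fix l assume "i <= l" "l <= j"
   show "norm (\<Sum>n\<in>{i..l}. ee (- (of_int k * of_int n / of_int M))) <= 1 / \<theta>"
   \<comment> \<open>The increments are \<open>- k / M\<close>; measured from the integer
     \<open>- 1\<close> they become \<open>1 - k / M\<close>, which keeps distance
     \<open>\<theta>\<close> from 0 and 1.\<close>
   proof (rule kusmin_landau[where k = "-1", OF th])
    fix n
    have "- (real_of_int k * of_int (n+1) / of_int M) - - (of_int k * of_int n / of_int M) - of_int (-1) = 1 - of_int k / of_int M"
     using Mr by (simp add: field_simps)
    then show "\<theta> <= - (of_int k * of_int (n+1) / of_int M) - - (of_int k * of_int n / of_int M) - of_int (-1) \<and>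
      - (of_int k * of_int (n+1) / of_int M) - - (of_int k * of_int n / of_int M) - of_int (-1) <= 1 - \<theta>"
     unfolding \<theta>_def by (simp only:) simp
   next
    fix n
    show "- (real_of_int k * of_int (n+1) / of_int M) - - (of_int k * of_int n / of_int M)
     <= - (real_of_int k * of_int (n+2) / of_int M) - - (of_int k * of_int (n+1) / of_int M)"
     using Mr by (simp add: field_simps)
   qed
  next
   fix n assume n: "i <= n" "n < j"
   have w: "W n >= 1/2" "W (n+1) >= 1/2" using W[of n] W[of "n+1"] n by auto
   have "1 / W (n+1) - 1 / W n = (W n - W (n+1)) / (W (n+1) * W n)" using w by (simp add: field_simps)
   then have "\<bar>1 / W (n+1) - 1 / W n\<bar> = \<bar>W n - W (n+1)\<bar> / (W (n+1) * W n)" using w by (simp add: abs_mult)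
   also have "... <= (pi / of_int M) / (1/4)"
   proof (rule frac_le)
    have "\<bar>W n - W (n+1)\<bar> <= pi * \<bar>of_int n / of_int M - of_int (n+1) / of_int M\<bar>"
     unfolding W_def by (rule bump_lipschitz)
    also have "of_int n / of_int M - of_int (n+1) / of_int M = - (1 / real_of_int M)" by (simp add: diff_divide_distrib[symmetric])
    finally show "\<bar>W n - W (n+1)\<bar> <= pi / of_int M" using Mr by simp
    have "(1/2) * (1/2) <= W (n+1) * W n" using w by (intro mult_mono) auto
    then show "1/4 <= W (n+1) * W n" by simp
   qed (use Mr in auto)
   finally show "\<bar>1 / W (n+1) - 1 / W n\<bar> <= 4 * pi / of_int M" by (simp add: mult.commute)
  qed (use True inv2 th in auto)
  also have "... <= 15 * (1/\<theta>)"
  proof (rule mult_right_mono)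
   have "of_int (j - i) * (4 * pi / of_int M) <= of_int M * (4 * pi / of_int M)"
    using ij Mr by (intro mult_right_mono) auto
   also have "... = 4 * pi" using Mr by simp
   also have "... <= 13" using pi_approx by simp
   finally show "2 + of_int (j - i) * (4 * pi / of_int M) <= 15" by simp
  qed (use th in auto)
  also have "1 / \<theta> <= of_int M / of_int k + of_int M / of_int (M - k)"
  proof -
   have "1 - real_of_int k / of_int M = of_int (M - k) / of_int M" using Mr by (simp add: field_simps)
   then have "1 / \<theta> = of_int M / of_int k \<or> 1 / \<theta> = of_int M / of_int (M - k)"
    unfolding \<theta>_def by (auto simp: min_def)
   then show ?thesis using k Mr by auto
  qed
  finally show ?thesis by simp
 qed
 have "norm (of_int M * (\<Sum>n\<in>{i..j}. F n)) <= (\<Sum>k\<in>{0..<M}. norm (c k) * B)"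
  unfolding key by (rule sum_norm_le) (auto simp: norm_mult intro!: mult_left_mono T)
 also have "... = (norm (c 0) + (\<Sum>k\<in>{1..<M}. norm (c k))) * B"
 proof -
  have "{0..<M} = insert 0 {1..<M}" using M by auto
  then show ?thesis by (simp add: sum_distrib_right[symmetric] distrib_right)
 qed
 also have "... <= (4 * of_int M + 15 * (of_int M * (1 + ln (of_int M)) + of_int M * (1 + ln (of_int M)))) * B"
 proof (intro mult_right_mono add_mono c0 B0)
  have "(\<Sum>k\<in>{1..<M}. norm (c k)) <= (\<Sum>k\<in>{1..<M}. 15 * (of_int M * (1 / of_int k) + of_int M * (1 / of_int (M - k))))"
   by (rule sum_mono) (use ck in auto)
  also have "... = 15 * (of_int M * (\<Sum>k\<in>{1..<M}. 1 / real_of_int k) + of_int M * (\<Sum>k\<in>{1..<M}. 1 / real_of_int (M - k)))"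
   by (simp only: sum.distrib[symmetric] sum_distrib_left)
  also have "(\<Sum>k\<in>{1..<M}. 1 / real_of_int (M - k)) = (\<Sum>k\<in>{1..<M}. 1 / real_of_int k)"
   by (rule sum.reindex_bij_witness[of _ "\<lambda>k. M - k" "\<lambda>k. M - k"]) auto
  also have "15 * (of_int M * (\<Sum>k\<in>{1..<M}. 1 / real_of_int k) + of_int M * (\<Sum>k\<in>{1..<M}. 1 / real_of_int k))
    <= 15 * (of_int M * (1 + ln (of_int M)) + of_int M * (1 + ln (of_int M)))"
  proof -
   have "(\<Sum>k\<in>{1..<M}. 1 / real_of_int k) <= (\<Sum>k\<in>{1..M}. 1 / real_of_int k)"
    by (rule sum_mono2) auto
   also have "... <= 1 + ln (of_int M)" by (rule sum_inverse_int[OF M])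
   finally show ?thesis using Mr by (intro mult_left_mono add_mono) auto
  qed
  finally show "(\<Sum>k\<in>{1..<M}. norm (c k)) <= 15 * (of_int M * (1 + ln (of_int M)) + of_int M * (1 + ln (of_int M)))" .
 qed
 also have "... <= of_int M * (34 * (1 + ln (of_int M)) * B)"
 proof -
  have "4 * (of_int M * B) * 1 <= 4 * (of_int M * B) * (1 + ln (of_int M))"
   using Mr B0 by (intro mult_left_mono) auto
  then show ?thesis by (simp add: algebra_simps)
 qed
 finally show ?thesis using Mr by (simp add: norm_mult)
qed

text \<open>Integers are detected among the multiples of \<open>1/L\<close> by additive characters, so that a sum
 over integers is controlled by sums over the finer lattice twisted by linear phases.\<close>

lemma completion_refined:
 fixes F :: "int => complex"
 assumes M: "M >= 1" and L: "L >= 1" and I: "real_of_int M / 4 <= of_int i" "real_of_int j <= 3 * of_int M / 4"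
  and B: "\<And>\<theta>. norm (\<Sum>n\<in>{0..L*M}. of_real (bump (of_int n / of_int (L*M))) * ee (\<theta> * of_int n) * F n) <= B"
 shows "norm (\<Sum>n\<in>{i..j}. F (L * n)) <= 34 * (1 + ln (of_int M)) * B"
proof (rule completion[OF M I])
 fix \<theta>
 define G where "G n = of_real (bump (of_int n / of_int (L*M))) * ee (\<theta> / of_int L * of_int n) * F n" for n
 have Lr: "real_of_int L >= 1" using L by simp
 have "of_int L * (\<Sum>n\<in>{0..M}. of_real (bump (of_int n / of_int M)) * ee (\<theta> * of_int n) * F (L * n)) = of_int L * (\<Sum>n\<in>{0..M}. G (L * n))"
  using Lr by (intro arg_cong2[where f = "(*)"] sum.cong refl) (auto simp: G_def)
 also have "(\<Sum>n\<in>{0..M}. G (L * n)) = (\<Sum>n\<in>{n\<in>{0..L*M}. L dvd n}. G n)"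
  by (rule sum.reindex_bij_witness[of _ "\<lambda>n. n div L" "\<lambda>n. L * n"])
    (use L in \<open>auto simp: zero_le_mult_iff elim!: dvdE\<close>)
 also have "of_int L * ... = (\<Sum>n\<in>{0..L*M}. G n * (if L dvd n then of_int L else 0))"
  by (subst sum.inter_filter) (auto simp: sum_distrib_left intro!: sum.cong)
 also have "... = (\<Sum>n\<in>{0..L*M}. G n * (\<Sum>k\<in>{0..<L}. ee (of_int k * of_int n / of_int L)))"
  by (simp only: sum_ee_orthogonal[OF L])
 also have "... = (\<Sum>k\<in>{0..<L}. \<Sum>n\<in>{0..L*M}. G n * ee (of_int k * of_int n / of_int L))"
  unfolding sum_distrib_left by (rule sum.swap)
 also have "... = (\<Sum>k\<in>{0..<L}. \<Sum>n\<in>{0..L*M}. of_real (bump (of_int n / of_int (L*M))) * ee ((\<theta> / of_int L + of_int k / of_int L) * of_int n) * F n)"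
  by (intro sum.cong refl) (simp add: G_def ee_add distrib_right)
 finally have eq: "of_int L * (\<Sum>n\<in>{0..M}. of_real (bump (of_int n / of_int M)) * ee (\<theta> * of_int n) * F (L * n)) =
  (\<Sum>k\<in>{0..<L}. \<Sum>n\<in>{0..L*M}. of_real (bump (of_int n / of_int (L*M))) * ee ((\<theta> / of_int L + of_int k / of_int L) * of_int n) * F n)" .
 have "norm (of_int L * (\<Sum>n\<in>{0..M}. of_real (bump (of_int n / of_int M)) * ee (\<theta> * of_int n) * F (L * n)))
  <= (\<Sum>k\<in>{0..<L}. B)" unfolding eq by (rule sum_norm_le) (rule B)
 then show "norm (\<Sum>n\<in>{0..M}. of_real (bump (of_int n / of_int M)) * ee (\<theta> * of_int n) * F (L * n)) <= B"
  using L Lr by (simp add: norm_mult)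
qed

text \<open>The second variable is completed inside the bound for the first, and only the first
  lives on the refined lattice. Each completion produces one linear twist, so the hypothesis is
  uniform in two.\<close>

lemma completion_2d:
 fixes F :: "int => int => complex"
 assumes M1: "M1 >= 1" and L: "L >= 1" and I: "real_of_int M1 / 4 <= of_int i" "real_of_int j <= 3 * of_int M1 / 4"
  and M2: "M2 >= 1" and J: "real_of_int M2 / 4 <= of_int i'" "real_of_int j' <= 3 * of_int M2 / 4"
  and B: "\<And>\<theta> \<theta>'. norm (\<Sum>n\<in>{0..L*M1}. \<Sum>m\<in>{0..M2}. of_real (bump (of_int n / of_int (L*M1))) *
     of_real (bump (of_int m / of_int M2)) * ee (\<theta> * of_int n + \<theta>' * of_int m) * F n m) <= B"
 shows "norm (\<Sum>n\<in>{i..j}. \<Sum>m\<in>{i'..j'}. F (L * n) m) <= 34 * (1 + ln (of_int M1)) * (34 * (1 + ln (of_int M2)) * B)"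
proof (rule completion_refined[OF M1 L I])
 fix \<theta>
 have "(\<Sum>n\<in>{0..L*M1}. of_real (bump (of_int n / of_int (L*M1))) * ee (\<theta> * of_int n) * (\<Sum>m\<in>{i'..j'}. F n m))
  = (\<Sum>m\<in>{i'..j'}. \<Sum>n\<in>{0..L*M1}. of_real (bump (of_int n / of_int (L*M1))) * ee (\<theta> * of_int n) * F n m)"
  unfolding sum_distrib_left by (rule sum.swap)
 also have "norm ... <= 34 * (1 + ln (of_int M2)) * B"
 proof (rule completion[OF M2 J])
  fix \<theta>'
  have "(\<Sum>m\<in>{0..M2}. of_real (bump (of_int m / of_int M2)) * ee (\<theta>' * of_int m) *
      (\<Sum>n\<in>{0..L*M1}. of_real (bump (of_int n / of_int (L*M1))) * ee (\<theta> * of_int n) * F n m))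
   = (\<Sum>n\<in>{0..L*M1}. \<Sum>m\<in>{0..M2}. of_real (bump (of_int n / of_int (L*M1))) *
     of_real (bump (of_int m / of_int M2)) * ee (\<theta> * of_int n + \<theta>' * of_int m) * F n m)"
   unfolding sum_distrib_left by (subst sum.swap) (simp add: ee_add mult_ac)
  then show "norm (\<Sum>m\<in>{0..M2}. of_real (bump (of_int m / of_int M2)) * ee (\<theta>' * of_int m) *
      (\<Sum>n\<in>{0..L*M1}. of_real (bump (of_int n / of_int (L*M1))) * ee (\<theta> * of_int n) * F n m)) <= B"
   using B by simp
 qed
 finally show "norm (\<Sum>n\<in>{0..L*M1}. of_real (bump (of_int n / of_int (L*M1))) * ee (\<theta> * of_int n) * (\<Sum>m\<in>{i'..j'}. F n m)) <= 34 * (1 + ln (of_int M2)) * B" .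
qed

section \<open>Weyl differencing over finite sets in abelian groups\<close>

definition autocorr :: "('a::ab_group_add) set => ('a => complex) => 'a => complex" where
 "autocorr D f z = (\<Sum>p\<in>{p\<in>D. p + z \<in> D}. f (p + z) * cnj (f p))"

lemma norm_sum_square:
 fixes f :: "'a => complex"
 shows "of_real ((norm (\<Sum>p\<in>A. f p))\<^sup>2) = (\<Sum>p\<in>A. \<Sum>q\<in>A. f p * cnj (f q))"
proof -
 have "of_real ((norm (\<Sum>p\<in>A. f p))\<^sup>2) = (\<Sum>p\<in>A. f p) * cnj (\<Sum>p\<in>A. f p)"
  by (rule complex_norm_square)
 then show ?thesis by (simp add: sum_product)
qed

text \<open>The square is expanded over all differences. This is efficient when the correlations
  decay in \<open>z\<close>, as they do for smoothly weighted sums.\<close>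

lemma norm_square_sum_le_autocorr:
 fixes f :: "'a::ab_group_add => complex"
 assumes D: "finite D" and Z: "finite Z" "\<And>p q. p \<in> D ==> q \<in> D ==> q - p \<in> Z"
 shows "(norm (\<Sum>p\<in>D. f p))\<^sup>2 <= (\<Sum>z\<in>Z. norm (autocorr D f z))"
proof -
 have "complex_of_real ((norm (\<Sum>p\<in>D. f p))\<^sup>2) = (\<Sum>p\<in>D. \<Sum>q\<in>D. f q * cnj (f p))"
  by (subst norm_sum_square, rule sum.swap)
 also have "... = (\<Sum>p\<in>D. \<Sum>z\<in>Z. if p + z \<in> D then f (p + z) * cnj (f p) else 0)"
 proof (rule sum.cong)
  fix p assume p: "p \<in> D"
  have "(\<Sum>q\<in>D. f q * cnj (f p)) = (\<Sum>z\<in>{z\<in>Z. p + z \<in> D}. f (p + z) * cnj (f p))"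
   by (rule sum.reindex_bij_witness[of _ "\<lambda>z. p + z" "\<lambda>q. q - p"]) (use Z p in auto)
  then show "(\<Sum>q\<in>D. f q * cnj (f p)) = (\<Sum>z\<in>Z. if p + z \<in> D then f (p + z) * cnj (f p) else 0)"
   using Z by (simp add: sum.inter_filter)
 qed simp
 also have "... = (\<Sum>z\<in>Z. autocorr D f z)"
  by (subst sum.swap) (simp add: autocorr_def sum.inter_filter D)
 finally have "norm (complex_of_real ((norm (\<Sum>p\<in>D. f p))\<^sup>2)) <= (\<Sum>z\<in>Z. norm (autocorr D f z))"
  by (metis norm_sum)
 then show ?thesis by (simp only: norm_of_real abs_power2)
qed

text \<open>The sum is averaged over the translates by \<open>V\<close>, and Cauchy-Schwarz is
  applied over the enlarged domain \<open>P\<close>. Each pair of translates gives the correlation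
  at \<open>v - v'\<close>, and each difference arises from at most \<open>card V\<close> pairs; so
  one of the two factors \<open>card V\<close> survives on the left.\<close>

lemma weyl_van_der_corput:
 fixes f :: "'a::ab_group_add => complex"
 assumes D: "finite D" and V: "finite V" "V \<noteq> {}"
  and P: "finite P" "\<And>p v. p \<in> D ==> v \<in> V ==> p - v \<in> P"
  and Z: "finite Z" "\<And>v v'. v \<in> V ==> v' \<in> V ==> v - v' \<in> Z"
 shows "real (card V) * (norm (\<Sum>p\<in>D. f p))\<^sup>2 <= real (card P) * (\<Sum>z\<in>Z. norm (autocorr D f z))"
proof -
 define F where "F p = (if p \<in> D then f p else 0)" for p
 define S where "S = (\<Sum>p\<in>D. f p)"
 define X where "X = (\<Sum>z\<in>Z. norm (autocorr D f z))"
 have shift: "(\<Sum>p\<in>P. F (p + v)) = S" if "v \<in> V" for v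
 proof -
  have "(\<Sum>p\<in>P. F (p + v)) = (\<Sum>p\<in>{p\<in>P. p + v \<in> D}. f (p + v))"
   using P by (simp add: F_def sum.inter_filter)
  also have "... = S" unfolding S_def
   by (rule sum.reindex_bij_witness[of _ "\<lambda>p. p - v" "\<lambda>p. p + v"]) (use P that in auto)
  finally show ?thesis .
 qed
 have corr: "(\<Sum>p\<in>P. F (p + v) * cnj (F (p + v'))) = autocorr D f (v - v')" if "v \<in> V" "v' \<in> V" for v v'
 proof -
  have "(\<Sum>p\<in>P. F (p + v) * cnj (F (p + v'))) = (\<Sum>p\<in>{p\<in>P. p + v \<in> D \<and> p + v' \<in> D}. f (p + v) * cnj (f (p + v')))"
   using P by (subst sum.inter_filter) (auto simp: F_def intro!: sum.cong)
  also have "... = autocorr D f (v - v')" unfolding autocorr_def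
  proof (rule sum.reindex_bij_witness[of _ "\<lambda>p. p - v'" "\<lambda>p. p + v'"])
   fix b assume "b \<in> {p\<in>D. p + (v - v') \<in> D}"
   then show "b - v' \<in> {p\<in>P. p + v \<in> D \<and> p + v' \<in> D}" using P that by (auto simp: algebra_simps)
  qed (use that in \<open>auto simp: algebra_simps\<close>)
  finally show ?thesis .
 qed
 have "of_nat (card V) * S = (\<Sum>v\<in>V. \<Sum>p\<in>P. F (p + v))" by (simp add: shift)
 also have "... = (\<Sum>p\<in>P. \<Sum>v\<in>V. F (p + v))" by (rule sum.swap)
 finally have 1: "of_nat (card V) * S = (\<Sum>p\<in>P. \<Sum>v\<in>V. F (p + v))" .
 have "(real (card V))\<^sup>2 * (norm S)\<^sup>2 = (norm (of_nat (card V) * S))\<^sup>2" by (simp add: norm_mult power_mult_distrib)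
 also have "... <= (\<Sum>p\<in>P. 1 * norm (\<Sum>v\<in>V. F (p + v)))\<^sup>2"
  unfolding 1 by (intro power_mono) (auto intro: norm_sum)
 also have "... <= (\<Sum>p\<in>P. 1\<^sup>2) * (\<Sum>p\<in>P. (norm (\<Sum>v\<in>V. F (p + v)))\<^sup>2)" by (rule Cauchy_Schwarz_ineq_sum)
 also have "... <= card P * (card V * X)"
  unfolding sum_constant power_one mult_1_right
 proof (rule mult_left_mono)
  show "(\<Sum>p\<in>P. (norm (\<Sum>v\<in>V. F (p + v)))\<^sup>2) <= card V * X"
  proof -
  have "complex_of_real (\<Sum>p\<in>P. (norm (\<Sum>v\<in>V. F (p + v)))\<^sup>2) = (\<Sum>p\<in>P. \<Sum>v\<in>V. \<Sum>v'\<in>V. F (p + v) * cnj (F (p + v')))"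
   unfolding of_real_sum norm_sum_square ..
  also have "... = (\<Sum>v\<in>V. \<Sum>v'\<in>V. \<Sum>p\<in>P. F (p + v) * cnj (F (p + v')))"
   by (rule trans[OF sum.swap], rule sum.cong[OF refl], rule sum.swap)
  also have "... = (\<Sum>v\<in>V. \<Sum>v'\<in>V. autocorr D f (v - v'))" using corr by simp
  finally have "norm (complex_of_real (\<Sum>p\<in>P. (norm (\<Sum>v\<in>V. F (p + v)))\<^sup>2)) = norm (\<Sum>v\<in>V. \<Sum>v'\<in>V. autocorr D f (v - v'))"
   by simp
  then have "(\<Sum>p\<in>P. (norm (\<Sum>v\<in>V. F (p + v)))\<^sup>2) = norm (\<Sum>v\<in>V. \<Sum>v'\<in>V. autocorr D f (v - v'))"
   by (simp add: sum_nonneg del: of_real_sum)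
  also have "... <= (\<Sum>v\<in>V. X)"
  proof (rule sum_norm_le)
   fix v assume v: "v \<in> V"
   have "norm (\<Sum>v'\<in>V. autocorr D f (v - v')) <= (\<Sum>v'\<in>V. norm (autocorr D f (v - v')))" by (rule norm_sum)
   also have "... = (\<Sum>z\<in>(\<lambda>v'. v - v') ` V. norm (autocorr D f z))"
    by (subst sum.reindex) (auto simp: inj_on_def)
   also have "... <= X" unfolding X_def by (rule sum_mono2) (use Z v in auto)
   finally show "norm (\<Sum>v'\<in>V. autocorr D f (v - v')) <= X" .
  qed
  finally show ?thesis by simp
  qed
 qed simp
 finally have "real (card V) * (real (card V) * (norm S)\<^sup>2) <= real (card V) * (real (card P) * X)"
  by (simp add: power2_eq_square mult_ac)
 moreover have "card V > 0" using V by (simp add: card_gt_0_iff)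
 ultimately show ?thesis by (simp add: S_def X_def)
qed

section \<open>Monomial phases\<close>

text \<open>Derivatives of \<open>x powr (- \<alpha>) * y powr (- \<beta>)\<close> along the vectors
  of the list. The recursion differentiates the monomial along the head, which raises one exponent,
  and continues with the tail; that the head may equally be applied last is what
  \<open>DD_has_derivative\<close> shows. Every derivative stays an explicit combination of
  monomials.\<close>

fun DD :: "(real \<times> real) list => real => real => real => real => real" where
 "DD [] \<alpha> \<beta> x y = x powr (- \<alpha>) * y powr (- \<beta>)"
| "DD (v # vs) \<alpha> \<beta> x y = - \<alpha> * fst v * DD vs (\<alpha> + 1) \<beta> x y - \<beta> * snd v * DD vs \<alpha> (\<beta> + 1) x y"

lemma powr_minus_add_one:
 fixes t a :: real
 assumes "t > 0" shows "t powr (- (a + 1)) = t powr (- a) / t"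
 using powr_diff[of t "- a" 1] assms by simp

lemma DD_has_derivative:
 assumes "x + t * fst v > 0" "y + t * snd v > 0"
 shows "((\<lambda>t. DD vs \<alpha> \<beta> (x + t * fst v) (y + t * snd v)) has_real_derivative
      DD (v # vs) \<alpha> \<beta> (x + t * fst v) (y + t * snd v)) (at t)"
 using assms
proof (induction vs arbitrary: \<alpha> \<beta>)
 case Nil
 have lin: "((\<lambda>t. a + t * b) has_real_derivative b) (at t)" for a b :: real
  by (auto intro!: derivative_eq_intros)
 have d1: "((\<lambda>t. (a + t * b) powr (- r)) has_real_derivative - r * b * ((a + t * b) powr (- (r + 1)))) (at t)"
  if "a + t * b > 0" for a b r :: real
 proof -
  have "- (r + 1) = - r - of_nat 1" by simp
  then show ?thesis using DERIV_fun_powr[OF lin that, of "- r"] by (simp add: mult_ac)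
 qed
 have "((\<lambda>t. (x + t * fst v) powr (- \<alpha>) * (y + t * snd v) powr (- \<beta>)) has_real_derivative
   (- \<alpha> * fst v * ((x + t * fst v) powr (- (\<alpha> + 1)))) * (y + t * snd v) powr (- \<beta>)
   + (- \<beta> * snd v * ((y + t * snd v) powr (- (\<beta> + 1)))) * (x + t * fst v) powr (- \<alpha>)) (at t)"
  by (intro DERIV_mult d1 Nil)
 then show ?case by (simp only: DD.simps) (simp add: mult_ac)
next
 case (Cons w ws)
 have "((\<lambda>t. - \<alpha> * fst w * DD ws (\<alpha> + 1) \<beta> (x + t * fst v) (y + t * snd v)
   - \<beta> * snd w * DD ws \<alpha> (\<beta> + 1) (x + t * fst v) (y + t * snd v)) has_real_derivative
   - \<alpha> * fst w * DD (v # ws) (\<alpha> + 1) \<beta> (x + t * fst v) (y + t * snd v)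
   - \<beta> * snd w * DD (v # ws) \<alpha> (\<beta> + 1) (x + t * fst v) (y + t * snd v)) (at t)"
  by (intro DERIV_diff DERIV_cmult Cons.IH Cons.prems)
 then show ?case by (simp add: algebra_simps)
qed

text \<open>Each derivative multiplies by an exponent that has grown by at most one per step, hence
  the rising factorial. \<open>s\<close> bounds both exponents, so that the induction may raise
  either of them.\<close>

lemma DD_bound:
 assumes "x > 0" "y > 0" "0 <= \<alpha>" "\<alpha> <= s" "0 <= \<beta>" "\<beta> <= s"
 shows "\<bar>DD vs \<alpha> \<beta> x y\<bar> <= pochhammer s (length vs) * (\<Prod>v\<leftarrow>vs. \<bar>fst v\<bar> / x + \<bar>snd v\<bar> / y) * (x powr (- \<alpha>) * y powr (- \<beta>))"
 using assms(3-)
proof (induction vs arbitrary: \<alpha> \<beta> s)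
 case (Cons v vs)
 define P where "P = (\<Prod>v\<leftarrow>vs. \<bar>fst v\<bar> / x + \<bar>snd v\<bar> / y)"
 define p where "p = pochhammer (s+1) (length vs)"
 define Q where "Q = x powr (- \<alpha>) * y powr (- \<beta>)"
 have P0: "P >= 0" unfolding P_def using assms by (intro prod_list_nonneg) auto
 have p0: "p >= 0" unfolding p_def using Cons.prems by (intro pochhammer_nonneg) auto
 have Q0: "Q >= 0" by (simp add: Q_def)
 have e1: "x powr (- (\<alpha>+1)) * y powr (- \<beta>) = Q / x" "x powr (- \<alpha>) * y powr (- (\<beta>+1)) = Q / y"
  using assms powr_minus_add_one[of x] powr_minus_add_one[of y] by (simp_all add: Q_def)
 have "\<bar>DD vs (\<alpha>+1) \<beta> x y\<bar> <= p * P * (Q / x)" "\<bar>DD vs \<alpha> (\<beta>+1) x y\<bar> <= p * P * (Q / y)"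
  using Cons.IH[of "\<alpha>+1" "s+1" \<beta>] Cons.IH[of \<alpha> "s+1" "\<beta>+1"] Cons.prems
  by (simp_all only: P_def p_def e1[symmetric])
 then have *: "\<bar>\<alpha> * fst v * DD vs (\<alpha> + 1) \<beta> x y\<bar> <= s * \<bar>fst v\<bar> * (p * P * (Q / x))"
   "\<bar>\<beta> * snd v * DD vs \<alpha> (\<beta> + 1) x y\<bar> <= s * \<bar>snd v\<bar> * (p * P * (Q / y))"
  unfolding abs_mult using Cons.prems by - (intro mult_mono; auto)+
 have "\<bar>- a - b\<bar> <= \<bar>a\<bar> + \<bar>b\<bar>" for a b :: real by simp
 from order.trans[OF this add_mono[OF *]]
 have "\<bar>DD (v # vs) \<alpha> \<beta> x y\<bar> <= s * \<bar>fst v\<bar> * (p * P * (Q / x)) + s * \<bar>snd v\<bar> * (p * P * (Q / y))"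
  by simp
 also have "... = (s * p) * ((\<bar>fst v\<bar> / x + \<bar>snd v\<bar> / y) * P) * Q" by (simp add: algebra_simps)
 also have "s * p = pochhammer s (length (v # vs))" by (simp add: p_def pochhammer_rec)
 finally show ?case by (simp add: P_def Q_def)
qed simp

text \<open>The phase at \<open>k = x y\<close>, differentiated along the directions in the list. The second term
 with \<open>V = -ga U\<close> accounts for replacing \<open>k\<close> by \<open>k + 1\<close>, so that both sums over \<open>\<psi>\<close> have
 monomial phases.\<close>

definition PH :: "real => real => real => (real \<times> real) list => real => real => real" where
 "PH ga U V vs x y = U * DD vs ga ga x y + V * DD vs (ga + 1) (ga + 1) x y"

fun Diff :: "(real \<times> real) list => (real => real => real) => real => real => real" where
 "Diff [] G x y = G x y"
| "Diff (v # vs) G x y = Diff vs G (x + fst v) (y + snd v) - Diff vs G x y"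

lemma PH_has_derivative:
 assumes "x + t * fst v > 0" "y + t * snd v > 0"
 shows "((\<lambda>t. PH ga U V vs (x + t * fst v) (y + t * snd v)) has_real_derivative
      PH ga U V (v # vs) (x + t * fst v) (y + t * snd v)) (at t)"
 unfolding PH_def by (intro DERIV_add DERIV_cmult DD_has_derivative assms)

abbreviation sumx :: "(real \<times> real) list => real" where "sumx vs \<equiv> (\<Sum>v\<leftarrow>vs. \<bar>fst v\<bar>)"
abbreviation sumy :: "(real \<times> real) list => real" where "sumy vs \<equiv> (\<Sum>v\<leftarrow>vs. \<bar>snd v\<bar>)"

lemma Diff_has_derivative:
 assumes "sumx vs < x + t * fst v" "sumy vs < y + t * snd v"
 shows "((\<lambda>t. Diff vs (PH ga U V ws) (x + t * fst v) (y + t * snd v)) has_real_derivative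
      Diff vs (PH ga U V (v # ws)) (x + t * fst v) (y + t * snd v)) (at t)"
 using assms
proof (induction vs arbitrary: x y)
 case Nil then show ?case using PH_has_derivative by simp
next
 case (Cons w vs)
 have "((\<lambda>t. Diff vs (PH ga U V ws) ((x + fst w) + t * fst v) ((y + snd w) + t * snd v)) has_real_derivative
      Diff vs (PH ga U V (v # ws)) ((x + fst w) + t * fst v) ((y + snd w) + t * snd v)) (at t)"
  by (rule Cons.IH) (use Cons.prems in \<open>auto simp: abs_if split: if_splits\<close>)
 moreover have "((\<lambda>t. Diff vs (PH ga U V ws) (x + t * fst v) (y + t * snd v)) has_real_derivative
      Diff vs (PH ga U V (v # ws)) (x + t * fst v) (y + t * snd v)) (at t)"
  by (rule Cons.IH) (use Cons.prems in \<open>auto simp: abs_if split: if_splits\<close>)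
 ultimately show ?case by (auto simp: algebra_simps intro!: derivative_eq_intros)
qed

text \<open>The mean value theorem is applied once per direction. Each application moves the head of
  \<open>vs\<close> to the derivative list \<open>ws\<close>, which reverses the order. The
  assumptions keep all intermediate points in the positive quadrant.\<close>

lemma Diff_mean_value:
 assumes "sumx vs < x" "sumy vs < y"
 obtains \<xi> \<eta> where "\<bar>\<xi> - x\<bar> <= sumx vs" "\<bar>\<eta> - y\<bar> <= sumy vs"
  "Diff vs (PH ga U V ws) x y = PH ga U V (rev vs @ ws) \<xi> \<eta>"
proof -
 have "\<exists>\<xi> \<eta>. \<bar>\<xi> - x\<bar> <= sumx vs \<and> \<bar>\<eta> - y\<bar> <= sumy vs \<and> Diff vs (PH ga U V ws) x y = PH ga U V (rev vs @ ws) \<xi> \<eta>"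
  using assms
 proof (induction vs arbitrary: x y ws)
  case (Cons v vs)
  define g where "g t = Diff vs (PH ga U V ws) (x + t * fst v) (y + t * snd v)" for t
  have pos: "sumx vs < x + t * fst v" "sumy vs < y + t * snd v" if "0 <= t" "t <= 1" for t
  proof -
   have "\<bar>t * fst v\<bar> <= 1 * \<bar>fst v\<bar>" "\<bar>t * snd v\<bar> <= 1 * \<bar>snd v\<bar>"
    unfolding abs_mult using that by (intro mult_right_mono; simp)+
   then show "sumx vs < x + t * fst v" "sumy vs < y + t * snd v" using Cons.prems by auto
  qed
  have "\<exists>t>0. t < 1 \<and> g 1 - g 0 = (1 - 0) * Diff vs (PH ga U V (v # ws)) (x + t * fst v) (y + t * snd v)"
  proof (rule MVT2)
   fix t :: real assume "0 <= t" "t <= 1"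
   then show "(g has_real_derivative Diff vs (PH ga U V (v # ws)) (x + t * fst v) (y + t * snd v)) (at t)"
    unfolding g_def using Diff_has_derivative pos by simp
  qed simp
  then obtain t where t: "0 < t" "t < 1" "g 1 - g 0 = Diff vs (PH ga U V (v # ws)) (x + t * fst v) (y + t * snd v)" by auto
  obtain \<xi> \<eta> where xi: "\<bar>\<xi> - (x + t * fst v)\<bar> <= sumx vs" "\<bar>\<eta> - (y + t * snd v)\<bar> <= sumy vs"
   "Diff vs (PH ga U V (v # ws)) (x + t * fst v) (y + t * snd v) = PH ga U V (rev vs @ (v # ws)) \<xi> \<eta>"
   using Cons.IH[of "x + t * fst v" "y + t * snd v" "v # ws"] pos[of t] t by auto
  have "\<bar>t * fst v\<bar> <= 1 * \<bar>fst v\<bar>" "\<bar>t * snd v\<bar> <= 1 * \<bar>snd v\<bar>"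
   unfolding abs_mult using t by (intro mult_right_mono; simp)+
  then have "\<bar>\<xi> - x\<bar> <= sumx (v # vs)" "\<bar>\<eta> - y\<bar> <= sumy (v # vs)" using xi by auto
  moreover have "Diff (v # vs) (PH ga U V ws) x y = PH ga U V (rev (v # vs) @ ws) \<xi> \<eta>"
   using t xi by (simp add: g_def)
  ultimately show ?case by blast
 qed auto
 then show ?thesis using that by blast
qed

text \<open>Length of a shift relative to the scales \<open>A\<close> and \<open>B\<close>: a
  derivative along \<open>v\<close> of a phase of size \<open>X\<close> has size about
  \<open>X * nrm A B v\<close>.\<close>

definition nrm :: "real => real => (real \<times> real) => real" where
 "nrm A B v = \<bar>fst v\<bar> / A + \<bar>snd v\<bar> / B"

lemma nrm_nonneg: "A > 0 ==> B > 0 ==> nrm A B v >= 0"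
 by (simp add: nrm_def)

text \<open>The factor \<open>4 ^ n\<close> comes from \<open>A / 4 <= x\<close> and
  \<open>B / 4 <= y\<close>, the power of 16 from \<open>A * B / 16 <= x * y\<close>, and the rising
  factorial from \<open>DD_bound\<close>.\<close>

definition phase_const :: "real => nat => real" where
 "phase_const ga n = 4 ^ n * 16 powr (ga + 1) * pochhammer (ga + 1) n"

lemma phase_const_pos: "ga > 0 ==> phase_const ga n > 0"
 by (simp add: phase_const_def pochhammer_pos)

lemma prod_list_nrm_le:
 assumes "A > 0" "B > 0" "A / 4 <= x" "B / 4 <= y"
 shows "(\<Prod>v\<leftarrow>vs. \<bar>fst v\<bar> / x + \<bar>snd v\<bar> / y) <= 4 ^ length vs * (\<Prod>v\<leftarrow>vs. nrm A B v)"
proof (induction vs)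
 case (Cons v vs)
 have "\<bar>fst v\<bar> / x <= \<bar>fst v\<bar> / (A/4)" "\<bar>snd v\<bar> / y <= \<bar>snd v\<bar> / (B/4)"
  by (rule frac_le; use assms in simp)+
 then have "\<bar>fst v\<bar> / x + \<bar>snd v\<bar> / y <= 4 * nrm A B v" by (simp add: nrm_def mult.commute)
 then have "(\<bar>fst v\<bar> / x + \<bar>snd v\<bar> / y) * (\<Prod>v\<leftarrow>vs. \<bar>fst v\<bar> / x + \<bar>snd v\<bar> / y)
   <= (4 * nrm A B v) * (4 ^ length vs * (\<Prod>v\<leftarrow>vs. nrm A B v))"
  using Cons assms by (intro mult_mono) (auto simp: nrm_nonneg intro!: prod_list_nonneg)
 then show ?case by (simp add: mult_ac)
qed simp

lemma DD_bound_region: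
 assumes AB: "A > 0" "B > 0" "A / 4 <= x" "B / 4 <= y" and g: "0 <= \<alpha>" "\<alpha> <= ga + 1" "ga > 0"
 shows "\<bar>DD vs \<alpha> \<alpha> x y\<bar> <= phase_const ga (length vs) * (A * B) powr (- \<alpha>) * (\<Prod>v\<leftarrow>vs. nrm A B v)"
proof -
 have xy: "x > 0" "y > 0" using AB by linarith+
 have P: "0 <= (\<Prod>v\<leftarrow>vs. nrm A B v)" using AB by (intro prod_list_nonneg) (auto simp: nrm_nonneg)
 have "\<bar>DD vs \<alpha> \<alpha> x y\<bar> <= pochhammer (ga+1) (length vs) * (\<Prod>v\<leftarrow>vs. \<bar>fst v\<bar> / x + \<bar>snd v\<bar> / y) * (x powr (- \<alpha>) * y powr (- \<alpha>))"
  by (rule DD_bound) (use xy g in auto)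
 also have "... <= pochhammer (ga+1) (length vs) * (4 ^ length vs * (\<Prod>v\<leftarrow>vs. nrm A B v)) * (16 powr (ga+1) * (A * B) powr (- \<alpha>))"
 proof (rule mult_mono)
  have "x powr (- \<alpha>) * y powr (- \<alpha>) = (x * y) powr (- \<alpha>)" using xy by (simp add: powr_mult)
  also have "... <= (A * B / 16) powr (- \<alpha>)"
  proof (rule powr_mono2')
   have "(A/4) * (B/4) <= x * y" using AB by (intro mult_mono) auto
   then show "A * B / 16 <= x * y" by simp
  qed (use g AB in auto)
  also have "... = 16 powr \<alpha> * (A * B) powr (- \<alpha>)"
   using AB by (simp add: powr_divide powr_minus field_simps)
  also have "... <= 16 powr (ga+1) * (A * B) powr (- \<alpha>)" using g by (intro mult_right_mono powr_mono) auto
  finally show "x powr (- \<alpha>) * y powr (- \<alpha>) <= 16 powr (ga+1) * (A * B) powr (- \<alpha>)" .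
  show "pochhammer (ga+1) (length vs) * (\<Prod>v\<leftarrow>vs. \<bar>fst v\<bar> / x + \<bar>snd v\<bar> / y) <= pochhammer (ga+1) (length vs) * (4 ^ length vs * (\<Prod>v\<leftarrow>vs. nrm A B v))"
   by (intro mult_left_mono prod_list_nrm_le AB pochhammer_nonneg) (use g in auto)
  show "0 <= pochhammer (ga+1) (length vs) * (4 ^ length vs * (\<Prod>v\<leftarrow>vs. nrm A B v))"
   using P g by (intro mult_nonneg_nonneg pochhammer_nonneg) auto
 qed simp
 finally show ?thesis by (simp add: phase_const_def mult_ac)
qed

text \<open>Since \<open>|V| <= ga * U\<close>, the term with exponent \<open>ga + 1\<close> is
  smaller than the main one by a factor of order \<open>A * B\<close>. The second claim records
  this, so that later computations may use the pure monomial.\<close>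

lemma PH_bound:
 assumes AB: "A > 0" "B > 0" "A * B >= 1" "A / 4 <= x" "B / 4 <= y" and g: "ga > 0"
  and U: "U > 0" "\<bar>V\<bar> <= ga * U" and X: "X = U * (A * B) powr (- ga)"
 shows "\<bar>PH ga U V vs x y\<bar> <= (1 + ga) * phase_const ga (length vs) * X * (\<Prod>v\<leftarrow>vs. nrm A B v)"
  and "\<bar>PH ga U V vs x y - U * DD vs ga ga x y\<bar> <= ga * phase_const ga (length vs) * X * (\<Prod>v\<leftarrow>vs. nrm A B v) / (A * B)"
proof -
 define P where "P = (\<Prod>v\<leftarrow>vs. nrm A B v)"
 have P: "P >= 0" unfolding P_def using AB by (intro prod_list_nonneg) (auto simp: nrm_nonneg)
 have pc: "phase_const ga (length vs) > 0" using phase_const_pos g by simp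
 have X0: "X >= 0" using U X by simp
 have 1: "\<bar>U * DD vs ga ga x y\<bar> <= U * (phase_const ga (length vs) * (A * B) powr (- ga) * P)"
  unfolding abs_mult P_def using U g by (intro mult_mono DD_bound_region AB) auto
 have 2: "\<bar>V * DD vs (ga+1) (ga+1) x y\<bar> <= (ga * U) * (phase_const ga (length vs) * (A * B) powr (- (ga+1)) * P)"
  unfolding abs_mult P_def using U g by (intro mult_mono DD_bound_region AB) auto
 also have "... = ga * phase_const ga (length vs) * X * P / (A * B)"
  unfolding X using AB powr_minus_add_one[of "A * B" ga] by (simp add: field_simps)
 finally have 3: "\<bar>V * DD vs (ga+1) (ga+1) x y\<bar> <= ga * phase_const ga (length vs) * X * P / (A * B)" .
 then show "\<bar>PH ga U V vs x y - U * DD vs ga ga x y\<bar> <= ga * phase_const ga (length vs) * X * (\<Prod>v\<leftarrow>vs. nrm A B v) / (A * B)"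
  by (simp add: PH_def P_def)
 have "ga * phase_const ga (length vs) * X * P / (A * B) <= ga * phase_const ga (length vs) * X * P / 1"
  using AB g pc X0 P by (intro divide_left_mono mult_nonneg_nonneg) auto
 then show "\<bar>PH ga U V vs x y\<bar> <= (1 + ga) * phase_const ga (length vs) * X * (\<Prod>v\<leftarrow>vs. nrm A B v)"
  using 1 3 by (simp add: PH_def P_def[symmetric] X algebra_simps)
qed

lemma PH_variation:
 assumes AB: "A > 0" "B > 0" "A * B >= 1" "A / 4 <= x" "B / 4 <= y" "A / 4 <= x'" "B / 4 <= y'" and g: "ga > 0"
  and U: "U > 0" "\<bar>V\<bar> <= ga * U" and X: "X = U * (A * B) powr (- ga)"
  and w: "\<bar>x' - x\<bar> <= w * A" "\<bar>y' - y\<bar> <= w * B"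
 shows "\<bar>PH ga U V vs x' y' - PH ga U V vs x y\<bar> <= 2 * w * (1 + ga) * phase_const ga (Suc (length vs)) * X * (\<Prod>v\<leftarrow>vs. nrm A B v)"
proof -
 define v where "v = (x' - x, y' - y)"
 have pos: "A/4 <= x + t * fst v \<and> B/4 <= y + t * snd v" if "0 <= t" "t <= 1" for t
 proof -
  have *: "c <= z + t * (z' - z)" if "c <= z" "c <= z'" for c z z' :: real
  proof -
   have "c = (1-t) * c + t * c" by (simp add: algebra_simps)
   also have "... <= (1-t) * z + t * z'"
    using that \<open>0 <= t\<close> \<open>t <= 1\<close> by (intro add_mono mult_left_mono) auto
   also have "... = z + t * (z' - z)" by (simp add: algebra_simps)
   finally show ?thesis .
  qed
  show ?thesis unfolding v_def fst_conv snd_conv by (intro conjI * AB)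
 qed
 define h where "h t = PH ga U V vs (x + t * fst v) (y + t * snd v)" for t
 have "\<exists>t>0. t < 1 \<and> h 1 - h 0 = (1 - 0) * PH ga U V (v # vs) (x + t * fst v) (y + t * snd v)"
 proof (rule MVT2)
  fix t :: real assume "0 <= t" "t <= 1"
  then show "(h has_real_derivative PH ga U V (v # vs) (x + t * fst v) (y + t * snd v)) (at t)"
   unfolding h_def using pos[of t] AB by (intro PH_has_derivative) auto
 qed simp
 then obtain t where t: "0 < t" "t < 1" "h 1 - h 0 = PH ga U V (v # vs) (x + t * fst v) (y + t * snd v)" by auto
 have "\<bar>PH ga U V (v # vs) (x + t * fst v) (y + t * snd v)\<bar> <= (1 + ga) * phase_const ga (length (v # vs)) * X * (\<Prod>v\<leftarrow>v # vs. nrm A B v)"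
  by (rule PH_bound) (use AB g U X pos[of t] t in auto)
 also have "... = ((1 + ga) * phase_const ga (Suc (length vs)) * X * (\<Prod>v\<leftarrow>vs. nrm A B v)) * nrm A B v" by simp
 also have "... <= ((1 + ga) * phase_const ga (Suc (length vs)) * X * (\<Prod>v\<leftarrow>vs. nrm A B v)) * (2 * w)"
 proof (rule mult_left_mono)
  have "\<bar>x' - x\<bar> / A <= w" "\<bar>y' - y\<bar> / B <= w" using w AB by (auto simp: field_simps)
  then show "nrm A B v <= 2 * w" by (simp add: nrm_def v_def)
  show "0 <= (1 + ga) * phase_const ga (Suc (length vs)) * X * (\<Prod>v\<leftarrow>vs. nrm A B v)"
   using AB g U X phase_const_pos[of ga "Suc (length vs)"]
   by (intro mult_nonneg_nonneg prod_list_nonneg) (auto simp: nrm_nonneg)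
 qed
 finally show ?thesis using t by (simp add: h_def v_def algebra_simps)
qed

text \<open>In the relative coordinates \<open>q1 / x\<close>, \<open>z1 / x\<close> and so on, a
  third derivative has the coefficient \<open>ga + 2\<close> if all three fall on one variable and
  \<open>ga\<close> otherwise. The Hessian entries \<open>M11\<close>, \<open>M12\<close>,
  \<open>M22\<close> used later are read off from this.\<close>

lemma DD_third:
 assumes "x > 0" "y > 0" and P_def: "P = ga * (ga + 1) * (x powr (- ga) * y powr (- ga))"
 shows "DD [(q1, q2), (z1, z2), (0, e)] ga ga x y =
   - (P * e / y) * (ga * ((q1/x) * (z1/x) + (q1/x) * (z2/y) + (q2/y) * (z1/x)) + (ga + 2) * ((q2/y) * (z2/y)))"
  and "DD [(q1, q2), (z1, z2), (e, 0)] ga ga x y =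
   - (P * e / x) * ((ga + 2) * ((q1/x) * (z1/x)) + ga * ((q1/x) * (z2/y) + (q2/y) * (z1/x) + (q2/y) * (z2/y)))"
proof -
 note s = powr_minus_add_one
 show "DD [(q1, q2), (z1, z2), (0, e)] ga ga x y =
   - (P * e / y) * (ga * ((q1/x) * (z1/x) + (q1/x) * (z2/y) + (q2/y) * (z1/x)) + (ga + 2) * ((q2/y) * (z2/y)))"
  by (simp only: DD.simps fst_conv snd_conv s[OF assms(1)] s[OF assms(2)]) (use assms(1,2) in \<open>simp add: P_def field_simps\<close>)
 show "DD [(q1, q2), (z1, z2), (e, 0)] ga ga x y =
   - (P * e / x) * ((ga + 2) * ((q1/x) * (z1/x)) + ga * ((q1/x) * (z2/y) + (q2/y) * (z1/x) + (q2/y) * (z2/y)))"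
  by (simp only: DD.simps fst_conv snd_conv s[OF assms(1)] s[OF assms(2)]) (use assms(1,2) in \<open>simp add: P_def field_simps\<close>)
qed

lemma DD_second:
 assumes "x > 0" "y > 0"
 shows "DD [(0, 1), (0, 1)] ga ga x y = ga * (ga + 1) * (x powr (- ga) * y powr (- ga)) / y^2"
proof -
 note s = powr_minus_add_one
 show ?thesis
  by (simp only: DD.simps fst_conv snd_conv s[OF assms(1)] s[OF assms(2)]) (use assms in \<open>simp add: power2_eq_square field_simps\<close>)
qed

section \<open>Sums over lattice points controlled by a linear map\<close>

lemma sum_inverse_dist_right:
 fixes t :: real
 assumes "of_int (b - a + 1) <= real_of_int M" "M >= 1"
 shows "(\<Sum>r\<in>{r\<in>{a..b}. t + 1 <= of_int r}. 1 / (of_int r - t)) <= 1 + ln (of_int M)"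
proof -
 define c where "c = max a (\<lceil>t\<rceil> + 1)"
 have eq: "{r\<in>{a..b}. t + 1 <= of_int r} = {c..b}"
  by (auto simp: c_def) linarith+
 have "(\<Sum>r\<in>{c..b}. 1 / (of_int r - t)) <= (\<Sum>r\<in>{c..b}. 1 / real_of_int (r - c + 1))"
 proof (rule sum_mono)
  fix r assume "r \<in> {c..b}"
  moreover have "of_int c >= t + 1" unfolding c_def by linarith
  ultimately show "1 / (of_int r - t) <= 1 / real_of_int (r - c + 1)" by (intro divide_left_mono) auto
 qed
 also have "... = (\<Sum>k\<in>{1..b-c+1}. 1 / real_of_int k)"
  by (rule sum.reindex_bij_witness[of _ "\<lambda>k. k + c - 1" "\<lambda>r. r - c + 1"]) auto
 also have "... <= (\<Sum>k\<in>{1..M}. 1 / real_of_int k)"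
  by (rule sum_mono2) (use assms in \<open>auto simp: c_def\<close>)
 also have "... <= 1 + ln (of_int M)" by (rule sum_inverse_int) fact
 finally show ?thesis unfolding eq .
qed

lemma sum_inverse_dist:
 fixes t :: real
 assumes "of_int (b - a + 1) <= real_of_int M" "M >= 1"
 shows "(\<Sum>r\<in>{r\<in>{a..b}. 1 <= \<bar>of_int r - t\<bar>}. 1 / \<bar>of_int r - t\<bar>) <= 2 * (1 + ln (of_int M))"
proof -
 have fin: "finite {r\<in>{a..b}. P r}" for P by (rule finite_subset[of _ "{a..b}"]) auto
 have "(\<Sum>r\<in>{r\<in>{a..b}. 1 <= \<bar>of_int r - t\<bar>}. 1 / \<bar>of_int r - t\<bar>)
   = (\<Sum>r\<in>{r\<in>{a..b}. t + 1 <= of_int r} \<union> {r\<in>{a..b}. of_int r <= t - 1}. 1 / \<bar>of_int r - t\<bar>)"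
  by (rule sum.cong) auto
 also have "... = (\<Sum>r\<in>{r\<in>{a..b}. t + 1 <= of_int r}. 1 / \<bar>of_int r - t\<bar>) + (\<Sum>r\<in>{r\<in>{a..b}. of_int r <= t - 1}. 1 / \<bar>of_int r - t\<bar>)"
  by (rule sum.union_disjoint) (auto intro: finite_subset[of _ "{a..b}"])
 also have "(\<Sum>r\<in>{r\<in>{a..b}. t + 1 <= of_int r}. 1 / \<bar>of_int r - t\<bar>) = (\<Sum>r\<in>{r\<in>{a..b}. t + 1 <= of_int r}. 1 / (of_int r - t))"
  by (rule sum.cong) auto
 also have "(\<Sum>r\<in>{r\<in>{a..b}. of_int r <= t - 1}. 1 / \<bar>of_int r - t\<bar>) = (\<Sum>r\<in>{r\<in>{-b..-a}. -t + 1 <= of_int r}. 1 / (of_int r - - t))"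
  by (rule sum.reindex_bij_witness[of _ uminus uminus]) auto
 also have "(\<Sum>r\<in>{r\<in>{a..b}. t + 1 <= of_int r}. 1 / (of_int r - t)) + (\<Sum>r\<in>{r\<in>{-b..-a}. -t + 1 <= of_int r}. 1 / (of_int r - - t))
   <= (1 + ln (of_int M)) + (1 + ln (of_int M))"
  by (intro add_mono sum_inverse_dist_right) (use assms in auto)
 finally show ?thesis by simp
qed

lemma card_int_near: "card {r\<in>{a..b::int}. \<bar>of_int r - t\<bar> < (1::real)} <= 2"
proof -
 have "{r\<in>{a..b::int}. \<bar>of_int r - t\<bar> < (1::real)} \<subseteq> {\<lfloor>t\<rfloor>, \<lfloor>t\<rfloor> + 1}"
  by auto linarith
 from card_mono[OF _ this] show ?thesis by (simp add: card_insert_if split: if_splits)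
qed

lemma sum_inverse_squares_int: "(\<Sum>r\<in>{1..N::int}. 1 / (of_int r)\<^sup>2 :: real) <= 2"
proof -
 have *: "(\<Sum>r\<in>{1..N::int}. 1 / (of_int r)\<^sup>2 :: real) <= 2 - 1 / of_int N" if "N >= 1"
  using that
 proof (induction N rule: int_ge_induct)
  case (step N)
  have "{1..N+1} = insert (N+1) {1..N}" using step.hyps by auto
  moreover have "1 / (real_of_int (N+1))\<^sup>2 <= 1 / of_int N - 1 / of_int (N+1)"
  proof -
   have "1 / (real_of_int (N+1))\<^sup>2 <= 1 / (of_int N * of_int (N+1))"
    using step.hyps by (intro divide_left_mono) (auto simp: power2_eq_square)
   also have "... = 1 / of_int N - 1 / of_int (N+1)" using step.hyps by (simp add: field_simps)
   finally show ?thesis .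
  qed
  ultimately show ?case using step by simp
 qed simp
 show ?thesis
 proof (cases "N >= 1")
  case True
  have "1 / real_of_int N >= 0" using True by simp
  then show ?thesis using *[OF True] by linarith
 qed simp
qed

lemma sum_symmetric_int:
 fixes f :: "int => real"
 assumes "N >= 0"
 shows "(\<Sum>r\<in>{-N..N}. f r) = f 0 + (\<Sum>r\<in>{1..N}. f r) + (\<Sum>r\<in>{1..N}. f (- r))"
proof -
 have "{-N..N} = insert 0 ({1..N} \<union> {-N..-1})" using assms by auto
 then have "(\<Sum>r\<in>{-N..N}. f r) = f 0 + ((\<Sum>r\<in>{1..N}. f r) + (\<Sum>r\<in>{-N..-1}. f r))"
  by (simp add: sum.union_disjoint)
 also have "(\<Sum>r\<in>{-N..-1}. f r) = (\<Sum>r\<in>{1..N}. f (- r))"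
  by (rule sum.reindex_bij_witness[of _ uminus uminus]) auto
 finally show ?thesis by simp
qed

text \<open>Here \<open>|V|\<^sup>2\<close> is bounded below by a product of a distance in the \<open>r\<close> direction and \<open>|s|\<close>,
 so that the sum factorises into two harmonic sums.\<close>

lemma lattice_sum_aux:
 fixes a b c d \<Lambda> \<kappa> :: real and N :: int
 defines "\<Delta> \<equiv> \<bar>a * d - b * c\<bar>" and "H \<equiv> 1 + ln (real_of_int (2 * N + 1))"
 assumes N: "N >= 1" and L: "\<Lambda> > 0" "\<bar>a\<bar> <= \<Lambda>" "\<bar>b\<bar> <= \<Lambda>" "\<bar>c\<bar> <= \<Lambda>" "\<bar>d\<bar> <= \<Lambda>" "\<Lambda> * of_int N <= 1"
  and k: "\<kappa> > 0" "\<kappa> <= 1" "\<kappa> * \<Lambda> <= \<bar>a\<bar>" and D: "\<Delta> > 0"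
  and f: "\<And>r s. 0 <= f r s" "\<And>r s. f r s <= (of_int N)\<^sup>2"
   "\<And>r s. f r s * (max \<bar>a * of_int r + b * of_int s\<bar> \<bar>c * of_int r + d * of_int s\<bar>)\<^sup>2 <= 1"
 shows "(\<Sum>r\<in>{-N..N}. \<Sum>s\<in>{-N..N}. f r s) <= 50 / \<kappa>^2 * H^2 / \<Delta>"
proof -
 define V where "V r s = max \<bar>a * of_int r + b * of_int s\<bar> \<bar>c * of_int r + d * of_int s\<bar>" for r s :: int
 have "\<kappa> * \<Lambda> > 0" using k L by simp
 then have a0: "a \<noteq> 0" using k by auto
 have H1: "H >= 1" unfolding H_def using N by simp
 have DL: "\<Delta> <= 2 * \<Lambda>^2"
 proof -
  have "\<Delta> <= \<bar>a\<bar> * \<bar>d\<bar> + \<bar>b\<bar> * \<bar>c\<bar>" unfolding \<Delta>_def abs_mult[symmetric] by simp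
  also have "... <= \<Lambda> * \<Lambda> + \<Lambda> * \<Lambda>" using L by (intro add_mono mult_mono) auto
  finally show ?thesis by (simp add: power2_eq_square)
 qed
 have inv: "1 / \<Lambda>^2 <= 2 / \<Delta>" using DL D L by (simp add: field_simps)
 have V1: "V r s >= \<kappa> * \<Lambda> * \<bar>of_int r - (- b * of_int s / a)\<bar>" for r s
 proof -
  have "\<kappa> * \<Lambda> * \<bar>of_int r - (- b * of_int s / a)\<bar> <= \<bar>a\<bar> * \<bar>of_int r - (- b * of_int s / a)\<bar>"
   using k by (intro mult_right_mono) auto
  also have "... = \<bar>a * (of_int r - (- b * of_int s / a))\<bar>" by (simp only: abs_mult)
  also have "a * (of_int r - (- b * of_int s / a)) = a * of_int r + b * of_int s" using a0 by (simp add: field_simps)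
  finally show ?thesis by (simp add: V_def)
 qed
 \<comment> \<open>Cramer's rule: the two coordinates of the image determine \<open>s\<close> times
   the determinant.\<close>
 have V2: "V r s >= \<bar>of_int s\<bar> * \<Delta> / (2 * \<Lambda>)" for r s
 proof -
  have "\<bar>of_int s\<bar> * \<Delta> = \<bar>a * (c * of_int r + d * of_int s) - c * (a * of_int r + b * of_int s)\<bar>"
   unfolding \<Delta>_def abs_mult[symmetric] by (simp add: algebra_simps)
  also have "... <= \<bar>a\<bar> * \<bar>c * of_int r + d * of_int s\<bar> + \<bar>c\<bar> * \<bar>a * of_int r + b * of_int s\<bar>"
   unfolding abs_mult[symmetric] by simp
  also have "... <= \<Lambda> * V r s + \<Lambda> * V r s" using L by (intro add_mono mult_mono) (auto simp: V_def)
  finally show ?thesis using L by (simp add: field_simps)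
 qed
 have V0: "V r s >= 0" for r s by (simp add: V_def)
 have inner: "(\<Sum>r\<in>{-N..N}. f r s) <= (1 / \<bar>of_int s\<bar>) * (12 / \<kappa> * H / \<Delta>)" if s: "s \<noteq> 0" for s
 proof -
  define t where "t = - b * of_int s / a"
  define S1 where "S1 = {r\<in>{-N..N}. 1 <= \<bar>of_int r - t\<bar>}"
  define S2 where "S2 = {r\<in>{-N..N}. \<bar>of_int r - t\<bar> < 1}"
  have fin: "finite S1" "finite S2" unfolding S1_def S2_def by (auto intro: finite_subset[of _ "{-N..N}"])
  have s0: "\<bar>real_of_int s\<bar> > 0" using s by simp
  have S12: "{-N..N} = S1 \<union> S2" "S1 \<inter> S2 = {}" by (auto simp: S1_def S2_def)
  have "(\<Sum>r\<in>{-N..N}. f r s) = (\<Sum>r\<in>S1. f r s) + (\<Sum>r\<in>S2. f r s)"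
   unfolding S12(1) by (rule sum.union_disjoint[OF fin S12(2)])
  also have "(\<Sum>r\<in>S1. f r s) <= (\<Sum>r\<in>S1. (2 / (\<kappa> * \<Delta> * \<bar>of_int s\<bar>)) * (1 / \<bar>of_int r - t\<bar>))"
  proof (rule sum_mono)
   fix r assume "r \<in> S1"
   then have r: "\<bar>of_int r - t\<bar> >= 1" by (simp add: S1_def)
   have pos: "(\<kappa> * \<Lambda> * \<bar>of_int r - t\<bar>) * (\<bar>of_int s\<bar> * \<Delta> / (2 * \<Lambda>)) > 0"
    using k L D s0 r by (intro mult_pos_pos divide_pos_pos) auto
   have "f r s * ((\<kappa> * \<Lambda> * \<bar>of_int r - t\<bar>) * (\<bar>of_int s\<bar> * \<Delta> / (2 * \<Lambda>))) <= f r s * (V r s * V r s)"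
    using f(1) V1[of r s] V2[of s r] V0 L D k by (intro mult_left_mono mult_mono) (auto simp: t_def)
   also have "... <= 1" using f(3)[of r s] by (simp add: V_def power2_eq_square)
   finally have "f r s <= 1 / ((\<kappa> * \<Lambda> * \<bar>of_int r - t\<bar>) * (\<bar>of_int s\<bar> * \<Delta> / (2 * \<Lambda>)))"
    by (subst pos_le_divide_eq[OF pos])
   also have "... = (2 / (\<kappa> * \<Delta> * \<bar>of_int s\<bar>)) * (1 / \<bar>of_int r - t\<bar>)" using L by simp
   finally show "f r s <= (2 / (\<kappa> * \<Delta> * \<bar>of_int s\<bar>)) * (1 / \<bar>of_int r - t\<bar>)" .
  qed
  also have "... = (2 / (\<kappa> * \<Delta> * \<bar>of_int s\<bar>)) * (\<Sum>r\<in>S1. 1 / \<bar>of_int r - t\<bar>)" by (simp only: sum_distrib_left)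
  also have "... <= (2 / (\<kappa> * \<Delta> * \<bar>of_int s\<bar>)) * (2 * H)"
   unfolding S1_def H_def using N k D s0 by (intro mult_left_mono sum_inverse_dist) auto
  also have "(\<Sum>r\<in>S2. f r s) <= (\<Sum>r\<in>S2. 2 / (\<bar>of_int s\<bar> * \<Delta>))"
  proof (rule sum_mono)
   fix r
   \<comment> \<open>For the at most two \<open>r\<close> next to \<open>t\<close> only the bound in
     terms of \<open>s\<close> is left. Its geometric mean with \<open>f r s <= N^2\<close> gives
     the first power of \<open>1 / |s|\<close>, by \<open>\<Lambda> * N <= 1\<close>.\<close>
   have "(f r s * (\<bar>of_int s\<bar> * \<Delta> / 2))\<^sup>2 <= 1\<^sup>2"
   proof -
    have "(f r s * (\<bar>of_int s\<bar> * \<Delta> / 2))\<^sup>2 = f r s * (f r s * ((\<bar>of_int s\<bar> * \<Delta> / (2 * \<Lambda>)) * (\<bar>of_int s\<bar> * \<Delta> / (2 * \<Lambda>)))) * \<Lambda>^2"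
     using L by (simp add: power2_eq_square field_simps)
    also have "... <= (of_int N)\<^sup>2 * (f r s * (V r s * V r s)) * \<Lambda>^2"
     using f(1,2) V2[of s r] V0 L D by (intro mult_right_mono mult_mono mult_left_mono) auto
    also have "... <= (of_int N)\<^sup>2 * 1 * \<Lambda>^2"
     using f(3)[of r s] by (intro mult_right_mono mult_left_mono) (auto simp: V_def power2_eq_square)
    also have "... = (\<Lambda> * of_int N)\<^sup>2" by (simp add: power_mult_distrib)
    also have "... <= 1\<^sup>2" using L N by (intro power_mono) auto
    finally show ?thesis .
   qed
   then have "f r s * (\<bar>of_int s\<bar> * \<Delta> / 2) <= 1" by (rule power2_le_imp_le) simp
   then show "f r s <= 2 / (\<bar>of_int s\<bar> * \<Delta>)" using s0 D by (simp add: field_simps)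
  qed
  also have "... = card S2 * (2 / (\<bar>of_int s\<bar> * \<Delta>))" by simp
  also have "... <= 2 * (2 / (\<bar>of_int s\<bar> * \<Delta>))"
   using card_int_near[of "-N" N t] s0 D by (intro mult_right_mono) (auto simp: S2_def)
  also have "(2 / (\<kappa> * \<Delta> * \<bar>of_int s\<bar>)) * (2 * H) + 2 * (2 / (\<bar>of_int s\<bar> * \<Delta>)) = (1 / \<bar>of_int s\<bar>) * ((4 * H / \<kappa> + 4) / \<Delta>)"
   using s0 D k by (simp add: field_simps)
  also have "... <= (1 / \<bar>of_int s\<bar>) * (12 / \<kappa> * H / \<Delta>)"
  proof (intro mult_left_mono divide_right_mono)
   have "1 <= H / \<kappa>" using H1 k by (simp add: field_simps)
   then show "4 * H / \<kappa> + 4 <= 12 / \<kappa> * H" by simp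
  qed (use s0 D in auto)
  finally show ?thesis by simp
 qed
 have zero: "(\<Sum>r\<in>{-N..N}. f r 0) <= 10 / \<kappa>^2 / \<Delta>"
 proof -
  have r0: "f r 0 <= (1 / (\<kappa> * \<Lambda>)\<^sup>2) * (1 / (of_int r)\<^sup>2)" if "r \<noteq> 0" for r
  proof -
   have "f r 0 * (\<kappa> * \<Lambda> * \<bar>of_int r\<bar>)\<^sup>2 <= f r 0 * (V r 0)\<^sup>2"
    using V1[of r 0] f(1) k L by (intro mult_left_mono power_mono) auto
   also have "... <= 1" using f(3)[of r 0] by (simp add: V_def)
   finally show ?thesis using that k L by (simp add: field_simps power_mult_distrib)
  qed
  have "(\<Sum>r\<in>{1..N}. f r 0) <= (\<Sum>r\<in>{1..N}. (1 / (\<kappa> * \<Lambda>)\<^sup>2) * (1 / (of_int r)\<^sup>2))"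
  proof (rule sum_mono)
   fix r assume "r \<in> {1..N}"
   then show "f r 0 <= (1 / (\<kappa> * \<Lambda>)\<^sup>2) * (1 / (of_int r)\<^sup>2)" by (intro r0) auto
  qed
  moreover have "(\<Sum>r\<in>{1..N}. f (- r) 0) <= (\<Sum>r\<in>{1..N}. (1 / (\<kappa> * \<Lambda>)\<^sup>2) * (1 / (of_int r)\<^sup>2))"
  proof (rule sum_mono)
   fix r assume "r \<in> {1..N}"
   then show "f (- r) 0 <= (1 / (\<kappa> * \<Lambda>)\<^sup>2) * (1 / (of_int r)\<^sup>2)" using r0[of "-r"] by simp
  qed
  moreover have "(\<Sum>r\<in>{1..N}. (1 / (\<kappa> * \<Lambda>)\<^sup>2) * (1 / (of_int r)\<^sup>2)) <= (1 / (\<kappa> * \<Lambda>)\<^sup>2) * 2"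
   unfolding sum_distrib_left[symmetric] by (intro mult_left_mono sum_inverse_squares_int) auto
  moreover have "f 0 0 <= 1 / \<Lambda>^2"
  proof -
   have "f 0 0 * \<Lambda>^2 <= (of_int N)\<^sup>2 * \<Lambda>^2" by (intro mult_right_mono f(2)) simp
   also have "... = (\<Lambda> * of_int N)\<^sup>2" by (simp add: power_mult_distrib)
   also have "... <= 1\<^sup>2" using L N by (intro power_mono) auto
   finally show ?thesis using L by (simp add: field_simps)
  qed
  ultimately have "(\<Sum>r\<in>{-N..N}. f r 0) <= 1 / \<Lambda>^2 + 4 * (1 / (\<kappa> * \<Lambda>)\<^sup>2)"
   using N by (subst sum_symmetric_int) auto
  also have "... = (1 + 4 / \<kappa>^2) * (1 / \<Lambda>^2)" using k L by (simp add: field_simps power_mult_distrib)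
  also have "... <= (5 / \<kappa>^2) * (2 / \<Delta>)"
  proof (intro mult_mono inv)
   have "\<kappa>\<^sup>2 <= 1" using k by (simp add: abs_square_le_1)
   then have "1 <= 1 / \<kappa>^2" using k by simp
   moreover have "5 / \<kappa>^2 = 1 / \<kappa>^2 + 4 / \<kappa>^2" by (simp flip: add_divide_distrib)
   ultimately show "1 + 4 / \<kappa>^2 <= 5 / \<kappa>^2" by linarith
  qed (use k L in auto)
  finally show ?thesis by simp
 qed
 have "(\<Sum>r\<in>{-N..N}. \<Sum>s\<in>{-N..N}. f r s) = (\<Sum>s\<in>{-N..N}. \<Sum>r\<in>{-N..N}. f r s)" by (rule sum.swap)
 also have "... = (\<Sum>r\<in>{-N..N}. f r 0) + (\<Sum>s\<in>{1..N}. \<Sum>r\<in>{-N..N}. f r s) + (\<Sum>s\<in>{1..N}. \<Sum>r\<in>{-N..N}. f r (- s))"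
  using N by (intro sum_symmetric_int) auto
 also have "... <= 10 / \<kappa>^2 / \<Delta> + (\<Sum>s\<in>{1..N}. (1 / of_int s) * (12 / \<kappa> * H / \<Delta>)) + (\<Sum>s\<in>{1..N}. (1 / of_int s) * (12 / \<kappa> * H / \<Delta>))"
 proof (intro add_mono zero sum_mono)
  fix s assume "s \<in> {1..N}"
  then show "(\<Sum>r\<in>{-N..N}. f r s) <= (1 / of_int s) * (12 / \<kappa> * H / \<Delta>)"
   "(\<Sum>r\<in>{-N..N}. f r (-s)) <= (1 / of_int s) * (12 / \<kappa> * H / \<Delta>)"
   using inner[of s] inner[of "-s"] by auto
 qed
 also have "... <= 10 / \<kappa>^2 / \<Delta> + H * (12 / \<kappa> * H / \<Delta>) + H * (12 / \<kappa> * H / \<Delta>)"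
 proof -
  have "(\<Sum>s\<in>{1..N}. 1 / real_of_int s) <= 1 + ln (of_int N)" using N by (rule sum_inverse_int)
  also have "... <= H" unfolding H_def using N by simp
  finally show ?thesis unfolding sum_distrib_right[symmetric] using H1 k D
   by (intro add_mono mult_right_mono) auto
 qed
 also have "... = (10 / \<kappa>^2 + 24 / \<kappa> * H^2) / \<Delta>"
  using k D by (simp add: add_divide_distrib power2_eq_square)
 also have "... <= (50 / \<kappa>^2 * H^2) / \<Delta>"
 proof (rule divide_right_mono)
  have "1 * 1 <= H * H" using H1 by (intro mult_mono) auto
  then have "10 / \<kappa>^2 * 1 <= 10 / \<kappa>^2 * H^2" by (intro mult_left_mono) (auto simp: power2_eq_square)
  moreover have "24 / \<kappa> * H^2 <= 24 / \<kappa>^2 * H^2"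
  proof (intro mult_right_mono divide_left_mono)
   show "\<kappa>\<^sup>2 <= \<kappa>" using k by (simp add: power2_eq_square mult_left_le)
  qed (use k in auto)
  moreover have "10 / \<kappa>^2 * H^2 = 10 * (H^2 / \<kappa>^2)" "24 / \<kappa>^2 * H^2 = 24 * (H^2 / \<kappa>^2)"
   "50 / \<kappa>^2 * H^2 = 50 * (H^2 / \<kappa>^2)" "0 <= H^2 / \<kappa>^2" by simp_all
  ultimately show "10 / \<kappa>^2 + 24 / \<kappa> * H^2 <= 50 / \<kappa>^2 * H^2" by linarith
 qed (use D in auto)
 finally show ?thesis .
qed

text \<open>Exchanging rows or columns keeps the absolute determinant and the maximum of the two
  coordinates, so any entry of size at least \<open>\<kappa> * \<Lambda>\<close> can be moved to the
  upper left corner.\<close>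

lemma lattice_sum:
 fixes a b c d \<Lambda> \<kappa> :: real and N :: int
 defines "\<Delta> \<equiv> \<bar>a * d - b * c\<bar>" and "H \<equiv> 1 + ln (real_of_int (2 * N + 1))"
 assumes N: "N >= 1" and L: "\<Lambda> > 0" "\<bar>a\<bar> <= \<Lambda>" "\<bar>b\<bar> <= \<Lambda>" "\<bar>c\<bar> <= \<Lambda>" "\<bar>d\<bar> <= \<Lambda>" "\<Lambda> * of_int N <= 1"
  and k: "\<kappa> > 0" "\<kappa> <= 1" "\<kappa> * \<Lambda> <= \<bar>a\<bar> \<or> \<kappa> * \<Lambda> <= \<bar>b\<bar> \<or> \<kappa> * \<Lambda> <= \<bar>c\<bar> \<or> \<kappa> * \<Lambda> <= \<bar>d\<bar>" and D: "\<Delta> > 0"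
  and f: "\<And>r s. 0 <= f r s" "\<And>r s. f r s <= (of_int N)\<^sup>2"
   "\<And>r s. f r s * (max \<bar>a * of_int r + b * of_int s\<bar> \<bar>c * of_int r + d * of_int s\<bar>)\<^sup>2 <= 1"
 shows "(\<Sum>r\<in>{-N..N}. \<Sum>s\<in>{-N..N}. f r s) <= 50 / \<kappa>^2 * H^2 / \<Delta>"
proof -
 have e: "\<bar>c * b - d * a\<bar> = \<Delta>" "\<bar>b * c - a * d\<bar> = \<Delta>" "\<bar>d * a - c * b\<bar> = \<Delta>"
  unfolding \<Delta>_def by (simp_all add: mult.commute abs_minus_commute)
 have D': "\<bar>c * b - d * a\<bar> > 0" "\<bar>b * c - a * d\<bar> > 0" "\<bar>d * a - c * b\<bar> > 0" using D e by simp_all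
 have f2: "\<And>s r. f r s * (max \<bar>b * of_int s + a * of_int r\<bar> \<bar>d * of_int s + c * of_int r\<bar>)\<^sup>2 <= 1"
  using f(3) by (simp add: add.commute)
 have f3: "\<And>r s. f r s * (max \<bar>c * of_int r + d * of_int s\<bar> \<bar>a * of_int r + b * of_int s\<bar>)\<^sup>2 <= 1"
  using f(3) by (simp add: max.commute)
 have f4: "\<And>s r. f r s * (max \<bar>d * of_int s + c * of_int r\<bar> \<bar>b * of_int s + a * of_int r\<bar>)\<^sup>2 <= 1"
  using f3 by (simp add: add.commute)
 from k(3) consider "\<kappa> * \<Lambda> <= \<bar>a\<bar>" | "\<kappa> * \<Lambda> <= \<bar>b\<bar>" | "\<kappa> * \<Lambda> <= \<bar>c\<bar>" | "\<kappa> * \<Lambda> <= \<bar>d\<bar>" by auto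
 then show ?thesis
 proof cases
  case 1
  show ?thesis unfolding \<Delta>_def H_def by (rule lattice_sum_aux[OF N L k(1,2) 1 D[unfolded \<Delta>_def] f])
 next
  case 2
  have "(\<Sum>s\<in>{-N..N}. \<Sum>r\<in>{-N..N}. f r s) <= 50 / \<kappa>^2 * H^2 / \<bar>b * c - a * d\<bar>"
   unfolding H_def by (rule lattice_sum_aux[OF N L(1,3,2,5,4,6) k(1,2) 2 D'(2) f(1,2) f2])
  then show ?thesis unfolding e by (subst sum.swap)
 next
  case 3
  have "(\<Sum>r\<in>{-N..N}. \<Sum>s\<in>{-N..N}. f r s) <= 50 / \<kappa>^2 * H^2 / \<bar>c * b - d * a\<bar>"
   unfolding H_def by (rule lattice_sum_aux[OF N L(1,4,5,2,3,6) k(1,2) 3 D'(1) f(1,2) f3])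
  then show ?thesis unfolding e .
 next
  case 4
  have "(\<Sum>s\<in>{-N..N}. \<Sum>r\<in>{-N..N}. f r s) <= 50 / \<kappa>^2 * H^2 / \<bar>d * a - c * b\<bar>"
   unfolding H_def by (rule lattice_sum_aux[OF N L(1,5,4,3,2,6) k(1,2) 4 D'(3) f(1,2) f4])
  then show ?thesis unfolding e by (subst sum.swap)
 qed
qed

section \<open>Smoothed sums over one box\<close>

definition kc :: "real => nat => real" where
 "kc ga n = (1 + ga) * phase_const ga n"

lemma kc_pos: "ga > 0 ==> kc ga n > 0"
 by (simp add: kc_def phase_const_pos)

text \<open>\<open>A\<close> and \<open>B\<close> are the scales of the two factors, and
  \<open>X\<close> is the size of the phase there. A dyadic block of pairs with \<open>a < b\<close>
  has \<open>A * A <= 2 * k\<close> and \<open>A * B = k / 2\<close>, which is where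
  \<open>A <= 4 * B\<close> comes from.\<close>

locale phase =
 fixes ga U V A B X :: real
 assumes gam: "ga > 0" and U: "U > 0" "\<bar>V\<bar> <= ga * U"
  and A1: "A >= 1" and B1: "B >= 1" and AB2: "A <= 4 * B" and X_def: "X = U * (A * B) powr (- ga)"
begin

abbreviation "F \<equiv> PH ga U V []"

lemma pos: "A > 0" "B > 0" "X > 0" "A * B >= 1"
proof -
 show "A > 0" "B > 0" using A1 B1 by auto
 then show "X > 0" using U by (simp add: X_def)
 have "1 * 1 <= A * B" using A1 B1 by (intro mult_mono) auto
 then show "A * B >= 1" by simp
qed

lemma kc_pos': "kc ga n > 0" using kc_pos gam by simp

text \<open>\<open>w <= 1/216\<close> makes \<open>54 * w <= 1/4\<close>, so every point reached
  stays where the derivative bounds hold. In units of \<open>w\<close> the 54 collects the box (24),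
  a shift inside the box (24), the Weyl shift (1) and a few single steps of the differences
  (5).\<close>

lemma Diff_bounds:
 assumes x0: "x0 >= A / 2" "y0 >= B / 2" and w: "0 <= w" "w <= 1/216"
  and loc: "\<bar>x - x0\<bar> + sumx vs <= 54 * w * A" "\<bar>y - y0\<bar> + sumy vs <= 54 * w * B"
 shows "\<bar>Diff vs F x y\<bar> <= kc ga (length vs) * X * (\<Prod>v\<leftarrow>vs. nrm A B v)"
  and "\<bar>Diff vs F x y - PH ga U V (rev vs) x0 y0\<bar> <= 108 * w * kc ga (Suc (length vs)) * X * (\<Prod>v\<leftarrow>vs. nrm A B v)"
proof -
 have wA: "54 * w * A <= A / 4" "54 * w * B <= B / 4"
  using mult_right_mono[OF w(2), of "54 * A"] mult_right_mono[OF w(2), of "54 * B"] pos by auto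
 have "sumx vs < x" "sumy vs < y" using loc wA x0 pos by linarith+
 then obtain \<xi> \<eta> where xi: "\<bar>\<xi> - x\<bar> <= sumx vs" "\<bar>\<eta> - y\<bar> <= sumy vs" "Diff vs F x y = PH ga U V (rev vs @ []) \<xi> \<eta>"
  using Diff_mean_value by blast
 have near: "\<bar>\<xi> - x0\<bar> <= 54 * w * A" "\<bar>\<eta> - y0\<bar> <= 54 * w * B" using xi loc by linarith+
 have reg: "A / 4 <= \<xi>" "B / 4 <= \<eta>" "A / 4 <= x0" "B / 4 <= y0" using near wA x0 pos by linarith+
 have rv: "(\<Prod>v\<leftarrow>rev vs. nrm A B v) = (\<Prod>v\<leftarrow>vs. nrm A B v)"
  by (simp add: rev_map[symmetric] prod_list.rev)
 show "\<bar>Diff vs F x y\<bar> <= kc ga (length vs) * X * (\<Prod>v\<leftarrow>vs. nrm A B v)"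
  using PH_bound(1)[OF pos(1,2,4) reg(1,2) gam U X_def, of "rev vs"] xi(3) rv by (simp add: kc_def)
 show "\<bar>Diff vs F x y - PH ga U V (rev vs) x0 y0\<bar> <= 108 * w * kc ga (Suc (length vs)) * X * (\<Prod>v\<leftarrow>vs. nrm A B v)"
  using PH_variation[OF pos(1,2,4) reg(3,4,1,2) gam U X_def near, of "rev vs"] xi(3) rv by (simp add: kc_def algebra_simps)
qed

definition smooth_c :: real where "smooth_c = 280 + 3 * kc ga 5 / kc ga 4"

text \<open>A correlation carries the product of two translated weights. The discrete product rule
  gives at most \<open>2 * 123 + 2 * 3.2^2 = 266.48\<close> for the second difference, rounded up to
  280.\<close>

lemma bump_product_bounds:
 fixes N r n :: int
 defines "u \<equiv> (\<lambda>n. bump (of_int n / of_int N) * bump (of_int (n + r) / of_int N))"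
 assumes N: "N >= 1"
 shows "\<bar>u n\<bar> <= 1" "\<bar>u (n+1) - u n\<bar> <= 280 / of_int N" "\<bar>u (n+2) - 2 * u (n+1) + u n\<bar> <= 280 / (of_int N)\<^sup>2"
proof -
 define a where "a = (\<lambda>n. bump (of_int n / of_int N))"
 define h where "h = 1 / real_of_int N"
 have h: "h > 0" using N by (simp add: h_def)
 have ab: "0 <= a n" "a n <= 1" for n by (simp_all add: a_def bump_bounds)
 have u: "u n = a n * a (n + r)" for n by (simp add: u_def a_def)
 have d1: "\<bar>a (n+1) - a n\<bar> <= 3.2 * h" for n
 proof -
  have "\<bar>a (n+1) - a n\<bar> <= pi * \<bar>of_int (n+1) / of_int N - of_int n / of_int N\<bar>"
   unfolding a_def by (rule bump_lipschitz)
  also have "real_of_int (n+1) / of_int N - of_int n / of_int N = h" by (simp add: h_def add_divide_distrib)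
  also have "pi * \<bar>h\<bar> <= 3.2 * h" using h pi_approx by (simp add: mult_right_mono)
  finally show ?thesis .
 qed
 have d2: "\<bar>a (n+2) - 2 * a (n+1) + a n\<bar> <= 123 * h^2" for n
 proof -
  have "\<bar>bump (of_int n / of_int N + 2 * h) - 2 * bump (of_int n / of_int N + h) + bump (of_int n / of_int N)\<bar> <= 12 * pi^2 * h^2"
   using h by (intro bump_second_difference) auto
  also have "... <= 123 * h^2"
  proof (rule mult_right_mono)
   have "pi^2 <= 3.2^2" using pi_approx by (intro power_mono) auto
   then show "12 * pi^2 <= 123" by (simp add: power2_eq_square)
  qed simp
  finally show ?thesis unfolding a_def h_def by (simp add: add_divide_distrib)
 qed
 show "\<bar>u n\<bar> <= 1" unfolding u abs_mult using ab[of n] ab[of "n+r"] by (intro mult_le_one) auto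
 have eq1: "u (n+1) - u n = (a (n+1) - a n) * a (n+1+r) + a n * (a (n+r+1) - a (n+r))" unfolding u by (simp add: algebra_simps)
 have "\<bar>u (n+1) - u n\<bar> <= \<bar>a (n+1) - a n\<bar> * \<bar>a (n+1+r)\<bar> + \<bar>a n\<bar> * \<bar>a (n+r+1) - a (n+r)\<bar>"
  unfolding eq1 by (rule order.trans[OF abs_triangle_ineq]) (simp add: abs_mult)
 also have "... <= (3.2 * h) * 1 + 1 * (3.2 * h)"
  using ab h by (intro add_mono mult_mono d1) auto
 also have "... <= 280 * h" using h by simp
 also have "... = 280 / of_int N" by (simp add: h_def)
 finally show "\<bar>u (n+1) - u n\<bar> <= 280 / of_int N" .
 have eq2: "u (n+2) - 2 * u (n+1) + u n = (a (n+2) - 2 * a (n+1) + a n) * a (n+r+2) + 2 * ((a (n+1) - a n) * (a ((n+r+1)+1) - a (n+r+1)))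
   + a n * (a (n+r+2) - 2 * a (n+r+1) + a (n+r))"
  unfolding u by (simp add: algebra_simps)
 have "\<bar>u (n+2) - 2 * u (n+1) + u n\<bar> <= \<bar>a (n+2) - 2 * a (n+1) + a n\<bar> * \<bar>a (n+r+2)\<bar> + 2 * (\<bar>a (n+1) - a n\<bar> * \<bar>a ((n+r+1)+1) - a (n+r+1)\<bar>)
   + \<bar>a n\<bar> * \<bar>a (n+r+2) - 2 * a (n+r+1) + a (n+r)\<bar>"
  unfolding eq2 by (rule order.trans[OF abs_triangle_ineq], rule add_mono, rule order.trans[OF abs_triangle_ineq]) (simp_all only: abs_mult abs_numeral order.refl)
 also have "... <= (123 * h^2) * 1 + 2 * ((3.2 * h) * (3.2 * h)) + 1 * (123 * h^2)"
  using ab h by (intro add_mono mult_mono d1 d2) auto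
 also have "... = 266.48 * h^2" by (simp add: power2_eq_square)
 also have "... <= 280 * h^2" by (intro mult_right_mono) auto
 also have "... = 280 / (of_int N)\<^sup>2" by (simp add: h_def power_divide)
 finally show "\<bar>u (n+2) - 2 * u (n+1) + u n\<bar> <= 280 / (of_int N)\<^sup>2" .
qed

text \<open>The hypotheses of \<open>smooth_sum_bound\<close> along one lattice direction
  \<open>e\<close>. The increment of the sequence is a threefold difference, hence close to a
  derivative at the base point. Freezing it there loses at most \<open>\<mu>\<close> by the
  hypothesis with 220, so half of the lower bound \<open>2 * \<mu>\<close> survives. Further
  differences gain factors \<open>1 / B\<close>, to be compared with
  \<open>N <= 24 * w * B\<close>.\<close>

lemma smooth_direction_sum:
 fixes N r :: int and e q z :: "real \<times> real"
 assumes x0: "x0 >= A / 2" "y0 >= B / 2" and w: "0 < w" "w <= 1/216"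
  and N: "N >= 1" "of_int N <= 24 * w * B" and e: "nrm A B e <= 1 / B" and z: "nrm A B z <= Z / B"
  and loc: "\<And>n. -2 <= n ==> n <= N + 2 ==> \<bar>xb + of_int n * fst e - x0\<bar> + (3 * \<bar>fst e\<bar> + \<bar>fst z\<bar> + \<bar>fst q\<bar>) <= 54 * w * A"
   "\<And>n. -2 <= n ==> n <= N + 2 ==> \<bar>yb + of_int n * snd e - y0\<bar> + (3 * \<bar>snd e\<bar> + \<bar>snd z\<bar> + \<bar>snd q\<bar>) <= 54 * w * B"
  and mu: "\<mu> > 0" "2 * \<mu> <= \<bar>PH ga U V [q, z, e] x0 y0\<bar>" "220 * kc ga 4 * w * (X * nrm A B q * Z / B^2) <= 2 * \<mu>"
  and small: "kc ga 3 * (X * nrm A B q * Z / B^2) <= 1/2"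
 shows "norm (\<Sum>n\<in>{0..N}. of_real (bump (of_int n / of_int N) * bump (of_int (n + r) / of_int N)) *
      ee (Diff [z, q] F (xb + of_int n * fst e) (yb + of_int n * snd e) + cst)) <= 8 * smooth_c^2 / (of_int N * \<mu>^2)"
proof (rule smooth_sum_bound)
 define x where "x n = Diff [z, q] F (xb + of_int n * fst e) (yb + of_int n * snd e) + cst" for n :: int
 define Y where "Y = X * nrm A B q * Z / B^2"
 have Npos: "real_of_int N >= 1" using N by simp
 have nq: "nrm A B q >= 0" and nz: "nrm A B z >= 0" and ne: "nrm A B e >= 0" using nrm_nonneg pos by auto
 have "0 <= Z / B" using nz z by linarith
 then have Z: "Z >= 0" using pos by (simp add: zero_le_divide_iff)
 have Y: "Y >= 0" unfolding Y_def using pos nq Z by simp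
 have "220 * (w * kc ga 4 * Y) <= 2 * \<mu>" using mu(3) by (simp add: Y_def mult_ac)
 then have wkY: "w * kc ga 4 * Y <= \<mu> / 110" by linarith
 have prod3: "nrm A B e * (nrm A B z * (nrm A B q * 1)) * X <= Y"
 proof -
  have "nrm A B e * (nrm A B z * (nrm A B q * 1)) * X <= (1/B) * ((Z/B) * (nrm A B q * 1)) * X"
   using e z nq nz ne pos Z by (intro mult_right_mono mult_mono) auto
  also have "... = Y" using pos by (simp add: Y_def power2_eq_square)
  finally show ?thesis .
 qed
 have prod4: "nrm A B e * (nrm A B e * (nrm A B z * (nrm A B q * 1))) * X <= Y / B"
 proof -
  have "nrm A B e * (nrm A B e * (nrm A B z * (nrm A B q * 1)) * X) <= (1/B) * Y"
   using e prod3 ne nz nq pos by (intro mult_mono) auto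
  then show ?thesis by simp
 qed
 have prod5: "nrm A B e * (nrm A B e * (nrm A B e * (nrm A B z * (nrm A B q * 1)))) * X <= Y / B^2"
 proof -
  have "nrm A B e * (nrm A B e * (nrm A B e * (nrm A B z * (nrm A B q * 1))) * X) <= (1/B) * (Y / B)"
   using e prod4 ne nz nq pos by (intro mult_mono) auto
  then show ?thesis by (simp add: power2_eq_square)
 qed
 have shift: "xb + of_int (n + 1) * fst e = xb + of_int n * fst e + fst e"
   "yb + of_int (n + 1) * snd e = yb + of_int n * snd e + snd e" for n :: int by (simp_all add: algebra_simps)
 have d: "x (n+1) - x n = Diff [e, z, q] F (xb + of_int n * fst e) (yb + of_int n * snd e)" for n
  unfolding x_def shift by simp
 have dd: "(x (n+1+1) - x (n+1)) - (x (n+1) - x n) = Diff [e, e, z, q] F (xb + of_int n * fst e) (yb + of_int n * snd e)" for n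
  unfolding d shift by simp
 have ddd: "(x (n+2+1) - x (n+2)) - 2 * (x (n+1+1) - x (n+1)) + (x (n+1) - x n) = Diff [e, e, e, z, q] F (xb + of_int n * fst e) (yb + of_int n * snd e)" for n
 proof -
  have "(x (n+2+1) - x (n+2)) - 2 * (x (n+1+1) - x (n+1)) + (x (n+1) - x n)
   = ((x ((n+1)+1+1) - x ((n+1)+1)) - (x ((n+1)+1) - x (n+1))) - ((x (n+1+1) - x (n+1)) - (x (n+1) - x n))"
   by (simp add: add.assoc)
  also have "... = Diff [e, e, e, z, q] F (xb + of_int n * fst e) (yb + of_int n * snd e)"
   unfolding dd shift by simp
  finally show ?thesis .
 qed
 have c1: "smooth_c >= 280" "smooth_c >= 3 * kc ga 5 / kc ga 4"
  unfolding smooth_c_def using kc_pos' by (simp_all add: divide_nonneg_pos less_imp_le)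
 show "1 <= N" "1 <= smooth_c" "0 < \<mu>" using N c1 mu by auto
 show "bump (of_int n / of_int N) * bump (of_int (n + r) / of_int N) = 0" if "n < 0 \<or> N < n" for n
 proof -
  have "of_int n / real_of_int N <= 0 \<or> of_int n / real_of_int N >= 1" using that Npos by (auto simp: field_simps)
  then show ?thesis by (simp add: bump_outside)
 qed
 show "\<bar>bump (of_int n / of_int N) * bump (of_int (n + r) / of_int N)\<bar> <= 1" for n
  using bump_product_bounds(1)[OF N(1), of n r] .
 show "\<bar>bump (of_int (n+1) / of_int N) * bump (of_int (n + 1 + r) / of_int N) - bump (of_int n / of_int N) * bump (of_int (n + r) / of_int N)\<bar> <= smooth_c / of_int N" for n
  by (rule order.trans[OF bump_product_bounds(2)[OF N(1)]]) (use c1 Npos in \<open>auto intro!: divide_right_mono\<close>)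
 show "\<bar>bump (of_int (n+2) / of_int N) * bump (of_int (n + 2 + r) / of_int N) - 2 * (bump (of_int (n+1) / of_int N) * bump (of_int (n + 1 + r) / of_int N))
   + bump (of_int n / of_int N) * bump (of_int (n + r) / of_int N)\<bar> <= smooth_c / (of_int N)\<^sup>2" for n
  by (rule order.trans[OF bump_product_bounds(3)[OF N(1)]]) (use c1 Npos in \<open>auto intro!: divide_right_mono\<close>)
 note fold = x_def[symmetric]
 show "\<mu> <= \<bar>Diff [z, q] F (xb + of_int (n+1) * fst e) (yb + of_int (n+1) * snd e) + cst - (Diff [z, q] F (xb + of_int n * fst e) (yb + of_int n * snd e) + cst)\<bar> \<and>
   \<bar>Diff [z, q] F (xb + of_int (n+1) * fst e) (yb + of_int (n+1) * snd e) + cst - (Diff [z, q] F (xb + of_int n * fst e) (yb + of_int n * snd e) + cst)\<bar> <= 1/2"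
  if n: "-2 <= n" "n <= N + 2" for n
  unfolding fold d
 proof
  have l: "\<bar>xb + of_int n * fst e - x0\<bar> + sumx [e, z, q] <= 54 * w * A" "\<bar>yb + of_int n * snd e - y0\<bar> + sumy [e, z, q] <= 54 * w * B"
   using loc[OF n] abs_ge_zero[of "fst e"] abs_ge_zero[of "snd e"] by - (simp only: list.map sum_list.Cons sum_list.Nil; linarith)+
  have "\<bar>Diff [e, z, q] F (xb + of_int n * fst e) (yb + of_int n * snd e)\<bar> <= kc ga (length [e,z,q]) * X * (\<Prod>v\<leftarrow>[e,z,q]. nrm A B v)"
   by (rule Diff_bounds(1)[OF x0 _ w(2) l]) (use w in auto)
  also have "... = kc ga 3 * (nrm A B e * (nrm A B z * (nrm A B q * 1)) * X)" by (simp add: numeral_3_eq_3)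
  also have "... <= kc ga 3 * Y" using prod3 kc_pos'[of 3] by (intro mult_left_mono) auto
  also have "... <= 1/2" using small by (simp add: Y_def)
  finally show "\<bar>Diff [e, z, q] F (xb + of_int n * fst e) (yb + of_int n * snd e)\<bar> <= 1/2" .
  have "\<bar>Diff [e, z, q] F (xb + of_int n * fst e) (yb + of_int n * snd e) - PH ga U V (rev [e,z,q]) x0 y0\<bar> <= 108 * w * kc ga (Suc (length [e,z,q])) * X * (\<Prod>v\<leftarrow>[e,z,q]. nrm A B v)"
   by (rule Diff_bounds(2)[OF x0 _ w(2) l]) (use w in auto)
  also have "... = 108 * (w * kc ga 4 * (nrm A B e * (nrm A B z * (nrm A B q * 1)) * X))" by (simp add: eval_nat_numeral)
  also have "... <= 108 * (w * kc ga 4 * Y)" using prod3 w kc_pos'[of 4] by (intro mult_left_mono) auto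
  also have "... <= \<mu>" using wkY mu by simp
  finally show "\<mu> <= \<bar>Diff [e, z, q] F (xb + of_int n * fst e) (yb + of_int n * snd e)\<bar>"
   using mu(2) by simp
 qed
 show "\<bar>(Diff [z, q] F (xb + of_int (n+1+1) * fst e) (yb + of_int (n+1+1) * snd e) + cst - (Diff [z, q] F (xb + of_int (n+1) * fst e) (yb + of_int (n+1) * snd e) + cst))
  - (Diff [z, q] F (xb + of_int (n+1) * fst e) (yb + of_int (n+1) * snd e) + cst - (Diff [z, q] F (xb + of_int n * fst e) (yb + of_int n * snd e) + cst))\<bar> <= smooth_c * \<mu> / of_int N"
  if n: "-2 <= n" "n <= N + 1" for n
  unfolding fold dd
 proof -
  have n': "n <= N + 2" using n by simp
  have l: "\<bar>xb + of_int n * fst e - x0\<bar> + sumx [e, e, z, q] <= 54 * w * A" "\<bar>yb + of_int n * snd e - y0\<bar> + sumy [e, e, z, q] <= 54 * w * B"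
   using loc[OF n(1) n'] abs_ge_zero[of "fst e"] abs_ge_zero[of "snd e"] by - (simp only: list.map sum_list.Cons sum_list.Nil; linarith)+
  have "\<bar>Diff [e, e, z, q] F (xb + of_int n * fst e) (yb + of_int n * snd e)\<bar> <= kc ga (length [e,e,z,q]) * X * (\<Prod>v\<leftarrow>[e,e,z,q]. nrm A B v)"
   by (rule Diff_bounds(1)[OF x0 _ w(2) l]) (use w in auto)
  also have "... = kc ga 4 * (nrm A B e * (nrm A B e * (nrm A B z * (nrm A B q * 1))) * X)" by (simp add: eval_nat_numeral)
  also have "... <= kc ga 4 * (Y / B)" using prod4 kc_pos'[of 4] by (intro mult_left_mono) auto
  also have "... = (kc ga 4 * (Y / B) * of_int N) / of_int N" using Npos by simp
  also have "... <= (smooth_c * \<mu>) / of_int N"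
  proof (rule divide_right_mono)
   have "kc ga 4 * (Y / B) * of_int N <= kc ga 4 * (Y / B) * (24 * w * B)"
    using N kc_pos'[of 4] Y pos by (intro mult_left_mono) auto
   also have "... = 24 * (w * kc ga 4 * Y)" using pos by simp
   also have "... <= 1 * \<mu>" using wkY mu by simp
   also have "... <= smooth_c * \<mu>" using c1 mu by (intro mult_right_mono) auto
   finally show "kc ga 4 * (Y / B) * of_int N <= smooth_c * \<mu>" .
  qed (use Npos in auto)
  finally show "\<bar>Diff [e, e, z, q] F (xb + of_int n * fst e) (yb + of_int n * snd e)\<bar> <= smooth_c * \<mu> / of_int N" .
 qed
 show "\<bar>(Diff [z, q] F (xb + of_int (n+2+1) * fst e) (yb + of_int (n+2+1) * snd e) + cst - (Diff [z, q] F (xb + of_int (n+2) * fst e) (yb + of_int (n+2) * snd e) + cst))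
  - 2 * (Diff [z, q] F (xb + of_int (n+1+1) * fst e) (yb + of_int (n+1+1) * snd e) + cst - (Diff [z, q] F (xb + of_int (n+1) * fst e) (yb + of_int (n+1) * snd e) + cst))
  + (Diff [z, q] F (xb + of_int (n+1) * fst e) (yb + of_int (n+1) * snd e) + cst - (Diff [z, q] F (xb + of_int n * fst e) (yb + of_int n * snd e) + cst))\<bar> <= smooth_c * \<mu> / (of_int N)\<^sup>2"
  if n: "-2 <= n" "n <= N" for n
  unfolding fold ddd
 proof -
  have n': "n <= N + 2" using n by simp
  have l: "\<bar>xb + of_int n * fst e - x0\<bar> + sumx [e, e, e, z, q] <= 54 * w * A" "\<bar>yb + of_int n * snd e - y0\<bar> + sumy [e, e, e, z, q] <= 54 * w * B"
   using loc[OF n(1) n'] abs_ge_zero[of "fst e"] abs_ge_zero[of "snd e"] by - (simp only: list.map sum_list.Cons sum_list.Nil; linarith)+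
  have "\<bar>Diff [e, e, e, z, q] F (xb + of_int n * fst e) (yb + of_int n * snd e)\<bar> <= kc ga (length [e,e,e,z,q]) * X * (\<Prod>v\<leftarrow>[e,e,e,z,q]. nrm A B v)"
   by (rule Diff_bounds(1)[OF x0 _ w(2) l]) (use w in auto)
  also have "... = kc ga 5 * (nrm A B e * (nrm A B e * (nrm A B e * (nrm A B z * (nrm A B q * 1)))) * X)" by (simp add: eval_nat_numeral)
  also have "... <= kc ga 5 * (Y / B^2)" using prod5 kc_pos'[of 5] by (intro mult_left_mono) auto
  also have "... = (kc ga 5 * (Y / B^2) * (of_int N)\<^sup>2) / (of_int N)\<^sup>2" using Npos by simp
  also have "... <= (smooth_c * \<mu>) / (of_int N)\<^sup>2"
  proof (rule divide_right_mono)
   have "kc ga 5 * (Y / B^2) * (of_int N)\<^sup>2 <= kc ga 5 * (Y / B^2) * (24 * w * B)\<^sup>2"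
    using N kc_pos'[of 5] Y pos by (intro mult_left_mono power_mono) auto
   also have "... = (576 * w * (kc ga 5 / kc ga 4)) * (w * kc ga 4 * Y)" using pos kc_pos'[of 4] by (simp add: power2_eq_square field_simps)
   also have "... <= (576 * (1/216) * (kc ga 5 / kc ga 4)) * (\<mu> / 110)"
   proof (rule mult_mono)
    have "0 <= kc ga 5 / kc ga 4" using kc_pos'[of 4] kc_pos'[of 5] by simp
    then show "576 * w * (kc ga 5 / kc ga 4) <= 576 * (1/216) * (kc ga 5 / kc ga 4)"
     using w by (intro mult_right_mono) auto
    show "w * kc ga 4 * Y <= \<mu> / 110" by (rule wkY)
    show "0 <= w * kc ga 4 * Y" using w kc_pos'[of 4] Y by (intro mult_nonneg_nonneg) auto
    show "0 <= 576 * (1/216) * (kc ga 5 / kc ga 4)" using kc_pos'[of 4] kc_pos'[of 5] by simp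
   qed
   also have "... = (576 / 216 / 110) * ((kc ga 5 / kc ga 4) * \<mu>)" by simp
   also have "... <= 3 * ((kc ga 5 / kc ga 4) * \<mu>)"
    using mu kc_pos'[of 4] kc_pos'[of 5] by (intro mult_right_mono) auto
   also have "... <= smooth_c * \<mu>" using c1 mu mult_right_mono[OF c1(2), of \<mu>] by simp
   finally show "kc ga 5 * (Y / B^2) * (of_int N)\<^sup>2 <= smooth_c * \<mu>" .
  qed (use Npos in auto)
  finally show "\<bar>Diff [e, e, e, z, q] F (xb + of_int n * fst e) (yb + of_int n * snd e)\<bar> <= smooth_c * \<mu> / (of_int N)\<^sup>2" .
 qed
qed

lemma PH_linear: "PH ga U V [q, (r / l, s), e] x y = PH ga U V [q, (1 / l, 0), e] x y * r + PH ga U V [q, (0, 1), e] x y * s"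
 by (simp add: PH_def algebra_simps)

text \<open>The matrix with rows \<open>(a, b)\<close> and \<open>(c, d)\<close> is the Hessian of
  the differenced phase in lattice units. The square of the sum is expanded into all shifts
  \<open>(r, s)\<close>; each correlation is a smooth sum whose phase has increments close to the
  image of \<open>(r, s)\<close> under this matrix. Summing by parts in the direction of the larger
  coordinate, and trivially in the other, bounds it by a constant over the square of that
  coordinate, and the lattice sum then produces the inverse determinant. \<open>H1\<close> keeps the
  increments below \<open>1/2\<close>, so nonzero integers are never approached.\<close>

lemma smooth_box_sum:
 fixes L M1 N2 :: int and q1 q2 \<kappa> x0 y0 w \<theta> \<theta>' :: real
 defines "N1 \<equiv> L * M1" and "q \<equiv> (q1, q2)"
 defines "a \<equiv> PH ga U V [q, (1 / of_int L, 0), (1 / of_int L, 0)] x0 y0" and "b \<equiv> PH ga U V [q, (0, 1), (1 / of_int L, 0)] x0 y0"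
  and "c \<equiv> PH ga U V [q, (1 / of_int L, 0), (0, 1)] x0 y0" and "d \<equiv> PH ga U V [q, (0, 1), (0, 1)] x0 y0"
 assumes x0: "x0 >= A / 2" "y0 >= B / 2" and w: "0 < w" "w <= 1/216" "1 <= w * A" "1 <= w * B"
  and L: "L >= 1" "B <= of_int L * A"
  and N1: "w * B <= of_int N1" "of_int N1 <= 24 * w * B" and N2: "w * B <= of_int N2" "of_int N2 <= 24 * w * B"
  and q: "\<bar>q1\<bar> <= w * A" "\<bar>q2\<bar> <= w * B" "nrm A B q > 0"
  and H1: "kc ga 3 * (X * nrm A B q) * (48 * w) / B <= 1/2"
  and H2: "\<And>r s :: real. 220 * kc ga 4 * w * (X * nrm A B q * (\<bar>r\<bar> + \<bar>s\<bar>) / B^2) <= max \<bar>a * r + b * s\<bar> \<bar>c * r + d * s\<bar>"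
  and k: "\<kappa> > 0" "\<kappa> <= 1" "\<kappa> * (kc ga 3 * (X * nrm A B q) / B^2) <= \<bar>a\<bar> \<or> \<kappa> * (kc ga 3 * (X * nrm A B q) / B^2) <= \<bar>b\<bar>
    \<or> \<kappa> * (kc ga 3 * (X * nrm A B q) / B^2) <= \<bar>c\<bar> \<or> \<kappa> * (kc ga 3 * (X * nrm A B q) / B^2) <= \<bar>d\<bar>"
  and D: "\<bar>a * d - b * c\<bar> > 0"
 shows "norm (\<Sum>n\<in>{0..N1}. \<Sum>m\<in>{0..N2}. of_real (bump (of_int n / of_int N1)) * of_real (bump (of_int m / of_int N2)) *
   ee (\<theta> * of_int n + \<theta>' * of_int m) * ee (Diff [q] F (x0 + of_int n / of_int L) (y0 + of_int m)))
  <= 280 * smooth_c / \<kappa> * (1 + ln (50 * B)) / sqrt \<bar>a * d - b * c\<bar>"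
proof -
 define \<Lambda> where "\<Lambda> = kc ga 3 * (X * nrm A B q) / B^2"
 define N where "N = max N1 N2"
 define f where "f = (\<lambda>(n::int, m::int). complex_of_real (bump (of_int n / of_int N1) * bump (of_int m / of_int N2)) *
   ee (\<theta> * of_int n + \<theta>' * of_int m + Diff [q] F (x0 + of_int n / of_int L) (y0 + of_int m)))"
 define DD' where "DD' = {0..N1} \<times> {0..N2}"
 define Vm where "Vm r s = max \<bar>a * r + b * s\<bar> \<bar>c * r + d * s\<bar>" for r s :: real
 have Npos: "N1 >= 1" "N2 >= 1" "N >= 1"
  using N1 N2 w(4) unfolding N_def by linarith+
 have Nr: "real_of_int N <= 24 * w * B" unfolding N_def using N1 N2 by (simp add: max_def)
 have Lr: "real_of_int L >= 1" using L by simp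
 have sc: "smooth_c >= 280" unfolding smooth_c_def using kc_pos' by (simp add: divide_nonneg_pos less_imp_le)
 have La: "\<Lambda> > 0" unfolding \<Lambda>_def using kc_pos' pos q by simp
 have LN: "\<Lambda> * of_int N <= 1"
 proof -
  define T where "T = kc ga 3 * (X * nrm A B q) * (48 * w) / B"
  have T: "T <= 1/2" unfolding T_def by (rule H1)
  have "\<Lambda> * of_int N <= \<Lambda> * (24 * w * B)" using La Nr by (intro mult_left_mono) auto
  also have "... = T / 2" using pos by (simp add: T_def \<Lambda>_def power2_eq_square)
  finally show ?thesis using T by linarith
 qed
 have e1: "nrm A B (1 / of_int L, 0) <= 1 / B"
 proof -
  have "nrm A B (1 / of_int L, 0) = 1 / (of_int L * A)" using Lr by (simp add: nrm_def)
  also have "... <= 1 / B" using L pos by (intro divide_left_mono) auto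
  finally show ?thesis .
 qed
 have e2: "nrm A B (0, 1) <= 1 / B" by (simp add: nrm_def)
 have entry: "\<bar>PH ga U V [q, z, e] x0 y0\<bar> <= \<Lambda>" if "nrm A B z <= 1 / B" "nrm A B e <= 1 / B" for z e
 proof -
  have "\<bar>PH ga U V [q, z, e] x0 y0\<bar> <= kc ga 3 * X * (\<Prod>v\<leftarrow>[q,z,e]. nrm A B v)"
   using PH_bound(1)[OF pos(1,2,4) _ _ gam U X_def, of x0 y0 "[q,z,e]"] x0 pos by (simp add: kc_def numeral_3_eq_3)
  also have "... = kc ga 3 * (X * nrm A B q) * (nrm A B z * nrm A B e)" by simp
  also have "... <= kc ga 3 * (X * nrm A B q) * ((1/B) * (1/B))"
   using that kc_pos'[of 3] pos q nrm_nonneg[of A B] by (intro mult_left_mono mult_mono) auto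
  also have "... = \<Lambda>" by (simp add: \<Lambda>_def power2_eq_square)
  finally show ?thesis .
 qed
 have BL: "B / of_int L <= A" using L Lr by (simp add: field_simps)
 have overL: "t / of_int L <= 24 * w * A" if "t <= 24 * w * B" for t
 proof -
  have "t / of_int L <= 24 * w * B / of_int L" using that Lr by (intro divide_right_mono) auto
  also have "... = 24 * w * (B / of_int L)" by simp
  also have "... <= 24 * w * A" using BL w by (intro mult_left_mono) auto
  finally show ?thesis .
 qed
 \<comment> \<open>\<open>1536 = 4 * 48 * 8\<close>: the 8 of \<open>smooth_sum_bound\<close>, a
   ratio of at most 48 between the two side lengths, and 4 because \<open>\<mu>\<close> is half of
   \<open>Vm r s\<close>.\<close>
 define C0 where "C0 = 1536 * smooth_c^2"
 have "280 * 280 <= smooth_c * smooth_c" using sc by (intro mult_mono) auto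
 then have C0: "C0 >= 4" by (simp add: C0_def power2_eq_square)
 have f0: "f (n, m) = 0" if "\<not> (0 <= n \<and> n <= N1 \<and> 0 <= m \<and> m <= N2)" for n m
 proof -
  have "of_int n / real_of_int N1 <= 0 \<or> of_int n / real_of_int N1 >= 1 \<or> of_int m / real_of_int N2 <= 0 \<or> of_int m / real_of_int N2 >= 1"
   using that Npos by (auto simp: field_simps)
  then have "bump (of_int n / of_int N1) = 0 \<or> bump (of_int m / of_int N2) = 0" using bump_outside by blast
  then show ?thesis by (auto simp: f_def)
 qed
 have f0': "f p = 0" if "p \<notin> DD'" for p
  using f0[of "fst p" "snd p"] that by (cases p) (auto simp: DD'_def)
 have nf: "norm (f p) <= 1" for p
  by (cases p) (auto simp: f_def norm_mult abs_mult intro!: mult_le_one bump_bounds simp: bump_bounds)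
 have finD: "finite DD'" "card DD' = nat (N1 + 1) * nat (N2 + 1)" by (simp_all add: DD'_def)
 have big: "norm (autocorr DD' f (r, s)) <= 4 * (of_int N)\<^sup>2" for r s
 proof -
  have "norm (autocorr DD' f (r, s)) <= (\<Sum>p\<in>{p\<in>DD'. p + (r,s) \<in> DD'}. 1)"
   unfolding autocorr_def by (rule sum_norm_le) (auto simp: norm_mult intro!: mult_le_one nf)
  also have "... <= (\<Sum>p\<in>DD'. 1)" using finD by (intro sum_mono2) auto
  also have "... = of_int (N1 + 1) * of_int (N2 + 1)" using finD Npos by simp
  also have "... <= of_int (2 * N) * of_int (2 * N)" using Npos by (intro mult_mono of_int_le_iff[THEN iffD2]) (auto simp: N_def)
  finally show ?thesis by (simp add: power2_eq_square)
 qed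
 have main: "norm (autocorr DD' f (r, s)) * (Vm r s)\<^sup>2 <= C0" if rs: "\<bar>r\<bar> <= N1" "\<bar>s\<bar> <= N2" for r s
 proof (cases "Vm r s = 0")
  case True
  then show ?thesis using C0 by simp
 next
  case False
  define z where "z = (real_of_int r / of_int L, real_of_int s)"
  define \<mu> where "\<mu> = Vm r s / 2"
  have mu: "\<mu> > 0" using False unfolding \<mu>_def Vm_def by (simp add: max_def split: if_splits)
  define Z where "Z = \<bar>real_of_int r\<bar> + \<bar>real_of_int s\<bar>"
  have nz: "nrm A B z <= Z / B"
  proof -
   have "nrm A B z = \<bar>real_of_int r\<bar> * nrm A B (1 / of_int L, 0) + \<bar>real_of_int s\<bar> * nrm A B (0, 1)"
    using Lr by (simp add: nrm_def z_def)
   also have "... <= \<bar>real_of_int r\<bar> * (1/B) + \<bar>real_of_int s\<bar> * (1/B)" using e1 e2 by (intro add_mono mult_left_mono) auto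
   finally show ?thesis by (simp add: Z_def add_divide_distrib)
  qed
  have rsr: "\<bar>real_of_int r\<bar> <= of_int N1" "\<bar>real_of_int s\<bar> <= of_int N2" using rs by linarith+
  then have rsb: "\<bar>real_of_int r\<bar> <= 24 * w * B" "\<bar>real_of_int s\<bar> <= 24 * w * B" using N1 N2 by linarith+
  have fz: "\<bar>fst z\<bar> <= 24 * w * A" using overL[OF rsb(1)] Lr by (simp add: z_def)
  have sz: "\<bar>snd z\<bar> <= 24 * w * B" using rsb by (simp add: z_def)
  have small: "kc ga 3 * (X * nrm A B q * Z / B^2) <= 1/2"
  proof -
   have "kc ga 3 * (X * nrm A B q * Z / B^2) = \<Lambda> * Z" by (simp add: \<Lambda>_def)
   also have "... <= \<Lambda> * (48 * w * B)" using La rsb by (intro mult_left_mono) (auto simp: Z_def)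
   also have "... = kc ga 3 * (X * nrm A B q) * (48 * w) / B" using pos by (simp add: \<Lambda>_def power2_eq_square)
   finally show ?thesis using H1 by (rule order.trans)
  qed
  have mu3: "220 * kc ga 4 * w * (X * nrm A B q * Z / B^2) <= 2 * \<mu>"
   using H2[of r s] by (simp add: \<mu>_def Vm_def Z_def)
  define w1 where "w1 n = bump (of_int n / of_int N1) * bump (of_int (n + r) / of_int N1)" for n
  define w2 where "w2 m = bump (of_int m / of_int N2) * bump (of_int (m + s) / of_int N2)" for m
  \<comment> \<open>Differencing turns the linear twist into a constant; this makes the estimate
    uniform in \<open>\<theta>\<close> and \<open>\<theta>'\<close>.\<close>
  define cst where "cst = \<theta> * of_int r + \<theta>' * of_int s"
  define G where "G n m = ee (Diff [z, q] F (x0 + of_int n / of_int L) (y0 + of_int m) + cst)" for n m :: int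
  have w12: "\<bar>w1 n\<bar> <= 1" "\<bar>w2 n\<bar> <= 1" for n
   unfolding w1_def w2_def using bump_product_bounds(1)[of N1 n r] bump_product_bounds(1)[of N2 n s] Npos by auto
  have auto_eq: "autocorr DD' f (r, s) = (\<Sum>n\<in>{0..N1}. \<Sum>m\<in>{0..N2}. of_real (w1 n) * of_real (w2 m) * G n m)"
  proof -
   have "autocorr DD' f (r, s) = (\<Sum>p\<in>DD'. f (p + (r,s)) * cnj (f p))"
    unfolding autocorr_def
   proof (rule sum.mono_neutral_left)
    show "\<forall>p\<in>DD' - {p\<in>DD'. p + (r, s) \<in> DD'}. f (p + (r, s)) * cnj (f p) = 0"
     using f0' by simp
   qed (use finD in auto)
   also have "... = (\<Sum>p\<in>{0..N1} \<times> {0..N2}. case p of (n, m) => of_real (w1 n) * of_real (w2 m) * G n m)"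
    unfolding DD'_def
   proof (rule sum.cong, simp, clarify)
    fix n m
    have "x0 + of_int (n + r) / of_int L = x0 + of_int n / of_int L + fst z" "y0 + of_int (m + s) = y0 + of_int m + snd z"
     by (simp_all add: z_def add_divide_distrib)
    then have "Diff [q] F (x0 + of_int (n + r) / of_int L) (y0 + of_int (m + s)) = Diff [z, q] F (x0 + of_int n / of_int L) (y0 + of_int m)
       + Diff [q] F (x0 + of_int n / of_int L) (y0 + of_int m)" by (simp only: Diff.simps(2)[of z])
    then have "ee (\<theta> * of_int (n + r) + \<theta>' * of_int (m + s) + Diff [q] F (x0 + of_int (n + r) / of_int L) (y0 + of_int (m + s)))
      = G n m * ee (\<theta> * of_int n + \<theta>' * of_int m + Diff [q] F (x0 + of_int n / of_int L) (y0 + of_int m))"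
     unfolding G_def cst_def ee_add[symmetric] by (intro arg_cong[where f = ee]) (simp add: distrib_left del: Diff.simps)
    moreover have "ee t * cnj (ee t) = 1" for t by (simp flip: ee_diff)
    ultimately show "f ((n, m) + (r, s)) * cnj (f (n, m)) = of_real (w1 n) * of_real (w2 m) * G n m"
     unfolding f_def w1_def w2_def by (simp add: mult_ac)
   qed
   finally show ?thesis by (simp add: sum.cartesian_product)
  qed
  have final: "norm (autocorr DD' f (r, s)) * (Vm r s)\<^sup>2 <= C0" if "norm (autocorr DD' f (r, s)) <= of_int (Na + 1) * (8 * smooth_c^2 / (of_int Nb * \<mu>^2))"
   "w * B <= of_int Nb" "of_int Na <= 24 * w * B" "Na >= 1" for Na Nb :: int
  proof -
   have Nb: "real_of_int Nb > 0" using that w by linarith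
   have "of_int (Na + 1) <= 2 * real_of_int Na" using that by simp
   then have "of_int (Na + 1) <= 48 * real_of_int Nb" using that by linarith
   then have "norm (autocorr DD' f (r, s)) <= (48 * of_int Nb) * (8 * smooth_c^2 / (of_int Nb * \<mu>^2))"
    using Nb by (intro order.trans[OF that(1)] mult_right_mono) auto
   also have "... = 384 * smooth_c^2 / \<mu>^2" using Nb by simp
   finally have "norm (autocorr DD' f (r, s)) * \<mu>^2 <= 384 * smooth_c^2" using mu by (simp add: field_simps)
   moreover have "(Vm r s)\<^sup>2 = 4 * \<mu>^2" by (simp add: \<mu>_def power_divide)
   ultimately show ?thesis by (simp add: C0_def mult.commute)
  qed
  show ?thesis
  proof (cases "Vm r s = \<bar>a * r + b * s\<bar>")
   case True
   have "norm (\<Sum>n\<in>{0..N1}. of_real (w1 n) * G n m) <= 8 * smooth_c^2 / (of_int N1 * \<mu>^2)" if m: "m \<in> {0..N2}" for m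
   proof -
    define e where "e = (1 / real_of_int L, 0 :: real)"
    have "norm (\<Sum>n\<in>{0..N1}. of_real (bump (of_int n / of_int N1) * bump (of_int (n + r) / of_int N1)) *
      ee (Diff [z, q] F (x0 + of_int n * fst e) ((y0 + of_int m) + of_int n * snd e) + cst)) <= 8 * smooth_c^2 / (of_int N1 * \<mu>^2)"
    proof (rule smooth_direction_sum[OF x0 w(1,2) Npos(1) N1(2) _ nz _ _ mu _ mu3 small])
     show "nrm A B e <= 1 / B" using e1 by (simp add: e_def)
     show "2 * \<mu> <= \<bar>PH ga U V [q, z, e] x0 y0\<bar>"
      unfolding z_def PH_linear[of q "real_of_int r" "real_of_int L" "real_of_int s"] e_def \<mu>_def using True by (simp add: a_def b_def)
     fix n :: int assume n: "- 2 <= n" "n <= N1 + 2"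
     have "\<bar>real_of_int n\<bar> <= 24 * w * B + 2" using n N1 Npos by linarith
     then have "\<bar>real_of_int n\<bar> / of_int L <= (24 * w * B + 2) / of_int L" using Lr by (intro divide_right_mono) auto
     also have "... <= 24 * w * A + 2"
     proof -
      have "2 / real_of_int L <= 2 / 1" using Lr by (intro divide_left_mono) auto
      then show ?thesis using overL[of "24 * w * B"] by (simp add: add_divide_distrib)
     qed
     finally have "\<bar>real_of_int n\<bar> / of_int L <= 24 * w * A + 2" .
     moreover have "3 * \<bar>fst e\<bar> <= 3"
     proof -
      have "1 / real_of_int L <= 1 / 1" using Lr by (intro divide_left_mono) auto
      moreover have "\<bar>fst e\<bar> = 1 / real_of_int L" using Lr by (simp add: e_def)
      ultimately show ?thesis by linarith
     qed
     ultimately show "\<bar>x0 + of_int n * fst e - x0\<bar> + (3 * \<bar>fst e\<bar> + \<bar>fst z\<bar> + \<bar>fst q\<bar>) <= 54 * w * A"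
      using fz q(1) w(3) Lr by (simp add: e_def q_def abs_mult)
     have "\<bar>real_of_int m\<bar> <= 24 * w * B" using m N2 by simp
     then show "\<bar>y0 + of_int m + of_int n * snd e - y0\<bar> + (3 * \<bar>snd e\<bar> + \<bar>snd z\<bar> + \<bar>snd q\<bar>) <= 54 * w * B"
      using sz q(2) w by (simp add: e_def q_def)
    qed
    then show ?thesis by (simp add: w1_def G_def e_def)
   qed note inner = this
   have "norm (autocorr DD' f (r, s)) = norm (\<Sum>m\<in>{0..N2}. of_real (w2 m) * (\<Sum>n\<in>{0..N1}. of_real (w1 n) * G n m))"
    unfolding auto_eq by (subst sum.swap) (simp add: sum_distrib_left mult_ac)
   also have "... <= (\<Sum>m\<in>{0..N2}. 1 * (8 * smooth_c^2 / (of_int N1 * \<mu>^2)))"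
    by (rule sum_norm_le, unfold norm_mult norm_of_real, rule mult_mono) (use w12 inner in auto)
   also have "... = of_int (N2 + 1) * (8 * smooth_c^2 / (of_int N1 * \<mu>^2))" using Npos by simp
   finally show ?thesis using final[of N2 N1] N1 N2 Npos by simp
  next
   case False
   then have V2: "Vm r s = \<bar>c * r + d * s\<bar>" by (auto simp: Vm_def max_def split: if_splits)
   have "norm (\<Sum>m\<in>{0..N2}. of_real (w2 m) * G n m) <= 8 * smooth_c^2 / (of_int N2 * \<mu>^2)" if m: "n \<in> {0..N1}" for n
   proof -
    define e where "e = (0 :: real, 1 :: real)"
    have "norm (\<Sum>m\<in>{0..N2}. of_real (bump (of_int m / of_int N2) * bump (of_int (m + s) / of_int N2)) *
      ee (Diff [z, q] F ((x0 + of_int n / of_int L) + of_int m * fst e) (y0 + of_int m * snd e) + cst)) <= 8 * smooth_c^2 / (of_int N2 * \<mu>^2)"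
    proof (rule smooth_direction_sum[OF x0 w(1,2) Npos(2) N2(2) _ nz _ _ mu _ mu3 small])
     show "nrm A B e <= 1 / B" using e2 by (simp add: e_def)
     show "2 * \<mu> <= \<bar>PH ga U V [q, z, e] x0 y0\<bar>"
      unfolding z_def PH_linear[of q "real_of_int r" "real_of_int L" "real_of_int s"] e_def \<mu>_def using V2 by (simp add: c_def d_def)
     fix m :: int assume "- 2 <= m" "m <= N2 + 2"
     then have "\<bar>real_of_int m\<bar> <= 24 * w * B + 2" using N2 Npos by linarith
     then show "\<bar>y0 + of_int m * snd e - y0\<bar> + (3 * \<bar>snd e\<bar> + \<bar>snd z\<bar> + \<bar>snd q\<bar>) <= 54 * w * B"
      using sz q(2) w by (simp add: e_def q_def)
     have "real_of_int n / of_int L <= 24 * w * A" "real_of_int n >= 0" by (rule overL) (use m N1 in auto)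
     then show "\<bar>x0 + of_int n / of_int L + of_int m * fst e - x0\<bar> + (3 * \<bar>fst e\<bar> + \<bar>fst z\<bar> + \<bar>fst q\<bar>) <= 54 * w * A"
      using fz q(1) w Lr by (simp add: e_def q_def)
    qed
    then show ?thesis by (simp add: w2_def G_def e_def)
   qed note inner = this
   have "norm (autocorr DD' f (r, s)) = norm (\<Sum>n\<in>{0..N1}. of_real (w1 n) * (\<Sum>m\<in>{0..N2}. of_real (w2 m) * G n m))"
    unfolding auto_eq by (simp add: sum_distrib_left mult_ac)
   also have "... <= (\<Sum>n\<in>{0..N1}. 1 * (8 * smooth_c^2 / (of_int N2 * \<mu>^2)))"
    by (rule sum_norm_le, unfold norm_mult norm_of_real, rule mult_mono) (use w12 inner in auto)
   also have "... = of_int (N1 + 1) * (8 * smooth_c^2 / (of_int N2 * \<mu>^2))" using Npos by simp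
   finally show ?thesis using final[of N1 N2] N1 N2 Npos by simp
  qed
 qed
 have main': "norm (autocorr DD' f (r, s)) * (Vm r s)\<^sup>2 <= C0" for r s
 proof (cases "\<bar>r\<bar> <= N1 \<and> \<bar>s\<bar> <= N2")
  case False
  then have "{p\<in>DD'. p + (r, s) \<in> DD'} = {}" by (auto simp: DD'_def)
  then have "autocorr DD' f (r, s) = 0" by (simp only: autocorr_def sum.empty)
  then show ?thesis using C0 by simp
 qed (use main in auto)
 have "(\<Sum>r\<in>{-N..N}. \<Sum>s\<in>{-N..N}. norm (autocorr DD' f (r, s)) / C0) <= 50 / \<kappa>^2 * (1 + ln (real_of_int (2 * N + 1)))\<^sup>2 / \<bar>a * d - b * c\<bar>"
 proof (rule lattice_sum[OF Npos(3) La _ _ _ _ LN k[folded \<Lambda>_def] D])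
  show "\<bar>a\<bar> <= \<Lambda>" "\<bar>b\<bar> <= \<Lambda>" "\<bar>c\<bar> <= \<Lambda>" "\<bar>d\<bar> <= \<Lambda>"
   unfolding a_def b_def c_def d_def by (intro entry e1 e2)+
  fix r s
  show "0 <= norm (autocorr DD' f (r, s)) / C0" using C0 by simp
  have "norm (autocorr DD' f (r, s)) <= 4 * (of_int N)\<^sup>2" by (rule big)
  also have "... <= C0 * (of_int N)\<^sup>2" using C0 by (intro mult_right_mono) auto
  finally show "norm (autocorr DD' f (r, s)) / C0 <= (of_int N)\<^sup>2" using C0 by (simp add: field_simps)
  show "norm (autocorr DD' f (r, s)) / C0 * (max \<bar>a * of_int r + b * of_int s\<bar> \<bar>c * of_int r + d * of_int s\<bar>)\<^sup>2 <= 1"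
   using main'[of r s] C0 by (simp add: Vm_def field_simps)
 qed
 then have sumb: "(\<Sum>z\<in>{-N..N} \<times> {-N..N}. norm (autocorr DD' f z)) <= C0 * (50 / \<kappa>^2 * (1 + ln (real_of_int (2 * N + 1)))\<^sup>2 / \<bar>a * d - b * c\<bar>)"
  using C0 by (simp add: sum.cartesian_product' sum_divide_distrib[symmetric] field_simps)
 have "(norm (\<Sum>p\<in>DD'. f p))\<^sup>2 <= (\<Sum>z\<in>{-N..N} \<times> {-N..N}. norm (autocorr DD' f z))"
  by (rule norm_square_sum_le_autocorr) (auto simp: DD'_def N_def)
 also note sumb
 also have "C0 * (50 / \<kappa>^2 * (1 + ln (real_of_int (2 * N + 1)))\<^sup>2 / \<bar>a * d - b * c\<bar>)
   <= (280 * smooth_c / \<kappa> * (1 + ln (50 * B)) / sqrt \<bar>a * d - b * c\<bar>)\<^sup>2"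
 proof -
  have "0 <= 1 + ln (real_of_int (2 * N + 1))" "1 + ln (real_of_int (2 * N + 1)) <= 1 + ln (50 * B)"
  proof -
   have "w * B <= 1 * B" using w pos by (intro mult_right_mono) auto
   moreover have "real_of_int N <= 24 * (w * B)" using Nr by (simp add: mult.assoc)
   ultimately have "2 * real_of_int N + 1 <= 50 * B" using B1 by linarith
   then have "real_of_int (2 * N + 1) <= 50 * B" by simp
   then show "1 + ln (real_of_int (2 * N + 1)) <= 1 + ln (50 * B)" using Npos by simp
   show "0 <= 1 + ln (real_of_int (2 * N + 1))" using Npos by simp
  qed
  then have "(1 + ln (real_of_int (2 * N + 1)))\<^sup>2 <= (1 + ln (50 * B))\<^sup>2" by (intro power_mono) auto
  then have "C0 * (50 / \<kappa>^2 * (1 + ln (real_of_int (2 * N + 1)))\<^sup>2 / \<bar>a * d - b * c\<bar>)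
   <= C0 * (50 / \<kappa>^2 * (1 + ln (50 * B))\<^sup>2 / \<bar>a * d - b * c\<bar>)"
   using C0 by (intro mult_left_mono divide_right_mono) auto
  also have "... = 76800 * (smooth_c / \<kappa> * (1 + ln (50 * B)))\<^sup>2 / \<bar>a * d - b * c\<bar>"
   by (simp add: C0_def power_mult_distrib power_divide)
  also have "... <= 78400 * (smooth_c / \<kappa> * (1 + ln (50 * B)))\<^sup>2 / \<bar>a * d - b * c\<bar>"
   by (intro divide_right_mono mult_right_mono) auto
  also have "... = (280 * smooth_c / \<kappa> * (1 + ln (50 * B)) / sqrt \<bar>a * d - b * c\<bar>)\<^sup>2"
   by (simp add: power_mult_distrib power_divide)
  finally show ?thesis .
 qed
 finally have "(norm (\<Sum>p\<in>DD'. f p))\<^sup>2 <= (280 * smooth_c / \<kappa> * (1 + ln (50 * B)) / sqrt \<bar>a * d - b * c\<bar>)\<^sup>2" .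
 then have "norm (\<Sum>p\<in>DD'. f p) <= 280 * smooth_c / \<kappa> * (1 + ln (50 * B)) / sqrt \<bar>a * d - b * c\<bar>"
 proof (rule power2_le_imp_le)
  have "ln (50 * B) >= 0" using B1 by simp
  then show "0 <= 280 * smooth_c / \<kappa> * (1 + ln (50 * B)) / sqrt \<bar>a * d - b * c\<bar>"
   using sc k by simp
 qed
 moreover have "(\<Sum>p\<in>DD'. f p) = (\<Sum>n\<in>{0..N1}. \<Sum>m\<in>{0..N2}. of_real (bump (of_int n / of_int N1)) * of_real (bump (of_int m / of_int N2)) *
   ee (\<theta> * of_int n + \<theta>' * of_int m) * ee (Diff [q] F (x0 + of_int n / of_int L) (y0 + of_int m)))"
  unfolding DD'_def sum.cartesian_product by (rule sum.cong) (auto simp: f_def ee_add simp del: Diff.simps)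
 ultimately show ?thesis by simp
qed

end

section \<open>The Hessian determinant of the differenced phase\<close>

definition p0 :: "real => real" where "p0 ga = ga * (ga + 1) * 8 powr (- ga)"
definition Dq :: "real => real => real => real" where "Dq ga u v = 2 * ga * (u^2 + v^2) + 4 * (ga + 1) * (u * v)"
text \<open>The first summand ensures that the approximate Hessian expands every
  \<open>(r, s)\<close> by more than the phase varies over the box, the second that the errors of
  its entries change the determinant by at most half.\<close>

definition ND :: "real => real" where
 "ND ga = 8000 * (ga + 1) * (220 * kc ga 4 + kc ga 3) / p0 ga + 1920000 * (kc ga 3)\<^sup>2 / (p0 ga)\<^sup>2"
definition w1 :: "real => real" where "w1 ga = min (1/216) (p0 ga / (20000 * kc ga 3))"
definition kap :: "real => real" where "kap ga = p0 ga / (2000 * kc ga 3 + p0 ga)"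

lemma p0_pos: "ga > 0 ==> p0 ga > 0" by (simp add: p0_def)

lemma w1_pos: "ga > 0 ==> w1 ga > 0" using p0_pos kc_pos by (simp add: w1_def)

text \<open>Up to a positive factor \<open>Dq ga u v\<close> is the determinant of the Hessian of the phase differenced
 along \<open>(u x, v y)\<close>; it degenerates along two lines through the origin.\<close>

lemma Dq_det: "Dq ga u v = ((ga+2)* u + ga* v) * (ga* u + (ga+2)* v) - (ga*(u+v)) * (ga*(u+v))"
 by (simp add: Dq_def power2_eq_square algebra_simps)

context phase
begin

text \<open>Up to an error \<open>\<tau>\<close> per entry, coming from the correction term of the
  phase, the Hessian is an explicit matrix built from \<open>M11\<close>, \<open>M12\<close>,
  \<open>M22\<close>. Cramer's rule converts the lower bound for its determinant into the first
  claim. The bounds \<open>1 / (10 * B)\<close> for \<open>\<zeta>1\<close> and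
  \<open>\<zeta>2\<close> express that one lattice step is about equally long in both
  variables.\<close>

lemma nondegenerate:
 fixes L :: int and q1 q2 x0 y0 w u v m :: real
 defines "q \<equiv> (q1, q2)"
 defines "a \<equiv> PH ga U V [q, (1 / of_int L, 0), (1 / of_int L, 0)] x0 y0" and "b \<equiv> PH ga U V [q, (0, 1), (1 / of_int L, 0)] x0 y0"
  and "c \<equiv> PH ga U V [q, (1 / of_int L, 0), (0, 1)] x0 y0" and "d \<equiv> PH ga U V [q, (0, 1), (0, 1)] x0 y0"
 defines "u \<equiv> q1 / x0" and "v \<equiv> q2 / y0"
 defines "m \<equiv> max \<bar>u\<bar> \<bar>v\<bar>"
 assumes x0: "A / 2 <= x0" "x0 <= 2 * A" "B / 2 <= y0" "y0 <= 4 * B" and L: "L >= 1" "B <= of_int L * A" "of_int L * A <= 5 * B"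
  and w: "1 / (A * B) <= w" "w <= w1 ga" and m: "m > 0" and Dm: "ND ga * w * m^2 <= \<bar>Dq ga u v\<bar>"
 shows "220 * kc ga 4 * w * (X * nrm A B q * (\<bar>r\<bar> + \<bar>s\<bar>) / B^2) <= max \<bar>a * r + b * s\<bar> \<bar>c * r + d * s\<bar>"
  and "kap ga * (kc ga 3 * (X * nrm A B q) / B^2) <= \<bar>a\<bar> \<or> kap ga * (kc ga 3 * (X * nrm A B q) / B^2) <= \<bar>b\<bar>
    \<or> kap ga * (kc ga 3 * (X * nrm A B q) / B^2) <= \<bar>c\<bar> \<or> kap ga * (kc ga 3 * (X * nrm A B q) / B^2) <= \<bar>d\<bar>"
  and "(p0 ga)\<^sup>2 * X^2 * \<bar>Dq ga u v\<bar> / (3200 * B^4) <= \<bar>a * d - b * c\<bar>"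
proof -
 define nq where "nq = nrm A B q"
 define \<zeta>1 where "\<zeta>1 = 1 / (of_int L * x0)"
 define \<zeta>2 where "\<zeta>2 = 1 / y0"
 define P where "P = U * (ga * (ga + 1) * (x0 powr (- ga) * y0 powr (- ga)))"
 define M11 where "M11 = (ga+2)* u + ga* v"
 define M12 where "M12 = ga*(u+v)"
 define M22 where "M22 = ga* u + (ga+2)* v"
 define \<tau> where "\<tau> = kc ga 3 * X * nq / (B^2 * (A * B))"
 define \<Lambda> where "\<Lambda> = kc ga 3 * (X * nq) / B^2"
 have Lr: "real_of_int L >= 1" using L by simp
 have xy: "x0 > 0" "y0 > 0" using x0 pos by linarith+
 have nq0: "nq >= 0" unfolding nq_def using pos nrm_nonneg by simp
 have k3: "kc ga 3 > 0" "kc ga 4 > 0" using kc_pos' by auto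
 have pp: "p0 ga > 0" using p0_pos gam by simp
 have z1: "1 / (10 * B) <= \<zeta>1"
 proof -
  have "of_int L * x0 <= of_int L * (2 * A)" using x0 Lr by (intro mult_left_mono) auto
  also have "... <= 10 * B" using L by (simp add: mult_ac)
  finally show ?thesis unfolding \<zeta>1_def using Lr xy by (intro divide_left_mono mult_pos_pos) (use pos in auto)
 qed
 have z2: "1 / (10 * B) <= \<zeta>2" unfolding \<zeta>2_def using x0 xy pos by (intro divide_left_mono) auto
 have zp: "\<zeta>1 > 0" "\<zeta>2 > 0" using xy Lr by (simp_all add: \<zeta>1_def \<zeta>2_def)
 have Pge: "P >= p0 ga * X"
 proof -
  have "x0 * y0 <= (2 * A) * (4 * B)" using x0 xy by (intro mult_mono) auto
  then have "(8 * (A * B)) powr (- ga) <= (x0 * y0) powr (- ga)" using xy gam by (intro powr_mono2') auto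
  then have "8 powr (- ga) * (A * B) powr (- ga) <= x0 powr (- ga) * y0 powr (- ga)"
   using pos xy by (simp add: powr_mult)
  then have "U * (ga * (ga + 1) * (8 powr (- ga) * (A * B) powr (- ga))) <= P"
   unfolding P_def using U gam by (intro mult_left_mono) auto
  then show ?thesis by (simp add: p0_def X_def mult_ac)
 qed
 have P0: "P > 0" using Pge pp pos by (smt (verit) mult_pos_pos)
 have e1: "nrm A B (1 / of_int L, 0) <= 1 / B"
 proof -
  have "nrm A B (1 / of_int L, 0) = 1 / (of_int L * A)" using Lr by (simp add: nrm_def)
  also have "... <= 1 / B" using L pos by (intro divide_left_mono) auto
  finally show ?thesis .
 qed
 have e2: "nrm A B (0, 1) <= 1 / B" by (simp add: nrm_def)
 have n3: "nq * (nrm A B z * nrm A B e) <= nq / B^2" if "nrm A B z <= 1 / B" "nrm A B e <= 1 / B" for z e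
 proof -
  have "nq * (nrm A B z * nrm A B e) <= nq * ((1/B) * (1/B))"
   using that pos nq0 nrm_nonneg[of A B] by (intro mult_left_mono mult_mono) auto
  then show ?thesis by (simp add: power2_eq_square)
 qed
 have err: "\<bar>PH ga U V [q, z, e] x0 y0 - U * DD [q, z, e] ga ga x0 y0\<bar> <= \<tau>" if "nrm A B z <= 1 / B" "nrm A B e <= 1 / B" for z e
 proof -
  have pc: "phase_const ga 3 > 0" using phase_const_pos gam by simp
  have "\<bar>PH ga U V [q, z, e] x0 y0 - U * DD [q, z, e] ga ga x0 y0\<bar> <= ga * phase_const ga 3 * X * (\<Prod>v\<leftarrow>[q,z,e]. nrm A B v) / (A * B)"
   using PH_bound(2)[OF pos(1,2,4) _ _ gam U X_def, of x0 y0 "[q,z,e]"] x0 pos by (simp add: numeral_3_eq_3)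
  also have "... = ga * phase_const ga 3 * X * (nq * (nrm A B z * nrm A B e)) / (A * B)" by (simp add: nq_def)
  also have "... <= kc ga 3 * X * (nq / B^2) / (A * B)"
  proof (intro divide_right_mono mult_mono n3 that)
   show "ga * phase_const ga 3 <= kc ga 3" using pc by (simp add: kc_def)
   show "0 <= nq * (nrm A B z * nrm A B e)" using nq0 nrm_nonneg[of A B] pos by (intro mult_nonneg_nonneg) auto
  qed (use pos k3 in auto)
  also have "... = \<tau>" by (simp add: \<tau>_def)
  finally show ?thesis .
 qed
 have entry: "\<bar>PH ga U V [q, z, e] x0 y0\<bar> <= \<Lambda>" if "nrm A B z <= 1 / B" "nrm A B e <= 1 / B" for z e
 proof -
  have "\<bar>PH ga U V [q, z, e] x0 y0\<bar> <= kc ga 3 * X * (\<Prod>v\<leftarrow>[q,z,e]. nrm A B v)"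
   using PH_bound(1)[OF pos(1,2,4) _ _ gam U X_def, of x0 y0 "[q,z,e]"] x0 pos by (simp add: kc_def numeral_3_eq_3)
  also have "... = kc ga 3 * X * (nq * (nrm A B z * nrm A B e))" by (simp add: nq_def)
  also have "... <= kc ga 3 * X * (nq / B^2)" using k3 pos that by (intro mult_left_mono n3) auto
  also have "... = \<Lambda>" by (simp add: \<Lambda>_def)
  finally show ?thesis .
 qed
 define a0 where "a0 = - (P * \<zeta>1 * (\<zeta>1 * M11))"
 define b0 where "b0 = - (P * \<zeta>1 * (\<zeta>2 * M12))"
 define c0 where "c0 = - (P * \<zeta>2 * (\<zeta>1 * M12))"
 define d0 where "d0 = - (P * \<zeta>2 * (\<zeta>2 * M22))"
 have zz: "(1 / real_of_int L) / x0 = \<zeta>1" "1 / y0 = \<zeta>2" by (simp_all add: \<zeta>1_def \<zeta>2_def)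
 have exact: "U * DD [q, (1 / of_int L, 0), (1 / of_int L, 0)] ga ga x0 y0 = a0" "U * DD [q, (0, 1), (1 / of_int L, 0)] ga ga x0 y0 = b0"
  "U * DD [q, (1 / of_int L, 0), (0, 1)] ga ga x0 y0 = c0" "U * DD [q, (0, 1), (0, 1)] ga ga x0 y0 = d0"
  unfolding q_def DD_third[OF xy refl] u_def[symmetric] v_def[symmetric] zz times_divide_eq_right[symmetric]
  by (simp_all add: a0_def b0_def c0_def d0_def P_def M11_def M12_def M22_def algebra_simps)
 have errs: "\<bar>a - a0\<bar> <= \<tau>" "\<bar>b - b0\<bar> <= \<tau>" "\<bar>c - c0\<bar> <= \<tau>" "\<bar>d - d0\<bar> <= \<tau>"
  unfolding a_def b_def c_def d_def exact[symmetric] by (intro err e1 e2)+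
 have ents: "\<bar>a\<bar> <= \<Lambda>" "\<bar>b\<bar> <= \<Lambda>" "\<bar>c\<bar> <= \<Lambda>" "\<bar>d\<bar> <= \<Lambda>"
  unfolding a_def b_def c_def d_def by (intro entry e1 e2)+
 have nqm: "nq <= 6 * m"
 proof -
  have "\<bar>q1\<bar> / A <= 2 * \<bar>u\<bar>"
  proof -
   have "\<bar>q1\<bar> / (2 * A) <= \<bar>q1\<bar> / x0" using x0 xy by (intro divide_left_mono) auto
   then show ?thesis using xy by (simp add: u_def)
  qed
  moreover have "\<bar>q2\<bar> / B <= 4 * \<bar>v\<bar>"
  proof -
   have "\<bar>q2\<bar> / (4 * B) <= \<bar>q2\<bar> / y0" using x0 xy by (intro divide_left_mono) auto
   then show ?thesis using xy by (simp add: v_def)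
  qed
  moreover have "\<bar>u\<bar> <= m" "\<bar>v\<bar> <= m" by (simp_all add: m_def)
  ultimately show ?thesis by (simp add: nq_def nrm_def q_def)
 qed
 have wp: "w > 0"
 proof -
  have "1 / (A * B) > 0" using pos by simp
  then show ?thesis using w by linarith
 qed
 have tauL: "\<tau> <= \<Lambda> * w"
 proof -
  have "\<tau> = \<Lambda> * (1 / (A * B))" by (simp add: \<tau>_def \<Lambda>_def)
  also have "... <= \<Lambda> * w" using w k3 pos nq0 by (intro mult_left_mono) (auto simp: \<Lambda>_def)
  finally show ?thesis .
 qed
 have Mb: "\<bar>M11\<bar> <= 2 * (ga+1) * m" "\<bar>M12\<bar> <= 2 * (ga+1) * m" "\<bar>M22\<bar> <= 2 * (ga+1) * m"
 proof -
  have uv: "\<bar>u\<bar> <= m" "\<bar>v\<bar> <= m" by (simp_all add: m_def)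
  have t: "\<bar>s * u + t * v\<bar> <= (s + t) * m" if "s >= 0" "t >= 0" for s t
  proof -
   have "\<bar>s * u + t * v\<bar> <= s * \<bar>u\<bar> + t * \<bar>v\<bar>" using abs_triangle_ineq[of "s* u" "t* v"] that by (simp add: abs_mult)
   also have "... <= s * m + t * m" using uv that by (intro add_mono mult_left_mono) auto
   finally show ?thesis by (simp add: distrib_right)
  qed
  show "\<bar>M11\<bar> <= 2 * (ga+1) * m" using t[of "ga+2" ga] gam by (simp add: M11_def algebra_simps)
  show "\<bar>M22\<bar> <= 2 * (ga+1) * m" using t[of ga "ga+2"] gam by (simp add: M22_def algebra_simps)
  have "\<bar>M12\<bar> <= (ga + ga) * m" using t[of ga ga] gam by (simp add: M12_def algebra_simps)
  also have "... <= 2 * (ga+1) * m" using m by (intro mult_right_mono) auto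
  finally show "\<bar>M12\<bar> <= 2 * (ga+1) * m" .
 qed
 have DM: "Dq ga u v = M11 * M22 - M12 * M12" by (simp add: Dq_det M11_def M12_def M22_def)
 define D where "D = \<bar>Dq ga u v\<bar>"
 have D1: "8000 * (ga + 1) * (220 * kc ga 4 + kc ga 3) / p0 ga * (w * m^2) <= D"
 proof -
  have "8000 * (ga + 1) * (220 * kc ga 4 + kc ga 3) / p0 ga * (w * m^2) <= ND ga * (w * m^2)"
   using wp by (intro mult_right_mono) (auto simp: ND_def)
  then show ?thesis using Dm by (simp add: D_def mult.assoc)
 qed
 have D2: "1920000 * (kc ga 3)\<^sup>2 / (p0 ga)\<^sup>2 * (w * m^2) <= D"
 proof -
  have "1920000 * (kc ga 3)\<^sup>2 / (p0 ga)\<^sup>2 * (w * m^2) <= ND ga * (w * m^2)"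
   using wp gam k3 pp by (intro mult_right_mono) (auto simp: ND_def)
  then show ?thesis using Dm by (simp add: D_def mult.assoc)
 qed
 show "220 * kc ga 4 * w * (X * nrm A B q * (\<bar>r\<bar> + \<bar>s\<bar>) / B^2) <= max \<bar>a * r + b * s\<bar> \<bar>c * r + d * s\<bar>"
 proof -
  define R where "R = \<bar>r\<bar> + \<bar>s\<bar>"
  define E where "E = max \<bar>M11 * (\<zeta>1 * r) + M12 * (\<zeta>2 * s)\<bar> \<bar>M12 * (\<zeta>1 * r) + M22 * (\<zeta>2 * s)\<bar>"
  have R0: "R >= 0" by (simp add: R_def)
  have E0: "E >= 0" by (simp add: E_def)
  have "D * \<bar>\<zeta>1 * r\<bar> = \<bar>M22 * (M11 * (\<zeta>1 * r) + M12 * (\<zeta>2 * s)) - M12 * (M12 * (\<zeta>1 * r) + M22 * (\<zeta>2 * s))\<bar>"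
   unfolding D_def DM abs_mult[symmetric] by (simp add: algebra_simps)
  also have "... <= \<bar>M22\<bar> * E + \<bar>M12\<bar> * E"
   by (rule order.trans[OF abs_triangle_ineq4]) (auto simp: abs_mult E_def intro!: add_mono mult_left_mono)
  also have "... <= 2 * (ga+1) * m * E + 2 * (ga+1) * m * E" using Mb E0 by (intro add_mono mult_right_mono) auto
  finally have 1: "D * \<bar>\<zeta>1 * r\<bar> <= 4 * (ga+1) * m * E" by (simp add: algebra_simps)
  have "D * \<bar>\<zeta>2 * s\<bar> = \<bar>M11 * (M12 * (\<zeta>1 * r) + M22 * (\<zeta>2 * s)) - M12 * (M11 * (\<zeta>1 * r) + M12 * (\<zeta>2 * s))\<bar>"
   unfolding D_def DM abs_mult[symmetric] by (simp add: algebra_simps)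
  also have "... <= \<bar>M11\<bar> * E + \<bar>M12\<bar> * E"
   by (rule order.trans[OF abs_triangle_ineq4]) (auto simp: abs_mult E_def intro!: add_mono mult_left_mono)
  also have "... <= 2 * (ga+1) * m * E + 2 * (ga+1) * m * E" using Mb E0 by (intro add_mono mult_right_mono) auto
  finally have 2: "D * \<bar>\<zeta>2 * s\<bar> <= 4 * (ga+1) * m * E" by (simp add: algebra_simps)
  have "(1 / (10 * B)) * \<bar>r\<bar> + (1 / (10 * B)) * \<bar>s\<bar> <= \<zeta>1 * \<bar>r\<bar> + \<zeta>2 * \<bar>s\<bar>"
   using z1 z2 by (intro add_mono mult_right_mono) auto
  then have "R / (10 * B) <= \<bar>\<zeta>1 * r\<bar> + \<bar>\<zeta>2 * s\<bar>" using zp by (simp add: R_def abs_mult add_divide_distrib)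
  then have "D * (R / (10 * B)) <= D * (\<bar>\<zeta>1 * r\<bar> + \<bar>\<zeta>2 * s\<bar>)" by (intro mult_left_mono) (auto simp: D_def)
  also have "... <= 8 * (ga+1) * m * E" using 1 2 by (simp add: algebra_simps)
  finally have Elow: "D * (R / (10 * B)) <= 8 * (ga+1) * m * E" .
  have "P * (1 / (10 * B)) * E <= max \<bar>a0 * r + b0 * s\<bar> \<bar>c0 * r + d0 * s\<bar>"
  proof -
   have i: "\<bar>a0 * r + b0 * s\<bar> = P * \<zeta>1 * \<bar>M11 * (\<zeta>1 * r) + M12 * (\<zeta>2 * s)\<bar>"
   proof -
    have "a0 * r + b0 * s = - (P * \<zeta>1 * (M11 * (\<zeta>1 * r) + M12 * (\<zeta>2 * s)))" by (simp add: a0_def b0_def algebra_simps)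
    then show ?thesis using P0 zp by (simp add: abs_mult)
   qed
   have ii: "\<bar>c0 * r + d0 * s\<bar> = P * \<zeta>2 * \<bar>M12 * (\<zeta>1 * r) + M22 * (\<zeta>2 * s)\<bar>"
   proof -
    have "c0 * r + d0 * s = - (P * \<zeta>2 * (M12 * (\<zeta>1 * r) + M22 * (\<zeta>2 * s)))" by (simp add: c0_def d0_def algebra_simps)
    then show ?thesis using P0 zp by (simp add: abs_mult)
   qed
   have t12: "P * (1 / (10 * B)) * t <= P * \<zeta>1 * t" "P * (1 / (10 * B)) * t <= P * \<zeta>2 * t" if "t >= 0" for t
    using z1 z2 P0 that by (intro mult_right_mono mult_left_mono; simp)+
   have "E = \<bar>M11 * (\<zeta>1 * r) + M12 * (\<zeta>2 * s)\<bar> \<or> E = \<bar>M12 * (\<zeta>1 * r) + M22 * (\<zeta>2 * s)\<bar>"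
    unfolding E_def max_def by (simp split: if_split)
   then show ?thesis
   proof
    assume eq: "E = \<bar>M11 * (\<zeta>1 * r) + M12 * (\<zeta>2 * s)\<bar>"
    have "P * (1 / (10 * B)) * E <= P * \<zeta>1 * \<bar>M11 * (\<zeta>1 * r) + M12 * (\<zeta>2 * s)\<bar>" using t12(1)[OF E0] unfolding eq .
    then show ?thesis unfolding i ii by (rule max.coboundedI1)
   next
    assume eq: "E = \<bar>M12 * (\<zeta>1 * r) + M22 * (\<zeta>2 * s)\<bar>"
    have "P * (1 / (10 * B)) * E <= P * \<zeta>2 * \<bar>M12 * (\<zeta>1 * r) + M22 * (\<zeta>2 * s)\<bar>" using t12(2)[OF E0] unfolding eq .
    then show ?thesis unfolding i ii by (rule max.coboundedI2)
   qed
  qed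
  moreover have "\<bar>a0 * r + b0 * s\<bar> <= \<bar>a * r + b * s\<bar> + \<tau> * R" "\<bar>c0 * r + d0 * s\<bar> <= \<bar>c * r + d * s\<bar> + \<tau> * R"
  proof -
   have t: "\<bar>f0 * r + g0 * s\<bar> <= \<bar>f * r + g * s\<bar> + \<tau> * R" if "\<bar>f - f0\<bar> <= \<tau>" "\<bar>g - g0\<bar> <= \<tau>" for f g f0 g0
   proof -
    have "f0 * r + g0 * s = (f * r + g * s) - ((f - f0) * r + (g - g0) * s)" by (simp add: algebra_simps)
    then have "\<bar>f0 * r + g0 * s\<bar> <= \<bar>f * r + g * s\<bar> + (\<bar>(f - f0) * r\<bar> + \<bar>(g - g0) * s\<bar>)" by linarith
    moreover have "\<bar>f - f0\<bar> * \<bar>r\<bar> <= \<tau> * \<bar>r\<bar>" "\<bar>g - g0\<bar> * \<bar>s\<bar> <= \<tau> * \<bar>s\<bar>" using that by (intro mult_right_mono; simp)+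
    ultimately show ?thesis by (simp add: R_def abs_mult distrib_left)
   qed
   show "\<bar>a0 * r + b0 * s\<bar> <= \<bar>a * r + b * s\<bar> + \<tau> * R" "\<bar>c0 * r + d0 * s\<bar> <= \<bar>c * r + d * s\<bar> + \<tau> * R"
    using t errs by blast+
  qed
  ultimately have low: "P * (1 / (10 * B)) * E - \<tau> * R <= max \<bar>a * r + b * s\<bar> \<bar>c * r + d * s\<bar>"
   by (auto simp: max_def split: if_splits)
  define K where "K = 220 * kc ga 4 + kc ga 3"
  have K0: "K > 0" using k3 by (simp add: K_def)
  have "K * w * (X * nq * R / B^2) <= P * (1 / (10 * B)) * E"
  proof -
   have gm: "8 * (ga+1) * m > 0" using gam m by simp
   have "K * w * (X * nq * R / B^2) <= K * w * (X * (6 * m) * R / B^2)"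
    using K0 wp pos nqm R0 by (intro mult_left_mono divide_right_mono mult_right_mono) auto
   also have "... <= K * w * (X * (10 * m) * R / B^2)"
    using K0 wp pos m R0 by (intro mult_left_mono divide_right_mono mult_right_mono) auto
   also have "... = (p0 ga * X) * (1 / (10 * B)) * ((8000 * (ga + 1) * K / p0 ga * (w * m^2)) * (R / (10 * B)) / (8 * (ga+1) * m))"
   proof -
    have *: "K * w * (X * (10 * m) * R / B^2) = (p0 ga * X) * (1 / (10 * B)) * ((8000 * g * K / p0 ga * (w * m^2)) * (R / (10 * B)) / (8 * g * m))" if "g > 0" for g
     using pp pos m that by (simp add: power2_eq_square field_simps)
    show ?thesis by (rule *) (use gam in simp)
   qed
   also have "... <= (p0 ga * X) * (1 / (10 * B)) * (D * (R / (10 * B)) / (8 * (ga+1) * m))"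
    using D1 pp pos R0 gm unfolding K_def by (intro mult_left_mono divide_right_mono mult_right_mono) auto
   also have "... <= (p0 ga * X) * (1 / (10 * B)) * E"
   proof (rule mult_left_mono)
    show "D * (R / (10 * B)) / (8 * (ga+1) * m) <= E"
     using Elow gm by (subst pos_divide_le_eq) (simp_all only: mult.commute)
   qed (use pp pos in auto)
   also have "... <= P * (1 / (10 * B)) * E" using Pge E0 pos by (intro mult_right_mono) auto
   finally show ?thesis .
  qed
  moreover have "\<tau> * R <= kc ga 3 * w * (X * nq * R / B^2)"
  proof -
   have "\<tau> * R <= \<Lambda> * w * R" using tauL R0 by (intro mult_right_mono)
   then show ?thesis by (simp add: \<Lambda>_def mult_ac)
  qed
  ultimately have "220 * kc ga 4 * w * (X * nq * R / B^2) <= P * (1 / (10 * B)) * E - \<tau> * R"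
   by (simp add: K_def algebra_simps)
  then show ?thesis using low by (simp add: nq_def R_def)
 qed
 have wk: "w * (20000 * kc ga 3) <= p0 ga"
 proof -
  have "w <= p0 ga / (20000 * kc ga 3)" using w by (simp add: w1_def)
  then show ?thesis using k3 by (simp add: field_simps)
 qed
 have zl: "1 / (100 * B^2) <= \<zeta>1 * \<zeta>1" "1 / (100 * B^2) <= \<zeta>1 * \<zeta>2" "1 / (100 * B^2) <= \<zeta>2 * \<zeta>2"
 proof -
  have t: "1 / (100 * B^2) = (1 / (10 * B)) * (1 / (10 * B))" by (simp add: power2_eq_square)
  show "1 / (100 * B^2) <= \<zeta>1 * \<zeta>1" "1 / (100 * B^2) <= \<zeta>1 * \<zeta>2" "1 / (100 * B^2) <= \<zeta>2 * \<zeta>2"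
   unfolding t using z1 z2 pos zp by (intro mult_mono; simp)+
 qed
 show "kap ga * (kc ga 3 * (X * nrm A B q) / B^2) <= \<bar>a\<bar> \<or> kap ga * (kc ga 3 * (X * nrm A B q) / B^2) <= \<bar>b\<bar>
    \<or> kap ga * (kc ga 3 * (X * nrm A B q) / B^2) <= \<bar>c\<bar> \<or> kap ga * (kc ga 3 * (X * nrm A B q) / B^2) <= \<bar>d\<bar>"
 proof -
  have target: "kap ga * \<Lambda> + \<tau> <= (p0 ga * X) * (1 / (100 * B^2)) * m"
  proof -
   have "kap ga <= p0 ga / (2000 * kc ga 3)" unfolding kap_def using pp k3 by (intro divide_left_mono mult_pos_pos) auto
   then have "kap ga * kc ga 3 <= p0 ga / 2000" using k3 by (simp add: field_simps)
   then have "kap ga * kc ga 3 * (X * nq / B^2) <= p0 ga / 2000 * (X * nq / B^2)"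
    using pos nq0 by (intro mult_right_mono) auto
   moreover have "\<tau> <= p0 ga / 20000 * (X * nq / B^2)"
   proof -
    have "\<tau> <= (w * kc ga 3) * (X * nq / B^2)" using tauL by (simp add: \<Lambda>_def mult_ac)
    also have "... <= (p0 ga / 20000) * (X * nq / B^2)" using wk pos nq0 by (intro mult_right_mono) auto
    finally show ?thesis .
   qed
   moreover have "kap ga * \<Lambda> = kap ga * kc ga 3 * (X * nq / B^2)" by (simp add: \<Lambda>_def)
   moreover have "(p0 ga / 2000 + p0 ga / 20000) * (X * nq / B^2) <= (p0 ga / 1000) * (X * nq / B^2)"
    using pp pos nq0 by (intro mult_right_mono) auto
   ultimately have "kap ga * \<Lambda> + \<tau> <= (p0 ga / 1000) * (X * nq / B^2)"
    unfolding distrib_right by linarith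
   also have "... <= (p0 ga / 1000) * (X * (10 * m) / B^2)"
    using pp pos nqm m by (intro mult_left_mono divide_right_mono) auto
   finally show ?thesis by (simp add: mult_ac)
  qed
  have big: "kap ga * \<Lambda> <= \<bar>f\<bar>" if "\<bar>f - f0\<bar> <= \<tau>" "\<bar>f0\<bar> = P * z * \<bar>M\<bar>" "1 / (100 * B^2) <= z" "m <= \<bar>M\<bar>" for f f0 z M
  proof -
   have "0 <= 1 / (100 * B^2)" by simp
   then have "z >= 0" using that(3) by linarith
   then have "(p0 ga * X) * (1 / (100 * B^2)) * m <= P * z * \<bar>M\<bar>"
    using Pge that m pp pos P0 by (intro mult_mono) auto
   then show ?thesis using target that by linarith
  qed
  have abs0: "\<bar>a0\<bar> = P * (\<zeta>1 * \<zeta>1) * \<bar>M11\<bar>" "\<bar>b0\<bar> = P * (\<zeta>1 * \<zeta>2) * \<bar>M12\<bar>" "\<bar>d0\<bar> = P * (\<zeta>2 * \<zeta>2) * \<bar>M22\<bar>"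
   unfolding a0_def b0_def d0_def using P0 zp by (simp_all add: abs_mult)
  \<comment> \<open>The diagonal entries differ from \<open>M12\<close> by \<open>2 * u\<close> and
    \<open>2 * v\<close>, one of which has absolute value \<open>2 * m\<close>; so not all three
    entries can be below \<open>m\<close>.\<close>
  have "m <= \<bar>M12\<bar> \<or> m <= \<bar>M11\<bar> \<or> m <= \<bar>M22\<bar>"
  proof -
   have "M11 = M12 + 2 * u" "M22 = M12 + 2 * v" by (simp_all add: M11_def M12_def M22_def algebra_simps)
   moreover have "\<bar>u\<bar> = m \<or> \<bar>v\<bar> = m" by (auto simp: m_def max_def)
   ultimately show ?thesis by linarith
  qed
  then show ?thesis using big[OF errs(1) abs0(1) zl(1)] big[OF errs(2) abs0(2) zl(2)] big[OF errs(4) abs0(3) zl(3)]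
   by (auto simp: \<Lambda>_def nq_def)
 qed
 show "(p0 ga)\<^sup>2 * X^2 * \<bar>Dq ga u v\<bar> / (3200 * B^4) <= \<bar>a * d - b * c\<bar>"
 proof -
  have "a0 * d0 - b0 * c0 = (P * (\<zeta>1 * \<zeta>2))\<^sup>2 * Dq ga u v" by (simp add: a0_def b0_def c0_def d0_def DM power2_eq_square algebra_simps)
  then have "\<bar>a0 * d0 - b0 * c0\<bar> = (P * (\<zeta>1 * \<zeta>2))\<^sup>2 * D" by (simp add: abs_mult D_def)
  moreover have "... >= (p0 ga * X * (1 / (40 * B^2)))\<^sup>2 * D"
  proof (intro mult_right_mono power_mono mult_mono)
   have "1 / (4 * B) <= \<zeta>2" unfolding \<zeta>2_def using x0 xy pos by (intro divide_left_mono) auto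
   then have "(1 / (10 * B)) * (1 / (4 * B)) <= \<zeta>1 * \<zeta>2" using z1 pos zp by (intro mult_mono) auto
   then show "1 / (40 * B^2) <= \<zeta>1 * \<zeta>2" by (simp add: power2_eq_square)
  qed (use Pge pp pos P0 in \<open>auto simp: D_def\<close>)
  moreover have "(p0 ga * X * (1 / (40 * B^2)))\<^sup>2 * D = (p0 ga)\<^sup>2 * X^2 * D / (1600 * B^4)"
   by (simp add: power_mult_distrib power_divide)
  ultimately have 1: "\<bar>a0 * d0 - b0 * c0\<bar> >= (p0 ga)\<^sup>2 * X^2 * D / (1600 * B^4)" by simp
  have La0: "\<Lambda> >= 0" using k3 pos nq0 by (simp add: \<Lambda>_def)
  have tau0: "\<tau> >= 0" using errs(1) by linarith
  have tauL': "\<tau> <= \<Lambda>"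
  proof -
   have "w <= 1" using w by (simp add: w1_def)
   then have "\<Lambda> * w <= \<Lambda> * 1" using La0 by (intro mult_left_mono) auto
   then show ?thesis using tauL by simp
  qed
  have prod: "\<bar>f * g - f0 * g0\<bar> <= 3 * (\<Lambda> * \<tau>)" if "\<bar>f - f0\<bar> <= \<tau>" "\<bar>g - g0\<bar> <= \<tau>" "\<bar>f\<bar> <= \<Lambda>" "\<bar>g\<bar> <= \<Lambda>" for f g f0 g0
  proof -
   have "f * g - f0 * g0 = f * (g - g0) + (f - f0) * g - (f - f0) * (g - g0)" by (simp add: algebra_simps)
   then have "\<bar>f * g - f0 * g0\<bar> <= \<bar>f\<bar> * \<bar>g - g0\<bar> + \<bar>f - f0\<bar> * \<bar>g\<bar> + \<bar>f - f0\<bar> * \<bar>g - g0\<bar>"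
    unfolding abs_mult[symmetric] by linarith
   also have "... <= \<Lambda> * \<tau> + \<tau> * \<Lambda> + \<tau> * \<Lambda>"
    using that La0 tau0 tauL' by (intro add_mono mult_mono) auto
   finally show ?thesis by (simp add: mult_ac)
  qed
  have "\<bar>a0 * d0 - b0 * c0\<bar> <= \<bar>a * d - b * c\<bar> + 6 * (\<Lambda> * \<tau>)"
   using prod[OF errs(1) errs(4) ents(1) ents(4)] prod[OF errs(2) errs(3) ents(2) ents(3)] by linarith
  moreover have "6 * (\<Lambda> * \<tau>) <= (p0 ga)\<^sup>2 * X^2 * D / (3200 * B^4)"
  proof -
   have "6 * (\<Lambda> * \<tau>) <= 6 * (\<Lambda> * (\<Lambda> * w))" using tauL La0 by (intro mult_left_mono) auto
   also have "... = 6 * (kc ga 3)\<^sup>2 * X^2 * w / B^4 * nq^2" by (simp add: \<Lambda>_def power2_eq_square power4_eq_xxxx mult_ac)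
   also have "... <= 6 * (kc ga 3)\<^sup>2 * X^2 * w / B^4 * (6 * m)\<^sup>2"
    using nqm nq0 wp by (intro mult_left_mono power_mono) auto
   also have "... <= 6 * (kc ga 3)\<^sup>2 * X^2 * w / B^4 * (10 * m)\<^sup>2"
    using m wp by (intro mult_left_mono power_mono) auto
   also have "... = (p0 ga)\<^sup>2 * X^2 * (1920000 * (kc ga 3)\<^sup>2 / (p0 ga)\<^sup>2 * (w * m^2)) / (3200 * B^4)"
    using pp pos by (simp add: power_mult_distrib)
   also have "... <= (p0 ga)\<^sup>2 * X^2 * D / (3200 * B^4)" using D2 by (intro divide_right_mono mult_left_mono) auto
   finally show ?thesis .
  qed
  moreover have "(p0 ga)\<^sup>2 * X^2 * D / (1600 * B^4) = (p0 ga)\<^sup>2 * X^2 * D / (3200 * B^4) + (p0 ga)\<^sup>2 * X^2 * D / (3200 * B^4)" by simp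
  ultimately show ?thesis using 1 by (simp add: D_def)
 qed
qed

end

section \<open>The two-dimensional estimate for sharp boxes\<close>

definition TC :: "real => real" where
 "TC ga = 25894400 * phase.smooth_c ga / (kap ga * p0 ga)"

text \<open>Moving the point of evaluation changes the form by at most
  \<open>96 * (ga + 1) * (w * m^2)\<close> and enlarges \<open>m\<close> by at most a factor 2. With
  these constants half of the determinant survives and \<open>ND\<close> applies at the new
  point.\<close>

definition NDc :: "real => real" where "NDc ga = 192 * (ga + 1) + 8 * ND ga"

lemma ND_pos: "ga > 0 ==> ND ga > 0"
proof -
 assume g: "ga > 0"
 have "kc ga 3 > 0" "kc ga 4 > 0" "p0 ga > 0" using kc_pos[OF g] p0_pos[OF g] by auto
 then show "ND ga > 0" unfolding ND_def using g by (intro add_pos_pos divide_pos_pos mult_pos_pos zero_less_power) auto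
qed

lemma Dq_variation:
 assumes g: "ga > 0" and w: "0 <= w" "w <= 1/216" and m: "\<bar>u\<bar> <= m" "\<bar>v\<bar> <= m"
  and d: "\<bar>u' - u\<bar> <= 4 * w * m" "\<bar>v' - v\<bar> <= 4 * w * m"
 shows "\<bar>Dq ga u' v' - Dq ga u v\<bar> <= 96 * (ga + 1) * (w * m^2)"
proof -
 have m0: "m >= 0" using m by simp
 have wm: "4 * w * m <= m"
 proof -
  have "(4 * w) * m <= 1 * m" using w m0 by (intro mult_right_mono) auto
  then show ?thesis by simp
 qed
 have wm0: "4 * w * m >= 0" using w m0 by simp
 have prod: "\<bar>a' * b' - a * b\<bar> <= 12 * (w * m^2)" if "\<bar>a' - a\<bar> <= 4 * w * m" "\<bar>b' - b\<bar> <= 4 * w * m" "\<bar>a\<bar> <= m" "\<bar>b\<bar> <= m" for a a' b b'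
 proof -
  have "a' * b' - a * b = a * (b' - b) + (a' - a) * b + (a' - a) * (b' - b)" by (simp add: algebra_simps)
  then have "\<bar>a' * b' - a * b\<bar> <= \<bar>a\<bar> * \<bar>b' - b\<bar> + \<bar>a' - a\<bar> * \<bar>b\<bar> + \<bar>a' - a\<bar> * \<bar>b' - b\<bar>"
   unfolding abs_mult[symmetric] by linarith
  also have "... <= m * (4 * w * m) + (4 * w * m) * m + m * (4 * w * m)"
   using that wm m0 wm0 by (intro add_mono mult_mono) auto
  finally show ?thesis by (simp add: power2_eq_square mult_ac)
 qed
 have "Dq ga u' v' - Dq ga u v = 2 * ga * (u' * u' - u * u) + 2 * ga * (v' * v' - v * v) + 4 * (ga + 1) * (u' * v' - u * v)"
  by (simp add: Dq_def power2_eq_square algebra_simps)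
 then have "\<bar>Dq ga u' v' - Dq ga u v\<bar> <= \<bar>2 * ga * (u' * u' - u * u)\<bar> + \<bar>2 * ga * (v' * v' - v * v)\<bar> + \<bar>4 * (ga + 1) * (u' * v' - u * v)\<bar>" by linarith
 also have "... = 2 * ga * \<bar>u' * u' - u * u\<bar> + 2 * ga * \<bar>v' * v' - v * v\<bar> + 4 * (ga + 1) * \<bar>u' * v' - u * v\<bar>"
  using g by (simp add: abs_mult)
 also have "... <= 2 * ga * (12 * (w * m^2)) + 2 * ga * (12 * (w * m^2)) + 4 * (ga + 1) * (12 * (w * m^2))"
  using g prod[OF d(1) d(1) m(1) m(1)] prod[OF d(2) d(2) m(2) m(2)] prod[OF d(1) d(2) m(1) m(2)]
  by (intro add_mono mult_left_mono) auto
 also have "... = (96 * ga + 48) * (w * m^2)" by (simp add: algebra_simps)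
 also have "... <= 96 * (ga + 1) * (w * m^2)" using w by (intro mult_right_mono) auto
 finally show ?thesis .
qed

context phase
begin

text \<open>The variable \<open>a\<close> is refined to \<open>n / L\<close> with \<open>L\<close> about \<open>B / A\<close>, which makes the box a square
 in lattice units; completion then replaces the sharp cut-offs by smooth ones.\<close>

lemma two_dim_bound:
 fixes i j i' j' q1 q2 :: int and w xc yc :: real
 defines "u \<equiv> of_int q1 / xc" and "v \<equiv> of_int q2 / yc"
 defines "m \<equiv> max \<bar>u\<bar> \<bar>v\<bar>"
 assumes rng: "A <= of_int i" "of_int j <= 2 * A" "B <= of_int i'" "of_int j' <= 4 * B" "of_int (j - i) <= w * A" "of_int (j' - i') <= w * B"
  and ne: "i <= j" "i' <= j'"
  and w: "w <= w1 ga" "1 / (A * B) <= w" "4 <= w * A" "4 <= w * B"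
  and c: "\<bar>xc - of_int i\<bar> <= w * A" "\<bar>yc - of_int i'\<bar> <= w * B"
  and q: "\<bar>of_int q1\<bar> <= w * A" "\<bar>of_int q2\<bar> <= w * B"
  and H1: "kc ga 3 * (X * nrm A B (of_int q1, of_int q2)) * (48 * w) / B <= 1/2"
  and m: "m > 0" and Dm: "NDc ga * w * m^2 <= \<bar>Dq ga u v\<bar>"
 shows "norm (\<Sum>a\<in>{i..j}. \<Sum>b\<in>{i'..j'}. ee (Diff [(of_int q1, of_int q2)] F (of_int a) (of_int b)))
   <= TC ga * (1 + ln (50 * B))^3 * (B^2 / (X * sqrt \<bar>Dq ga u v\<bar>))"
proof -
 \<comment> \<open>With \<open>4 * k1\<close> as completed length the origin is moved to
   \<open>i - k1\<close>, so that the given interval becomes part of \<open>[k1, 3 * k1]\<close>,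
   the middle half demanded by the completion. The other variable is treated likewise.\<close>
 define k1 where "k1 = \<lceil>w * A / 2\<rceil>"
 define k2 where "k2 = \<lceil>w * B / 2\<rceil>"
 define L where "L = \<lceil>B / A\<rceil>"
 define x0 where "x0 = real_of_int (i - k1)"
 define y0 where "y0 = real_of_int (i' - k2)"
 define q where "q = (real_of_int q1, real_of_int q2)"
 have w216: "w <= 1/216" using w(1) by (simp add: w1_def)
 have wp: "w > 0" using w(2) pos by (smt (verit) divide_pos_pos mult_pos_pos)
 have wA: "w * A <= A / 216" "w * B <= B / 216"
  using mult_right_mono[OF w216, of A] mult_right_mono[OF w216, of B] pos by auto
 have k1: "w * A / 2 <= of_int k1" "of_int k1 <= 3/4 * (w * A)" "k1 >= 1" "of_int k1 <= w * A / 2 + 1"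
  using w(3) unfolding k1_def by linarith+
 have k2: "w * B / 2 <= of_int k2" "of_int k2 <= 3/4 * (w * B)" "k2 >= 1" "of_int k2 <= w * B / 2 + 1"
  using w(4) unfolding k2_def by linarith+
 have BA: "B / A > 0" using pos by simp
 have L: "L >= 1" "B <= of_int L * A" "of_int L * A <= 5 * B"
 proof -
  show "L >= 1" unfolding L_def using BA by linarith
  have "B / A <= of_int L" "of_int L <= B / A + 1" unfolding L_def by linarith+
  then have "B / A * A <= of_int L * A" "of_int L * A <= (B / A + 1) * A" using pos by (intro mult_right_mono; simp)+
  then show "B <= of_int L * A" "of_int L * A <= 5 * B" using pos AB2 by (simp_all add: distrib_right)
 qed
 have x0: "A / 2 <= x0" "x0 <= 2 * A" "B / 2 <= y0" "y0 <= 4 * B"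
 proof -
  have e: "x0 = of_int i - of_int k1" "y0 = of_int i' - of_int k2" by (simp_all add: x0_def y0_def)
  have "real_of_int i <= of_int j" "real_of_int i' <= of_int j'" using ne by simp_all
  moreover have "real_of_int k1 >= 1" "real_of_int k2 >= 1" using k1 k2 by simp_all
  ultimately show "A / 2 <= x0" "x0 <= 2 * A" "B / 2 <= y0" "y0 <= 4 * B" 
   using e k1(2) k2(2) wA rng pos by linarith+
 qed
 have xcp: "xc > 0" "yc > 0" using c rng wA pos by linarith+
 have xy0: "x0 > 0" "y0 > 0" using x0 pos by linarith+
 \<comment> \<open>The hypothesis on \<open>Dq\<close> refers to the point \<open>(xc, yc)\<close>,
   because later all shifts are classified at one common point; it is transferred to the corner
   \<open>(x0, y0)\<close> of the present range.\<close>
 define u0 where "u0 = of_int q1 / x0"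
 define v0 where "v0 = of_int q2 / y0"
 define m0 where "m0 = max \<bar>u0\<bar> \<bar>v0\<bar>"
 have um: "\<bar>u\<bar> <= m" "\<bar>v\<bar> <= m" by (simp_all add: m_def)
 have du: "\<bar>u0 - u\<bar> <= 4 * w * m"
 proof -
  have "u0 - u = u * ((xc - x0) / x0)" unfolding u0_def u_def using xcp xy0 by (simp add: field_simps)
  then have "\<bar>u0 - u\<bar> = \<bar>u\<bar> * (\<bar>xc - x0\<bar> / x0)" using xy0 by (simp add: abs_mult)
  also have "... <= m * ((2 * (w * A)) / (A / 2))"
  proof (intro mult_mono um frac_le)
   show "\<bar>xc - x0\<bar> <= 2 * (w * A)" unfolding x0_def using c(1) k1 by auto
  qed (use x0 xy0 pos m wp in auto)
  finally show ?thesis using pos by (simp add: mult_ac)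
 qed
 have dv: "\<bar>v0 - v\<bar> <= 4 * w * m"
 proof -
  have "v0 - v = v * ((yc - y0) / y0)" unfolding v0_def v_def using xcp xy0 by (simp add: field_simps)
  then have "\<bar>v0 - v\<bar> = \<bar>v\<bar> * (\<bar>yc - y0\<bar> / y0)" using xy0 by (simp add: abs_mult)
  also have "... <= m * ((2 * (w * B)) / (B / 2))"
  proof (intro mult_mono um frac_le)
   show "\<bar>yc - y0\<bar> <= 2 * (w * B)" unfolding y0_def using c(2) k2 by auto
  qed (use x0 xy0 pos m wp in auto)
  finally show ?thesis using pos by (simp add: mult_ac)
 qed
 have wm: "4 * w * m <= m / 2"
 proof -
  have "(4 * w) * m <= (1/2) * m" using w216 m by (intro mult_right_mono) auto
  then show ?thesis by simp
 qed
 have m0m: "m0 <= 2 * m" "m0 > 0"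
 proof -
  have "\<bar>u0\<bar> <= 2 * m" "\<bar>v0\<bar> <= 2 * m" using du dv um wm m by linarith+
  then show "m0 <= 2 * m" by (simp add: m0_def)
  have "\<bar>u\<bar> = m \<or> \<bar>v\<bar> = m" by (auto simp: m_def max_def)
  then have "\<bar>u0\<bar> > 0 \<or> \<bar>v0\<bar> > 0" using du dv wm m by linarith
  then show "m0 > 0" by (auto simp: m0_def)
 qed
 have wm2: "w * m^2 >= 0" using wp by simp
 have var: "\<bar>Dq ga u0 v0 - Dq ga u v\<bar> <= 96 * (ga + 1) * (w * m^2)"
  by (rule Dq_variation[OF gam _ w216 um du dv]) (use wp in simp)
 have Dbig: "192 * (ga + 1) * (w * m^2) + 8 * ND ga * (w * m^2) <= \<bar>Dq ga u v\<bar>"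
  using Dm by (simp add: NDc_def algebra_simps)
 have NDp: "ND ga * (w * m^2) >= 0" using ND_pos gam wm2 by (simp add: less_imp_le)
 have half: "\<bar>Dq ga u v\<bar> / 2 <= \<bar>Dq ga u0 v0\<bar>" using var Dbig NDp by linarith
 have Dpos: "\<bar>Dq ga u v\<bar> > 0"
 proof -
  have "0 < 192 * (ga + 1) * (w * m^2)" using gam wp m by simp
  then show ?thesis using Dbig NDp by linarith
 qed
 have Dm0: "ND ga * w * m0^2 <= \<bar>Dq ga u0 v0\<bar>"
 proof -
  have "m0\<^sup>2 <= (2 * m)\<^sup>2" using m0m by (intro power_mono) auto
  then have "ND ga * w * m0^2 <= ND ga * w * (2 * m)\<^sup>2" using ND_pos[OF gam] wp by (intro mult_left_mono) auto
  also have "... = 4 * ND ga * (w * m^2)" by (simp add: power_mult_distrib)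
  also have "... <= \<bar>Dq ga u v\<bar> / 2"
  proof -
   have "0 <= 192 * (ga + 1) * (w * m^2)" using gam wm2 by simp
   then show ?thesis using Dbig by linarith
  qed
  finally show ?thesis using half by linarith
 qed
 note nd = nondegenerate[OF x0 L w(2,1) m0m(2)[unfolded m0_def u0_def v0_def] Dm0[unfolded m0_def u0_def v0_def]]
 define a where "a = PH ga U V [q, (1 / of_int L, 0), (1 / of_int L, 0)] x0 y0"
 define b where "b = PH ga U V [q, (0, 1), (1 / of_int L, 0)] x0 y0"
 define c' where "c' = PH ga U V [q, (1 / of_int L, 0), (0, 1)] x0 y0"
 define d where "d = PH ga U V [q, (0, 1), (0, 1)] x0 y0"
 note nd' = nd[folded q_def, folded a_def b_def c'_def d_def u0_def v0_def]
 have nqp: "nrm A B q > 0"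
 proof -
  have "q1 \<noteq> 0 \<or> q2 \<noteq> 0" using m by (auto simp: m_def u_def v_def)
  then show ?thesis using pos by (auto simp: nrm_def q_def intro: add_pos_nonneg add_nonneg_pos)
 qed
 have pp: "p0 ga > 0" using p0_pos gam by simp
 have kp: "kap ga > 0" "kap ga <= 1" using pp kc_pos'[of 3] by (auto simp: kap_def)
 have sc: "smooth_c > 0" unfolding smooth_c_def using kc_pos' by (simp add: add_pos_pos)
 have det: "(p0 ga * X / (80 * B^2))\<^sup>2 * \<bar>Dq ga u v\<bar> <= \<bar>a * d - b * c'\<bar>"
 proof -
  have "(p0 ga * X / (80 * B^2))\<^sup>2 * \<bar>Dq ga u v\<bar> = (p0 ga)\<^sup>2 * X^2 * (\<bar>Dq ga u v\<bar> / 2) / (3200 * B^4)"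
   by (simp add: power_mult_distrib power_divide)
  also have "... <= (p0 ga)\<^sup>2 * X^2 * \<bar>Dq ga u0 v0\<bar> / (3200 * B^4)"
   using half by (intro divide_right_mono mult_left_mono) auto
  also note nd'(3)
  finally show ?thesis .
 qed
 have lead: "p0 ga * X / (80 * B^2) > 0" using pp pos by simp
 have detpos: "\<bar>a * d - b * c'\<bar> > 0"
  using det lead Dpos by (smt (verit) mult_pos_pos zero_less_power)
 have M1: "4 * k1 >= 1" "4 * k2 >= 1" using k1 k2 by auto
 have LA4: "of_int L * (4 * of_int k1) >= of_int L * (2 * (w * A))" "of_int L * (4 * of_int k1) <= of_int L * (3 * (w * A))"
 proof -
  have "2 * (w * A) <= 4 * of_int k1" "4 * of_int k1 <= 3 * (w * A)" "0 <= real_of_int L" using k1 L by linarith+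
  then show "of_int L * (4 * of_int k1) >= of_int L * (2 * (w * A))" "of_int L * (4 * of_int k1) <= of_int L * (3 * (w * A))"
   by (simp_all only: mult_left_mono)
 qed
 have wLA: "w * B <= w * (of_int L * A)" "w * (of_int L * A) <= w * (5 * B)" using L wp by (intro mult_left_mono; simp)+
 have N1: "w * B <= of_int (L * (4 * k1))" "of_int (L * (4 * k1)) <= 24 * w * B"
 proof -
  have e: "real_of_int (L * (4 * k1)) = of_int L * (4 * of_int k1)" "of_int L * (2 * (w * A)) = 2 * (w * (of_int L * A))"
   "of_int L * (3 * (w * A)) = 3 * (w * (of_int L * A))" "w * (5 * B) = 5 * (w * B)" "24 * w * B = 24 * (w * B)"
   by simp_all
  have "w * B > 0" using wp pos by simp
  then show "w * B <= of_int (L * (4 * k1))" "of_int (L * (4 * k1)) <= 24 * w * B"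
   using LA4 wLA unfolding e by linarith+
 qed
 have N2: "w * B <= of_int (4 * k2)" "of_int (4 * k2) <= 24 * w * B"
 proof -
  have e: "real_of_int (4 * k2) = 4 * of_int k2" "24 * w * B = 24 * (w * B)" by simp_all
  show "w * B <= of_int (4 * k2)" "of_int (4 * k2) <= 24 * w * B" unfolding e using k2 w(4) by linarith+
 qed
 define Bd where "Bd = 280 * smooth_c / kap ga * (1 + ln (50 * B)) / sqrt \<bar>a * d - b * c'\<bar>"
 define G where "G n k = ee (Diff [q] F (x0 + of_int n / of_int L) (y0 + of_int k))" for n k :: int
 have core: "norm (\<Sum>n\<in>{k1..j - i + k1}. \<Sum>k\<in>{k2..j' - i' + k2}. G (L * n) k) <= 34 * (1 + ln (of_int (4 * k1))) * (34 * (1 + ln (of_int (4 * k2))) * Bd)"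
 proof (rule completion_2d[OF M1(1) L(1) _ _ M1(2)])
  show "real_of_int (4 * k1) / 4 <= of_int k1" "real_of_int (4 * k2) / 4 <= of_int k2" by simp_all
  show "real_of_int (j - i + k1) <= 3 * of_int (4 * k1) / 4" using rng(5) k1 by simp
  show "real_of_int (j' - i' + k2) <= 3 * of_int (4 * k2) / 4" using rng(6) k2 by simp
  fix \<theta> \<theta>'
  show "norm (\<Sum>n\<in>{0..L * (4 * k1)}. \<Sum>k\<in>{0..4 * k2}. of_real (bump (of_int n / of_int (L * (4 * k1)))) * of_real (bump (of_int k / of_int (4 * k2))) *
     ee (\<theta> * of_int n + \<theta>' * of_int k) * G n k) <= Bd"
   unfolding G_def Bd_def a_def b_def c'_def d_def q_def
  proof (rule smooth_box_sum[OF x0(1,3) wp w216 _ _ L(1,2) N1 N2 q _ H1 _ kp])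
   show "1 <= w * A" "1 <= w * B" using w by auto
  qed (use nqp nd' detpos in \<open>auto simp: q_def a_def b_def c'_def d_def\<close>)
 qed
 have eqsum: "(\<Sum>a\<in>{i..j}. \<Sum>b\<in>{i'..j'}. ee (Diff [(of_int q1, of_int q2)] F (of_int a) (of_int b)))
   = (\<Sum>n\<in>{k1..j - i + k1}. \<Sum>k\<in>{k2..j' - i' + k2}. G (L * n) k)"
 proof (rule sum.reindex_bij_witness[of _ "\<lambda>n. n + (i - k1)" "\<lambda>a. a - (i - k1)"])
  fix a assume "a \<in> {i..j}"
  show "(\<Sum>k\<in>{k2..j' - i' + k2}. G (L * (a - (i - k1))) k) = (\<Sum>b\<in>{i'..j'}. ee (Diff [(of_int q1, of_int q2)] F (of_int a) (of_int b)))"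
  proof (rule sum.reindex_bij_witness[of _ "\<lambda>b. b - (i' - k2)" "\<lambda>k. k + (i' - k2)"])
   fix k
   have "x0 + of_int (L * (a - (i - k1))) / of_int L = of_int a" "y0 + of_int k = of_int (k + (i' - k2))"
    using L by (simp_all add: x0_def y0_def)
   then show "ee (Diff [(of_int q1, of_int q2)] F (of_int a) (of_int (k + (i' - k2)))) = G (L * (a - (i - k1))) k"
    by (simp only: G_def q_def)
  qed auto
 qed auto
 have H: "ln (50 * B) >= 0" using B1 by simp
 have Bd0: "Bd >= 0" unfolding Bd_def using sc kp H by simp
 have wAB: "w * A <= A" "w * B <= B" using wA pos by linarith+
 have "real_of_int (4 * k1) <= 50 * B" "real_of_int (4 * k2) <= 50 * B"   proof -
  have e: "real_of_int (4 * k1) = 4 * of_int k1" "real_of_int (4 * k2) = 4 * of_int k2" by simp_all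
  show "real_of_int (4 * k1) <= 50 * B" "real_of_int (4 * k2) <= 50 * B" 
   unfolding e using k1(2) k2(2) AB2 pos wAB by linarith+
 qed
 then have lns: "1 + ln (real_of_int (4 * k1)) <= 1 + ln (50 * B)" "1 + ln (real_of_int (4 * k2)) <= 1 + ln (50 * B)"
  using k1 k2 B1 by (simp_all add: ln_le_cancel_iff del: ln_mult)
 have "norm (\<Sum>a\<in>{i..j}. \<Sum>b\<in>{i'..j'}. ee (Diff [(of_int q1, of_int q2)] F (of_int a) (of_int b)))
   <= 34 * (1 + ln (of_int (4 * k1))) * (34 * (1 + ln (of_int (4 * k2))) * Bd)"
  unfolding eqsum by (rule core)
 also have "... <= 34 * (1 + ln (50 * B)) * (34 * (1 + ln (50 * B)) * Bd)"
  using lns Bd0 H k1 k2 by (intro mult_mono mult_left_mono mult_right_mono) auto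
 finally have fin1: "norm (\<Sum>a\<in>{i..j}. \<Sum>b\<in>{i'..j'}. ee (Diff [(of_int q1, of_int q2)] F (of_int a) (of_int b)))
   <= 34 * (1 + ln (50 * B)) * (34 * (1 + ln (50 * B)) * Bd)" .
 have "Bd <= 280 * smooth_c / kap ga * (1 + ln (50 * B)) * (80 * B^2 / (p0 ga * X * sqrt \<bar>Dq ga u v\<bar>))"
 proof -
  have "p0 ga * X / (80 * B^2) * sqrt \<bar>Dq ga u v\<bar> <= sqrt \<bar>a * d - b * c'\<bar>"
   using real_sqrt_le_mono[OF det] pp pos by (simp add: real_sqrt_mult abs_mult)
  then have "1 / sqrt \<bar>a * d - b * c'\<bar> <= 1 / (p0 ga * X / (80 * B^2) * sqrt \<bar>Dq ga u v\<bar>)"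
   using lead Dpos detpos by (intro divide_left_mono mult_pos_pos) auto
  also have "... = 80 * B^2 / (p0 ga * X * sqrt \<bar>Dq ga u v\<bar>)" by simp
  finally have "280 * smooth_c / kap ga * (1 + ln (50 * B)) * (1 / sqrt \<bar>a * d - b * c'\<bar>) <= 280 * smooth_c / kap ga * (1 + ln (50 * B)) * (80 * B^2 / (p0 ga * X * sqrt \<bar>Dq ga u v\<bar>))"
   using sc kp H by (intro mult_left_mono) auto
  then show ?thesis by (simp add: Bd_def)
 qed
 then have "34 * (1 + ln (50 * B)) * (34 * (1 + ln (50 * B)) * Bd) <= 34 * (1 + ln (50 * B)) * (34 * (1 + ln (50 * B)) *
   (280 * smooth_c / kap ga * (1 + ln (50 * B)) * (80 * B^2 / (p0 ga * X * sqrt \<bar>Dq ga u v\<bar>))))"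
  using H by (intro mult_left_mono) auto
 \<comment> \<open>\<open>25894400 = 34 * 34 * 280 * 80\<close>: two completions, the smooth box
   sum, and the lower bound for the root of the determinant.\<close>
 also have "... = TC ga * (1 + ln (50 * B))^3 * (B^2 / (X * sqrt \<bar>Dq ga u v\<bar>))"
 proof -
  have "34 * H * (34 * H * (280 * s / k * H * (80 * b / (p * Y * r)))) = 25894400 * s / (k * p) * H^3 * (b / (Y * r))" for H s k b p Y r :: real
   by (simp add: power3_eq_cube mult_ac)
  then show ?thesis unfolding TC_def .
 qed
 finally show ?thesis using fin1 by linarith
qed

end

section \<open>Degenerate shifts\<close>

definition e0 :: "real => real" where "e0 ga = ga^2 / ((ga + 2)\<^sup>2 * (2 * ga + 3))"

lemma e0_bounds:
 assumes "ga > 0" shows "0 < e0 ga" "e0 ga <= 1" "e0 ga <= ga"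
proof -
 have d: "(ga + 2)\<^sup>2 * (2 * ga + 3) > 0" using assms by (intro mult_pos_pos zero_less_power) auto
 show "0 < e0 ga" unfolding e0_def using assms d by simp
 have "ga\<^sup>2 * 1 <= (ga + 2)\<^sup>2 * (2 * ga + 3)" using assms by (intro mult_mono power_mono) auto
 then show "e0 ga <= 1" unfolding e0_def using d by (simp add: divide_le_eq)
 have "1 <= (ga + 2)" "1 <= 2 * ga + 3" "ga <= ga + 2" using assms by auto
 then have "ga * 1 * 1 <= (ga + 2) * (ga + 2) * (2 * ga + 3)" using assms by (intro mult_mono) auto
 then have "ga * ga <= ga * ((ga + 2)\<^sup>2 * (2 * ga + 3))" using assms by (intro mult_left_mono) (auto simp: power2_eq_square)
 then show "e0 ga <= ga" unfolding e0_def using d by (simp add: divide_le_eq power2_eq_square)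
qed

text \<open>In the notation of \<open>nondegenerate\<close>, \<open>Dq = M11 * M22 - M12^2\<close>.
  A small \<open>M22\<close> forces \<open>|u| = m\<close> and
  \<open>|M12| >= ga * m / (ga + 2)\<close>, so the form cannot be small at the same time.
  \<open>e0\<close> is chosen such that \<open>M12^2 >= (2 * ga + 3) * e0 * m^2\<close>, while
  \<open>|M11 * M22| <= (2 * ga + 2) * e0 * m^2\<close>. Thus on the degenerate lines the second
  derivative in \<open>b\<close> alone has full size.\<close>

lemma Dq_dichotomy:
 assumes g: "ga > 0" and m: "m = max \<bar>u\<bar> \<bar>v\<bar>"
 shows "e0 ga * m^2 <= \<bar>Dq ga u v\<bar> \<or> e0 ga * m <= \<bar>ga * u + (ga + 2) * v\<bar>"
proof (rule ccontr)
 assume "\<not> ?thesis"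
 then have D: "\<bar>Dq ga u v\<bar> < e0 ga * m^2" and M: "\<bar>ga * u + (ga + 2) * v\<bar> < e0 ga * m" by auto
 note e = e0_bounds[OF g]
 have m0: "m >= 0" by (simp add: m)
 have em: "e0 ga * m <= m" using mult_right_mono[OF e(2) m0] by simp
 have mp: "m > 0"
 proof (rule ccontr)
  assume "\<not> m > 0" then show False using m0 em M by linarith
 qed
 have u: "\<bar>u\<bar> = m"
 proof (rule ccontr)
  assume "\<bar>u\<bar> \<noteq> m"
  then have v: "\<bar>v\<bar> = m" "\<bar>u\<bar> <= m" by (auto simp: m max_def split: if_splits)
  have "(ga + 2) * \<bar>v\<bar> = \<bar>(ga * u + (ga + 2) * v) - ga * u\<bar>" using g by (simp add: abs_mult)
  then have "(ga + 2) * \<bar>v\<bar> <= \<bar>ga * u + (ga + 2) * v\<bar> + \<bar>ga * u\<bar>" by linarith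
  moreover have "\<bar>ga * u\<bar> <= ga * m" using g v by (simp add: abs_mult)
  ultimately have "(ga + 2) * \<bar>v\<bar> <= m + ga * m" using M em by linarith
  then have "(ga + 2) * m <= m + ga * m" using v by simp
  then show False using mp by (simp add: distrib_right)
 qed
 have v: "\<bar>v\<bar> <= m" by (simp add: m)
 have "\<bar>(ga + 2) * (u + v)\<bar> = \<bar>2 * u + (ga * u + (ga + 2) * v)\<bar>" by (simp add: algebra_simps)
 then have "(ga + 2) * \<bar>u + v\<bar> >= m" using M em u g by (simp add: abs_mult)
 then have "m / (ga + 2) <= \<bar>u + v\<bar>" using g by (simp add: divide_le_eq mult.commute)
 then have "(ga * (m / (ga + 2)))\<^sup>2 <= (ga * \<bar>u + v\<bar>)\<^sup>2" using g m0 by (intro power_mono mult_left_mono) auto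
 moreover have "(ga * (m / (ga + 2)))\<^sup>2 = (2 * ga + 3) * (e0 ga * m^2)"
  unfolding e0_def using g by (simp add: power_mult_distrib power_divide)
 ultimately have M12: "(2 * ga + 3) * (e0 ga * m^2) <= (ga * (u + v)) * (ga * (u + v))"
  by (simp add: power_mult_distrib power2_eq_square)
 have "\<bar>(ga + 2) * u + ga * v\<bar> <= (ga + 2) * \<bar>u\<bar> + ga * \<bar>v\<bar>" using g by (intro order.trans[OF abs_triangle_ineq]) (simp add: abs_mult)
 also have "... <= (ga + 2) * m + ga * m" using g u v by (intro add_mono mult_left_mono) auto
 finally have "\<bar>(ga + 2) * u + ga * v\<bar> * \<bar>ga * u + (ga + 2) * v\<bar> <= ((ga + 2) * m + ga * m) * (e0 ga * m)"
  using M g m0 by (intro mult_mono) auto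
 then have "\<bar>((ga + 2) * u + ga * v) * (ga * u + (ga + 2) * v)\<bar> <= (2 * ga + 2) * (e0 ga * m^2)"
  unfolding abs_mult by (simp add: power2_eq_square algebra_simps)
 then have "(2 * ga + 3) * (e0 ga * m^2) - (2 * ga + 2) * (e0 ga * m^2) <= \<bar>Dq ga u v\<bar>"
  using M12 unfolding Dq_det by linarith
 then show False using D by (simp add: algebra_simps)
qed

text \<open>\<open>Dq ga 0 v = 2 * ga * v^2\<close> is large, so a small value of the form keeps the
  vector away from the axis \<open>u = 0\<close>. Near the degenerate lines the first coordinate of
  the shift is therefore never negligible.\<close>

lemma Dq_small_min:
 assumes g: "ga > 0" and m: "m = max \<bar>u\<bar> \<bar>v\<bar>" and D: "\<bar>Dq ga u v\<bar> < e0 ga * m^2"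
 shows "ga / (4 * ga + 4) * m <= \<bar>u\<bar>"
proof (cases "\<bar>u\<bar> = m")
 case True
 have "ga / (4 * ga + 4) <= 1" using g by simp
 then show ?thesis using True mult_right_mono[of "ga / (4 * ga + 4)" 1 m] abs_ge_zero[of u] by simp
next
 case False
 then have v: "\<bar>v\<bar> = m" "\<bar>u\<bar> <= m" by (auto simp: m max_def split: if_splits)
 have m0: "m > 0" using v(1) False v(2) by linarith
 have "v\<^sup>2 = m^2" using v(1) by (metis power2_abs)
 have "2 * ga * (u^2 + v^2) <= \<bar>Dq ga u v\<bar> + \<bar>4 * (ga + 1) * (u * v)\<bar>" unfolding Dq_def by linarith
 also have "\<bar>4 * (ga + 1) * (u * v)\<bar> = 4 * (ga + 1) * (\<bar>u\<bar> * m)" using g v by (simp add: abs_mult)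
 finally have "2 * ga * (u^2 + m^2) < e0 ga * m^2 + 4 * (ga + 1) * (\<bar>u\<bar> * m)"
  using D unfolding \<open>v\<^sup>2 = m^2\<close> by linarith
 moreover have "2 * ga * m^2 <= 2 * ga * (u^2 + m^2)" using g by (intro mult_left_mono) auto
 ultimately have "2 * ga * m^2 < e0 ga * m^2 + 4 * (ga + 1) * (\<bar>u\<bar> * m)" by linarith
 moreover have "e0 ga * m^2 <= ga * m^2" using e0_bounds(3)[OF g] by (intro mult_right_mono) auto
 ultimately have "(ga * m) * m <= ((4 * ga + 4) * \<bar>u\<bar>) * m" by (simp add: power2_eq_square algebra_simps)
 then have "ga * m <= (4 * ga + 4) * \<bar>u\<bar>" using m0 by simp
 then show ?thesis using g by (simp add: divide_le_eq mult.commute)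
qed

text \<open>\<open>hT\<close> bounds the ratio of the upper to the lower bound for the second
  differences in the degenerate case (\<open>192 = 6 * 32\<close>); \<open>w2\<close> makes the
  errors from freezing the point and dropping the correction term at most
  \<open>\<mu>\<close>.\<close>

definition hT :: "real => real" where "hT ga = 1 + 192 * kc ga 3 / (p0 ga * e0 ga)"
definition w2 :: "real => real" where "w2 ga = p0 ga * e0 ga / (192 * (108 * kc ga 4 + kc ga 3))"

context phase
begin

text \<open>For a fixed \<open>a\<close> the second derivative of the differenced phase in
  \<open>b\<close> has the main term \<open>- U * P * M22 / yc^2\<close>, where
  \<open>M22 = ga * u + (ga + 2) * v\<close> is bounded below by assumption. It has size at least
  \<open>2 * \<mu>\<close> at the fixed point and loses at most \<open>\<mu>\<close> along the row,
  so the second difference test applies.\<close>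

lemma one_dim_bound_diff:
 fixes i' j' q1 q2 a :: int and w xc yc :: real
 defines "u \<equiv> of_int q1 / xc" and "v \<equiv> of_int q2 / yc"
 defines "m \<equiv> max \<bar>u\<bar> \<bar>v\<bar>"
 defines "\<mu> \<equiv> p0 ga * e0 ga * (X * m) / (32 * B^2)"
 assumes c: "A <= xc" "xc <= 2 * A" "B <= yc" "yc <= 4 * B"
  and rng: "\<bar>of_int a - xc\<bar> <= w * A" "\<bar>of_int i' - yc\<bar> <= w * B" "\<bar>of_int j' - yc\<bar> <= w * B" "of_int (j' - i') <= w * B"
  and w: "w <= 1/216" "w <= w2 ga" "1 / (A * B) <= w" "4 <= w * B"
  and q: "\<bar>of_int q1\<bar> <= w * A" "\<bar>of_int q2\<bar> <= w * B"
  and m: "m > 0" and M: "e0 ga * m <= \<bar>ga * u + (ga + 2) * v\<bar>"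
 shows "norm (\<Sum>b\<in>{i'..j'}. ee (Diff [(of_int q1, of_int q2)] F (of_int a) (of_int b)))
   <= 8 * hT ga * (2 * (w * B) * sqrt \<mu> + 1 / sqrt \<mu>)"
proof -
 define q where "q = (real_of_int q1, real_of_int q2)"
 define nq where "nq = nrm A B q"
 define e2 where "e2 = (0::real, 1::real)"
 note e = e0_bounds[OF gam]
 have pp: "p0 ga > 0" using p0_pos gam by simp
 have k3: "kc ga 3 > 0" "kc ga 4 > 0" using kc_pos' by auto
 have xy: "xc > 0" "yc > 0" using c pos by linarith+
 have nq0: "nq >= 0" unfolding nq_def using pos nrm_nonneg by simp
 have AB1: "A * B > 0" using pos by simp
 have wp: "w > 0" using w(3) AB1 by (smt (verit) divide_pos_pos)
 have mu: "\<mu> > 0" unfolding \<mu>_def using pp e pos m by simp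
 have nqm: "nq <= 6 * m"
 proof -
  have "\<bar>real_of_int q1\<bar> / A = \<bar>u\<bar> * (xc / A)" "\<bar>real_of_int q2\<bar> / B = \<bar>v\<bar> * (yc / B)" unfolding u_def v_def using xy pos by simp_all
  moreover have "\<bar>u\<bar> * (xc / A) <= m * 2" "\<bar>v\<bar> * (yc / B) <= m * 4"
   using c pos xy by (intro mult_mono; auto simp: m_def divide_le_eq)+
  ultimately have "\<bar>real_of_int q1\<bar> / A <= m * 2" "\<bar>real_of_int q2\<bar> / B <= m * 4" by linarith+
  then show ?thesis unfolding nq_def nrm_def q_def fst_conv snd_conv by linarith
 qed
 define P where "P = ga * (ga + 1) * (xc powr (- ga) * yc powr (- ga))"
 define M22 where "M22 = ga * u + (ga + 2) * v"
 define N where "N = X * nq / B^2"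
 have N0: "N >= 0" unfolding N_def using pos nq0 by simp
 have Nm: "N <= X * (6 * m) / B^2" unfolding N_def using pos nqm by (intro divide_right_mono mult_left_mono) auto
 have UP: "U * P >= p0 ga * X"
 proof -
  have "xc powr (- ga) * yc powr (- ga) = (xc * yc) powr (- ga)" using xy by (simp add: powr_mult)
  moreover have "(xc * yc) powr (- ga) >= (8 * (A * B)) powr (- ga)"
  proof (rule powr_mono2')
   have "xc * yc <= (2 * A) * (4 * B)" using c xy pos by (intro mult_mono) auto
   then show "xc * yc <= 8 * (A * B)" by simp
  qed (use gam xy in auto)
  moreover have "(8 * (A * B)) powr (- ga) = 8 powr (- ga) * (A * B) powr (- ga)" using AB1 by (simp only: powr_mult)
  ultimately have ge: "8 powr (- ga) * (A * B) powr (- ga) <= xc powr (- ga) * yc powr (- ga)" by simp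
  have "p0 ga * X = U * (ga * (ga + 1) * (8 powr (- ga) * (A * B) powr (- ga)))" by (simp add: p0_def X_def)
  also have "... <= U * P" unfolding P_def using ge U gam by (intro mult_left_mono) auto
  finally show ?thesis .
 qed
 define \<Phi> where "\<Phi> = PH ga U V [q, e2, e2] xc yc"
 have DDe: "U * DD [q, e2, e2] ga ga xc yc = - (U * P * M22 / yc^2)"
  unfolding q_def e2_def
  by (subst DD_third(1)[OF xy P_def]) (simp add: M22_def u_def v_def power2_eq_square algebra_simps add_divide_distrib)
 have prod: "(\<Prod>v\<leftarrow>[q, e2, e2]. nrm A B v) * X = N" "(\<Prod>v\<leftarrow>[e2, e2, q]. nrm A B v) * X = N"
  using pos by (simp_all add: N_def nq_def e2_def nrm_def[of A B "(0,1)"] power2_eq_square)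
 have err1: "\<bar>\<Phi> - U * DD [q, e2, e2] ga ga xc yc\<bar> <= kc ga 3 * w * N"
 proof -
  have "\<bar>\<Phi> - U * DD [q, e2, e2] ga ga xc yc\<bar> <= ga * phase_const ga (length [q, e2, e2]) * X * (\<Prod>v\<leftarrow>[q, e2, e2]. nrm A B v) / (A * B)"
   unfolding \<Phi>_def by (rule PH_bound(2)[OF pos(1,2,4) _ _ gam U X_def]) (use c pos in auto)
  also have "... = ga * phase_const ga 3 * (1 / (A * B)) * ((\<Prod>v\<leftarrow>[q, e2, e2]. nrm A B v) * X)" by (simp add: numeral_3_eq_3)
  also have "... <= kc ga 3 * w * N" unfolding prod
  proof (intro mult_right_mono mult_mono w(3) N0)
   show "ga * phase_const ga 3 <= kc ga 3" using phase_const_pos[OF gam, of 3] by (simp add: kc_def distrib_right)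
  qed (use k3 AB1 in auto)
  finally show ?thesis .
 qed
 \<comment> \<open>The main term carries a minus sign, hence the sign opposite to that of
   \<open>M22\<close>.\<close>
 define s where "s = (if M22 > 0 then -1 else (1::real))"
 have s: "s = 1 \<or> s = -1" by (simp add: s_def)
 have main: "s * (U * DD [q, e2, e2] ga ga xc yc) >= 2 * \<mu>"
 proof -
  have "s * (U * DD [q, e2, e2] ga ga xc yc) = U * P * \<bar>M22\<bar> / yc^2" unfolding DDe s_def by (simp add: abs_if)
  moreover have "(p0 ga * X) * (e0 ga * m) / (4 * B)\<^sup>2 <= U * P * \<bar>M22\<bar> / yc^2"
  proof (rule frac_le)
   have "yc * yc <= (4 * B) * (4 * B)" using c xy by (intro mult_mono) auto
   then show "yc\<^sup>2 <= (4 * B)\<^sup>2" by (simp add: power2_eq_square)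
   have P0: "0 <= U * P" using UP pp pos by (meson mult_nonneg_nonneg less_imp_le order.trans)
   then show "0 <= U * P * \<bar>M22\<bar>" by simp
   show "p0 ga * X * (e0 ga * m) <= U * P * \<bar>M22\<bar>" using UP M P0 e m unfolding M22_def by (intro mult_mono[of _ "U * P"]) auto
  qed (use xy in auto)
  moreover have "(p0 ga * X) * (e0 ga * m) / (4 * B)\<^sup>2 = 2 * \<mu>" by (simp add: \<mu>_def power_mult_distrib)
  ultimately show ?thesis by linarith
 qed
 have wN: "(108 * kc ga 4 + kc ga 3) * (w * N) <= \<mu>"
 proof -
  define k where "k = 108 * kc ga 4 + kc ga 3"
  have k: "k > 0" using k3 by (simp add: k_def)
  have "w * (192 * k) <= p0 ga * e0 ga" using w(2) k unfolding w2_def k_def[symmetric] by (simp add: pos_le_divide_eq)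
  then have "w * (192 * k) * (X * m / (32 * B^2)) <= p0 ga * e0 ga * (X * m / (32 * B^2))" using pos m by (intro mult_right_mono) auto
  moreover have "k * (w * N) <= k * (w * (X * (6 * m) / B^2))" using k wp Nm by (intro mult_left_mono) auto
  moreover have "k * (w * (X * (6 * m) / B^2)) = w * (192 * k) * (X * m / (32 * B^2))" by simp
  moreover have "p0 ga * e0 ga * (X * m / (32 * B^2)) = \<mu>" by (simp add: \<mu>_def)
  ultimately show ?thesis unfolding k_def by linarith
 qed
 have wN0: "kc ga 4 * (w * N) >= 0" "kc ga 3 * (w * N) >= 0" using k3 wp N0 by simp_all
 show ?thesis
 proof (rule second_difference_test_abs[OF mu _ s])
  have "192 * kc ga 3 / (p0 ga * e0 ga) >= 0" using k3 pp e by simp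
  then show "hT ga >= 1" by (simp add: hT_def)
  show "of_int (j' - i' + 1) <= 2 * (w * B)" using rng(4) w(4) by simp
  show "0 <= 2 * (w * B)" using wp pos by simp
  fix n :: int assume n: "i' <= n" "n <= j'"
  define y where "y = Diff [e2, e2, q] F (of_int a) (of_int n)"
  have eq: "Diff [(of_int q1, of_int q2)] F (of_int a) (of_int (n+2)) - 2 * Diff [(of_int q1, of_int q2)] F (of_int a) (of_int (n+1))
    + Diff [(of_int q1, of_int q2)] F (of_int a) (of_int n) = y"
   by (simp add: y_def e2_def q_def add.assoc add.commute add.left_commute)
  have nb: "real_of_int i' <= of_int n" "real_of_int n <= of_int j'" using n by simp_all
  have loc: "\<bar>of_int a - xc\<bar> + sumx [e2, e2, q] <= 54 * w * A" "\<bar>of_int n - yc\<bar> + sumy [e2, e2, q] <= 54 * w * B"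
  proof -
   have wA0: "w * A > 0" "w * B > 0" using wp pos by simp_all
   have e: "54 * w * A = 54 * (w * A)" "54 * w * B = 54 * (w * B)" by simp_all
   have sx: "sumx [e2, e2, q] = \<bar>of_int q1\<bar>" "sumy [e2, e2, q] = 2 + \<bar>of_int q2\<bar>" by (simp_all add: e2_def q_def)
   show "\<bar>of_int a - xc\<bar> + sumx [e2, e2, q] <= 54 * w * A" unfolding e sx using rng(1) q(1) wA0 by linarith
   have "\<bar>of_int n - yc\<bar> <= w * B" using nb rng(2,3) by linarith
   then show "\<bar>of_int n - yc\<bar> + sumy [e2, e2, q] <= 54 * w * B" unfolding e sx using q(2) wA0 w(4) by linarith
  qed
  have x0: "A / 2 <= xc" "B / 2 <= yc" using c pos by linarith+
  have b1: "\<bar>y\<bar> <= kc ga 3 * N"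
  proof -
   have "\<bar>y\<bar> <= kc ga (length [e2, e2, q]) * X * (\<Prod>v\<leftarrow>[e2, e2, q]. nrm A B v)"
    unfolding y_def by (rule Diff_bounds(1)[OF x0 less_imp_le[OF wp] w(1) loc])
   also have "... = kc ga 3 * ((\<Prod>v\<leftarrow>[e2, e2, q]. nrm A B v) * X)" by (simp add: numeral_3_eq_3)
   finally show ?thesis unfolding prod .
  qed
  have b2: "\<bar>y - \<Phi>\<bar> <= 108 * (kc ga 4 * (w * N))"
  proof -
   have "\<bar>y - PH ga U V (rev [e2, e2, q]) xc yc\<bar> <= 108 * w * kc ga (Suc (length [e2, e2, q])) * X * (\<Prod>v\<leftarrow>[e2, e2, q]. nrm A B v)"
    unfolding y_def by (rule Diff_bounds(2)[OF x0 less_imp_le[OF wp] w(1) loc])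
   also have "... = 108 * w * kc ga 4 * ((\<Prod>v\<leftarrow>[e2, e2, q]. nrm A B v) * X)" by (simp add: eval_nat_numeral)
   finally show ?thesis unfolding prod by (simp add: \<Phi>_def mult_ac)
  qed
  have "\<bar>s * y - s * (U * DD [q, e2, e2] ga ga xc yc)\<bar> = \<bar>y - U * DD [q, e2, e2] ga ga xc yc\<bar>" using s by auto
  moreover have "\<bar>y - U * DD [q, e2, e2] ga ga xc yc\<bar> <= \<mu>"
  proof -
   have "(108 * kc ga 4 + kc ga 3) * (w * N) = 108 * (kc ga 4 * (w * N)) + kc ga 3 * w * N" by (simp add: algebra_simps)
   then show ?thesis using b2 err1 wN by linarith
  qed
  ultimately have lo: "\<mu> <= s * y" using main by linarith
  have "s * y <= \<bar>y\<bar>" using s by auto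
  also have "... <= kc ga 3 * (X * (6 * m) / B^2)" using b1 Nm k3 by (meson mult_left_mono order.trans less_imp_le)
  also have "... = 192 * kc ga 3 / (p0 ga * e0 ga) * \<mu>" using pp e pos unfolding \<mu>_def by simp
  also have "... <= hT ga * \<mu>" unfolding hT_def using mu by (intro mult_right_mono) auto
  finally show "\<mu> <= s * (Diff [(of_int q1, of_int q2)] F (of_int a) (of_int (n+2)) - 2 * Diff [(of_int q1, of_int q2)] F (of_int a) (of_int (n+1))
    + Diff [(of_int q1, of_int q2)] F (of_int a) (of_int n)) \<and>
   s * (Diff [(of_int q1, of_int q2)] F (of_int a) (of_int (n+2)) - 2 * Diff [(of_int q1, of_int q2)] F (of_int a) (of_int (n+1))
    + Diff [(of_int q1, of_int q2)] F (of_int a) (of_int n)) <= hT ga * \<mu>"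
   unfolding eq using lo by blast
 qed
qed

definition p1 :: real where "p1 = ga * (ga + 1) * 12 powr (- ga)"
definition hF :: real where "hF = 1 + 72 * kc ga 2 / p1"
definition K0 :: real where "K0 = 72 * kc ga 2 / p1"

text \<open>The undifferenced phase has no degeneracy in \<open>b\<close>: its second derivative is
  positive and of order \<open>X / B^2\<close>. \<open>K0 <= A * B\<close> makes the correction term
  at most half of the main one, and \<open>B >= 3\<close> leaves room for the two extra steps of a
  second difference.\<close>

lemma one_dim_bound:
 fixes b1 b2 a :: int
 assumes AB: "K0 <= A * B" and a: "A <= of_int a" "of_int a <= 2 * A" and b: "B <= of_int b1" "of_int b2 <= 4 * B"
  and len: "of_int (b2 - b1 + 1) <= M" "M >= 0" and B3: "B >= 3"
 shows "norm (\<Sum>b\<in>{b1..b2}. ee (F (of_int a) (of_int b))) <= 8 * hF * (M * sqrt (p1 * X / (72 * B^2)) + 1 / sqrt (p1 * X / (72 * B^2)))"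
proof (rule second_difference_test_abs[where s = 1])
 define e2 where "e2 = (0::real, 1::real)"
 have pp: "p1 > 0" using gam by (simp add: p1_def)
 have k2: "kc ga 2 > 0" using kc_pos' by auto
 have AB1: "A * B > 0" using pos by simp
 show mu: "p1 * X / (72 * B^2) > 0" using pp pos by simp
 have "72 * kc ga 2 / p1 >= 0" using k2 pp by simp
 then show "hF >= 1" by (simp add: hF_def)
 fix n assume n: "b1 <= n" "n <= b2"
 have nb: "real_of_int b1 <= of_int n" "real_of_int n <= of_int b2" using n by simp_all
 have eq: "F (of_int a) (of_int (n+2)) - 2 * F (of_int a) (of_int (n+1)) + F (of_int a) (of_int n) = Diff [e2, e2] F (of_int a) (of_int n)"
  by (simp add: e2_def add.assoc add.commute add.left_commute)
 have "sumx [e2, e2] < of_int a" "sumy [e2, e2] < of_int n"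
  using a nb b pos B3 by (simp_all add: e2_def)
 then obtain \<xi> \<eta> where xi: "\<bar>\<xi> - of_int a\<bar> <= sumx [e2, e2]" "\<bar>\<eta> - of_int n\<bar> <= sumy [e2, e2]"
  "Diff [e2, e2] F (of_int a) (of_int n) = PH ga U V (rev [e2, e2] @ []) \<xi> \<eta>"
  using Diff_mean_value by blast
 have eta: "\<bar>\<eta> - of_int n\<bar> <= 2" "Diff [e2, e2] F (of_int a) (of_int n) = PH ga U V [e2, e2] (of_int a) \<eta>"
  using xi by (simp_all add: e2_def)
 have reg: "A / 4 <= of_int a" "B / 4 <= \<eta>" "\<eta> <= 6 * B" using eta(1) nb b a B3 pos by linarith+
 then have xy: "real_of_int a > 0" "\<eta> > 0" using pos by linarith+
 have prod: "(\<Prod>v\<leftarrow>[e2, e2]. nrm A B v) = 1 / B^2" by (simp add: e2_def nrm_def power2_eq_square)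
 define P where "P = ga * (ga + 1) * (of_int a powr (- ga) * \<eta> powr (- ga))"
 have UP: "U * P >= p1 * X"
 proof -
  have "of_int a powr (- ga) * \<eta> powr (- ga) = (of_int a * \<eta>) powr (- ga)" using xy by (simp add: powr_mult)
  moreover have "(of_int a * \<eta>) powr (- ga) >= (12 * (A * B)) powr (- ga)"
  proof (rule powr_mono2')
   have "of_int a * \<eta> <= (2 * A) * (6 * B)" using a reg xy pos by (intro mult_mono) auto
   then show "of_int a * \<eta> <= 12 * (A * B)" by simp
  qed (use gam xy in auto)
  moreover have "(12 * (A * B)) powr (- ga) = 12 powr (- ga) * (A * B) powr (- ga)" using AB1 by (simp only: powr_mult)
  ultimately have ge: "12 powr (- ga) * (A * B) powr (- ga) <= of_int a powr (- ga) * \<eta> powr (- ga)" by simp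
  have "p1 * X = U * (ga * (ga + 1) * (12 powr (- ga) * (A * B) powr (- ga)))" by (simp add: p1_def X_def)
  also have "... <= U * P" unfolding P_def using ge U gam by (intro mult_left_mono) auto
  finally show ?thesis .
 qed
 have DDe: "U * DD [e2, e2] ga ga (of_int a) \<eta> = U * P / \<eta>^2"
  unfolding e2_def by (subst DD_second[OF xy]) (simp add: P_def)
 have low: "U * P / \<eta>^2 >= p1 * X / (36 * B^2)"
 proof (rule frac_le)
  have "\<eta> * \<eta> <= (6 * B) * (6 * B)" using reg xy by (intro mult_mono) auto
  then show "\<eta>\<^sup>2 <= 36 * B^2" by (simp add: power2_eq_square)
  have "0 <= p1 * X" using pp pos by simp
  then show "0 <= U * P" using UP by linarith
 qed (use UP xy in auto)
 have err: "\<bar>PH ga U V [e2, e2] (of_int a) \<eta> - U * P / \<eta>^2\<bar> <= p1 * X / (72 * B^2)"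
 proof -
  have "\<bar>PH ga U V [e2, e2] (of_int a) \<eta> - U * DD [e2, e2] ga ga (of_int a) \<eta>\<bar> <= ga * phase_const ga (length [e2, e2]) * X * (\<Prod>v\<leftarrow>[e2, e2]. nrm A B v) / (A * B)"
   by (rule PH_bound(2)[OF pos(1,2,4) reg(1,2) gam U X_def])
  then have "\<bar>PH ga U V [e2, e2] (of_int a) \<eta> - U * P / \<eta>^2\<bar> <= ga * phase_const ga 2 * X * (1 / B^2) / (A * B)"
   unfolding DDe prod by (simp add: eval_nat_numeral)
  also have "... = (ga * phase_const ga 2 / (A * B)) * (X / B^2)" by simp
  also have "... <= (p1 / 72) * (X / B^2)"
  proof (rule mult_right_mono)
   have "72 * kc ga 2 <= A * B * p1" using AB pp unfolding K0_def by (simp add: divide_le_eq)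
   moreover have "ga * phase_const ga 2 <= kc ga 2" using phase_const_pos[OF gam, of 2] by (simp add: kc_def distrib_right)
   ultimately have "72 * (ga * phase_const ga 2) <= A * B * p1" by linarith
   then show "ga * phase_const ga 2 / (A * B) <= p1 / 72" using AB1 by (simp add: divide_le_eq mult_ac)
  qed (use pos in auto)
  finally show ?thesis by simp
 qed
 have up: "\<bar>PH ga U V [e2, e2] (of_int a) \<eta>\<bar> <= hF * (p1 * X / (72 * B^2))"
 proof -
  have "\<bar>PH ga U V [e2, e2] (of_int a) \<eta>\<bar> <= (1 + ga) * phase_const ga (length [e2, e2]) * X * (\<Prod>v\<leftarrow>[e2, e2]. nrm A B v)"
   by (rule PH_bound(1)[OF pos(1,2,4) reg(1,2) gam U X_def])
  also have "... = kc ga 2 * X * (1 / B^2)" unfolding prod by (simp add: kc_def eval_nat_numeral)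
  also have "... = 72 * kc ga 2 / p1 * (p1 * X / (72 * B^2))" using pp by simp
  also have "... <= hF * (p1 * X / (72 * B^2))" unfolding hF_def using mu by (intro mult_right_mono) auto
  finally show ?thesis .
 qed
 have two: "p1 * X / (36 * B^2) = p1 * X / (72 * B^2) + p1 * X / (72 * B^2)" by simp
 show "p1 * X / (72 * B^2) <= 1 * (F (of_int a) (of_int (n+2)) - 2 * F (of_int a) (of_int (n+1)) + F (of_int a) (of_int n)) \<and>
   1 * (F (of_int a) (of_int (n+2)) - 2 * F (of_int a) (of_int (n+1)) + F (of_int a) (of_int n)) <= hF * (p1 * X / (72 * B^2))"
  unfolding eq eta(2) mult_1
 proof
  show "p1 * X / (72 * B^2) <= PH ga U V [e2, e2] (of_int a) \<eta>"
  proof -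
   have "Q <= s" if "\<bar>s - t\<bar> <= Q" "R <= t" "R = Q + Q" for s t Q R :: real using that by linarith
   then show ?thesis using err low two by blast
  qed
  show "PH ga U V [e2, e2] (of_int a) \<eta> <= hF * (p1 * X / (72 * B^2))" using up by linarith
 qed
qed (use len in auto)

end

section \<open>Summation over the Weyl shifts\<close>

lemma autocorr_box:
 fixes G :: "int => int => real"
 shows "autocorr ({i..j} \<times> {i'..j'}) (\<lambda>p. ee (G (fst p) (snd p))) (q1, q2) =
  (\<Sum>a\<in>{max i (i - q1)..min j (j - q1)}. \<Sum>b\<in>{max i' (i' - q2)..min j' (j' - q2)}. ee (G (a + q1) (b + q2) - G a b))"
proof -
 have "{p \<in> {i..j} \<times> {i'..j'}. p + (q1, q2) \<in> {i..j} \<times> {i'..j'}} = {max i (i - q1)..min j (j - q1)} \<times> {max i' (i' - q2)..min j' (j' - q2)}"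
  by (auto simp: plus_prod_def)
 then have "autocorr ({i..j} \<times> {i'..j'}) (\<lambda>p. ee (G (fst p) (snd p))) (q1, q2) =
  (\<Sum>p\<in>{max i (i - q1)..min j (j - q1)} \<times> {max i' (i' - q2)..min j' (j' - q2)}. ee (G (fst p + q1) (snd p + q2) - G (fst p) (snd p)))"
  by (simp add: autocorr_def ee_diff)
 then show ?thesis by (simp add: sum.cartesian_product case_prod_unfold)
qed

lemma card_int_within:
 fixes a b :: int and t R :: real
 assumes "R >= 0"
 shows "real (card {r\<in>{a..b}. \<bar>of_int r - t\<bar> <= R}) <= 2 * R + 1"
proof -
 have "{r\<in>{a..b}. \<bar>of_int r - t\<bar> <= R} \<subseteq> {\<lceil>t - R\<rceil>..\<lfloor>t + R\<rfloor>}" by (auto simp: ceiling_le_iff le_floor_iff abs_le_iff)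
 then have "card {r\<in>{a..b}. \<bar>of_int r - t\<bar> <= R} <= card {\<lceil>t - R\<rceil>..\<lfloor>t + R\<rfloor>}" by (intro card_mono) auto
 also have "... = nat (\<lfloor>t + R\<rfloor> - \<lceil>t - R\<rceil> + 1)" by simp
 finally have "real (card {r\<in>{a..b}. \<bar>of_int r - t\<bar> <= R}) <= real (nat (\<lfloor>t + R\<rfloor> - \<lceil>t - R\<rceil> + 1))" by simp
 also have "... <= 2 * R + 1"
 proof (cases "\<lfloor>t + R\<rfloor> - \<lceil>t - R\<rceil> + 1 >= 0")
  case True
  have "real_of_int \<lfloor>t + R\<rfloor> <= t + R" "t - R <= of_int \<lceil>t - R\<rceil>" by linarith+
  moreover have "real (nat (\<lfloor>t + R\<rfloor> - \<lceil>t - R\<rceil> + 1)) = of_int \<lfloor>t + R\<rfloor> - of_int \<lceil>t - R\<rceil> + 1" using True by simp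
  ultimately show ?thesis by linarith
 qed (use assms in simp)
 finally show ?thesis .
qed

text \<open>Cut off at distance 1, so that sums over integers are logarithmic; shifts closer than
  that to a degenerate line are charged to the one-variable bound instead.\<close>

definition recip :: "real => real" where "recip t = (if \<bar>t\<bar> >= 1 then 1 / \<bar>t\<bar> else 0)"

lemma recip_nonneg: "recip t >= 0" by (simp add: recip_def)

lemma sum_recip:
 fixes a b :: int
 assumes M: "of_int (b - a + 1) <= real_of_int M" "M >= 1"
 shows "(\<Sum>r\<in>{a..b}. recip (of_int r - t)) <= 2 * (1 + ln (of_int M))"
proof -
 have "(\<Sum>r\<in>{a..b}. recip (of_int r - t)) = (\<Sum>r\<in>{r\<in>{a..b}. 1 <= \<bar>of_int r - t\<bar>}. 1 / \<bar>of_int r - t\<bar>)"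
  unfolding recip_def by (rule sum.inter_filter[symmetric]) simp
 then show ?thesis using sum_inverse_dist[OF M] by simp
qed

text \<open>The three kinds of shifts \<open>(q1, q2)\<close>: those at distance at least 1 from the degenerate
 directions, those with \<open>q2 = 0\<close>, and those near a degenerate direction, where only a
 one-dimensional bound \<open>E q1\<close> is available.\<close>

lemma Weyl_shift_sum:
 fixes T :: "int => int => real" and Q1 Q2 :: int and c1 c2 E :: "int => real"
 assumes Q: "Q1 >= 1" "Q2 >= 1" and nn: "G >= 0" "\<rho> >= 0" "\<And>q. E q >= 0" "R >= 0"
  and T0: "T 0 0 <= T0"
  and T: "\<And>q1 q2. [|\<bar>q1\<bar> < Q1; \<bar>q2\<bar> < Q2; q1 \<noteq> 0 \<or> q2 \<noteq> 0|] ==> T q1 q2 <=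
    G * (recip (of_int q2 - 0) + recip (of_int q2 - c1 q1) + recip (of_int q2 - c2 q1))
    + (if q2 = 0 then G * \<rho> * recip (of_int q1 - 0) else 0)
    + ((if q1 \<noteq> 0 \<and> \<bar>of_int q2 - c1 q1\<bar> <= R then E q1 else 0) + (if q1 \<noteq> 0 \<and> \<bar>of_int q2 - c2 q1\<bar> <= R then E q1 else 0))"
  and L: "1 + ln (2 * of_int Q1) <= L" "1 + ln (2 * of_int Q2) <= L"
 shows "(\<Sum>q1\<in>{-(Q1-1)..Q1-1}. \<Sum>q2\<in>{-(Q2-1)..Q2-1}. T q1 q2) <= T0 + 12 * of_int Q1 * (G * L) + 2 * G * \<rho> * L
  + 2 * (2 * R + 1) * (\<Sum>q1\<in>{-(Q1-1)..Q1-1} - {0}. E q1)"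
proof -
 define Z1 where "Z1 = {-(Q1-1)..Q1-1}"
 define Z2 where "Z2 = {-(Q2-1)..Q2-1}"
 define e where "e c q1 q2 = (if q1 \<noteq> 0 \<and> \<bar>real_of_int q2 - c q1\<bar> <= R then E q1 else 0)" for c :: "int => real" and q1 q2 :: int
 define h where "h q1 q2 = (if q2 = 0 then G * \<rho> * recip (of_int q1 - 0) else 0)" for q1 q2 :: int
 define k where "k q1 q2 = G * (recip (of_int q2 - 0) + recip (of_int q2 - c1 q1) + recip (of_int q2 - c2 q1))" for q1 q2 :: int
 have z: "0 \<in> Z1" "0 \<in> Z2" "finite Z1" "finite Z2" using Q by (auto simp: Z1_def Z2_def)
 have en: "e c q1 q2 >= 0" "h q1 q2 >= 0" "k q1 q2 >= 0" for c q1 q2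
  using nn recip_nonneg by (auto simp: e_def h_def k_def add_nonneg_nonneg)
 have "(\<Sum>q1\<in>Z1. \<Sum>q2\<in>Z2. T q1 q2) <= (\<Sum>q1\<in>Z1. \<Sum>q2\<in>Z2. (if q1 = 0 then if q2 = 0 then \<bar>T0\<bar> + (T0 - \<bar>T0\<bar>) else 0 else 0) + (k q1 q2 + h q1 q2 + (e c1 q1 q2 + e c2 q1 q2)))"
 proof (intro sum_mono)
  fix q1 q2 assume q: "q1 \<in> Z1" "q2 \<in> Z2"
  show "T q1 q2 <= (if q1 = 0 then if q2 = 0 then \<bar>T0\<bar> + (T0 - \<bar>T0\<bar>) else 0 else 0) + (k q1 q2 + h q1 q2 + (e c1 q1 q2 + e c2 q1 q2))"
  proof (cases "q1 = 0 \<and> q2 = 0")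
   case True
   have "0 <= k q1 q2 + h q1 q2 + (e c1 q1 q2 + e c2 q1 q2)" using en by (intro add_nonneg_nonneg)
   then show ?thesis using True T0 by simp
  next
   case False
   then show ?thesis using T[of q1 q2] q by (auto simp: Z1_def Z2_def k_def h_def e_def)
  qed
 qed
 also have "... = T0 + ((\<Sum>q1\<in>Z1. \<Sum>q2\<in>Z2. k q1 q2) + (\<Sum>q1\<in>Z1. \<Sum>q2\<in>Z2. h q1 q2) + ((\<Sum>q1\<in>Z1. \<Sum>q2\<in>Z2. e c1 q1 q2) + (\<Sum>q1\<in>Z1. \<Sum>q2\<in>Z2. e c2 q1 q2)))"
 proof -
  have "(\<Sum>q1\<in>Z1. \<Sum>q2\<in>Z2. (if q1 = 0 then if q2 = 0 then \<bar>T0\<bar> + (T0 - \<bar>T0\<bar>) else 0 else 0)) = (\<Sum>q1\<in>Z1. if q1 = 0 then T0 else 0)"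
   using z by (intro sum.cong refl) (auto simp: sum.delta)
  also have "... = T0" using z by (simp add: sum.delta)
  finally show ?thesis by (simp only: sum.distrib)
 qed
 finally have main: "(\<Sum>q1\<in>Z1. \<Sum>q2\<in>Z2. T q1 q2) <= T0 + ((\<Sum>q1\<in>Z1. \<Sum>q2\<in>Z2. k q1 q2) + (\<Sum>q1\<in>Z1. \<Sum>q2\<in>Z2. h q1 q2) + ((\<Sum>q1\<in>Z1. \<Sum>q2\<in>Z2. e c1 q1 q2) + (\<Sum>q1\<in>Z1. \<Sum>q2\<in>Z2. e c2 q1 q2)))" .
 have L0: "L >= 0" using L(1) Q ln_ge_zero[of "2 * real_of_int Q1"] by linarith
 have rs: "(\<Sum>q2\<in>Z2. recip (of_int q2 - t)) <= 2 * L" "(\<Sum>q1\<in>Z1. recip (of_int q1 - t)) <= 2 * L" for t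
  unfolding Z1_def Z2_def using sum_recip[of "Q2 - 1" "-(Q2-1)" "2 * Q2" t] sum_recip[of "Q1 - 1" "-(Q1-1)" "2 * Q1" t] Q L by auto
 have "(\<Sum>q1\<in>Z1. \<Sum>q2\<in>Z2. k q1 q2) <= (\<Sum>q1\<in>Z1. G * (2 * L + 2 * L + 2 * L))"
 proof (rule sum_mono)
  fix q1
  show "(\<Sum>q2\<in>Z2. k q1 q2) <= G * (2 * L + 2 * L + 2 * L)"
   unfolding k_def sum_distrib_left[symmetric] sum.distrib by (intro mult_left_mono add_mono rs nn)
 qed
 also have "... = real (card Z1) * (6 * (G * L))" by simp
 also have "... <= (2 * of_int Q1) * (6 * (G * L))" using nn L0 Q by (intro mult_right_mono) (auto simp: Z1_def)
 finally have K: "(\<Sum>q1\<in>Z1. \<Sum>q2\<in>Z2. k q1 q2) <= 12 * of_int Q1 * (G * L)" by simp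
 have "(\<Sum>q1\<in>Z1. \<Sum>q2\<in>Z2. h q1 q2) = (\<Sum>q1\<in>Z1. G * \<rho> * recip (of_int q1 - 0))"
  unfolding h_def using z by (intro sum.cong refl) (simp add: sum.delta)
 also have "... <= G * \<rho> * (2 * L)" unfolding sum_distrib_left[symmetric] using nn by (intro mult_left_mono rs) auto
 finally have Hh: "(\<Sum>q1\<in>Z1. \<Sum>q2\<in>Z2. h q1 q2) <= 2 * G * \<rho> * L" by simp
 have Ee: "(\<Sum>q1\<in>Z1. \<Sum>q2\<in>Z2. e c q1 q2) <= (2 * R + 1) * (\<Sum>q1\<in>Z1 - {0}. E q1)" for c
 proof -
  have "(\<Sum>q1\<in>Z1. \<Sum>q2\<in>Z2. e c q1 q2) = (\<Sum>q1\<in>Z1 - {0}. \<Sum>q2\<in>Z2. e c q1 q2)"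
   using z by (intro sum.mono_neutral_right) (auto simp: e_def)
  also have "... <= (\<Sum>q1\<in>Z1 - {0}. (2 * R + 1) * E q1)"
  proof (rule sum_mono)
   fix q1 assume q1: "q1 \<in> Z1 - {0}"
   have "(\<Sum>q2\<in>Z2. e c q1 q2) = (\<Sum>q2\<in>{q2\<in>Z2. \<bar>of_int q2 - c q1\<bar> <= R}. E q1)"
   proof -
    have "(\<Sum>q2\<in>Z2. e c q1 q2) = (\<Sum>q2\<in>Z2. if \<bar>of_int q2 - c q1\<bar> <= R then E q1 else 0)" using q1 by (simp add: e_def)
    also have "... = (\<Sum>q2\<in>{q2\<in>Z2. \<bar>of_int q2 - c q1\<bar> <= R}. E q1)" by (rule sum.inter_filter[OF z(4), symmetric])
    finally show ?thesis .
   qed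
   also have "... <= (2 * R + 1) * E q1" unfolding Z2_def using nn card_int_within[OF nn(4), of "-(Q2-1)" "Q2-1" "c q1"] by (simp add: mult_right_mono)
   finally show "(\<Sum>q2\<in>Z2. e c q1 q2) <= (2 * R + 1) * E q1" .
  qed
  finally show ?thesis by (simp add: sum_distrib_left)
 qed
 show ?thesis using main K Hh Ee[of c1] Ee[of c2] unfolding Z1_def Z2_def by (simp add: algebra_simps)
qed

text \<open>As a quadratic in \<open>v / u\<close> the form has a discriminant proportional to
  \<open>(ga + 1)^2 - ga^2 = 2 * ga + 1 > 0\<close>. So there are two distinct real zero lines for
  every \<open>ga\<close>, and degenerate shifts cannot be avoided.\<close>

lemma Dq_factor:
 assumes "ga > 0"
 shows "Dq ga u v = 2 * ga * ((v - (- (ga + 1) + sqrt (2 * ga + 1)) / ga * u) * (v - (- (ga + 1) - sqrt (2 * ga + 1)) / ga * u))"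
proof -
 define s where "s = sqrt (2 * ga + 1)"
 have s: "s * s = 2 * ga + 1" using assms by (simp add: s_def)
 have "ga * ga * ((v - (- (ga + 1) + s) / ga * u) * (v - (- (ga + 1) - s) / ga * u)) = (ga * v + (ga + 1) * u - s * u) * (ga * v + (ga + 1) * u + s * u)"
  using assms by (simp add: field_simps)
 also have "... = (ga * v + (ga + 1) * u)\<^sup>2 - (s * s) * u^2" by (simp add: power2_eq_square algebra_simps)
 also have "... = ga * ga * (u^2 + v^2) + ga * 2 * (ga + 1) * (u * v)" unfolding s by (simp add: power2_eq_square algebra_simps)
 finally have "ga * (ga * ((v - (- (ga + 1) + s) / ga * u) * (v - (- (ga + 1) - s) / ga * u))) = ga * (ga * (u^2 + v^2) + 2 * (ga + 1) * (u * v))"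
  by (simp add: algebra_simps)
 then have "ga * ((v - (- (ga + 1) + s) / ga * u) * (v - (- (ga + 1) - s) / ga * u)) = ga * (u^2 + v^2) + 2 * (ga + 1) * (u * v)"
  using assms by simp
 then show ?thesis unfolding s_def[symmetric] Dq_def mult.assoc[of 2 ga] by simp
qed

text \<open>Arithmetic-geometric mean. It separates the two zero lines and turns the inverse root of
  the determinant into a sum of inverse distances.\<close>

lemma inverse_sqrt_mult_le:
 fixes a b :: real
 assumes "a > 0" "b > 0"
 shows "1 / sqrt (a * b) <= 1 / a + 1 / b"
proof -
 have "0 <= (1 / sqrt a - 1 / sqrt b)\<^sup>2" by simp
 also have "... = 1 / a + 1 / b - 2 * (1 / sqrt (a * b))"
  using assms by (simp add: power2_diff power_divide real_sqrt_mult)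
 finally have "2 * (1 / sqrt (a * b)) <= 1 / a + 1 / b" by simp
 moreover have "1 / sqrt (a * b) >= 0" using assms by simp
 ultimately show ?thesis by linarith
qed

lemma sum_inverse_sqrt: "(\<Sum>n\<in>{1..N}. 1 / sqrt (real n)) <= 2 * sqrt (real N)"
proof (induction N)
 case (Suc N)
 have "1 / sqrt (real (Suc N)) <= 2 * (sqrt (real (Suc N)) - sqrt (real N))"
 proof -
  define a where "a = sqrt (real (Suc N))"
  define b where "b = sqrt (real N)"
  have ab: "a > 0" "0 <= b" "b <= a" by (simp_all add: a_def b_def)
  have "(a - b) * (a + b) = 1" by (simp add: a_def b_def algebra_simps)
  moreover have "(a - b) * (a + b) <= (a - b) * (2 * a)" using ab by (intro mult_left_mono) auto
  ultimately have "1 <= 2 * (a - b) * a" by (simp add: mult_ac)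
  then have "1 / a <= 2 * (a - b)" using ab by (simp add: divide_le_eq)
  then show ?thesis by (simp only: a_def b_def)
 qed
 then show ?case using Suc by simp
qed simp

section \<open>Sums over boxes and hyperbolic regions\<close>

text \<open>The bound \<open>1/8\<close> yields \<open>\<rho> <= w\<close>, and
  \<open>1 / (192 * kc ga 3)\<close> keeps the increments of the twice differenced phase at most
  \<open>1/2\<close>.\<close>

definition c\<rho> :: "real => real" where "c\<rho> ga = min (1/8) (1 / (192 * kc ga 3))"
definition wmax :: "real => real" where "wmax ga = min (w1 ga) (min (w2 ga) (e0 ga / NDc ga))"
definition kmin :: "real => real" where "kmin ga = ga / (4 * ga + 4)"
definition r1 :: "real => real" where "r1 ga = (- (ga + 1) + sqrt (2 * ga + 1)) / ga"
definition r2 :: "real => real" where "r2 ga = (- (ga + 1) - sqrt (2 * ga + 1)) / ga"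
definition s0 :: "real => real" where "s0 ga = sqrt (p0 ga * e0 ga / 32)"
definition Gam :: "real => real" where "Gam ga = 4 / sqrt (e0 ga) + 4 / sqrt (2 * ga)"

text \<open>For given \<open>u\<close> the two zeros in \<open>v\<close> are at least
  \<open>2 * |u| / ga\<close> apart, so one of the two distances is at least
  \<open>kmin ga * m / ga\<close>; the factorisation then makes the other one small.\<close>

lemma near_root:
 assumes g: "ga > 0" and m: "m > 0" "kmin ga * m <= \<bar>u\<bar>" and n: "n >= 0" "\<bar>Dq ga u v\<bar> < n * m^2"
 shows "\<bar>v - r1 ga * u\<bar> <= n * m / (2 * kmin ga) \<or> \<bar>v - r2 ga * u\<bar> <= n * m / (2 * kmin ga)"
proof (rule ccontr)
 assume neg: "\<not> ?thesis"
 define t where "t = n * m / (2 * kmin ga)"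
 define \<alpha> where "\<alpha> = \<bar>v - r1 ga * u\<bar>"
 define \<beta> where "\<beta> = \<bar>v - r2 ga * u\<bar>"
 have k: "kmin ga > 0" using g by (simp add: kmin_def)
 have t0: "t >= 0" using n m k by (simp add: t_def)
 have ab: "\<alpha> > t" "\<beta> > t" using neg by (auto simp: t_def \<alpha>_def \<beta>_def)
 have "r1 ga - r2 ga = 2 * sqrt (2 * ga + 1) / ga" using g by (simp add: r1_def r2_def diff_divide_distrib[symmetric])
 moreover have "sqrt (2 * ga + 1) >= 1" using g by simp
 ultimately have r: "r1 ga - r2 ga >= 2 / ga" using g by (simp add: divide_right_mono)
 have "2 / ga > 0" using g by simp
 then have rp: "r1 ga - r2 ga >= 0" using r by linarith
 have "2 / ga * (kmin ga * m) <= (r1 ga - r2 ga) * \<bar>u\<bar>" using r rp m k g by (intro mult_mono) auto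
 also have "... = \<bar>(r1 ga - r2 ga) * u\<bar>" using rp by (simp add: abs_mult)
 also have "... <= \<alpha> + \<beta>" unfolding \<alpha>_def \<beta>_def left_diff_distrib by linarith
 finally have "2 * (kmin ga * m / ga) <= \<alpha> + \<beta>" by simp
 then have "t * (kmin ga * m / ga) <= \<alpha> * \<beta>"
 proof -
  assume s: "2 * (kmin ga * m / ga) <= \<alpha> + \<beta>"
  have p: "kmin ga * m / ga >= 0" using k m g by simp
  show ?thesis
  proof (cases "kmin ga * m / ga <= \<beta>")
   case True then show ?thesis using ab t0 p by (intro mult_mono) auto
  next
   case False
   then have "kmin ga * m / ga <= \<alpha>" using s by linarith
   then have "(kmin ga * m / ga) * t <= \<alpha> * \<beta>" using ab t0 p by (intro mult_mono) auto
   then show ?thesis by (simp add: mult.commute)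
  qed
 qed
 then have "2 * ga * (t * (kmin ga * m / ga)) <= 2 * ga * (\<alpha> * \<beta>)" using g by (intro mult_left_mono) auto
 moreover have "2 * ga * (t * (kmin ga * m / ga)) = n * m^2" using g k by (simp add: t_def power2_eq_square)
 moreover have "2 * ga * (\<alpha> * \<beta>) = \<bar>Dq ga u v\<bar>" unfolding Dq_factor[OF g] \<alpha>_def \<beta>_def r1_def r2_def using g by (simp add: abs_mult)
 ultimately show False using n by linarith
qed

context phase
begin

text \<open>The one-variable bound summed over the rows of a box, with \<open>m <= \<rho>\<close>
  inserted in the growing term and \<open>m >= |q| / (2 * A)\<close> in the decaying one. Only the
  first coordinate \<open>q\<close> of the shift remains.\<close>

definition Eq :: "real => real => real => real" where
 "Eq w \<rho> q = 16 * hT ga * (w * A) * (2 * w * (s0 ga * sqrt (X * \<rho>)) + B * sqrt (2 * A) / (s0 ga * sqrt X) * (1 / sqrt \<bar>q\<bar>))"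

lemma hT_pos: "hT ga >= 1"
proof -
 have "192 * kc ga 3 / (p0 ga * e0 ga) >= 0" using kc_pos'[of 3] p0_pos[OF gam] e0_bounds[OF gam] by simp
 then show ?thesis by (simp add: hT_def)
qed

lemma s0_pos: "s0 ga > 0" using p0_pos[OF gam] e0_bounds[OF gam] by (simp add: s0_def)

lemma Eq_nonneg: "w >= 0 ==> \<rho> >= 0 ==> Eq w \<rho> q >= 0"
 unfolding Eq_def using hT_pos s0_pos pos by (intro mult_nonneg_nonneg add_nonneg_nonneg) auto

text \<open>The second difference test in \<open>b\<close> for each fixed \<open>a\<close>, and the
  trivial sum over \<open>a\<close>. The point at which the lower bound \<open>M\<close> is assumed
  is the corner of the full box, common to all shifts, while the sum runs over the part that
  overlaps its translate.\<close>

lemma rows_bound: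
 fixes a0 a1 b0 b1 i j i' j' q1 q2 :: int and w \<rho> :: real
 defines "u \<equiv> of_int q1 / of_int a0" and "v \<equiv> of_int q2 / of_int b0"
 defines "m \<equiv> max \<bar>u\<bar> \<bar>v\<bar>"
 assumes base: "A <= of_int a0" "of_int a1 <= 2 * A" "B <= of_int b0" "of_int b1 <= 4 * B" "of_int (a1 - a0) <= w * A" "of_int (b1 - b0) <= w * B" 
  and sub: "a0 <= i" "j <= a1" "b0 <= i'" "j' <= b1" "i <= j" "i' <= j'"
  and w: "w <= wmax ga" "1 / (A * B) <= w" "4 <= w * A" "4 <= w * B" and \<rho>: "0 < \<rho>" "\<rho> <= w"
  and q: "\<bar>of_int q1\<bar> <= A * \<rho>" "\<bar>of_int q2\<bar> <= B * \<rho>" "q1 \<noteq> 0"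
  and M: "e0 ga * m <= \<bar>ga * u + (ga + 2) * v\<bar>" and m\<rho>: "m <= \<rho>"
 shows "norm (\<Sum>a\<in>{i..j}. \<Sum>b\<in>{i'..j'}. ee (Diff [(of_int q1, of_int q2)] F (of_int a) (of_int b))) <= Eq w \<rho> (of_int q1)"
proof -
 define \<mu> where "\<mu> = p0 ga * e0 ga * (X * m) / (32 * B^2)"
 have w216: "w <= 1/216" "w <= w2 ga" using w(1) by (simp_all add: wmax_def w1_def)
 have wp: "w > 0" using \<rho> by linarith
 have r: "real_of_int a0 <= of_int i" "real_of_int i <= of_int j" "real_of_int j <= of_int a1" 
   "real_of_int b0 <= of_int i'" "real_of_int i' <= of_int j'" "real_of_int j' <= of_int b1" using sub by simp_all
 have a0: "real_of_int a0 > 0" "real_of_int b0 > 0" using base pos by linarith+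
 have um: "\<bar>of_int q1\<bar> / (2 * A) <= m"
 proof -
  have "\<bar>real_of_int q1\<bar> / (2 * A) <= \<bar>of_int q1\<bar> / of_int a0" using base r a0 pos by (intro divide_left_mono mult_pos_pos) auto
  also have "... = \<bar>u\<bar>" unfolding u_def using a0 by simp
  finally show ?thesis by (simp add: m_def)
 qed
 have q1p: "\<bar>real_of_int q1\<bar> > 0" using q(3) by simp
 have "0 < \<bar>real_of_int q1\<bar> / (2 * A)" using q1p pos by (intro divide_pos_pos) auto
 then have mp: "m > 0" using um by linarith
 have \<rho>w: "A * \<rho> <= w * A" "B * \<rho> <= w * B" using \<rho> pos by (simp_all add: mult.commute)
 have smu: "sqrt \<mu> = s0 ga * sqrt (X * m) / B"
 proof -
  have "\<mu> = (p0 ga * e0 ga / 32) * (X * m) / B^2" by (simp add: \<mu>_def)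
  then show ?thesis using pos by (simp add: s0_def real_sqrt_mult real_sqrt_divide)
 qed
 have row: "norm (\<Sum>b\<in>{i'..j'}. ee (Diff [(of_int q1, of_int q2)] F (of_int a) (of_int b)))
   <= 8 * hT ga * (2 * (w * B) * sqrt \<mu> + 1 / sqrt \<mu>)" if a: "a \<in> {i..j}" for a
  unfolding \<mu>_def m_def u_def v_def
 proof (rule one_dim_bound_diff)
  have ar: "real_of_int i <= of_int a" "real_of_int a <= of_int j" using a by simp_all
  have e: "real_of_int (a1 - a0) = of_int a1 - of_int a0" "real_of_int (b1 - b0) = of_int b1 - of_int b0" "real_of_int (j' - i') = of_int j' - of_int i'" by simp_all
  show "A <= of_int a0" "of_int a0 <= 2 * A" "B <= of_int b0" "of_int b0 <= 4 * B" using base r by linarith+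
  show "\<bar>of_int a - real_of_int a0\<bar> <= w * A" using base(5) ar r unfolding e by linarith
  show "\<bar>of_int i' - real_of_int b0\<bar> <= w * B" "\<bar>of_int j' - real_of_int b0\<bar> <= w * B" "of_int (j' - i') <= w * B"
   using base(6) r unfolding e by linarith+
  show "\<bar>of_int q1\<bar> <= w * A" "\<bar>of_int q2\<bar> <= w * B" using q \<rho>w by linarith+
 qed (use w w216 mp M in \<open>auto simp: m_def u_def v_def\<close>)
 have "norm (\<Sum>a\<in>{i..j}. \<Sum>b\<in>{i'..j'}. ee (Diff [(of_int q1, of_int q2)] F (of_int a) (of_int b))) <= (\<Sum>a\<in>{i..j}. 8 * hT ga * (2 * (w * B) * sqrt \<mu> + 1 / sqrt \<mu>))"
  by (rule sum_norm_le) (rule row)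
 also have "... = of_int (j - i + 1) * (8 * hT ga * (2 * (w * B) * sqrt \<mu> + 1 / sqrt \<mu>))" using sub by simp
 also have "... <= (2 * (w * A)) * (8 * hT ga * (2 * w * (s0 ga * sqrt (X * \<rho>)) + B * sqrt (2 * A) / (s0 ga * sqrt X) * (1 / sqrt \<bar>of_int q1\<bar>)))"
 proof (rule mult_mono)
  have e: "real_of_int (j - i + 1) = of_int j - of_int i + 1" "real_of_int (a1 - a0) = of_int a1 - of_int a0" by simp_all
  show "of_int (j - i + 1) <= 2 * (w * A)" using base(5) r w(3) unfolding e by linarith
  have "2 * (w * B) * sqrt \<mu> = 2 * w * (s0 ga * sqrt (X * m))" unfolding smu using pos by simp
  also have "... <= 2 * w * (s0 ga * sqrt (X * \<rho>))" using wp s0_pos m\<rho> pos by (intro mult_left_mono) auto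
  finally have 1: "2 * (w * B) * sqrt \<mu> <= 2 * w * (s0 ga * sqrt (X * \<rho>))" .
  have "1 / sqrt \<mu> = B / (s0 ga * sqrt X) * (1 / sqrt m)" unfolding smu by (simp add: real_sqrt_mult)
  also have "... <= B / (s0 ga * sqrt X) * (sqrt (2 * A) / sqrt \<bar>of_int q1\<bar>)"
  proof (rule mult_left_mono)
   have "sqrt (\<bar>of_int q1\<bar> / (2 * A)) <= sqrt m" using um by simp
   then have "1 / sqrt m <= 1 / sqrt (\<bar>of_int q1\<bar> / (2 * A))" using mp q1p pos by (intro divide_left_mono mult_pos_pos) auto
   then show "1 / sqrt m <= sqrt (2 * A) / sqrt \<bar>of_int q1\<bar>" by (simp add: real_sqrt_divide)
  qed (use s0_pos pos in simp)
  finally have 2: "1 / sqrt \<mu> <= B * sqrt (2 * A) / (s0 ga * sqrt X) * (1 / sqrt \<bar>of_int q1\<bar>)" by simp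
  show "8 * hT ga * (2 * (w * B) * sqrt \<mu> + 1 / sqrt \<mu>) <= 8 * hT ga * (2 * w * (s0 ga * sqrt (X * \<rho>)) + B * sqrt (2 * A) / (s0 ga * sqrt X) * (1 / sqrt \<bar>of_int q1\<bar>))"
   using hT_pos by (intro mult_left_mono add_mono 1 2) auto
  have "sqrt \<mu> >= 0" unfolding smu using s0_pos pos mp by simp
  then show "0 <= 8 * hT ga * (2 * (w * B) * sqrt \<mu> + 1 / sqrt \<mu>)" using hT_pos wp pos by simp
 qed (use wp pos in simp)
 also have "... = Eq w \<rho> (of_int q1)" by (simp add: Eq_def)
 finally show ?thesis .
qed

text \<open>Three cases for the form at the corner of the box. If it is of order \<open>m^2\<close>,
  the two-dimensional bound is inverse in \<open>m\<close>, hence in \<open>q2\<close>, or in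
  \<open>q1\<close> when \<open>q2 = 0\<close>. If it is smaller but at least
  \<open>NDc ga * w * m^2\<close>, and the shift keeps distance 1 from both lines, the factorisation
  gives inverse distances. Otherwise the shift lies within \<open>R\<close> of a line and the rows
  are estimated one by one. \<open>C1\<close> and \<open>C2\<close> are the positions of the two
  lines for given \<open>q1\<close>.\<close>

lemma shift_case_bound:
 fixes a0 a1 b0 b1 i j i' j' q1 q2 :: int and w \<rho> :: real
 defines "G \<equiv> Gam ga * (TC ga * (1 + ln (50 * B))^3 * (B^3 / X))"
 defines "C1 \<equiv> r1 ga * (of_int b0 / of_int a0) * of_int q1" and "C2 \<equiv> r2 ga * (of_int b0 / of_int a0) * of_int q1"
 defines "R \<equiv> 1 + 2 * NDc ga * w * (B * \<rho>) / kmin ga"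
 assumes base: "A <= of_int a0" "of_int a1 <= 2 * A" "B <= of_int b0" "of_int b1 <= 4 * B" "of_int (a1 - a0) <= w * A" "of_int (b1 - b0) <= w * B" 
  and ne: "a0 <= a1" "b0 <= b1"
  and sub: "a0 <= i" "j <= a1" "b0 <= i'" "j' <= b1"
  and w: "w <= wmax ga" "1 / (A * B) <= w" "4 <= w * A" "4 <= w * B" and \<rho>: "0 < \<rho>" "\<rho> <= w" "96 * kc ga 3 * (X * \<rho> * w) / B <= 1/2"
  and q: "\<bar>of_int q1\<bar> <= A * \<rho>" "\<bar>of_int q2\<bar> <= B * \<rho>" "q1 \<noteq> 0 \<or> q2 \<noteq> 0"
 shows "norm (\<Sum>a\<in>{i..j}. \<Sum>b\<in>{i'..j'}. ee (Diff [(of_int q1, of_int q2)] F (of_int a) (of_int b)))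
  <= G * (recip (of_int q2 - 0) + recip (of_int q2 - C1) + recip (of_int q2 - C2))
    + (if q2 = 0 then G * (A / B) * recip (of_int q1 - 0) else 0)
    + ((if q1 \<noteq> 0 \<and> \<bar>of_int q2 - C1\<bar> <= R then Eq w \<rho> (of_int q1) else 0) + (if q1 \<noteq> 0 \<and> \<bar>of_int q2 - C2\<bar> <= R then Eq w \<rho> (of_int q1) else 0))"
  (is "?S <= ?N + ?Z + ?E")
proof -
 define u where "u = real_of_int q1 / of_int a0"
 define v where "v = real_of_int q2 / of_int b0"
 define m where "m = max \<bar>u\<bar> \<bar>v\<bar>"
 define T where "T = TC ga * (1 + ln (50 * B))^3"
 note e = e0_bounds[OF gam]
 have w216: "w <= 1/216" "w <= w1 ga" "w <= w2 ga" "w <= e0 ga / NDc ga" using w(1) by (simp_all add: wmax_def w1_def)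
 have wp: "w > 0" using \<rho> by linarith
 have NDp: "NDc ga > 0" unfolding NDc_def using ND_pos[OF gam] gam by (intro add_pos_pos) auto
 have k: "kmin ga > 0" using gam by (simp add: kmin_def)
 have "kap ga > 0" "smooth_c > 0" using p0_pos[OF gam] kc_pos'[of 3] kc_pos'[of 4] kc_pos'[of 5] by (simp_all add: kap_def smooth_c_def add_pos_pos)
 then have TC0: "TC ga > 0" unfolding TC_def using p0_pos[OF gam] by simp
 have ln0: "ln (50 * B) >= 0" using B1 by simp
 have T0: "T >= 0" unfolding T_def using TC0 ln0 by simp
 have Gm: "Gam ga > 0" unfolding Gam_def using e gam by (intro add_pos_pos) auto
 have G: "G = Gam ga * (T * (B^3 / X))" by (simp add: G_def T_def)
 have G0: "G >= 0" unfolding G using Gm T0 pos by simp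
 have N0: "?N >= 0" using G0 recip_nonneg by (intro mult_nonneg_nonneg add_nonneg_nonneg)
 have Z0: "?Z >= 0" using G0 recip_nonneg pos by simp
 have E0: "?E >= 0" using Eq_nonneg wp \<rho> by simp
 show ?thesis
 proof (cases "i <= j \<and> i' <= j'")
  case False
  then have "?S = 0" by auto
  then show ?thesis using N0 Z0 E0 by linarith
 next
  case True
  have r: "real_of_int a0 <= of_int i" "real_of_int i <= of_int j" "real_of_int j <= of_int a1" 
   "real_of_int b0 <= of_int i'" "real_of_int i' <= of_int j'" "real_of_int j' <= of_int b1" using sub True by simp_all
  have a0: "real_of_int a0 > 0" "real_of_int b0 > 0" "of_int a0 <= 2 * A" "of_int b0 <= 4 * B" using base r pos by linarith+
  have au: "\<bar>u\<bar> = \<bar>of_int q1\<bar> / of_int a0" "\<bar>v\<bar> = \<bar>of_int q2\<bar> / of_int b0" using a0 by (simp_all add: u_def v_def)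
  have m\<rho>: "m <= \<rho>"
  proof -
   have "\<bar>real_of_int q1\<bar> / of_int a0 <= (A * \<rho>) / A" using q base pos \<rho> by (intro frac_le) auto
   moreover have "\<bar>real_of_int q2\<bar> / of_int b0 <= (B * \<rho>) / B" using q base pos \<rho> by (intro frac_le) auto
   ultimately show ?thesis unfolding m_def au using pos by simp
  qed
  have mp: "m > 0"
   using q(3) a0 unfolding m_def au by (auto simp: less_max_iff_disj)
  have um: "\<bar>u\<bar> <= m" "\<bar>v\<bar> <= m" by (simp_all add: m_def)
  have two: "?S <= T * (B^2 / (X * sqrt \<bar>Dq ga u v\<bar>))" if D: "NDc ga * w * m^2 <= \<bar>Dq ga u v\<bar>"
   unfolding T_def u_def v_def
  proof (rule two_dim_bound)
   have e: "real_of_int (a1 - a0) = of_int a1 - of_int a0" "real_of_int (b1 - b0) = of_int b1 - of_int b0" 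
    "real_of_int (j - i) = of_int j - of_int i" "real_of_int (j' - i') = of_int j' - of_int i'" by simp_all
   have \<rho>w: "A * \<rho> <= w * A" "B * \<rho> <= w * B" using \<rho> pos by (simp_all add: mult.commute)
   show "A <= of_int i" "of_int j <= 2 * A" "B <= of_int i'" "of_int j' <= 4 * B" "of_int (j - i) <= w * A" "of_int (j' - i') <= w * B"
    using base r unfolding e by linarith+
   show "\<bar>of_int a0 - real_of_int i\<bar> <= w * A" "\<bar>of_int b0 - real_of_int i'\<bar> <= w * B" using base r unfolding e by linarith+
   show "\<bar>of_int q1\<bar> <= w * A" "\<bar>of_int q2\<bar> <= w * B" using q \<rho>w by linarith+
   have "nrm A B (of_int q1, of_int q2) <= 2 * \<rho>"
   proof -
    have "\<bar>real_of_int q1\<bar> / A <= \<rho>" "\<bar>real_of_int q2\<bar> / B <= \<rho>" using q pos by (simp_all add: divide_le_eq mult.commute)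
    then show ?thesis by (simp add: nrm_def)
   qed
   then have "kc ga 3 * (X * nrm A B (of_int q1, of_int q2)) * (48 * w) / B <= kc ga 3 * (X * (2 * \<rho>)) * (48 * w) / B"
    using kc_pos'[of 3] pos wp by (intro divide_right_mono mult_right_mono mult_left_mono) auto
   also have "... = 96 * kc ga 3 * (X * \<rho> * w) / B" by simp
   finally show "kc ga 3 * (X * nrm A B (of_int q1, of_int q2)) * (48 * w) / B <= 1/2" using \<rho>(3) by linarith
  qed (use True w w216 mp D in \<open>auto simp: m_def u_def v_def\<close>)
  show ?thesis
  proof (cases "e0 ga * m^2 <= \<bar>Dq ga u v\<bar>")
   case big: True
   have "w * NDc ga <= e0 ga" using w216(4) NDp by (simp add: pos_le_divide_eq)
   then have "(w * NDc ga) * m^2 <= e0 ga * m^2" by (intro mult_right_mono) auto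
   then have "NDc ga * w * m^2 <= \<bar>Dq ga u v\<bar>" using big by (simp add: mult.commute)
   note two[OF this]
   also have "T * (B^2 / (X * sqrt \<bar>Dq ga u v\<bar>)) <= T * (B^2 / (X * (sqrt (e0 ga) * m)))"
   proof (intro mult_left_mono divide_left_mono T0)
    have "sqrt (e0 ga) * m = sqrt (e0 ga * m^2)" using mp by (simp add: real_sqrt_mult)
    then show sq: "sqrt (e0 ga) * m <= sqrt \<bar>Dq ga u v\<bar>" using big by simp
    have "sqrt (e0 ga) * m > 0" using e mp by simp
    then show "0 < X * sqrt \<bar>Dq ga u v\<bar> * (X * (sqrt (e0 ga) * m))" using sq pos e mp by (intro mult_pos_pos[of "X * sqrt _" "X * (_ * m)"] mult_pos_pos[of X]) linarith+
   qed (use pos in auto)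
   finally have S: "?S <= T * (B^2 / X) * (1 / sqrt (e0 ga)) * (1 / m)" by (simp add: mult_ac)
   have pre: "T * (B^2 / X) * (1 / sqrt (e0 ga)) >= 0" using T0 pos e by simp
   have Gg: "T * (B^2 / X) * (1 / sqrt (e0 ga)) * (4 * B) <= G"
   proof -
    have "(4 / sqrt (e0 ga)) * (T * (B^3 / X)) <= Gam ga * (T * (B^3 / X))"
     unfolding Gam_def using gam T0 pos by (intro mult_right_mono) auto
    moreover have "T * (B^2 / X) * (1 / sqrt (e0 ga)) * (4 * B) = (4 / sqrt (e0 ga)) * (T * (B^3 / X))"
     by (simp add: power2_eq_square power3_eq_cube mult_ac)
    ultimately show ?thesis unfolding G by simp
   qed
   show ?thesis
   proof (cases "q2 = 0")
    case False
    have q2: "\<bar>real_of_int q2\<bar> >= 1" using False by linarith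
    have "\<bar>real_of_int q2\<bar> / (4 * B) <= m"
     using um(2) a0 pos unfolding au by (intro order.trans[OF _ um(2)[unfolded au]] divide_left_mono mult_pos_pos) auto
    then have "1 / m <= 1 / (\<bar>real_of_int q2\<bar> / (4 * B))" using q2 pos mp by (intro divide_left_mono mult_pos_pos divide_pos_pos) auto
    also have "... = (4 * B) * recip (of_int q2 - 0)" using q2 by (simp add: recip_def)
    finally have "T * (B^2 / X) * (1 / sqrt (e0 ga)) * (1 / m) <= T * (B^2 / X) * (1 / sqrt (e0 ga)) * ((4 * B) * recip (of_int q2 - 0))"
     using pre by (intro mult_left_mono)
    also have "... = (T * (B^2 / X) * (1 / sqrt (e0 ga)) * (4 * B)) * recip (of_int q2 - 0)" by (simp only: mult.assoc)
    also have "... <= G * recip (of_int q2 - 0)" by (intro mult_right_mono Gg recip_nonneg)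
    also have "... <= ?N" using G0 recip_nonneg by (intro mult_left_mono) (auto simp: add_nonneg_nonneg add.assoc)
    finally show ?thesis using S Z0 E0 by linarith
   next
    case q20: True
    then have q1: "\<bar>real_of_int q1\<bar> >= 1" using q(3) by linarith
    have "\<bar>real_of_int q1\<bar> / (2 * A) <= m"
     using um(1) a0 pos unfolding au by (intro order.trans[OF _ um(1)[unfolded au]] divide_left_mono mult_pos_pos) auto
    then have "1 / m <= 1 / (\<bar>real_of_int q1\<bar> / (2 * A))" using q1 pos mp by (intro divide_left_mono mult_pos_pos divide_pos_pos) auto
    also have "... = (2 * A) * recip (of_int q1 - 0)" using q1 by (simp add: recip_def)
    also have "... <= (4 * A) * recip (of_int q1 - 0)" using pos recip_nonneg by (intro mult_right_mono) auto
    finally have "T * (B^2 / X) * (1 / sqrt (e0 ga)) * (1 / m) <= T * (B^2 / X) * (1 / sqrt (e0 ga)) * ((4 * A) * recip (of_int q1 - 0))"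
     using pre by (intro mult_left_mono)
    also have "... = (T * (B^2 / X) * (1 / sqrt (e0 ga)) * (4 * B)) * ((A / B) * recip (of_int q1 - 0))" using pos by simp
    also have "... <= G * ((A / B) * recip (of_int q1 - 0))" using pos by (intro mult_right_mono Gg mult_nonneg_nonneg recip_nonneg) auto
    also have "... = ?Z" using q20 by simp
    finally show ?thesis using S N0 E0 by linarith
   qed
  next
   case small: False
   then have small': "\<bar>Dq ga u v\<bar> < e0 ga * m^2" by simp
   have M: "e0 ga * m <= \<bar>ga * u + (ga + 2) * v\<bar>" using Dq_dichotomy[OF gam m_def] small by blast
   have ku: "kmin ga * m <= \<bar>u\<bar>" using Dq_small_min[OF gam m_def small'] by (simp add: kmin_def)
   moreover have "kmin ga * m > 0" using k mp by simp
   ultimately have q1: "q1 \<noteq> 0" by (auto simp: u_def)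
   have rows: "?S <= Eq w \<rho> (of_int q1)"
    by (rule rows_bound[OF base sub _ _ w \<rho>(1,2) q(1,2) q1]) (use True M m\<rho> in \<open>auto simp: m_def u_def v_def\<close>)
   have roots: "v - r1 ga * u = (of_int q2 - C1) / of_int b0" "v - r2 ga * u = (of_int q2 - C2) / of_int b0"
    using a0 by (simp_all add: u_def v_def C1_def C2_def diff_divide_distrib)
   show ?thesis
   proof (cases "NDc ga * w * m^2 <= \<bar>Dq ga u v\<bar> \<and> 1 <= \<bar>of_int q2 - C1\<bar> \<and> 1 <= \<bar>of_int q2 - C2\<bar>")
    case good: True
    define \<alpha> where "\<alpha> = \<bar>of_int q2 - C1\<bar> / of_int b0"
    define \<beta> where "\<beta> = \<bar>of_int q2 - C2\<bar> / of_int b0"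
    have ab: "\<alpha> > 0" "\<beta> > 0" using good a0 by (auto simp: \<alpha>_def \<beta>_def intro!: divide_pos_pos)
    have "\<bar>Dq ga u v\<bar> = 2 * ga * (\<bar>v - r1 ga * u\<bar> * \<bar>v - r2 ga * u\<bar>)"
     unfolding Dq_factor[OF gam] r1_def r2_def using gam by (simp add: abs_mult)
    also have "... = 2 * ga * (\<alpha> * \<beta>)" unfolding roots using a0 by (simp add: \<alpha>_def \<beta>_def)
    finally have D: "\<bar>Dq ga u v\<bar> = 2 * ga * (\<alpha> * \<beta>)" .
    have "?S <= T * (B^2 / (X * sqrt \<bar>Dq ga u v\<bar>))" using good by (intro two) simp
    also have "... = T * (B^2 / X) * (1 / sqrt (2 * ga)) * (1 / sqrt (\<alpha> * \<beta>))" unfolding D real_sqrt_mult[of "2 * ga"] by simp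
    also have "... <= T * (B^2 / X) * (1 / sqrt (2 * ga)) * (1 / \<alpha> + 1 / \<beta>)"
     using T0 gam pos by (intro mult_left_mono inverse_sqrt_mult_le ab) auto
    also have "1 / \<alpha> + 1 / \<beta> = of_int b0 * (recip (of_int q2 - C1) + recip (of_int q2 - C2))"
     using good by (simp add: \<alpha>_def \<beta>_def recip_def distrib_left)
    also have "T * (B^2 / X) * (1 / sqrt (2 * ga)) * (of_int b0 * (recip (of_int q2 - C1) + recip (of_int q2 - C2)))
     <= T * (B^2 / X) * (1 / sqrt (2 * ga)) * ((4 * B) * (recip (of_int q2 - C1) + recip (of_int q2 - C2)))"
     using T0 gam pos a0 recip_nonneg by (intro mult_left_mono mult_right_mono add_nonneg_nonneg) auto
    also have "... = (4 / sqrt (2 * ga) * (T * (B^3 / X))) * (recip (of_int q2 - C1) + recip (of_int q2 - C2))"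
     by (simp add: power2_eq_square power3_eq_cube mult_ac)
    also have "... <= G * (recip (of_int q2 - C1) + recip (of_int q2 - C2))"
     unfolding G Gam_def using e T0 pos recip_nonneg by (intro mult_right_mono add_nonneg_nonneg) auto
    also have "... <= ?N" using G0 recip_nonneg[of "of_int q2 - 0"] by (intro mult_left_mono) auto
    finally show ?thesis using Z0 E0 by linarith
   next
    case bad: False
    \<comment> \<open>The summand 1 in \<open>R\<close> covers the shifts within distance 1 of a
      line whose form is still above the threshold; the other summand comes from
      \<open>near_root\<close>.\<close>
    have R1: "R >= 1" unfolding R_def using NDp wp pos \<rho> k by simp
    have "\<bar>of_int q2 - C1\<bar> <= R \<or> \<bar>of_int q2 - C2\<bar> <= R"
    proof (cases "NDc ga * w * m^2 <= \<bar>Dq ga u v\<bar>")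
     case True
     then show ?thesis using bad R1 by linarith
    next
     case False
     then have D: "\<bar>Dq ga u v\<bar> < (NDc ga * w) * m^2" by simp
     have "NDc ga * w >= 0" using NDp wp by simp
     from near_root[OF gam mp ku this D]
     have "\<bar>of_int q2 - C1\<bar> / of_int b0 <= NDc ga * w * m / (2 * kmin ga) \<or> \<bar>of_int q2 - C2\<bar> / of_int b0 <= NDc ga * w * m / (2 * kmin ga)"
      unfolding roots using a0 by simp
     then have "\<bar>of_int q2 - C1\<bar> <= NDc ga * w * m / (2 * kmin ga) * of_int b0 \<or> \<bar>of_int q2 - C2\<bar> <= NDc ga * w * m / (2 * kmin ga) * of_int b0"
      using a0 by (simp only: pos_divide_le_eq)
     moreover have "NDc ga * w * m / (2 * kmin ga) * of_int b0 <= NDc ga * w * \<rho> / (2 * kmin ga) * (4 * B)"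
      using NDp wp mp m\<rho> k a0 by (intro mult_mono divide_right_mono mult_left_mono) auto
     moreover have "NDc ga * w * \<rho> / (2 * kmin ga) * (4 * B) <= R" unfolding R_def by (simp add: mult_ac)
     ultimately show ?thesis by linarith
    qed
    then have "Eq w \<rho> (of_int q1) <= ?E" using q1 Eq_nonneg[of w \<rho> "of_int q1"] wp \<rho> by auto
    then show ?thesis using rows N0 Z0 by linarith
   qed
  qed
 qed
qed

end

section \<open>Estimate of one box and assembly of hyperbolic regions\<close>

lemma sum_blocks:
 fixes f :: "int => complex"
 assumes N: "N >= 1" and E: "E >= 0" and "a <= b"
  and f: "\<And>c d. a <= c ==> c <= d ==> d <= b ==> d - c < N ==> norm (\<Sum>n\<in>{c..d}. f n) <= E"
 shows "norm (\<Sum>n\<in>{a..b}. f n) <= (of_int (b - a) / of_int N + 1) * E"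
 using assms(3-)
proof (induction "nat (b - a)" arbitrary: a rule: less_induct)
 case less
 show ?case
 proof (cases "b - a < N")
  case True
  have "norm (\<Sum>n\<in>{a..b}. f n) <= E" using less.prems True by auto
  also have "E = (0 + 1) * E" by simp
  also have "... <= (of_int (b - a) / of_int N + 1) * E" using less.prems N E by (intro mult_right_mono add_right_mono) auto
  finally show ?thesis .
 next
  case False
  have "{a..b} = {a..a + N - 1} \<union> {a + N..b}" using False N by auto
  then have "(\<Sum>n\<in>{a..b}. f n) = (\<Sum>n\<in>{a..a + N - 1}. f n) + (\<Sum>n\<in>{a + N..b}. f n)" by (simp add: sum.union_disjoint)
  then have "norm (\<Sum>n\<in>{a..b}. f n) <= norm (\<Sum>n\<in>{a..a + N - 1}. f n) + norm (\<Sum>n\<in>{a + N..b}. f n)" by (simp add: norm_triangle_ineq)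
  moreover have "norm (\<Sum>n\<in>{a..a + N - 1}. f n) <= E" using less.prems(2)[of a "a + N - 1"] N False by auto
  moreover have "norm (\<Sum>n\<in>{a + N..b}. f n) <= (of_int (b - (a + N)) / of_int N + 1) * E"
   by (rule less.hyps) (use N False less.prems in auto)
  ultimately have "norm (\<Sum>n\<in>{a..b}. f n) <= E + (of_int (b - (a + N)) / of_int N + 1) * E" by linarith
  also have "of_int (b - (a + N)) / real_of_int N + 1 = of_int (b - a) / of_int N" using N by (simp add: field_simps)
  finally show ?thesis by (simp add: distrib_right add.commute)
 qed
qed

text \<open>The common part \<open>{L1..R1}\<close> of the rows is cut into boxes, the ends of the rows are treated
 one row at a time.\<close>

lemma norm_sum_rows:
 fixes f :: "int => int => complex" and l r :: "int => int"
 assumes N: "N >= 1" and E: "E1 >= 0" "E2 >= 0" and cd: "c <= d"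
  and l: "\<And>a. c <= a ==> a <= d ==> L0 <= l a \<and> l a <= L1" and r: "\<And>a. c <= a ==> a <= d ==> R1 <= r a \<and> r a <= R0"
  and s: "L1 - L0 <= s" "R0 - R1 <= s"
  and box: "\<And>i j. L1 <= i ==> i <= j ==> j <= R1 ==> j - i < N ==> norm (\<Sum>a\<in>{c..d}. \<Sum>b\<in>{i..j}. f a b) <= E1"
  and strip: "\<And>a i j. c <= a ==> a <= d ==> l a <= i ==> j <= r a ==> j - i + 1 <= 2 * s ==> norm (\<Sum>b\<in>{i..j}. f a b) <= E2"
  and M: "of_int (R0 - L0) <= M" "M >= 0"
 shows "norm (\<Sum>a\<in>{c..d}. \<Sum>b\<in>{l a..r a}. f a b) <= (M / of_int N + 1) * E1 + of_int (d - c + 1) * (2 * E2)"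
proof -
 have cdn: "real (card {c..d}) = of_int (d - c + 1)" using cd by simp
 have pre: "(M / of_int N + 1) * E1 >= 0" using M N E by (intro mult_nonneg_nonneg add_nonneg_nonneg) auto
 show ?thesis
 proof (cases "L1 <= R1")
  case True
  have split: "(\<Sum>b\<in>{l a..r a}. f a b) = (\<Sum>b\<in>{L1..R1}. f a b) + ((\<Sum>b\<in>{l a..L1 - 1}. f a b) + (\<Sum>b\<in>{R1 + 1..r a}. f a b))"
   if a: "a \<in> {c..d}" for a
  proof -
   have "{l a..r a} = {L1..R1} \<union> ({l a..L1 - 1} \<union> {R1 + 1..r a})" using a l[of a] r[of a] True by auto
   also have "(\<Sum>b\<in>.... f a b) = (\<Sum>b\<in>{L1..R1}. f a b) + (\<Sum>b\<in>{l a..L1 - 1} \<union> {R1 + 1..r a}. f a b)"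
    by (rule sum.union_disjoint) auto
   also have "(\<Sum>b\<in>{l a..L1 - 1} \<union> {R1 + 1..r a}. f a b) = (\<Sum>b\<in>{l a..L1 - 1}. f a b) + (\<Sum>b\<in>{R1 + 1..r a}. f a b)"
    using True by (intro sum.union_disjoint) auto
   finally show ?thesis .
  qed
  have eq: "(\<Sum>a\<in>{c..d}. \<Sum>b\<in>{l a..r a}. f a b) = (\<Sum>b\<in>{L1..R1}. \<Sum>a\<in>{c..d}. f a b) + (\<Sum>a\<in>{c..d}. (\<Sum>b\<in>{l a..L1 - 1}. f a b) + (\<Sum>b\<in>{R1 + 1..r a}. f a b))"
   by (subst sum.swap) (simp only: split sum.distrib cong: sum.cong)
  have "norm (\<Sum>b\<in>{L1..R1}. \<Sum>a\<in>{c..d}. f a b) <= (of_int (R1 - L1) / of_int N + 1) * E1"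
  proof (rule sum_blocks[OF N E(1) True])
   fix i j assume "L1 <= i" "i <= j" "j <= R1" "j - i < N"
   then show "norm (\<Sum>b\<in>{i..j}. \<Sum>a\<in>{c..d}. f a b) <= E1" using box[of i j] by (subst sum.swap)
  qed
  moreover have "(of_int (R1 - L1) / of_int N + 1) * E1 <= (M / of_int N + 1) * E1"
  proof (intro mult_right_mono add_right_mono divide_right_mono)
   have "R1 - L1 <= R0 - L0" using l[of c] r[of c] cd by auto
   then have "real_of_int (R1 - L1) <= of_int (R0 - L0)" by (simp only: of_int_le_iff)
   then show "of_int (R1 - L1) <= M" using M by linarith
  qed (use N E in auto)
  moreover have "norm (\<Sum>a\<in>{c..d}. (\<Sum>b\<in>{l a..L1 - 1}. f a b) + (\<Sum>b\<in>{R1 + 1..r a}. f a b)) <= (\<Sum>a\<in>{c..d}. E2 + E2)"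
  proof (rule sum_norm_le)
   fix a assume a: "a \<in> {c..d}"
   have s0: "s >= 0" using s l[of a] a by auto
   have "norm (\<Sum>b\<in>{l a..L1 - 1}. f a b) <= E2" by (rule strip) (use a l[of a] r[of a] s s0 True in auto)
   moreover have "norm (\<Sum>b\<in>{R1 + 1..r a}. f a b) <= E2" by (rule strip) (use a l[of a] r[of a] s s0 True in auto)
   ultimately show "norm ((\<Sum>b\<in>{l a..L1 - 1}. f a b) + (\<Sum>b\<in>{R1 + 1..r a}. f a b)) <= E2 + E2"
    by (rule order.trans[OF norm_triangle_ineq add_mono])
  qed
  moreover have "(\<Sum>a\<in>{c..d}. E2 + E2) = of_int (d - c + 1) * (2 * E2)" using cdn by simp
  ultimately have "norm (\<Sum>b\<in>{L1..R1}. \<Sum>a\<in>{c..d}. f a b) + norm (\<Sum>a\<in>{c..d}. (\<Sum>b\<in>{l a..L1 - 1}. f a b) + (\<Sum>b\<in>{R1 + 1..r a}. f a b))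
    <= (M / of_int N + 1) * E1 + of_int (d - c + 1) * (2 * E2)" by linarith
  then show ?thesis unfolding eq by (rule order.trans[OF norm_triangle_ineq])
 next
  case False
  have "norm (\<Sum>a\<in>{c..d}. \<Sum>b\<in>{l a..r a}. f a b) <= (\<Sum>a\<in>{c..d}. E2)"
  proof (rule sum_norm_le)
   fix a assume a: "a \<in> {c..d}"
   show "norm (\<Sum>b\<in>{l a..r a}. f a b) <= E2" by (rule strip) (use a l[of a] r[of a] s False in auto)
  qed
  also have "... = of_int (d - c + 1) * E2" using cdn by simp
  also have "... <= of_int (d - c + 1) * (2 * E2)" using cd E by (intro mult_left_mono) auto
  finally show ?thesis using pre by linarith
 qed
qed

lemma sum_symmetric_inverse_sqrt:
 fixes Q :: int and d e t :: real
 assumes Q: "Q >= 1" "of_int Q - 1 <= t" and de: "d >= 0" "e >= 0"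
 shows "(\<Sum>q\<in>{-(Q-1)..Q-1} - {0}. d + e * (1 / sqrt \<bar>of_int q\<bar>)) <= 2 * t * d + 4 * e * sqrt t"
proof -
 define N where "N = nat (Q - 1)"
 define f where "f n = d + e * (1 / sqrt (real n))" for n
 have eq: "{-(Q-1)..Q-1} - {0} = int ` {1..N} \<union> (\<lambda>n. - int n) ` {1..N}"
 proof (intro equalityI subsetI)
  fix q assume q: "q \<in> {-(Q-1)..Q-1} - {0}"
  consider "q > 0" | "q < 0" using q by fastforce
  then show "q \<in> int ` {1..N} \<union> (\<lambda>n. - int n) ` {1..N}"
  proof cases
   case 1 then have "q = int (nat q)" "nat q \<in> {1..N}" using q by (auto simp: N_def) then show ?thesis by blast
  next
   case 2 then have "q = - int (nat (- q))" "nat (- q) \<in> {1..N}" using q by (auto simp: N_def) then show ?thesis by blast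
  qed
 qed (use Q in \<open>auto simp: N_def\<close>)
 have "(\<Sum>q\<in>{-(Q-1)..Q-1} - {0}. d + e * (1 / sqrt \<bar>of_int q\<bar>)) = (\<Sum>n\<in>{1..N}. f n) + (\<Sum>n\<in>{1..N}. f n)"
  unfolding eq by (subst sum.union_disjoint, simp, simp, force) (simp add: sum.reindex inj_on_def f_def)
 also have "(\<Sum>n\<in>{1..N}. f n) = real N * d + e * (\<Sum>n\<in>{1..N}. 1 / sqrt (real n))" by (simp add: f_def sum.distrib sum_distrib_left)
 finally have "(\<Sum>q\<in>{-(Q-1)..Q-1} - {0}. d + e * (1 / sqrt \<bar>of_int q\<bar>)) = 2 * (real N * d) + 2 * (e * (\<Sum>n\<in>{1..N}. 1 / sqrt (real n)))" by simp
 moreover have Nt: "real N <= t" using Q by (simp add: N_def)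
 have "e * (\<Sum>n\<in>{1..N}. 1 / sqrt (real n)) <= e * (2 * sqrt t)"
 proof (rule mult_left_mono[OF _ de(2)])
  show "(\<Sum>n\<in>{1..N}. 1 / sqrt (real n)) <= 2 * sqrt t" using sum_inverse_sqrt[of N] real_sqrt_le_mono[OF Nt] by linarith
 qed
 moreover have "real N * d <= t * d" using Nt de by (intro mult_right_mono)
 ultimately show ?thesis by simp
qed

context phase
begin

definition Ce :: real where "Ce = 16 * hT ga * (4 * s0 ga * sqrt (c\<rho> ga) + 4 * sqrt 2 / (s0 ga * sqrt (c\<rho> ga)))"
definition Cbox2 :: real where "Cbox2 = 4 / (c\<rho> ga)\<^sup>2 + 14 * Gam ga * TC ga / c\<rho> ga + Ce * (24 / c\<rho> ga + 8 * NDc ga / kmin ga)"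

lemma constants_pos: "c\<rho> ga > 0" "TC ga > 0" "Gam ga > 0" "NDc ga > 0" "kmin ga > 0" "Ce > 0" "wmax ga > 0" "Cbox2 > 0"
proof -
 note e = e0_bounds[OF gam] and k = kc_pos'
 show c: "c\<rho> ga > 0" using k[of 3] by (simp add: c\<rho>_def)
 have "kap ga > 0" "smooth_c > 0" using p0_pos[OF gam] k[of 3] k[of 4] k[of 5] by (simp_all add: kap_def smooth_c_def add_pos_pos)
 then show TC: "TC ga > 0" unfolding TC_def using p0_pos[OF gam] by simp
 show Gm: "Gam ga > 0" unfolding Gam_def using e gam by (intro add_pos_pos) auto
 show N: "NDc ga > 0" unfolding NDc_def using ND_pos[OF gam] gam by (intro add_pos_pos) auto
 show km: "kmin ga > 0" using gam by (simp add: kmin_def)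
 show Ce: "Ce > 0" unfolding Ce_def using hT_pos s0_pos c by (intro mult_pos_pos add_pos_pos divide_pos_pos) auto
 have "w2 ga > 0" unfolding w2_def using p0_pos[OF gam] e k[of 3] k[of 4] by (intro divide_pos_pos mult_pos_pos add_pos_pos) auto
 then show "wmax ga > 0" using w1_pos[OF gam] e N by (simp add: wmax_def)
 show "Cbox2 > 0" unfolding Cbox2_def using c TC Gm N km Ce by (intro add_pos_pos mult_pos_pos divide_pos_pos) auto
qed

text \<open>Weyl step with shifts of relative length \<open>\<rho> = c * g^2 / X\<close>, so that
  \<open>X * \<rho> * w / B = c\<close> is just small enough for the two-dimensional estimate. After
  division by the number of shifts, and up to constants, the zero shift contributes
  \<open>w^2 * X^2 / g^4\<close>, the generic ones \<open>w^2 * g^2\<close> times logarithms, and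
  the degenerate ones \<open>w^2 * (A * X / (B * g) + w * A * g)\<close>. By
  \<open>X <= g^3\<close>, \<open>A * B <= g^3\<close> and \<open>A <= 4 * B\<close> each is of
  order \<open>w^2 * g^2\<close> up to logarithms.\<close>

lemma box_bound:
 fixes a0 a1 b0 b1 :: int and g w :: real
 assumes g: "g >= 1" and h: "16 * g^2 <= A * B" "A * B <= g^3" "X <= g^3" "g^4 <= 4 * X * sqrt (A * B)" 
  and w_def: "w = B / g^2" and wm: "w <= wmax ga"
  and base: "A <= of_int a0" "of_int a1 <= 2 * A" "B <= of_int b0" "of_int b1 <= 4 * B" "of_int (a1 - a0) <= w * A" "of_int (b1 - b0) <= w * B"
  and ne: "a0 <= a1" "b0 <= b1"
 shows "norm (\<Sum>a\<in>{a0..a1}. \<Sum>b\<in>{b0..b1}. ee (F (of_int a) (of_int b))) <= 3 * sqrt Cbox2 * (1 + ln (50 * B))\<^sup>2 * (w^2 * sqrt (A * B) * g)"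
proof -
 define c where "c = c\<rho> ga"
 define \<rho> where "\<rho> = c * g^2 / X"
 define Q1 where "Q1 = \<lceil>A * \<rho>\<rceil>"
 define Q2 where "Q2 = \<lceil>B * \<rho>\<rceil>"
 define L where "L = 1 + ln (50 * B)"
 note cp = constants_pos
 have c: "c > 0" "c <= 1/8" "192 * kc ga 3 * c <= 1"
 proof -
  show "c > 0" using cp by (simp add: c_def)
  show "c <= 1/8" by (simp add: c_def c\<rho>_def)
  have "c <= 1 / (192 * kc ga 3)" by (simp add: c_def c\<rho>_def)
  then show "192 * kc ga 3 * c <= 1" using kc_pos'[of 3] by (simp add: field_simps)
 qed
 have gp: "g > 0" "g\<^sup>2 > 0" using g by auto
 have wp: "w > 0" using pos gp by (simp add: w_def)
 have wA16: "w * A >= 16" unfolding w_def using h(1) gp by (simp add: pos_le_divide_eq mult_ac)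
 have wB: "w * B >= 4"
 proof -
  have "w * A <= w * (4 * B)" using AB2 wp by (intro mult_left_mono) auto
  then show ?thesis using wA16 by simp
 qed
 have wAB: "1 / (A * B) <= w"
 proof -
  have "g\<^sup>2 <= A * B" using h(1) gp by linarith
  also have "... <= A * B * B" using B1 pos by simp
  finally have "g\<^sup>2 <= A * B * B" .
  then show ?thesis unfolding w_def using gp pos by (simp add: field_simps)
 qed
 have w216: "w <= 1/216" using wm by (simp add: wmax_def w1_def)
 have rho: "\<rho> > 0" using c gp pos by (simp add: \<rho>_def)
 have sAB: "sqrt (A * B) <= 2 * B"
 proof -
  have "A * B <= (4 * B) * B" using AB2 pos by (intro mult_right_mono) auto
  then have "A * B <= (2 * B)\<^sup>2" by (simp add: power2_eq_square)
  then show ?thesis using pos by (intro real_le_lsqrt) auto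
 qed
 \<comment> \<open>Here \<open>g^4 <= 4 * X * sqrt (A * B)\<close> enters: a Weyl shift must not be
   longer than the box.\<close>
 have rhow: "\<rho> <= w"
 proof -
  have "4 * X * sqrt (A * B) <= 4 * X * (2 * B)" using sAB pos by (intro mult_left_mono) auto
  moreover have "4 * X * (2 * B) = 8 * (X * B)" by simp
  ultimately have "g^4 <= 8 * (X * B)" using h(4) by linarith
  then have "c * g^4 <= (1/8) * (8 * (X * B))" using c gp by (intro mult_mono) auto
  then have "c * (g^2 * g^2) <= X * B" by (simp add: power2_eq_square power4_eq_xxxx mult_ac)
  then show ?thesis unfolding \<rho>_def w_def using pos gp by (simp add: field_simps)
 qed
 have rho3: "96 * kc ga 3 * (X * \<rho> * w) / B <= 1/2"
 proof -
  have "96 * kc ga 3 * (X * \<rho> * w) / B = 96 * kc ga 3 * c" unfolding \<rho>_def w_def using pos gp by simp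
  then show ?thesis using c by simp
 qed
 have Q1: "Q1 >= 1" "of_int Q1 >= A * \<rho>" "of_int Q1 - 1 <= A * \<rho>" "of_int Q1 - 1 < A * \<rho>"
  and Q2: "Q2 >= 1" "of_int Q2 >= B * \<rho>" "of_int Q2 - 1 <= B * \<rho>" "of_int Q2 - 1 < B * \<rho>"
 proof -
  have "A * \<rho> > 0" "B * \<rho> > 0" using pos rho by simp_all
  then show "Q1 >= 1" "of_int Q1 >= A * \<rho>" "of_int Q1 - 1 <= A * \<rho>" "of_int Q1 - 1 < A * \<rho>" "Q2 >= 1" "of_int Q2 >= B * \<rho>" "of_int Q2 - 1 <= B * \<rho>" "of_int Q2 - 1 < B * \<rho>"
   unfolding Q1_def Q2_def by linarith+
 qed
 have Aw: "A * \<rho> <= w * A" "B * \<rho> <= w * B" using rhow pos by (simp_all add: mult.commute)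
 have wAs: "w * A <= A / 216" "w * B <= B / 216" using mult_right_mono[OF w216, of A] mult_right_mono[OF w216, of B] pos by auto
 have LQ: "1 + ln (2 * of_int Q1) <= L" "1 + ln (2 * of_int Q2) <= L"
 proof -
  have "2 * real_of_int Q1 <= 50 * B" "2 * real_of_int Q2 <= 50 * B" using Q1 Q2 Aw wAs AB2 B1 pos by linarith+
  then show "1 + ln (2 * of_int Q1) <= L" "1 + ln (2 * of_int Q2) <= L" unfolding L_def using Q1(1) Q2(1) pos by (simp_all del: ln_mult)
 qed
 have L1: "L >= 1" unfolding L_def using B1 by simp
 define G where "G a b = F (of_int a) (of_int b)" for a b :: int
 define f where "f p = ee (G (fst p) (snd p))" for p :: "int \<times> int"
 define D where "D = {a0..a1} \<times> {b0..b1}"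
 define V where "V = {0..<Q1} \<times> {0..<Q2}"
 define P where "P = {a0 - Q1..a1} \<times> {b0 - Q2..b1}"
 define Z where "Z = {-(Q1-1)..Q1-1} \<times> {-(Q2-1)..Q2-1}"
 define S where "S = norm (\<Sum>p\<in>D. f p)"
 define T where "T q1 q2 = norm (autocorr D f (q1, q2))" for q1 q2
 have Seq: "S = norm (\<Sum>a\<in>{a0..a1}. \<Sum>b\<in>{b0..b1}. ee (F (of_int a) (of_int b)))"
  by (simp add: S_def D_def f_def G_def sum.cartesian_product case_prod_unfold)
 have Teq: "T q1 q2 = norm (\<Sum>a\<in>{max a0 (a0 - q1)..min a1 (a1 - q1)}. \<Sum>b\<in>{max b0 (b0 - q2)..min b1 (b1 - q2)}. ee (Diff [(of_int q1, of_int q2)] F (of_int a) (of_int b)))" for q1 q2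
  unfolding T_def D_def f_def autocorr_box by (simp add: G_def)
 have wvdc: "real (card V) * S^2 <= real (card P) * (\<Sum>z\<in>Z. norm (autocorr D f z))"
  unfolding S_def
 proof (rule weyl_van_der_corput)
  show "finite D" "finite V" "finite P" "finite Z" by (simp_all add: D_def V_def P_def Z_def)
  show "V \<noteq> {}" using Q1 Q2 by (simp add: V_def)
  show "\<And>p v. p \<in> D ==> v \<in> V ==> p - v \<in> P" unfolding D_def V_def P_def minus_prod_def by auto
  show "\<And>v v'. v \<in> V ==> v' \<in> V ==> v - v' \<in> Z" unfolding V_def Z_def minus_prod_def by auto
 qed
 have cV: "real (card V) = of_int Q1 * of_int Q2" using Q1 Q2 by (simp add: V_def card_cartesian_product)
 have cP: "real (card P) <= 9 * (w^2 * (A * B))"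
 proof -
  have "real (card P) = of_int (a1 - a0 + Q1 + 1) * of_int (b1 - b0 + Q2 + 1)"
   using ne Q1 Q2 by (simp add: P_def card_cartesian_product algebra_simps)
  also have "... <= (3 * (w * A)) * (3 * (w * B))"
  proof (rule mult_mono)
   show "of_int (a1 - a0 + Q1 + 1) <= 3 * (w * A)" using base(5) Q1 Aw wA16 by simp
   show "of_int (b1 - b0 + Q2 + 1) <= 3 * (w * B)" using base(6) Q2 Aw wB by simp
  qed (use wp pos ne Q2 in auto)
  finally show ?thesis by (simp add: power2_eq_square mult_ac)
 qed
 define GG where "GG = Gam ga * (TC ga * (1 + ln (50 * B))^3 * (B^3 / X))"
 define R where "R = 1 + 2 * NDc ga * w * (B * \<rho>) / kmin ga"
 define T0 where "T0 = 4 * (w^2 * (A * B))"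
 define SE where "SE = (\<Sum>q1\<in>{-(Q1-1)..Q1-1} - {0}. Eq w \<rho> (of_int q1))"
 have GG0: "GG >= 0" unfolding GG_def using cp L1[unfolded L_def] pos by simp
 have "(\<Sum>q1\<in>{-(Q1-1)..Q1-1}. \<Sum>q2\<in>{-(Q2-1)..Q2-1}. T q1 q2) <= T0 + 12 * of_int Q1 * (GG * L) + 2 * GG * (A / B) * L + 2 * (2 * R + 1) * SE"
  unfolding SE_def
 proof (rule Weyl_shift_sum[OF Q1(1) Q2(1) GG0 _ _ _ _ _ LQ])
  show "0 <= A / B" using pos by simp
  show "0 <= Eq w \<rho> (of_int q)" for q using Eq_nonneg wp rho by simp
  show "0 <= R" unfolding R_def using cp wp pos rho by simp
  show "T 0 0 <= T0"
  proof -
   have "T 0 0 <= (\<Sum>a\<in>{a0..a1}. \<Sum>b\<in>{b0..b1}. 1)" unfolding Teq by (simp add: norm_mult)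
   also have "... = of_int (a1 - a0 + 1) * of_int (b1 - b0 + 1)" using ne by simp
   also have "... <= (2 * (w * A)) * (2 * (w * B))"
    using base(5,6) wA16 wB ne wp pos by (intro mult_mono) auto
   finally show ?thesis by (simp add: T0_def power2_eq_square mult_ac)
  qed
  fix q1 q2 :: int assume q: "\<bar>q1\<bar> < Q1" "\<bar>q2\<bar> < Q2" "q1 \<noteq> 0 \<or> q2 \<noteq> 0"
  have q': "\<bar>real_of_int q1\<bar> <= A * \<rho>" "\<bar>real_of_int q2\<bar> <= B * \<rho>"
  proof -
   have "\<bar>q1\<bar> <= Q1 - 1" "\<bar>q2\<bar> <= Q2 - 1" using q by linarith+
   then have "real_of_int \<bar>q1\<bar> <= of_int (Q1 - 1)" "real_of_int \<bar>q2\<bar> <= of_int (Q2 - 1)" by (simp_all only: of_int_le_iff)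
   then show "\<bar>real_of_int q1\<bar> <= A * \<rho>" "\<bar>real_of_int q2\<bar> <= B * \<rho>" using Q1(3) Q2(3) by simp_all
  qed
  show "T q1 q2 <= GG * (recip (of_int q2 - 0) + recip (of_int q2 - r1 ga * (of_int b0 / of_int a0) * of_int q1) + recip (of_int q2 - r2 ga * (of_int b0 / of_int a0) * of_int q1))
    + (if q2 = 0 then GG * (A / B) * recip (of_int q1 - 0) else 0)
    + ((if q1 \<noteq> 0 \<and> \<bar>of_int q2 - r1 ga * (of_int b0 / of_int a0) * of_int q1\<bar> <= R then Eq w \<rho> (of_int q1) else 0)
    + (if q1 \<noteq> 0 \<and> \<bar>of_int q2 - r2 ga * (of_int b0 / of_int a0) * of_int q1\<bar> <= R then Eq w \<rho> (of_int q1) else 0))"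
   unfolding Teq GG_def R_def
   by (rule shift_case_bound[OF base ne _ _ _ _ wm wAB _ wB rho rhow rho3 q' q(3)]) (use wA16 in auto)
 qed
 then have sumT: "(\<Sum>z\<in>Z. norm (autocorr D f z)) <= T0 + 12 * of_int Q1 * (GG * L) + 2 * GG * (A / B) * L + 2 * (2 * R + 1) * SE"
  by (simp add: Z_def T_def sum.cartesian_product case_prod_unfold)
 define q where "q = real_of_int Q1 * of_int Q2"
 have Qr: "real_of_int Q1 >= 1" "real_of_int Q2 >= 1" using Q1 Q2 by simp_all
 have qp: "q > 0" unfolding q_def using Qr by simp
 have X6: "X\<^sup>2 <= g^6"
 proof -
  have "X * X <= g^3 * g^3" using h(3) pos gp by (intro mult_mono) auto
  then show ?thesis by (simp add: power2_eq_square flip: power_add)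
 qed
 have ta: "T0 <= q * (4 / c^2 * (w^2 * g^2))"
 proof -
  have "(A * \<rho>) * (B * \<rho>) <= q" unfolding q_def using Q1 Q2 pos rho by (intro mult_mono) auto
  then have "(A * \<rho>) * (B * \<rho>) * (4 / c^2 * (w^2 * g^2)) <= q * (4 / c^2 * (w^2 * g^2))" by (intro mult_right_mono) auto
  moreover have "(A * \<rho>) * (B * \<rho>) * (4 / c^2 * (w^2 * g^2)) = 4 * (w^2 * (A * B)) * (g^6 / X^2)"
   unfolding \<rho>_def using c pos by (simp add: power2_eq_square eval_nat_numeral)
  moreover have "4 * (w^2 * (A * B)) * 1 <= 4 * (w^2 * (A * B)) * (g^6 / X^2)"
   using X6 pos by (intro mult_left_mono) auto
  ultimately show ?thesis unfolding T0_def by linarith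
 qed
 define Y where "Y = GG * L / (B * \<rho>)"
 have Y0: "Y >= 0" unfolding Y_def using GG0 L1 pos rho by simp
 have Yeq: "Y = Gam ga * TC ga / c * (L^4 * (w^2 * g^2))"
  unfolding Y_def GG_def L_def[symmetric] \<rho>_def w_def using pos gp c by (simp add: field_simps power2_eq_square eval_nat_numeral)
 have GLY: "GG * L = Y * (B * \<rho>)" unfolding Y_def using pos rho by simp
 have tb: "12 * of_int Q1 * (GG * L) <= q * (12 * Y)"
 proof -
  have "Y * (B * \<rho>) <= Y * of_int Q2" using Y0 Q2 by (intro mult_left_mono) auto
  then have "(12 * of_int Q1) * (GG * L) <= (12 * of_int Q1) * (Y * of_int Q2)" unfolding GLY by (rule mult_left_mono) (use Qr in simp)
  then show ?thesis by (simp add: q_def mult_ac)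
 qed
 have tc: "2 * GG * (A / B) * L <= q * (2 * Y)"
 proof -
  have "2 * GG * (A / B) * L = 2 * (A / B) * (GG * L)" by simp
  also have "... = 2 * Y * (A * \<rho>)" unfolding GLY using pos by simp
  also have "... <= 2 * Y * q"
  proof (rule mult_left_mono)
   have "A * \<rho> * 1 <= q" unfolding q_def using Q1 Qr pos rho by (intro mult_mono) auto
   then show "A * \<rho> <= q" by simp
  qed (use Y0 in auto)
  finally show ?thesis by (simp add: mult_ac)
 qed
 have SE: "SE <= of_int Q1 * (w^2 * A * g * Ce)"
 proof -
  define d where "d = 2 * w * (s0 ga * sqrt (X * \<rho>))"
  define e where "e = B * sqrt (2 * A) / (s0 ga * sqrt X)"
  have de: "d >= 0" "e >= 0" unfolding d_def e_def using wp s0_pos pos rho by simp_all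
  have Xr: "X * \<rho> = c * g^2" unfolding \<rho>_def using pos by simp
  have sX: "sqrt (X * \<rho>) = sqrt c * g" unfolding Xr using gp by (simp add: real_sqrt_mult)
  have "SE = 16 * hT ga * (w * A) * (\<Sum>q1\<in>{-(Q1-1)..Q1-1} - {0}. d + e * (1 / sqrt \<bar>of_int q1\<bar>))"
   unfolding SE_def Eq_def d_def e_def sum_distrib_left ..
  also have "... <= 16 * hT ga * (w * A) * (2 * (A * \<rho>) * d + 4 * e * sqrt (A * \<rho>))"
   using hT_pos wp pos by (intro mult_left_mono sum_symmetric_inverse_sqrt[OF Q1(1,3) de]) auto
  also have "4 * e * sqrt (A * \<rho>) = (A * \<rho>) * (4 * sqrt 2 / (s0 ga * sqrt c) * (w * g))"
  proof -
   have "4 * e * sqrt (A * \<rho>) = 4 * B * sqrt 2 / s0 ga * (sqrt A * sqrt A) * (sqrt \<rho> / sqrt X)"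
    unfolding e_def by (simp add: real_sqrt_mult)
   also have "sqrt \<rho> / sqrt X = \<rho> / (sqrt c * g)"
   proof -
    have "sqrt \<rho> * (sqrt c * g) = \<rho> * sqrt X" unfolding sX[symmetric] using rho by (simp add: real_sqrt_mult)
    then show ?thesis using pos c gp by (simp add: field_simps)
   qed
   also have "4 * B * sqrt 2 / s0 ga * (sqrt A * sqrt A) * (\<rho> / (sqrt c * g)) = (A * \<rho>) * (4 * sqrt 2 / (s0 ga * sqrt c) * (B / g))" using pos by (simp add: mult_ac)
   also have "B / g = w * g" unfolding w_def using gp by (simp add: power2_eq_square)
   finally show ?thesis .
  qed
  also have "2 * (A * \<rho>) * d = (A * \<rho>) * (4 * s0 ga * sqrt c * (w * g))" unfolding d_def sX by simp
  also have "16 * hT ga * (w * A) * ((A * \<rho>) * (4 * s0 ga * sqrt c * (w * g)) + (A * \<rho>) * (4 * sqrt 2 / (s0 ga * sqrt c) * (w * g)))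
   = (A * \<rho>) * (w^2 * A * g * Ce)"
  proof -
   have "16 * h * (w * A) * (t * (x * (w * g)) + t * (y * (w * g))) = t * (w^2 * A * g * (16 * h * (x + y)))" for h t x y :: real
    by (simp add: power2_eq_square algebra_simps)
   then show ?thesis unfolding Ce_def c_def[symmetric] .
  qed
  also have "... <= of_int Q1 * (w^2 * A * g * Ce)" using Q1 pos gp cp by (intro mult_right_mono) auto
  finally show ?thesis .
 qed
 have td: "2 * (2 * R + 1) * SE <= q * (w^2 * g^2 * (Ce * (24 / c + 8 * NDc ga / kmin ga)))"
 proof -
  define n where "n = NDc ga / kmin ga"
  have n0: "n > 0" using cp by (simp add: n_def)
  have Req: "2 * R + 1 = 3 + 4 * n * w * (B * \<rho>)" by (simp add: R_def n_def)
  have "3 + 4 * n * w * (B * \<rho>) <= of_int Q2 * (3 / (B * \<rho>) + 4 * n * w)"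
  proof -
   have "(B * \<rho>) * (3 / (B * \<rho>) + 4 * n * w) <= of_int Q2 * (3 / (B * \<rho>) + 4 * n * w)" using Q2 n0 wp pos rho by (intro mult_right_mono) auto
   moreover have "(B * \<rho>) * (3 / (B * \<rho>) + 4 * n * w) = 3 + 4 * n * w * (B * \<rho>)" using pos rho by (simp add: distrib_left)
   ultimately show ?thesis by simp
  qed
  then have "2 * (2 * R + 1) * SE <= 2 * (of_int Q2 * (3 / (B * \<rho>) + 4 * n * w)) * (of_int Q1 * (w^2 * A * g * Ce))"
   unfolding Req using SE n0 wp pos rho Qr by (intro mult_mono) (auto simp: SE_def intro!: sum_nonneg Eq_nonneg)
  also have "... = q * (w^2 * Ce * (6 * (A * g / (B * \<rho>)) + 8 * n * (w * A * g)))" by (simp add: q_def algebra_simps)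
  also have "... <= q * (w^2 * Ce * (6 * (4 * g^2 / c) + 8 * n * g^2))"
  proof (intro mult_left_mono add_mono)
   have "A * g / (B * \<rho>) = (A * X) / (B * g * c)" unfolding \<rho>_def using pos gp c by (simp add: field_simps power2_eq_square)
   also have "... <= ((4 * B) * g^3) / (B * g * c)" using AB2 h(3) pos gp c by (intro divide_right_mono mult_mono) auto
   also have "... = 4 * g^2 / c" using pos gp by (simp add: power2_eq_square eval_nat_numeral)
   finally show "A * g / (B * \<rho>) <= 4 * g^2 / c" .
   have "w * A * g = A * B / g" unfolding w_def using gp by (simp add: power2_eq_square)
   also have "... <= g^3 / g" using h(2) gp by (intro divide_right_mono) auto
   finally show "w * A * g <= g^2" using gp by (simp add: power2_eq_square eval_nat_numeral)
  qed (use n0 cp qp in auto)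
  also have "... = q * (w^2 * g^2 * (Ce * (24 / c + 8 * n)))" by (simp add: algebra_simps)
  finally show ?thesis by (simp add: n_def)
 qed
 have total: "(\<Sum>z\<in>Z. norm (autocorr D f z)) <= q * (Cbox2 * L^4 * (w^2 * g^2))"
 proof -
  define t where "t = w^2 * g^2"
  have t0: "t >= 0" by (simp add: t_def)
  have L4: "L^4 >= 1" using L1 by simp
  have e1: "4 / c^2 * t <= 4 / c^2 * (L^4 * t)" using L4 t0 by (intro mult_left_mono) (auto simp: mult_le_cancel_right1)
  have e2: "t * (Ce * (24 / c + 8 * NDc ga / kmin ga)) <= (L^4 * t) * (Ce * (24 / c + 8 * NDc ga / kmin ga))"
   using L4 t0 cp c by (intro mult_right_mono) (auto simp: mult_le_cancel_right1 intro!: add_nonneg_nonneg)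
  have "(\<Sum>z\<in>Z. norm (autocorr D f z)) <= q * (4 / c^2 * t) + q * (12 * Y) + q * (2 * Y) + q * (t * (Ce * (24 / c + 8 * NDc ga / kmin ga)))"
   using sumT ta tb tc td unfolding t_def by linarith
  also have "... = q * (4 / c^2 * t + 14 * Y + t * (Ce * (24 / c + 8 * NDc ga / kmin ga)))" by (simp add: algebra_simps)
  also have "... <= q * (4 / c^2 * (L^4 * t) + 14 * Y + (L^4 * t) * (Ce * (24 / c + 8 * NDc ga / kmin ga)))"
   using e1 e2 qp by (intro mult_left_mono) auto
  also have "... = q * (Cbox2 * L^4 * t)" unfolding Cbox2_def Yeq t_def[symmetric] c_def[symmetric] by (simp add: algebra_simps)
  finally show ?thesis by (simp add: t_def)
 qed
 have "q * S^2 <= 9 * (w^2 * (A * B)) * (q * (Cbox2 * L^4 * (w^2 * g^2)))"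
 proof -
  have "q * S^2 <= real (card P) * (\<Sum>z\<in>Z. norm (autocorr D f z))" using wvdc unfolding cV q_def .
  also have "... <= 9 * (w^2 * (A * B)) * (q * (Cbox2 * L^4 * (w^2 * g^2)))"
   using cP total pos by (intro mult_mono sum_nonneg) auto
  finally show ?thesis .
 qed
 then have "q * S^2 <= q * (9 * (w^2 * (A * B)) * (Cbox2 * L^4 * (w^2 * g^2)))" by (simp add: mult_ac)
 then have "S\<^sup>2 <= 9 * (w^2 * (A * B)) * (Cbox2 * L^4 * (w^2 * g^2))" using qp by simp
 also have "... = (3 * sqrt Cbox2 * L^2 * (w^2 * sqrt (A * B) * g))\<^sup>2"
  using cp pos by (simp add: power_mult_distrib)
 finally have "S <= 3 * sqrt Cbox2 * L^2 * (w^2 * sqrt (A * B) * g)"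
  by (rule power2_le_imp_le) (use cp pos gp in auto)
 then show ?thesis unfolding Seq L_def .
qed

end

lemma int_le_div_iff:
 fixes m n q :: int
 assumes "q > 0" shows "n <= m div q \<longleftrightarrow> n * q <= m"
proof
 assume "n <= m div q"
 then have "n * q <= m div q * q" using assms by (intro mult_right_mono) auto
 also have "... <= m" using div_mult_mod_eq[of m q] pos_mod_sign[OF assms, of m] by linarith
 finally show "n * q <= m" .
next
 assume "n * q <= m"
 then have "n * q div q <= m div q" using assms by (intro zdiv_mono1) auto
 then show "n <= m div q" using assms by simp
qed

lemma int_div_less_iff:
 fixes m n q :: int
 assumes "q > 0" shows "m div q < n \<longleftrightarrow> m < n * q"
 using int_le_div_iff[OF assms, of n m] by linarith

context phase
begin

definition Kt :: real where "Kt = max K0 36"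
definition \<sigma> :: real where "\<sigma> = sqrt (p1 / 72)"
definition CD :: real where
 "CD = 8 * (4 + sqrt Kt) + 16 * hF * (5 * \<sigma> / wmax ga + 2 / \<sigma>) + 81 * sqrt Cbox2 + 48 * hF * (10 * \<sigma> + 2 / \<sigma>)"

lemma CD_bounds:
 "8 * (4 + sqrt Kt) <= CD" "16 * hF * (5 * \<sigma> / wmax ga + 2 / \<sigma>) <= CD"
 "81 * sqrt Cbox2 + 48 * hF * (10 * \<sigma> + 2 / \<sigma>) <= CD" "CD > 0"
proof -
 define a where "a = 8 * (4 + sqrt Kt)"
 define b where "b = 16 * hF * (5 * \<sigma> / wmax ga + 2 / \<sigma>)"
 define c where "c = 81 * sqrt Cbox2"
 define d where "d = 48 * hF * (10 * \<sigma> + 2 / \<sigma>)"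
 have p1p: "p1 > 0" using gam by (simp add: p1_def)
 have sg: "\<sigma> > 0" using p1p by (simp add: \<sigma>_def)
 have "72 * kc ga 2 / p1 >= 0" using kc_pos'[of 2] p1p by simp
 then have "hF >= 1" by (simp add: hF_def)
 then have "b >= 0" "c >= 0" "d >= 0" unfolding b_def c_def d_def using sg constants_pos by simp_all
 moreover have "sqrt Kt >= 0" by (simp add: Kt_def)
 then have "a > 0" by (simp add: a_def add_pos_nonneg)
 moreover have "CD = a + b + c + d" by (simp add: CD_def a_def b_def c_def d_def)
 ultimately have "a <= CD" "b <= CD" "c + d <= CD" "CD > 0" by linarith+
 then show "8 * (4 + sqrt Kt) <= CD" "16 * hF * (5 * \<sigma> / wmax ga + 2 / \<sigma>) <= CD"
  "81 * sqrt Cbox2 + 48 * hF * (10 * \<sigma> + 2 / \<sigma>) <= CD" "CD > 0" unfolding a_def b_def c_def d_def .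
qed

text \<open>If \<open>A * B\<close> is below \<open>16 * g^2\<close> or a constant,
  \<open>sqrt (A * B)\<close> is at most of order \<open>g\<close> and the trivial bound suffices.
  If \<open>w > wmax ga\<close>, boxes of this size are too large for the local analysis, but then
  \<open>A * sqrt X\<close> is of order \<open>sqrt (A * B) * g\<close> at most and single rows
  suffice. Otherwise \<open>a\<close> is cut into blocks of length about \<open>w * A\<close>, along
  which the ends of the rows move so little that all but short strips is common to the rows.\<close>

lemma dyadic_rows:
 fixes K K' a0 a1 :: int and g :: real
 assumes K: "of_int K = 2 * (A * B)" "K <= K'" "K' <= 2 * K"
  and g: "g >= 1" and h: "A * B <= g^3" "X <= g^3" "g^4 <= 4 * X * sqrt (A * B)"
  and a: "A <= of_int a0" "of_int a1 <= 2 * A" "a0 <= a1"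
 shows "norm (\<Sum>a\<in>{a0..a1}. \<Sum>b\<in>{max a (K div a) + 1..K' div a}. ee (F (of_int a) (of_int b))) <= CD * (1 + ln (50 * B))\<^sup>2 * (sqrt (A * B) * g)"
proof -
 define L where "L = 1 + ln (50 * B)"
 define n where "n = sqrt (A * B)"
 define sx where "sx = sqrt X"
 define l where "l a = max a (K div a) + 1" for a
 define r where "r a = K' div a" for a
 note cp = constants_pos
 have gp: "g > 0" "g\<^sup>2 > 0" using g by auto
 have L1: "L >= 1" unfolding L_def using B1 by simp
 have L2: "L\<^sup>2 >= 1" using L1 by simp
 have nn: "n > 0" "n * n = A * B" "n >= 1" using pos by (simp_all add: n_def)
 have sx: "sx > 0" "sx * sx = X" using pos by (simp_all add: sx_def)
 have p1p: "p1 > 0" using gam by (simp add: p1_def)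
 have sg: "\<sigma> > 0" using p1p by (simp add: \<sigma>_def)
 have hF0: "hF >= 1"
 proof -
  have "72 * kc ga 2 / p1 >= 0" using kc_pos'[of 2] p1p by simp
  then show ?thesis by (simp add: hF_def)
 qed
 have Kp: "K >= 1" 
 proof -
  have "real_of_int K > 0" using K(1) pos by simp
  then show ?thesis by linarith
 qed
 have Kr: "real_of_int K' <= 4 * (A * B)" using K by linarith
 have ap: "real_of_int c > 0" if "a0 <= c" for c :: int using that a pos by (smt (verit) of_int_le_iff)
 have nsx: "n * sx <= g^3"
 proof (rule power2_le_imp_le)
  have "(n * sx)\<^sup>2 = (A * B) * X" using nn sx by (simp add: power2_eq_square mult_ac)
  also have "... <= g^3 * g^3" using h pos gp by (intro mult_mono) auto
  finally show "(n * sx)\<^sup>2 <= (g^3)\<^sup>2" by (simp add: power2_eq_square)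
 qed (use gp in simp)
 \<comment> \<open>A consequence of \<open>A * B <= g^3\<close> and
   \<open>g^4 <= 4 * X * sqrt (A * B)\<close>; it controls the second term of the second difference
   test, which sums to \<open>A * B / sqrt X\<close>.\<close>
 have n2: "n <= 2 * g * sx"
 proof (rule power2_le_imp_le)
  have "(A * B) * (A * B) <= g^3 * g^3" by (rule mult_mono) (use h pos gp in auto)
  then have "(n * n) * (n * n) <= g^3 * g^3" unfolding nn(2) .
  also have "... = g^2 * g^4" by (simp flip: power_add)
  also have "... <= g^2 * (4 * X * n)" using h(3) by (intro mult_left_mono) (auto simp: n_def)
  finally have "n * (n * n * n) <= n * (4 * g^2 * X)" by (simp add: mult_ac)
  then have "n * n * n <= 4 * g^2 * X" using nn by simp
  moreover have "n * n * 1 <= n * n * n" using nn(1,3) by (intro mult_left_mono) simp_all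
  moreover have "(2 * g * sx)\<^sup>2 = 4 * g^2 * X" unfolding sx(2)[symmetric] by (simp add: power2_eq_square)
  ultimately show "n\<^sup>2 <= (2 * g * sx)\<^sup>2" by (simp add: power2_eq_square[of n])
 qed (use gp sx in simp)
 have ABs: "A * B / sx <= 2 * (n * g)"
 proof -
  have "n * n <= n * (2 * g * sx)" using n2 nn by (intro mult_left_mono) auto
  then show ?thesis using nn sx by (simp add: divide_le_eq mult_ac)
 qed
 have low: "B < of_int b" if "a0 <= c" "c <= a1" "l c <= b" for c b :: int
 proof -
  have c: "real_of_int c > 0" "real_of_int c <= of_int a1" using that ap by auto
  have "K div c < b" using that by (auto simp: l_def)
  then have "K < b * c" using ap[OF that(1)] by (simp add: int_div_less_iff)
  then have "real_of_int K < of_int b * of_int c" by (metis of_int_less_iff of_int_mult)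
  moreover have "of_int b * of_int c <= of_int b * (2 * A)"
  proof (rule mult_left_mono)
   have "b > 0" using \<open>K < b * c\<close> Kp c by (smt (verit) of_int_0_less_iff zero_less_mult_pos2)
   then show "0 <= real_of_int b" by simp
  qed (use c a in linarith)
  ultimately have "(2 * A) * B < (2 * A) * of_int b" using K(1) by (simp add: mult_ac)
  then show ?thesis using pos by simp
 qed
 have high: "real_of_int b <= 4 * B" if "a0 <= c" "b <= r c" for c b :: int
 proof -
  have c: "real_of_int c > 0" "A <= of_int c" using that ap a by (auto intro: order.trans)
  have "b * c <= K'" using that(2) c unfolding r_def by (simp add: int_le_div_iff)
  then have "real_of_int b * of_int c <= 4 * (A * B)" using Kr by (metis of_int_le_iff of_int_mult order.trans)
  show ?thesis
  proof (rule ccontr)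
   assume "\<not> ?thesis"
   then have "(4 * B) * A < of_int b * of_int c" using c pos by (intro mult_less_le_imp_less) auto
   then show False using \<open>real_of_int b * of_int c <= 4 * (A * B)\<close> by (simp add: mult_ac)
  qed
 qed
 have l1: "l c >= 2" if "a0 <= c" for c using ap[OF that] by (simp add: l_def)
 define S where "S = norm (\<Sum>a\<in>{a0..a1}. \<Sum>b\<in>{l a..r a}. ee (F (of_int a) (of_int b)))"
 have cnt: "of_int (a1 - a0 + 1) <= 2 * A" using a A1 by simp
 have each: "S <= (2 * A) * E" if E: "E >= 0" "\<And>c. a0 <= c ==> c <= a1 ==> norm (\<Sum>b\<in>{l c..r c}. ee (F (of_int c) (of_int b))) <= E" for E
 proof -
  have "S <= (\<Sum>c\<in>{a0..a1}. E)" unfolding S_def by (rule sum_norm_le) (use E in auto)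
  also have "... = of_int (a1 - a0 + 1) * E" using a by simp
  also have "... <= (2 * A) * E" using cnt E by (intro mult_right_mono)
  finally show ?thesis .
 qed
 have "S <= CD * L^2 * (n * g)"
 proof (cases "A * B < 16 * g^2 \<or> A * B < Kt")
  case True
  have "S <= (2 * A) * (4 * B)"
  proof (rule each)
   fix c assume c: "a0 <= c" "c <= a1"
   have "norm (\<Sum>b\<in>{l c..r c}. ee (F (of_int c) (of_int b))) <= (\<Sum>b\<in>{l c..r c}. 1)" by (rule sum_norm_le) simp
   also have "... = real (nat (r c - l c + 1))" by simp
   also have "... <= 4 * B"
   proof (cases "r c - l c + 1 >= 0")
    case True
    have "real (nat (r c - l c + 1)) <= of_int (r c)" using l1[OF c(1)] True by simp
    then show ?thesis using high[OF c(1), of "r c"] by simp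
   qed (use pos in simp)
   finally show "norm (\<Sum>b\<in>{l c..r c}. ee (F (of_int c) (of_int b))) <= 4 * B" .
  qed (use pos in simp)
  also have "... = 8 * n * n" using nn by simp
  also have "... <= 8 * n * ((4 + sqrt Kt) * g)"
  proof (rule mult_left_mono)
   have Kt0: "Kt >= 0" by (simp add: Kt_def)
   have "n <= 4 * g \<or> n <= sqrt Kt"
   proof (cases "A * B < 16 * g^2")
    case True
    then have "n <= sqrt (16 * g^2)" unfolding n_def by simp
    then show ?thesis using gp by (simp add: real_sqrt_mult)
   next
    case False
    then show ?thesis using True unfolding n_def by simp
   qed
   moreover have "sqrt Kt * 1 <= sqrt Kt * g" using g Kt0 by (intro mult_left_mono) auto
   moreover have "4 * g >= 0" "sqrt Kt * g >= 0" using gp Kt0 by simp_all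
   ultimately show "n <= (4 + sqrt Kt) * g" unfolding distrib_right by linarith
  qed (use nn in simp)
  also have "... = (8 * (4 + sqrt Kt)) * 1 * (n * g)" by simp
  also have "... <= CD * L^2 * (n * g)"
  proof (intro mult_right_mono mult_mono L2 CD_bounds(1))
   show "0 <= CD" using CD_bounds by simp
  qed (use nn gp in auto)
  finally show ?thesis .
 next
  case False
  then have AB16: "16 * g^2 <= A * B" and ABK: "K0 <= A * B" "36 <= A * B" by (auto simp: Kt_def)
  have B3: "B >= 3"
  proof (rule ccontr)
   assume "\<not> ?thesis"
   then have "B * B < 3 * 3" using pos by (intro mult_strict_mono) auto
   moreover have "A * B <= 4 * B * B" using AB2 pos by (intro mult_right_mono) auto
   ultimately show False using ABK by simp
  qed
  have mu: "sqrt (p1 * X / (72 * B^2)) = \<sigma> * sx / B"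
  proof -
   have "p1 * X / (72 * B^2) = (p1 / 72) * X / B^2" by simp
   then show ?thesis using pos by (simp only: real_sqrt_divide real_sqrt_mult \<sigma>_def sx_def real_sqrt_abs abs_of_pos)
  qed
  have one: "norm (\<Sum>b\<in>{i..j}. ee (F (of_int c) (of_int b))) <= 8 * hF * (M * (\<sigma> * sx / B) + B / (\<sigma> * sx))"
   if "a0 <= c" "c <= a1" "l c <= i" "j <= r c" "of_int (j - i + 1) <= M" "M >= 0" for c i j M
  proof -
   have "norm (\<Sum>b\<in>{i..j}. ee (F (of_int c) (of_int b))) <= 8 * hF * (M * sqrt (p1 * X / (72 * B^2)) + 1 / sqrt (p1 * X / (72 * B^2)))"
   proof (rule one_dim_bound[OF ABK(1) _ _ _ _ that(5,6) B3])
    have "real_of_int a0 <= of_int c" "real_of_int c <= of_int a1" using that by simp_all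
    then show "A <= of_int c" "of_int c <= 2 * A" using a by linarith+
    show "B <= of_int i" using low[OF that(1,2,3)] by simp
    show "of_int j <= 4 * B" using high[OF that(1,4)] .
   qed
   then show ?thesis unfolding mu by simp
  qed
  define w where "w = B / g^2"
  have wp: "w > 0" using pos gp by (simp add: w_def)
  have wAs: "w * A * sx <= n * g"
  proof -
   have "w * A * sx = n * (n * sx) / g^2" unfolding w_def using nn by (simp add: mult_ac)
   also have "... <= n * g^3 / g^2" using nsx nn by (intro divide_right_mono mult_left_mono) auto
   also have "... = n * g" using gp by (simp add: eval_nat_numeral)
   finally show ?thesis .
  qed
  show ?thesis
  proof (cases "w <= wmax ga")
   case False
   have "S <= (2 * A) * (8 * hF * ((5 * B) * (\<sigma> * sx / B) + B / (\<sigma> * sx)))"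
   proof (rule each)
    fix c assume c: "a0 <= c" "c <= a1"
    show "norm (\<Sum>b\<in>{l c..r c}. ee (F (of_int c) (of_int b))) <= 8 * hF * ((5 * B) * (\<sigma> * sx / B) + B / (\<sigma> * sx))"
    proof (rule one[OF c])
     show "of_int (r c - l c + 1) <= 5 * B" using high[OF c(1), of "r c"] l1[OF c(1)] pos by simp
    qed (use pos in auto)
   qed (use hF0 sg sx pos in simp)
   also have "... = 16 * hF * (5 * \<sigma> * (A * sx) + (A * B / sx) / \<sigma>)" using pos sx by (simp add: field_simps)
   also have "... <= 16 * hF * (5 * \<sigma> * (n * g / wmax ga) + (2 * (n * g)) / \<sigma>)"
   proof (intro mult_left_mono add_mono divide_right_mono ABs)
    have "wmax ga * (A * sx) <= w * (A * sx)" using False pos sx by (intro mult_right_mono) auto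
    also have "... <= n * g" using wAs by (simp add: mult_ac)
    finally show "A * sx <= n * g / wmax ga" using cp by (simp add: pos_le_divide_eq mult_ac)
   qed (use sg hF0 in auto)
   also have "... = (16 * hF * (5 * \<sigma> / wmax ga + 2 / \<sigma>)) * 1 * (n * g)" using cp by (simp add: algebra_simps)
   also have "... <= CD * L^2 * (n * g)"
   proof (intro mult_right_mono mult_mono L2 CD_bounds(2))
    show "0 <= CD" using CD_bounds by simp
   qed (use nn gp in auto)
   finally show ?thesis .
  next
   case wm: True
   have w1: "w <= 1/216" using wm by (simp add: wmax_def w1_def)
   have wA16: "w * A >= 16" unfolding w_def using AB16 gp by (simp add: pos_le_divide_eq mult_ac)
   have wAwB: "w * A <= 4 * (w * B)" using mult_left_mono[OF AB2, of w] wp by simp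
   have wB: "w * B >= 4" using wA16 wAwB by linarith
   define N1 where "N1 = \<lfloor>w * A\<rfloor>"
   define N2 where "N2 = \<lfloor>w * B\<rfloor>"
   \<comment> \<open>Along a block the hyperbolas move by at most \<open>4 * (w * B) + 1\<close>,
     and the diagonal \<open>a < b\<close> by at most \<open>w * A <= 4 * (w * B)\<close>.\<close>
   define s where "s = \<lfloor>5 * (w * B)\<rfloor>"
   have N1: "of_int N1 <= w * A" "w * A / 2 <= of_int N1" "N1 >= 1" unfolding N1_def using wA16 by linarith+
   have N2: "of_int N2 <= w * B" "w * B / 2 <= of_int N2" "N2 >= 1" unfolding N2_def using wB by linarith+
   have s: "of_int s <= 5 * (w * B)" unfolding s_def by linarith
   define E1 where "E1 = 3 * sqrt Cbox2 * L^2 * (w^2 * n * g)"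
   define E2 where "E2 = 8 * hF * ((10 * (w * B)) * (\<sigma> * sx / B) + B / (\<sigma> * sx))"
   have E10: "E1 >= 0" unfolding E1_def using cp nn gp by simp
   have E20: "E2 >= 0" unfolding E2_def using hF0 wp pos sg sx by simp
   have block: "norm (\<Sum>a\<in>{c..d}. \<Sum>b\<in>{l a..r a}. ee (F (of_int a) (of_int b))) <= 9 / w * E1 + (w * A) * (2 * E2)"
    if cd: "a0 <= c" "c <= d" "d <= a1" "d - c < N1" for c d
   proof -
    have cr: "real_of_int c > 0" "real_of_int d > 0" "A <= of_int c" "real_of_int c <= of_int d" "of_int d <= 2 * A"
     using cd ap[of c] ap[of d] a by (auto intro: order.trans)
    have dcw: "real_of_int d - of_int c + 1 <= w * A"
    proof -
     have "d - c + 1 <= N1" using cd by simp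
     then have "real_of_int (d - c + 1) <= of_int N1" by (simp only: of_int_le_iff)
     then show ?thesis using N1 by simp
    qed
    have divd: "T div d <= T div e" "T div e <= T div c" if "c <= e" "e <= d" "T >= 0" for e T
     using that cr by (auto intro!: zdiv_mono2)
    have gap: "T div c - T div d <= s" if T: "T >= 0" "real_of_int T <= 4 * (A * B)" for T
    proof -
     have "real_of_int (T div c) <= of_int T / of_int c" "of_int T / of_int d - 1 <= real_of_int (T div d)"
      using real_of_int_div4[of T c] real_of_int_div3[of T d] by linarith+
     moreover have "of_int T / of_int c - of_int T / of_int d <= 4 * (w * B)"
     proof -
      have "of_int T / of_int c - of_int T / of_int d = real_of_int T * (of_int d - of_int c) / (of_int c * of_int d)"
      proof -
       have gen: "t / p - t / q = t * (q - p) / (p * q)" if "p > 0" "q > 0" for t p q :: real using that by (simp add: field_simps)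
       show ?thesis by (rule gen[OF cr(1,2)])
      qed
      also have "... <= (4 * (A * B)) * (w * A) / (A * A)"
       using T cr dcw pos by (intro frac_le mult_mono) auto
      also have "... = 4 * (w * B)" using pos by simp
      finally show ?thesis .
     qed
     ultimately have "real_of_int (T div c - T div d) <= 5 * (w * B)" using wB by simp
     then show ?thesis unfolding s_def by (simp add: le_floor_iff)
    qed
    have "norm (\<Sum>a\<in>{c..d}. \<Sum>b\<in>{l a..r a}. ee (F (of_int a) (of_int b))) <= (4 * B / of_int N2 + 1) * E1 + of_int (d - c + 1) * (2 * E2)"
    proof (rule norm_sum_rows[OF N2(3) E10 E20 cd(2), where ?L0.0 = "max c (K div d) + 1" and ?L1.0 = "max d (K div c) + 1" and ?R1.0 = "K' div d" and ?R0.0 = "K' div c" and s = s])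
     show "max c (K div d) + 1 <= l e \<and> l e <= max d (K div c) + 1" if "c <= e" "e <= d" for e
      using divd[OF that, of K] Kp that unfolding l_def by auto
     show "K' div d <= r e \<and> r e <= K' div c" if "c <= e" "e <= d" for e
      using divd[OF that, of K'] Kp K that unfolding r_def by auto
     have "d - c <= s"
     proof -
      have "real_of_int (d - c) <= 5 * (w * B)" using dcw wAwB wB by simp
      then show ?thesis unfolding s_def by (simp add: le_floor_iff)
     qed
     moreover have "K div c - K div d <= s" using gap[of K] Kp K pos by simp
     ultimately show "max d (K div c) + 1 - (max c (K div d) + 1) <= s" by linarith
     show "K' div c - K' div d <= s" using gap[of K'] Kp K Kr by simp
     show "norm (\<Sum>a\<in>{c..d}. \<Sum>b\<in>{i..j}. ee (F (of_int a) (of_int b))) <= E1"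
      if ij: "max d (K div c) + 1 <= i" "i <= j" "j <= K' div d" "j - i < N2" for i j
      unfolding E1_def L_def n_def
     proof (rule box_bound[OF g AB16 h w_def wm])
      have "l c <= i" using ij(1) cd(2) by (simp add: l_def)
      then show "B <= of_int i" using low[of c i] cd by simp
      show "of_int j <= 4 * B" using high[of d j] cd ij by (simp add: r_def)
      show "of_int (d - c) <= w * A" using dcw by simp
      have "real_of_int (j - i) <= of_int N2" using ij by simp
      then show "of_int (j - i) <= w * B" using N2 by linarith
     qed (use cr cd ij in auto)
     show "norm (\<Sum>b\<in>{i..j}. ee (F (of_int e) (of_int b))) <= E2"
      if e: "c <= e" "e <= d" "l e <= i" "j <= r e" "j - i + 1 <= 2 * s" for e i j
      unfolding E2_def
     proof (rule one)
      have "real_of_int (j - i + 1) <= of_int (2 * s)" using e(5) by (simp only: of_int_le_iff)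
      then show "of_int (j - i + 1) <= 10 * (w * B)" using s by simp
     qed (use e cd wp pos in auto)
     have "max c (K div d) + 1 >= 0" using cr by simp
     then have "real_of_int (K' div c - (max c (K div d) + 1)) <= of_int (K' div c)" by simp
     then show "of_int (K' div c - (max c (K div d) + 1)) <= 4 * B" using high[of c "K' div c"] cd by (simp add: r_def)
    qed (use pos in simp)
    also have "... <= 9 / w * E1 + (w * A) * (2 * E2)"
    proof (intro add_mono mult_right_mono E10)
     have "4 * B / of_int N2 <= 4 * B / (w * B / 2)" using N2 wp pos by (intro divide_left_mono mult_pos_pos) auto
     also have "... = 8 / w" using pos by simp
     finally have "4 * B / of_int N2 <= 8 / w" .
     moreover have "1 <= 1 / w" using w1 wp by simp
     ultimately show "4 * B / of_int N2 + 1 <= 9 / w" by simp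
     show "of_int (d - c + 1) <= w * A" using dcw by simp
    qed (use E20 in simp)
    finally show ?thesis .
   qed
   have "S <= (of_int (a1 - a0) / of_int N1 + 1) * (9 / w * E1 + (w * A) * (2 * E2))"
    unfolding S_def by (rule sum_blocks[OF N1(3) _ a(3) block]) (use E10 E20 wp pos in auto)
   also have "... <= (3 / w) * (9 / w * E1 + (w * A) * (2 * E2))"
   proof (rule mult_right_mono)
    have "of_int (a1 - a0) / of_int N1 <= A / (w * A / 2)"
     using a N1 wp pos by (intro frac_le) auto
    also have "... = 2 / w" using pos by simp
    finally have "of_int (a1 - a0) / of_int N1 <= 2 / w" .
    moreover have "1 <= 1 / w" using w1 wp by simp
    ultimately show "of_int (a1 - a0) / of_int N1 + 1 <= 3 / w" by simp
   qed (use E10 E20 wp pos in auto)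
   also have "... = 27 / w^2 * E1 + 6 * A * E2" using wp by (simp add: power2_eq_square field_simps)
   also have "27 / w^2 * E1 = (81 * sqrt Cbox2) * L^2 * (n * g)" unfolding E1_def using wp by (simp add: power2_eq_square)
   also have "6 * A * E2 <= (48 * hF * (10 * \<sigma> + 2 / \<sigma>)) * L^2 * (n * g)"
   proof -
    have "6 * A * E2 = 48 * hF * (10 * \<sigma> * (w * A * sx) + (A * B / sx) / \<sigma>)" unfolding E2_def using pos sx sg by (simp add: field_simps)
    also have "... <= 48 * hF * (10 * \<sigma> * (n * g) + (2 * (n * g)) / \<sigma>)"
     using hF0 sg by (intro mult_left_mono add_mono divide_right_mono ABs wAs) auto
    also have "... = (48 * hF * (10 * \<sigma> + 2 / \<sigma>)) * 1 * (n * g)" by (simp add: algebra_simps)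
    also have "... <= (48 * hF * (10 * \<sigma> + 2 / \<sigma>)) * L^2 * (n * g)"
     using hF0 sg nn gp by (intro mult_right_mono mult_left_mono L2) auto
    finally show ?thesis .
   qed
   finally have "S <= (81 * sqrt Cbox2) * L^2 * (n * g) + (48 * hF * (10 * \<sigma> + 2 / \<sigma>)) * L^2 * (n * g)" by simp
   also have "... = (81 * sqrt Cbox2 + 48 * hF * (10 * \<sigma> + 2 / \<sigma>)) * (L^2 * (n * g))" by (simp add: algebra_simps)
   also have "... <= CD * (L^2 * (n * g))"
    by (rule mult_right_mono[OF CD_bounds(3)]) (use nn gp in simp)
   finally show ?thesis by (simp add: mult_ac)
  qed
 qed
 then show ?thesis unfolding S_def L_def n_def l_def r_def .
qed

end

section \<open>From factor pairs to sums with divisor coefficients\<close>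

lemma card_divisor_pairs:
 fixes k :: int
 assumes k: "k > 0"
 shows "card {p::int \<times> int. fst p >= 1 \<and> snd p >= 1 \<and> fst p * snd p = k} = divisor_count (nat k)"
proof -
 have "{p::int \<times> int. fst p >= 1 \<and> snd p >= 1 \<and> fst p * snd p = k} = (\<lambda>m. (int m, k div int m)) ` {m. m dvd nat k \<and> m > 0}"
 proof (intro equalityI subsetI)
  fix p :: "int \<times> int" assume p: "p \<in> {p. fst p >= 1 \<and> snd p >= 1 \<and> fst p * snd p = k}"
  have "nat k = nat (fst p) * nat (snd p)" using p by (auto simp: nat_mult_distrib)
  moreover have "p = (int (nat (fst p)), k div int (nat (fst p)))" using p by (auto simp: prod_eq_iff)
  ultimately show "p \<in> (\<lambda>m. (int m, k div int m)) ` {m. m dvd nat k \<and> m > 0}" using p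
   by (intro image_eqI[of _ _ "nat (fst p)"]) auto
 next
  fix p assume "p \<in> (\<lambda>m. (int m, k div int m)) ` {m. m dvd nat k \<and> m > 0}"
  then obtain m where m: "m dvd nat k" "m > 0" "p = (int m, k div int m)" by auto
  obtain t where t: "nat k = m * t" using m(1) by auto
  have "t > 0" using t k by (cases t) auto
  moreover have "k = int m * int t" using t k by (metis int_nat_eq less_imp_le of_nat_mult)
  ultimately show "p \<in> {p. fst p >= 1 \<and> snd p >= 1 \<and> fst p * snd p = k}" using m by auto
 qed
 then show ?thesis by (simp add: divisor_count_def card_image inj_on_def)
qed

lemma sum_dyadic:
 fixes f :: "int => complex"
 shows "(\<Sum>a\<in>{1..2 ^ Suc J - 1}. f a) = (\<Sum>j\<in>{..J}. \<Sum>a\<in>{2 ^ j..2 ^ Suc j - 1}. f a)"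
proof (induction J)
 case (Suc J)
 have split: "{1..y - 1} = {1..x - 1} \<union> {x..y - 1}" if "1 <= x" "x <= y" for x y :: int using that by auto
 have "{1..2 ^ Suc (Suc J) - 1} = {1..2 ^ Suc J - 1} \<union> {2 ^ Suc J..2 ^ Suc (Suc J) - (1::int)}"
  by (rule split[OF one_le_power]) simp_all
 then have "(\<Sum>a\<in>{1..2 ^ Suc (Suc J) - 1}. f a) = (\<Sum>a\<in>{1..2 ^ Suc J - 1}. f a) + (\<Sum>a\<in>{2 ^ Suc J..2 ^ Suc (Suc J) - 1}. f a)"
  by (simp only:) (rule sum.union_disjoint, auto)
 then show ?case unfolding Suc.IH by simp
qed simp

text \<open>By symmetry the pairs with \<open>a < b\<close> are counted twice, plus the squares. The
  lower limit \<open>max a (K div a) + 1\<close> encodes both \<open>a < b\<close> and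
  \<open>K < a * b\<close>, and \<open>a * a <= a * b <= 2 * K < 4 ^ Suc J\<close> limits
  \<open>a\<close> to \<open>J + 1\<close> dyadic blocks.\<close>

lemma sum_divisor_count:
 fixes e :: "int => complex" and K K' :: int
 assumes K: "K >= 1" "K' <= 2 * K" and J: "2 * K < 4 ^ Suc J"
 shows "norm (\<Sum>k\<in>{K+1..K'}. of_nat (divisor_count (nat k)) * e k) <=
   2 * (\<Sum>j\<in>{..J}. norm (\<Sum>a\<in>{2 ^ j..2 ^ Suc j - 1}. \<Sum>b\<in>{max a (K div a) + 1..K' div a}. e (a * b)))
   + norm (\<Sum>a\<in>{a. a >= 1 \<and> K < a * a \<and> a * a <= K'}. e (a * a))"
proof -
 define Pr where "Pr = {p::int \<times> int. fst p >= 1 \<and> snd p >= 1 \<and> K < fst p * snd p \<and> fst p * snd p <= K'}"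
 define h where "h p = e (fst p * snd p)" for p :: "int \<times> int"
 have "Pr \<subseteq> {1..K'} \<times> {1..K'}"
 proof
  fix p assume p: "p \<in> Pr"
  obtain a b where ab: "p = (a, b)" by (cases p)
  have 1: "1 <= a" "1 <= b" "a * b <= K'" using p by (auto simp: Pr_def ab)
  have "a * 1 <= a * b" by (rule mult_left_mono) (use 1 in auto)
  moreover have "1 * b <= a * b" by (rule mult_right_mono) (use 1 in auto)
  ultimately have "a <= K'" "b <= K'" using 1 by linarith+
  then show "p \<in> {1..K'} \<times> {1..K'}" using 1 by (simp add: ab)
 qed
 then have fin: "finite Pr" by (rule finite_subset) simp
 have "(\<Sum>k\<in>{K+1..K'}. of_nat (divisor_count (nat k)) * e k) = (\<Sum>k\<in>{K+1..K'}. \<Sum>p\<in>{p\<in>Pr. fst p * snd p = k}. h p)"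
 proof (rule sum.cong[OF refl])
  fix k assume k: "k \<in> {K+1..K'}"
  then have eq: "{p\<in>Pr. fst p * snd p = k} = {p::int \<times> int. fst p >= 1 \<and> snd p >= 1 \<and> fst p * snd p = k}" by (auto simp: Pr_def)
  have "(\<Sum>p\<in>{p\<in>Pr. fst p * snd p = k}. h p) = (\<Sum>p\<in>{p\<in>Pr. fst p * snd p = k}. e k)" by (rule sum.cong) (auto simp: h_def)
  also have "... = of_nat (card {p\<in>Pr. fst p * snd p = k}) * e k" by simp
  also have "card {p\<in>Pr. fst p * snd p = k} = divisor_count (nat k)" unfolding eq using k K by (intro card_divisor_pairs) auto
  finally show "of_nat (divisor_count (nat k)) * e k = (\<Sum>p\<in>{p\<in>Pr. fst p * snd p = k}. h p)" by simp
 qed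
 also have "... = (\<Sum>p\<in>Pr. h p)" by (rule sum.group[OF fin]) (auto simp: Pr_def)
 also have "Pr = ({p\<in>Pr. fst p < snd p} \<union> {p\<in>Pr. snd p < fst p}) \<union> {p\<in>Pr. fst p = snd p}" by auto
 also have "(\<Sum>p\<in>.... h p) = ((\<Sum>p\<in>{p\<in>Pr. fst p < snd p}. h p) + (\<Sum>p\<in>{p\<in>Pr. snd p < fst p}. h p)) + (\<Sum>p\<in>{p\<in>Pr. fst p = snd p}. h p)"
 proof -
  have "(\<Sum>p\<in>{p\<in>Pr. fst p < snd p} \<union> {p\<in>Pr. snd p < fst p}. h p) = (\<Sum>p\<in>{p\<in>Pr. fst p < snd p}. h p) + (\<Sum>p\<in>{p\<in>Pr. snd p < fst p}. h p)"
   using fin by (intro sum.union_disjoint) auto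
  then show ?thesis using fin by (subst sum.union_disjoint) auto
 qed
 also have "(\<Sum>p\<in>{p\<in>Pr. snd p < fst p}. h p) = (\<Sum>p\<in>{p\<in>Pr. fst p < snd p}. h p)"
  by (rule sum.reindex_bij_witness[of _ prod.swap prod.swap]) (auto simp: Pr_def h_def mult.commute)
 also have "(\<Sum>p\<in>{p\<in>Pr. fst p = snd p}. h p) = (\<Sum>a\<in>{a. a >= 1 \<and> K < a * a \<and> a * a <= K'}. e (a * a))"
  by (rule sum.reindex_bij_witness[of _ "\<lambda>a. (a, a)" fst]) (auto simp: Pr_def h_def)
 also have "(\<Sum>p\<in>{p\<in>Pr. fst p < snd p}. h p) = (\<Sum>a\<in>{1..2 ^ Suc J - 1}. \<Sum>b\<in>{max a (K div a) + 1..K' div a}. e (a * b))"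
 proof -
  have "{p\<in>Pr. fst p < snd p} = Sigma {1..2 ^ Suc J - 1} (\<lambda>a. {max a (K div a) + 1..K' div a})"
  proof (intro equalityI subsetI)
   fix p assume p: "p \<in> {p\<in>Pr. fst p < snd p}"
   obtain a b where ab: "p = (a, b)" by (cases p)
   have a: "a >= 1" "a < b" "K < a * b" "a * b <= K'" using p by (auto simp: ab Pr_def)
   have "a * a <= a * b" using a by (intro mult_left_mono) auto
   then have "a * a < 4 ^ Suc J" using a K J by linarith
   moreover have "(4::int) ^ Suc J = 2 ^ Suc J * 2 ^ Suc J" by (simp flip: power_mult_distrib)
   ultimately have "a < 2 ^ Suc J" by (metis not_le mult_mono' zero_le_numeral zero_le_power)
   moreover have "K div a < b" using a by (simp add: int_div_less_iff mult.commute)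
   moreover have "b <= K' div a" using a by (simp add: int_le_div_iff mult.commute)
   ultimately show "p \<in> Sigma {1..2 ^ Suc J - 1} (\<lambda>a. {max a (K div a) + 1..K' div a})" using a by (simp add: ab)
  next
   fix p assume p: "p \<in> Sigma {1..2 ^ Suc J - 1} (\<lambda>a. {max a (K div a) + 1..K' div a})"
   obtain a b where ab: "p = (a, b)" by (cases p)
   have a: "a >= 1" "a < b" "K div a < b" "b <= K' div a" using p by (auto simp: ab)
   then have "K < a * b" "a * b <= K'" by (simp_all add: int_div_less_iff int_le_div_iff mult.commute)
   then show "p \<in> {p\<in>Pr. fst p < snd p}" using a by (simp add: ab Pr_def)
  qed
  then show ?thesis by (simp add: sum.Sigma h_def case_prod_unfold)
 qed
 finally have eq: "(\<Sum>k\<in>{K+1..K'}. of_nat (divisor_count (nat k)) * e k) =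
   ((\<Sum>a\<in>{1..2 ^ Suc J - 1}. \<Sum>b\<in>{max a (K div a) + 1..K' div a}. e (a * b)) + (\<Sum>a\<in>{1..2 ^ Suc J - 1}. \<Sum>b\<in>{max a (K div a) + 1..K' div a}. e (a * b)))
   + (\<Sum>a\<in>{a. a >= 1 \<and> K < a * a \<and> a * a <= K'}. e (a * a))" .
 have "norm (\<Sum>a\<in>{1..2 ^ Suc J - 1}. \<Sum>b\<in>{max a (K div a) + 1..K' div a}. e (a * b)) <= (\<Sum>j\<in>{..J}. norm (\<Sum>a\<in>{2 ^ j..2 ^ Suc j - 1}. \<Sum>b\<in>{max a (K div a) + 1..K' div a}. e (a * b)))"
  unfolding sum_dyadic by (rule norm_sum)
 moreover have "norm ((x + x) + y) <= 2 * norm x + norm y" for x y :: complex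
  using norm_triangle_ineq[of "x + x" y] norm_triangle_ineq[of x x] by linarith
 ultimately show ?thesis unfolding eq by (smt (verit))
qed

lemma PH_nil: "x > 0 ==> y > 0 ==> PH ga U V [] x y = U * (x * y) powr (- ga) + V * (x * y) powr (- (ga + 1))"
 by (simp only: PH_def DD.simps powr_mult)

definition CM :: "real => real" where "CM ga = 2 * phase.CD ga + 2"

text \<open>All dyadic blocks have \<open>A * B = k / 2\<close> and hence the same phase size
  \<open>X\<close>, so each obeys the same bound, and their number \<open>J + 1\<close> costs one
  more logarithm. The squares are estimated trivially.\<close>

lemma divisor_exponential_sum:
 fixes K K' :: int and ga U V g X :: real
 assumes gam: "ga > 0" and U: "U > 0" "\<bar>V\<bar> <= ga * U" and K: "K >= 8" "K <= K'" "K' <= 2 * K"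
  and X: "X = U * (of_int K / 2) powr (- ga)"
  and g: "g >= 1" "of_int K / 2 <= g^3" "X <= g^3" "g^4 <= 4 * X * sqrt (of_int K / 2)"
 shows "norm (\<Sum>k\<in>{K+1..K'}. of_nat (divisor_count (nat k)) * ee (U * of_int k powr (- ga) + V * of_int k powr (- (ga + 1))))
  <= CM ga * (1 + ln (50 * of_int K))^3 * (sqrt (of_int K) * g)"
proof -
 define k where "k = real_of_int K"
 have k8: "k >= 8" using K by (simp add: k_def)
 define L where "L = 1 + ln (50 * k)"
 have L1: "L >= 1" unfolding L_def using k8 by simp
 define e where "e n = ee (U * of_int n powr (- ga) + V * of_int n powr (- (ga + 1)))" for n :: int
 have "\<exists>J. (4::nat) ^ J <= nat (2 * K) \<and> nat (2 * K) < 4 ^ Suc J"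
  using ex_power_ivl1[of 4 "nat (2 * K)"] K by auto
 then obtain J where J: "(4::nat) ^ J <= nat (2 * K)" "nat (2 * K) < 4 ^ Suc J" by blast
 have J1: "(4::real) ^ J <= 2 * k"
 proof -
  have "real (4 ^ J) <= real (nat (2 * K))" using J(1) by (simp only: of_nat_le_iff)
  then show ?thesis using K by (simp add: k_def)
 qed
 have J2: "2 * K < 4 ^ Suc J"
 proof -
  have "int (nat (2 * K)) < int (4 ^ Suc J)" using J(2) by (simp only: of_nat_less_iff)
  then show ?thesis using K by simp
 qed
 have JL: "real J + 1 <= L"
 proof -
  have "real J * ln 4 <= ln (2 * k)"
   using J1 k8 by (subst ln_realpow[symmetric]) (auto simp del: ln_mult)
  moreover have "ln (4::real) >= 1"
  proof -
   have "ln (4::real) = 2 * ln 2" using ln_realpow[of 2 2] by simp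
   then show ?thesis using ln2_ge_two_thirds by simp
  qed
  then have "real J * 1 <= real J * ln 4" by (intro mult_left_mono) auto
  moreover have "ln (2 * k) <= ln (50 * k)" using k8 by (simp del: ln_mult)
  ultimately show ?thesis unfolding L_def by simp
 qed
 \<comment> \<open>\<open>phase.CD\<close> depends on \<open>ga\<close> alone, but its positivity is
   proved inside the locale; an arbitrary instance makes it available here.\<close>
 interpret aux: phase ga U V 1 1 U by unfold_locales (use gam U in auto)
 have CD0: "phase.CD ga >= 0" using aux.CD_bounds(4) by simp
 have block: "norm (\<Sum>a\<in>{2 ^ j..2 ^ Suc j - 1}. \<Sum>b\<in>{max a (K div a) + 1..K' div a}. e (a * b)) <= phase.CD ga * L^2 * (sqrt k * g)" if j: "j <= J" for j
 proof -
  define A where "A = (2::real) ^ j"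
  define B where "B = k / (2 * A)"
  have A: "A >= 1" by (simp add: A_def)
  have "A * A = 4 ^ j" unfolding A_def by (simp flip: power_mult_distrib)
  also have "... <= 4 ^ J" using j by (intro power_increasing) auto
  finally have A2: "A * A <= 2 * k" using J1 by linarith
  have AB: "A * B = k / 2" using A by (simp add: B_def)
  have "A <= k / 2"
  proof (rule power2_le_imp_le)
   have "8 * k <= k * k" using k8 by (intro mult_right_mono) auto
   then show "A\<^sup>2 <= (k / 2)\<^sup>2" using A2 by (simp add: power2_eq_square)
  qed (use k8 in simp)
  then have B: "B >= 1" using A by (simp add: B_def)
  have A4: "A <= 4 * B" using A A2 by (simp add: B_def pos_le_divide_eq)
  interpret phase ga U V A B X
   by unfold_locales (use gam U A B A4 X in \<open>simp_all only: k_def AB\<close>)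
  have "norm (\<Sum>a\<in>{2 ^ j..2 ^ Suc j - 1}. \<Sum>b\<in>{max a (K div a) + 1..K' div a}. e (a * b))
    = norm (\<Sum>a\<in>{2 ^ j..2 ^ Suc j - 1}. \<Sum>b\<in>{max a (K div a) + 1..K' div a}. ee (F (of_int a) (of_int b)))"
  proof (intro arg_cong[of _ _ norm] sum.cong refl)
   fix a b :: int assume ab: "a \<in> {2 ^ j..2 ^ Suc j - 1}" "b \<in> {max a (K div a) + 1..K' div a}"
   have "(0::int) < 2 ^ j" by simp
   then have "a > 0" "b > 0" using ab by auto
   then show "e (a * b) = ee (F (of_int a) (of_int b))" by (simp only: e_def PH_nil of_int_0_less_iff of_int_mult)
  qed
  also have "... <= CD * (1 + ln (50 * B))\<^sup>2 * (sqrt (A * B) * g)"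
  proof (rule dyadic_rows[OF _ K(2,3) g(1)])
   show "of_int K = 2 * (A * B)" using AB by (simp add: k_def)
   show "A * B <= g^3" "X <= g^3" "g^4 <= 4 * X * sqrt (A * B)" using g unfolding AB k_def by simp_all
   show "A <= of_int (2 ^ j)" "of_int (2 ^ Suc j - 1) <= 2 * A" by (simp_all add: A_def)
   have "(1::int) <= 2 ^ j" by simp
   then show "(2::int) ^ j <= 2 ^ Suc j - 1" by simp
  qed
  also have "... <= CD * L^2 * (sqrt k * g)"
   unfolding AB
  proof (intro mult_mono mult_left_mono power_mono)
   have "B <= k" using A k8 by (simp add: B_def divide_le_eq)
   then show "1 + ln (50 * B) <= L" unfolding L_def using B by (simp del: ln_mult)
   show "sqrt (k / 2) <= sqrt k" using k8 by simp
  qed (use CD0 g k8 B in auto)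
  finally show ?thesis .
 qed
 have diag: "norm (\<Sum>a\<in>{a. a >= 1 \<and> K < a * a \<and> a * a <= K'}. e (a * a)) <= 2 * (sqrt k * g)"
 proof -
  have sub: "{a. a >= 1 \<and> K < a * a \<and> a * a <= K'} \<subseteq> {1..\<lfloor>sqrt (2 * k)\<rfloor>}"
  proof
   fix a assume "a \<in> {a. a >= 1 \<and> K < a * a \<and> a * a <= K'}"
   then have a: "a >= 1" "a * a <= 2 * K" using K by auto
   then have "real_of_int (a * a) <= of_int (2 * K)" by (simp only: of_int_le_iff)
   then have "(of_int a)\<^sup>2 <= 2 * k" by (simp add: k_def power2_eq_square)
   then have "of_int a <= sqrt (2 * k)" by (rule real_le_rsqrt)
   then show "a \<in> {1..\<lfloor>sqrt (2 * k)\<rfloor>}" using a by (simp add: le_floor_iff)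
  qed
  have "norm (\<Sum>a\<in>{a. a >= 1 \<and> K < a * a \<and> a * a <= K'}. e (a * a)) <= (\<Sum>a\<in>{a. a >= 1 \<and> K < a * a \<and> a * a <= K'}. 1)"
   by (rule sum_norm_le) (simp add: e_def)
  also have "... <= (\<Sum>a\<in>{1..\<lfloor>sqrt (2 * k)\<rfloor>}. 1)" by (rule sum_mono2[OF _ sub]) auto
  also have "... = real (nat \<lfloor>sqrt (2 * k)\<rfloor>)" by simp
  also have "... <= sqrt (2 * k)" using k8 by simp
  also have "... <= sqrt (4 * k)" using k8 by simp
  also have "... = 2 * (sqrt k * 1)" by (simp add: real_sqrt_mult)
  also have "... <= 2 * (sqrt k * g)" using g k8 by (intro mult_left_mono) auto
  finally show ?thesis .
 qed
 define t where "t = sqrt k * g"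
 have t: "t >= 0" using g k8 by (simp add: t_def)
 have "norm (\<Sum>n\<in>{K+1..K'}. of_nat (divisor_count (nat n)) * e n) <=
   2 * (\<Sum>j\<in>{..J}. norm (\<Sum>a\<in>{2 ^ j..2 ^ Suc j - 1}. \<Sum>b\<in>{max a (K div a) + 1..K' div a}. e (a * b)))
   + norm (\<Sum>a\<in>{a. a >= 1 \<and> K < a * a \<and> a * a <= K'}. e (a * a))"
  by (rule sum_divisor_count[OF _ K(3) J2]) (use K in simp)
 also have "... <= 2 * (\<Sum>j\<in>{..J}. phase.CD ga * L^2 * t) + 2 * t"
  unfolding t_def by (intro add_mono mult_left_mono sum_mono block diag) auto
 also have "(\<Sum>j\<in>{..J}. phase.CD ga * L^2 * t) = (real J + 1) * (phase.CD ga * L^2 * t)" by (simp add: add.commute)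
 also have "2 * ((real J + 1) * (phase.CD ga * L^2 * t)) + 2 * t <= 2 * (L * (phase.CD ga * L^2 * t)) + 2 * (L^3 * t)"
 proof (intro add_mono mult_left_mono mult_right_mono JL)
  have "1 * t <= L^3 * t" using L1 t by (intro mult_right_mono) auto
  then show "t <= L^3 * t" by simp
 qed (use CD0 t in auto)
 also have "... = CM ga * L^3 * t" by (simp add: CM_def algebra_simps power2_eq_square power3_eq_cube)
 finally show ?thesis unfolding e_def t_def L_def k_def .
qed

text \<open>Two applications of the mean value theorem. The first order term is the one carried by
  \<open>V = - ga * U\<close>, so that only this second order error remains for the sum over
  \<open>\<psi>\<close> at \<open>k + 1\<close>.\<close>

lemma powr_second_order:
 fixes k ga :: real
 assumes k: "k > 0" and g: "ga > 0"
 shows "\<bar>(k + 1) powr (- ga) - (k powr (- ga) - ga * k powr (- (ga + 1)))\<bar> <= ga * (ga + 1) * k powr (- (ga + 2))"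
proof -
 have d: "((\<lambda>t. t powr (- a)) has_real_derivative - a * t powr (- (a + 1))) (at t)" if "t > 0" for a t :: real
  using DERIV_fun_powr[OF DERIV_ident that, of "- a"] by simp
 have "\<exists>t>k. t < k + 1 \<and> ((k + 1) powr (- ga) + ga * k powr (- (ga + 1)) * (k + 1)) - (k powr (- ga) + ga * k powr (- (ga + 1)) * k)
   = (k + 1 - k) * (- ga * t powr (- (ga + 1)) + ga * k powr (- (ga + 1)))"
  by (rule MVT2) (use k in \<open>auto intro!: derivative_eq_intros d\<close>)
 then obtain t where t: "t > k" "t < k + 1"
  "((k + 1) powr (- ga) + ga * k powr (- (ga + 1)) * (k + 1)) - (k powr (- ga) + ga * k powr (- (ga + 1)) * k)
   = - ga * t powr (- (ga + 1)) + ga * k powr (- (ga + 1))" by auto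
 have "\<exists>s>k. s < t \<and> t powr (- (ga + 1)) - k powr (- (ga + 1)) = (t - k) * (- (ga + 1) * s powr (- (ga + 1 + 1)))"
  by (rule MVT2[OF t(1)]) (rule d, use k in auto)
 then obtain s where s: "s > k" "s < t" "t powr (- (ga + 1)) - k powr (- (ga + 1)) = (t - k) * (- (ga + 1) * s powr (- (ga + 1 + 1)))" by blast
 have sk: "s powr (- (ga + 1 + 1)) <= k powr (- (ga + 1 + 1))" using s k g by (intro powr_mono2') auto
 have "ga * ((t - k) * ((ga + 1) * s powr (- (ga + 1 + 1)))) <= ga * (1 * ((ga + 1) * k powr (- (ga + 1 + 1))))"
  using t g sk by (intro mult_left_mono mult_mono) auto
 moreover have "0 <= ga * ((t - k) * ((ga + 1) * s powr (- (ga + 1 + 1))))" using t g by simp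
 moreover have "(k + 1) powr (- ga) - (k powr (- ga) - ga * k powr (- (ga + 1))) = ga * ((t - k) * ((ga + 1) * s powr (- (ga + 1 + 1))))"
 proof -
  have "(k + 1) powr (- ga) - (k powr (- ga) - ga * k powr (- (ga + 1))) = - ga * (t powr (- (ga + 1)) - k powr (- (ga + 1)))"
   using t(3) by (simp add: algebra_simps)
  then show ?thesis unfolding s(3) by (simp add: algebra_simps)
 qed
 ultimately show ?thesis by (simp add: add.assoc)
qed

definition CP :: "real => real" where "CP ga = 46 * (2 powr (ga + 1) + CM ga + 7 * ga * (ga + 1))"

text \<open>Frequencies \<open>h\<close> up to \<open>t = k / (2 powr ga * N)\<close> are used, and
  the phase size is \<open>X = 2 powr ga * h * Y <= k * Y / N\<close>. With
  \<open>g^3 = max k X\<close>, the second and third condition in \<open>c\<close> give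
  \<open>sqrt k * g <= N\<close> when \<open>k\<close> respectively \<open>X\<close> is the larger
  one. The fourth gives \<open>X <= k * sqrt k\<close>, which yields
  \<open>g^4 <= X * sqrt k\<close> if \<open>X > k\<close> and bounds the linearisation error; the
  fifth gives \<open>g^4 <= X * sqrt k\<close> if \<open>X <= k\<close>.\<close>

lemma dyadic_psi:
 fixes ga z N \<delta> D :: real and K K' :: int
 defines "k \<equiv> real_of_int K"
 defines "Y \<equiv> z * k powr (- ga)"
 assumes gam: "ga > 0" and z: "z > 0" and \<delta>: "\<delta> = 0 \<or> \<delta> = 1" and K: "K >= 8" "K <= K'" "K' <= 2 * K" and N: "N > 0"
  and D: "D >= 1" "\<And>n. K < n ==> n <= K' ==> real (divisor_count (nat n)) <= D"
  and c: "2 powr ga * N <= k" "k powr (5/6) <= N" "k powr (5/2) * Y <= N^4" "Y <= sqrt k * N" "k powr (5/6) <= Y"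
 shows "\<bar>\<Sum>n\<in>{K+1..K'}. real (divisor_count (nat n)) * psi (z * (of_int n + \<delta>) powr (- ga))\<bar> <= CP ga * (1 + ln (50 * k))^5 * (D * N)"
proof -
 define L where "L = 1 + ln (50 * k)"
 define d where "d n = real (divisor_count (nat n))" for n :: int
 define y where "y n = z * (of_int n + \<delta>) powr (- ga)" for n :: int
 have k8: "k >= 8" using K by (simp add: k_def)
 have L1: "L >= 1" unfolding L_def using k8 by simp
 interpret aux: phase ga 1 0 1 1 1 by unfold_locales (use gam in auto)
 have CM0: "CM ga >= 0" unfolding CM_def using aux.CD_bounds(4) by simp
 have Y: "Y > 0" unfolding Y_def using z k8 by simp
 \<comment> \<open>The factor \<open>2 powr ga\<close> cancels the one in \<open>X\<close>, which is
   taken at \<open>k / 2\<close>. Truncation at about \<open>t\<close> frequencies costs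
   \<open>k / t\<close> times \<open>D\<close>, of order \<open>D * N\<close>.\<close>
 define t where "t = k / (2 powr ga * N)"
 have t1: "t >= 1" unfolding t_def using c(1) N by simp
 have "1 <= nat \<lfloor>t\<rfloor>" using t1 by linarith
 then obtain J where J: "2 ^ J <= nat \<lfloor>t\<rfloor>" "nat \<lfloor>t\<rfloor> < 2 ^ (J + 1)" using ex_power_ivl1[of 2 "nat \<lfloor>t\<rfloor>"] by auto
 have J1: "2 ^ J <= t"
 proof -
  have "real (2 ^ J) <= real (nat \<lfloor>t\<rfloor>)" using J(1) by (simp only: of_nat_le_iff)
  also have "... <= t" using t1 by simp
  finally show ?thesis by simp
 qed
 have J2: "t <= 2 * 2 ^ J"
 proof -
  have "real (nat \<lfloor>t\<rfloor>) + 1 <= real (2 ^ (J + 1))" using J(2) by (simp only: of_nat_Suc[symmetric] of_nat_le_iff Suc_leI add.commute flip: Suc_eq_plus1_left)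
  moreover have "t <= real (nat \<lfloor>t\<rfloor>) + 1" using t1 by linarith
  ultimately show ?thesis by simp
 qed
 have kN: "sqrt k <= N"
 proof -
  have "sqrt k = k powr (1/2)" using k8 by (simp add: powr_half_sqrt)
  also have "... <= k powr (5/6)" using k8 by (intro powr_mono) auto
  finally show ?thesis using c(2) by linarith
 qed
 have tk: "t <= k"
 proof -
  have "1 <= sqrt k" using k8 by simp
  then have "1 <= N" using kN by linarith
  then have "1 * 1 <= 2 powr ga * N" using gam by (intro mult_mono ge_one_powr_ge_zero) auto
  then have "k / (2 powr ga * N) <= k / 1" using k8 by (intro divide_left_mono) auto
  then show ?thesis by (simp add: t_def)
 qed
 have lnJ: "real J * ln 2 <= ln k"
 proof -
  have "ln (2 ^ J) <= ln k" using J1 tk by (subst ln_le_cancel_iff) (use k8 in auto)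
  then show ?thesis by (simp add: ln_realpow)
 qed
 have lnkL: "1 + ln k <= L" unfolding L_def using k8 by simp
 have JL: "real J + 1 <= 2 * L"
 proof -
  have "real J * (1/2) <= real J * ln 2" using ln2_ge_two_thirds by (intro mult_left_mono) auto
  then show ?thesis using lnJ lnkL L1 by linarith
 qed
 have harm: "(\<Sum>h\<in>{1..2 ^ J}. 1 / real h) <= L"
 proof -
  have "(\<Sum>h\<in>{1..2 ^ J}. 1 / real h) <= 1 + ln (real (2 ^ J))" by (rule sum_inverse_le_ln) simp
  also have "... <= L" using lnJ lnkL by (simp add: ln_realpow)
  finally show ?thesis .
 qed
 have dn: "d n >= 0" "n \<in> {K+1..K'} ==> d n <= D" for n using D by (auto simp: d_def)
 have W: "(\<Sum>n\<in>{K+1..K'}. d n) <= k * D"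
 proof -
  have "(\<Sum>n\<in>{K+1..K'}. d n) <= (\<Sum>n\<in>{K+1..K'}. D)" by (intro sum_mono dn)
  also have "... = of_int (K' - K) * D" using K by simp
  also have "... <= k * D" using K D by (intro mult_right_mono) (auto simp: k_def)
  finally show ?thesis .
 qed
 have exps: "norm (\<Sum>n\<in>{K+1..K'}. of_real (d n) * ee (real h * y n)) <= (CM ga + 7 * ga * (ga + 1)) * (L^3 * D * N)" if h: "h \<in> {1..2 ^ J}" for h
 proof -
  define U where "U = real h * z"
  define V where "V = - \<delta> * ga * U"
  define X where "X = U * (k / 2) powr (- ga)"
  have h1: "real h >= 1" "real h <= t"
  proof -
   show "real h >= 1" using h by simp
   have "real h <= real (2 ^ J)" using h by (simp only: of_nat_le_iff atLeastAtMost_iff)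
   moreover have "real (2 ^ J) = 2 ^ J" by simp
   ultimately show "real h <= t" using J1 by linarith
  qed
  have U: "U > 0" "\<bar>V\<bar> <= ga * U" using h1 z gam \<delta> by (auto simp: U_def V_def abs_mult)
  have Xeq: "X = 2 powr ga * (real h * Y)"
   unfolding X_def U_def Y_def using k8 by (simp add: powr_divide powr_minus field_simps)
  have p2: "2 powr ga >= 1" using gam by (intro ge_one_powr_ge_zero) auto
  have XY: "Y <= X" "real h * Y <= X"
  proof -
   have "1 * Y <= real h * Y" using h1 Y by (intro mult_right_mono) auto
   moreover show "real h * Y <= X" unfolding Xeq using mult_right_mono[OF p2, of "real h * Y"] Y by simp
   ultimately show "Y <= X" by simp
  qed
  have Xp: "X > 0" using XY Y by linarith
  have Xle: "X <= k * Y / N"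
  proof -
   have "X <= 2 powr ga * (t * Y)" unfolding Xeq using h1 Y by (intro mult_left_mono mult_right_mono) auto
   also have "... = k * Y / N" unfolding t_def using N by simp
   finally show ?thesis .
  qed
  have X32: "X <= k * sqrt k"
  proof -
   have "k * Y / N <= k * (sqrt k * N) / N" using c(4) k8 N by (intro divide_right_mono mult_left_mono) auto
   then show ?thesis using Xle N by simp
  qed
  have XN: "X <= (N / sqrt k)^3"
  proof -
   have "k powr (5/2) = k * k * sqrt k"
   proof -
    have "k powr (5/2) = k powr (2 + 1/2)" by simp
    also have "... = k powr 2 * k powr (1/2)" by (rule powr_add)
    finally show ?thesis using k8 by (simp add: powr_half_sqrt powr_numeral power2_eq_square)
   qed
   then have "k * k * sqrt k * Y <= N^4" using c(3) by simp
   then have "k * Y / N <= N^3 / (k * sqrt k)" using k8 N by (simp add: field_simps eval_nat_numeral)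
   also have "... = (N / sqrt k)^3" using k8 by (simp add: power_divide eval_nat_numeral)
   finally show ?thesis using Xle by linarith
  qed
  define g where "g = (max k X) powr (1/3)"
  have mx: "max k X > 0" using k8 by simp
  have g3: "g^3 = max k X"
  proof -
   have "g^3 = g powr 3" using mx by (simp add: g_def powr_numeral)
   then show ?thesis using mx by (simp add: g_def powr_powr)
  qed
  have g1: "g >= 1" unfolding g_def using k8 by (intro ge_one_powr_ge_zero) auto
  have root: "s powr (1/3) <= r" if "s <= r^3" "r >= 0" "s >= 0" for s r :: real
  proof (cases "r = 0")
   case True then show ?thesis using that by simp
  next
   case False
   have "s powr (1/3) <= (r^3) powr (1/3)" using that by (intro powr_mono2) auto
   also have "r^3 = r powr 3" using False that by (simp add: powr_numeral)
   also have "(r powr 3) powr (1/3) = r powr (3 * (1/3))" by (rule powr_powr)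
   also have "... = r" using that by simp
   finally show ?thesis .
  qed
  have k56: "k powr (5/6) = k powr (1/3) * sqrt k"
  proof -
   have "k powr (5/6) = k powr (1/3 + 1/2)" by simp
   also have "... = k powr (1/3) * k powr (1/2)" by (rule powr_add)
   finally show ?thesis using k8 by (simp add: powr_half_sqrt)
  qed
  have gcases: "sqrt k * g <= N \<and> g^4 <= X * sqrt k"
  proof (cases "X <= k")
   case True
   then have g: "g = k powr (1/3)" "g^3 = k" using g3 by (simp_all add: g_def max_def)
   have "sqrt k * g = k powr (5/6)" unfolding k56 g by simp
   moreover have "g^4 <= X * sqrt k"
   proof -
    have "g^4 = g^3 * g" by (simp add: eval_nat_numeral)
    also have "... = k * k powr (1/3)" using g by simp
    also have "... = k powr (5/6) * sqrt k" unfolding k56 using k8 by simp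
    also have "... <= X * sqrt k" using c(5) XY k8 by (intro mult_right_mono) auto
    finally show ?thesis .
   qed
   ultimately show ?thesis using c(2) by simp
  next
   case False
   then have g: "g = X powr (1/3)" "g^3 = X" using g3 by (simp_all add: g_def max_def)
   have "g <= N / sqrt k" unfolding g by (rule root[OF XN]) (use N Xp k8 in auto)
   then have "sqrt k * g <= N" using k8 by (simp add: field_simps)
   moreover have "g <= sqrt k" unfolding g by (rule root) (use X32 Xp k8 in \<open>auto simp: power3_eq_cube\<close>)
   then have "g^3 * g <= X * sqrt k" unfolding g(2) using Xp by (intro mult_left_mono) auto
   ultimately show ?thesis by (simp add: eval_nat_numeral mult_ac)
  qed
  have main: "norm (\<Sum>n\<in>{K+1..K'}. of_nat (divisor_count (nat n)) * ee (U * of_int n powr (- ga) + V * of_int n powr (- (ga + 1))))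
   <= CM ga * (1 + ln (50 * of_int K))^3 * (sqrt (of_int K) * g)"
  proof (rule divisor_exponential_sum[OF gam U K _ g1])
   show "X = U * (of_int K / 2) powr (- ga)" by (simp add: X_def k_def)
   show "of_int K / 2 <= g^3" "X <= g^3" unfolding g3 k_def[symmetric] using k8 by auto
   have "g^4 <= X * sqrt k" using gcases by blast
   also have "... <= X * (4 * sqrt (k / 2))"
   proof (rule mult_left_mono)
    have "sqrt k <= sqrt (16 * (k / 2))" using k8 by simp
    then show "sqrt k <= 4 * sqrt (k / 2)" by (simp only: real_sqrt_mult) simp
   qed (use Xp in simp)
   finally show "g^4 <= 4 * X * sqrt (of_int K / 2)" by (simp add: k_def mult_ac)
  qed
  have mainN: "CM ga * (1 + ln (50 * of_int K))^3 * (sqrt (of_int K) * g) <= CM ga * (L^3 * D * N)"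
  proof -
   have "CM ga * (L^3) * (sqrt k * g) <= CM ga * (L^3) * (D * N)"
   proof (rule mult_left_mono)
    have "1 * N <= D * N" using D N by (intro mult_right_mono) auto
    then show "sqrt k * g <= D * N" using gcases by linarith
   qed (use CM0 L1 in simp)
   then show ?thesis by (simp add: L_def k_def mult.assoc)
  qed
  \<comment> \<open>Replacing the phase by its two-term expansion changes each exponential by
    \<open>h * Y / k^2 <= 1 / sqrt k\<close> up to constants, hence the whole sum by order
    \<open>D * sqrt k <= D * N\<close>.\<close>
  have err: "norm (\<Sum>n\<in>{K+1..K'}. of_real (d n) * (ee (real h * y n) - ee (U * of_int n powr (- ga) + V * of_int n powr (- (ga + 1))))) <= 7 * ga * (ga + 1) * (D * N)"
  proof -
   have "norm (\<Sum>n\<in>{K+1..K'}. of_real (d n) * (ee (real h * y n) - ee (U * of_int n powr (- ga) + V * of_int n powr (- (ga + 1))))) <= (\<Sum>n\<in>{K+1..K'}. d n * (7 * ga * (ga + 1) * (sqrt k / k)))"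
   proof (rule sum_norm_le)
    fix n assume n: "n \<in> {K+1..K'}"
    define m where "m = real_of_int n"
    have "k + 1 <= m" using n unfolding k_def m_def by (metis atLeastAtMost_iff of_int_1 of_int_add of_int_le_iff)
    then have mk: "m >= k" "m > 0" using k8 by linarith+
    have "\<bar>real h * y n - (U * m powr (- ga) + V * m powr (- (ga + 1)))\<bar> <= U * (ga * (ga + 1) * m powr (- (ga + 2)))"
    proof (cases "\<delta> = 0")
     case True
     then have "real h * y n - (U * m powr (- ga) + V * m powr (- (ga + 1))) = 0" by (simp add: y_def U_def V_def m_def)
     then show ?thesis using U gam by simp
    next
     case False
     then have d1: "\<delta> = 1" using \<delta> by simp
     have "real h * y n - (U * m powr (- ga) + V * m powr (- (ga + 1))) = U * ((m + 1) powr (- ga) - (m powr (- ga) - ga * m powr (- (ga + 1))))"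
      by (simp add: y_def U_def V_def m_def d1 algebra_simps)
     then show ?thesis using U powr_second_order[OF mk(2) gam] by (simp add: abs_mult)
    qed
    also have "... <= ga * (ga + 1) * (sqrt k / k)"
    proof -
     have "m powr (- (ga + 2)) <= k powr (- (ga + 2))" using mk k8 gam by (intro powr_mono2') auto
     also have "... = k powr (- ga) / k^2"
     proof -
      have "k powr (- (ga + 2)) = k powr (- ga + - 2)" by simp
      also have "... = k powr (- ga) * k powr (- 2)" by (rule powr_add)
      finally show ?thesis using k8 by (simp add: powr_minus powr_numeral divide_inverse)
     qed
     finally have "U * m powr (- (ga + 2)) <= U * (k powr (- ga) / k^2)" using U by (intro mult_left_mono) auto
     also have "... = real h * Y / k^2" by (simp add: U_def Y_def)
     also have "... <= (k * sqrt k) / k^2" using XY(2) X32 by (intro divide_right_mono) auto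
     also have "... = sqrt k / k" using k8 by (simp add: power2_eq_square)
     finally have "ga * (ga + 1) * (U * m powr (- (ga + 2))) <= ga * (ga + 1) * (sqrt k / k)" using gam by (intro mult_left_mono) auto
     then show ?thesis by (simp add: mult_ac)
    qed
    finally have "norm (ee (real h * y n) - ee (U * m powr (- ga) + V * m powr (- (ga + 1)))) <= 2 * pi * (ga * (ga + 1) * (sqrt k / k))"
     using norm_ee_diff_le order.trans by (meson mult_left_mono pi_ge_zero mult_nonneg_nonneg zero_le_numeral)
    also have "... <= 7 * (ga * (ga + 1) * (sqrt k / k))" using pi_approx gam k8 by (intro mult_right_mono) auto
    finally have "norm (ee (real h * y n) - ee (U * m powr (- ga) + V * m powr (- (ga + 1)))) <= 7 * ga * (ga + 1) * (sqrt k / k)" by simp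
    then show "norm (of_real (d n) * (ee (real h * y n) - ee (U * of_int n powr (- ga) + V * of_int n powr (- (ga + 1))))) <= d n * (7 * ga * (ga + 1) * (sqrt k / k))"
     unfolding norm_mult m_def norm_of_real using dn(1)[of n] by (intro mult_mono) auto
   qed
   also have "... = (\<Sum>n\<in>{K+1..K'}. d n) * (7 * ga * (ga + 1) * (sqrt k / k))" by (rule sum_distrib_right[symmetric])
   also have "... <= (k * D) * (7 * ga * (ga + 1) * (sqrt k / k))" using W gam k8 by (intro mult_right_mono) auto
   also have "... = 7 * ga * (ga + 1) * (D * sqrt k)" using k8 by simp
   also have "... <= 7 * ga * (ga + 1) * (D * N)" using kN D gam by (intro mult_left_mono) auto
   finally show ?thesis .
  qed
  have errN: "7 * ga * (ga + 1) * (D * N) <= 7 * ga * (ga + 1) * (L^3 * D * N)"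
  proof (rule mult_left_mono)
   have "1 * (D * N) <= L^3 * (D * N)" using L1 D N by (intro mult_right_mono) auto
   then show "D * N <= L^3 * D * N" by (simp add: mult.assoc)
  qed (use gam in simp)
  have "(\<Sum>n\<in>{K+1..K'}. of_real (d n) * ee (real h * y n)) =
   (\<Sum>n\<in>{K+1..K'}. of_nat (divisor_count (nat n)) * ee (U * of_int n powr (- ga) + V * of_int n powr (- (ga + 1))))
   + (\<Sum>n\<in>{K+1..K'}. of_real (d n) * (ee (real h * y n) - ee (U * of_int n powr (- ga) + V * of_int n powr (- (ga + 1)))))"
   by (simp add: d_def algebra_simps flip: sum.distrib)
  then have "norm (\<Sum>n\<in>{K+1..K'}. of_real (d n) * ee (real h * y n)) <= CM ga * (L^3 * D * N) + 7 * ga * (ga + 1) * (L^3 * D * N)"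
   using main mainN err errN by (simp only:) (rule order.trans[OF norm_triangle_ineq add_mono]; linarith)
  then show ?thesis by (simp add: distrib_right)
 qed
 define T where "T = L^3 * D * N"
 have T0: "T >= 0" unfolding T_def using L1 D N by simp
 define E where "E = CM ga + 7 * ga * (ga + 1)"
 have E0: "E >= 0" unfolding E_def using CM0 gam by simp
 have hs: "(\<Sum>h\<in>{1..2 ^ J}. norm (\<Sum>n\<in>{K+1..K'}. of_real (d n) * ee (real h * y n)) / real h) <= L * (E * T)"
 proof -
  have "(\<Sum>h\<in>{1..2 ^ J}. norm (\<Sum>n\<in>{K+1..K'}. of_real (d n) * ee (real h * y n)) / real h) <= (\<Sum>h\<in>{1..2 ^ J}. 1 / real h * (E * T))"
  proof (rule sum_mono)
   fix h :: nat assume h: "h \<in> {1..2 ^ J}"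
   then show "norm (\<Sum>n\<in>{K+1..K'}. of_real (d n) * ee (real h * y n)) / real h <= 1 / real h * (E * T)"
    using exps[OF h] unfolding E_def T_def by (simp add: divide_right_mono)
  qed
  also have "... = (\<Sum>h\<in>{1..2 ^ J}. 1 / real h) * (E * T)" by (rule sum_distrib_right[symmetric])
  also have "... <= L * (E * T)" using harm E0 T0 by (intro mult_right_mono) auto
  finally show ?thesis .
 qed
 have WJ: "(\<Sum>n\<in>{K+1..K'}. d n) / 2 ^ J <= 2 powr (ga + 1) * (L * T)"
 proof -
  have "(\<Sum>n\<in>{K+1..K'}. d n) / 2 ^ J <= (k * D) / (t / 2)" using W J2 t1 k8 D by (intro frac_le) auto
  also have "... = 2 powr (ga + 1) * (D * N)" unfolding t_def using k8 N by (simp add: powr_add)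
  also have "... <= 2 powr (ga + 1) * (L^4 * (D * N))"
  proof (rule mult_left_mono)
   have "1 * (D * N) <= L^4 * (D * N)" using L1 D N by (intro mult_right_mono) auto
   then show "D * N <= L^4 * (D * N)" by simp
  qed simp
  also have "L^4 * (D * N) = L * T" by (simp add: T_def eval_nat_numeral)
  finally show ?thesis .
 qed
 have "\<bar>\<Sum>n\<in>{K+1..K'}. d n * psi (y n)\<bar> <= 23 * (real J + 1) * ((\<Sum>n\<in>{K+1..K'}. d n) / 2 ^ J
   + (\<Sum>h\<in>{1..2 ^ J}. norm (\<Sum>n\<in>{K+1..K'}. of_real (d n) * ee (real h * y n)) / real h))"
  by (rule sum_psi_bound) (rule dn)
 also have "... <= 23 * (2 * L) * (2 powr (ga + 1) * (L * T) + L * (E * T))"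
  using JL hs WJ L1 dn by (intro mult_mono add_mono mult_left_mono) (auto intro!: add_nonneg_nonneg sum_nonneg divide_nonneg_nonneg)
 also have "... = CP ga * L^5 * (D * N)" unfolding CP_def E_def T_def by (simp add: eval_nat_numeral algebra_simps)
 finally show ?thesis unfolding d_def y_def L_def .
qed

lemma sum_doubling:
 fixes f :: "int => real"
 assumes K0: "K0 >= 1" and E: "E >= 0"
  and f: "\<And>K K'. K0 <= K ==> K <= K' ==> K' <= 2 * K ==> K' <= M ==> \<bar>\<Sum>n\<in>{K+1..K'}. f n\<bar> <= E"
 shows "K0 <= M' ==> M' <= 2 ^ J * K0 ==> M' <= M ==> \<bar>\<Sum>n\<in>{K0+1..M'}. f n\<bar> <= real J * E"
proof (induction J arbitrary: M')
 case 0 then show ?case by simp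
next
 case (Suc J)
 show ?case
 proof (cases "M' <= 2 ^ J * K0")
  case True
  then have "\<bar>\<Sum>n\<in>{K0+1..M'}. f n\<bar> <= real J * E" using Suc by auto
  then show ?thesis using E by (simp add: distrib_right)
 next
  case False
  define P where "P = 2 ^ J * K0"
  have P: "K0 <= P" "P < M'" "M' <= 2 * P" using K0 False Suc.prems by (auto simp: P_def)
  have "{K0+1..M'} = {K0+1..P} \<union> {P+1..M'}" using P by auto
  then have "(\<Sum>n\<in>{K0+1..M'}. f n) = (\<Sum>n\<in>{K0+1..P}. f n) + (\<Sum>n\<in>{P+1..M'}. f n)" by (simp add: sum.union_disjoint)
  moreover have "\<bar>\<Sum>n\<in>{K0+1..P}. f n\<bar> <= real J * E" using P Suc.prems by (intro Suc.IH) (auto simp: P_def)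
  moreover have "\<bar>\<Sum>n\<in>{P+1..M'}. f n\<bar> <= E" using P Suc.prems by (intro f) auto
  ultimately show ?thesis by (simp add: distrib_right)
 qed
qed

section \<open>The error term\<close>

text \<open>The exponent enters the estimates through these inequalities. With
  \<open>N = x powr \<theta>\<close>, the first is \<open>k powr (5/6) <= N\<close> at the upper end
  \<open>k = x powr (1 - c * \<theta>)\<close>, the second is \<open>Y <= sqrt k * N\<close> at the
  lower end \<open>k = N\<close>. The remaining two give \<open>1 - c * \<theta> > 0\<close> and
  \<open>N >= 1\<close>.\<close>

lemma theta_c_bounds:
 assumes "c > 0"
 shows "5 <= theta_c c * (5 * c + 6)" "2 <= theta_c c * (3 * c + 2)" "c * theta_c c < 1" "theta_c c > 0"
proof -
 have p: "2 * c^2 + 5 * c + 2 > 0" "5 * c + 6 > 0" "3 * c + 2 > 0" using assms by (simp_all add: add_pos_pos)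
 have "5 <= theta_c c * (5 * c + 6) \<and> 2 <= theta_c c * (3 * c + 2) \<and> c * theta_c c < 1 \<and> theta_c c > 0"
 proof (cases "c < 2/3")
  case True
  have t: "theta_c c = (2 * c + 2) / (2 * c^2 + 5 * c + 2)" using True by (simp add: theta_c_def)
  have "5 * (2 * c^2 + 5 * c + 2) <= (2 * c + 2) * (5 * c + 6)" using True by (simp add: power2_eq_square algebra_simps)
  then have 1: "5 <= theta_c c * (5 * c + 6)" unfolding t using p by (simp add: pos_le_divide_eq)
  have "2 * (2 * c^2 + 5 * c + 2) <= (2 * c + 2) * (3 * c + 2)" by (simp add: power2_eq_square algebra_simps)
  then have 2: "2 <= theta_c c * (3 * c + 2)" unfolding t using p by (simp add: pos_le_divide_eq)
  have "c * (2 * c + 2) < 2 * c^2 + 5 * c + 2" using assms by (simp add: power2_eq_square algebra_simps)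
  then have 3: "c * theta_c c < 1" unfolding t using p by (simp add: pos_divide_less_eq)
  have "theta_c c > 0" unfolding t using p assms by simp
  then show ?thesis using 1 2 3 by blast
 next
  case False
  have t: "theta_c c = 5 / (5 * c + 6)" using False by (simp add: theta_c_def)
  have "2 * (5 * c + 6) <= 5 * (3 * c + 2)" using False by (simp add: algebra_simps)
  then have 2: "2 <= theta_c c * (3 * c + 2)" unfolding t using p by (simp add: pos_le_divide_eq)
  have 3: "c * theta_c c < 1" unfolding t using p by (simp add: pos_divide_less_eq)
  have "theta_c c > 0" unfolding t using p by simp
  moreover have "theta_c c * (5 * c + 6) = 5" using t p by (intro iffD1[OF nonzero_eq_divide_eq]) auto
  ultimately show ?thesis using 2 3 by simp
 qed
 then show "5 <= theta_c c * (5 * c + 6)" "2 <= theta_c c * (3 * c + 2)" "c * theta_c c < 1" "theta_c c > 0" by blast+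
qed

lemma divisor_value_sum:
 fixes c x :: real and M :: nat
 defines "F \<equiv> (\<lambda>k::nat. x powr (1/c) * real k powr (- (1/c)))"
 assumes c: "c > 0" and x: "x >= 1" and M: "M >= 1" and D: "D >= 0" "\<And>n. n >= 1 ==> real n <= x ==> real (divisor_count n) <= D"
 shows "\<bar>S_dc c x - (\<Sum>k\<in>{1..M}. real (divisor_count k) * (of_int \<lfloor>F k\<rfloor> - of_int \<lfloor>F (Suc k)\<rfloor>))\<bar> <= D * F (Suc M)"
proof -
 define v where "v n = nat \<lfloor>x / real n powr c\<rfloor>" for n
 define A where "A = {n::nat. 1 <= n \<and> real n <= x powr (1/c)}"
 have fin: "finite A"
 proof (rule finite_subset)
  show "A \<subseteq> {..nat \<lfloor>x powr (1/c)\<rfloor>}" by (auto simp: A_def le_nat_floor)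
 qed simp
 have Fx: "F k = (x / real k) powr (1/c)" if "k >= 1" for k
  unfolding F_def using x that by (simp add: powr_divide powr_minus_divide)
 \<comment> \<open>This equivalence also shows that the values above \<open>M\<close> come from the
   initial segment \<open>n <= F (Suc M)\<close>, which is estimated trivially.\<close>
 have key: "k <= v n \<longleftrightarrow> real n <= F k" if "n >= 1" "k >= 1" for n k
 proof -
  have np: "real n powr c > 0" using that by simp
  have "k <= v n \<longleftrightarrow> real k <= x / real n powr c"
   unfolding v_def using x np by (simp add: le_nat_iff le_floor_iff)
  also have "... \<longleftrightarrow> real n powr c <= x / real k" using that np by (simp add: pos_le_divide_eq mult.commute)
  also have "... \<longleftrightarrow> real n <= (x / real k) powr (1/c)"
  proof
   assume "real n powr c <= x / real k"
   then have "(real n powr c) powr (1/c) <= (x / real k) powr (1/c)" using c by (intro powr_mono2) auto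
   then show "real n <= (x / real k) powr (1/c)" using c that by (simp add: powr_powr)
  next
   assume "real n <= (x / real k) powr (1/c)"
   then have "real n powr c <= ((x / real k) powr (1/c)) powr c" using c by (intro powr_mono2) auto
   then show "real n powr c <= x / real k" using c that x by (simp add: powr_powr)
  qed
  finally show ?thesis using Fx[OF that(2)] by simp
 qed
 have F1: "F 1 = x powr (1/c)" by (simp add: F_def)
 have Fpos: "F k >= 0" for k by (simp add: F_def)
 have Fmono: "F (Suc k) <= F k" if "k >= 1" for k
  unfolding F_def using that c by (intro mult_left_mono powr_mono2') auto
 have v1: "v n >= 1" if "n \<in> A" for n using key[of n 1] that F1 by (auto simp: A_def)
 have vx: "real (v n) <= x" if "n \<in> A" for n
 proof -
  have "real n powr c >= 1" using that c by (intro ge_one_powr_ge_zero) (auto simp: A_def)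
  then have "x / real n powr c <= x / 1" using x that by (intro divide_left_mono) (auto simp: A_def)
  moreover have "real (v n) <= x / real n powr c" unfolding v_def using x by (simp add: of_nat_floor)
  ultimately show ?thesis by simp
 qed
 have inA: "n \<in> A" if "n >= 1" "k >= 1" "real n <= F k" for n k
 proof -
  have "F k <= F 1" unfolding F_def using that c by (intro mult_left_mono powr_mono2') auto
  then show ?thesis using that F1 by (simp add: A_def)
 qed
 have "S_dc c x = (\<Sum>n\<in>A. real (divisor_count (v n)))" by (simp add: S_dc_def A_def v_def)
 also have "A = {n\<in>A. v n <= M} \<union> {n\<in>A. M < v n}" by auto
 also have "(\<Sum>n\<in>.... real (divisor_count (v n))) = (\<Sum>n\<in>{n\<in>A. v n <= M}. real (divisor_count (v n))) + (\<Sum>n\<in>{n\<in>A. M < v n}. real (divisor_count (v n)))"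
  using fin by (intro sum.union_disjoint) auto
 also have "(\<Sum>n\<in>{n\<in>A. v n <= M}. real (divisor_count (v n))) = (\<Sum>k\<in>{1..M}. \<Sum>n\<in>{n\<in>{n\<in>A. v n <= M}. v n = k}. real (divisor_count (v n)))"
  using fin v1 by (intro sum.group[symmetric]) auto
 also have "... = (\<Sum>k\<in>{1..M}. real (divisor_count k) * (of_int \<lfloor>F k\<rfloor> - of_int \<lfloor>F (Suc k)\<rfloor>))"
 proof (rule sum.cong[OF refl])
  fix k assume k: "k \<in> {1..M}"
  have set: "{n\<in>{n\<in>A. v n <= M}. v n = k} = {nat \<lfloor>F (Suc k)\<rfloor> + 1..nat \<lfloor>F k\<rfloor>}"
  proof (intro equalityI subsetI)
   fix n assume n: "n \<in> {n\<in>{n\<in>A. v n <= M}. v n = k}"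
   then have n1: "n >= 1" by (simp add: A_def)
   have "real n <= F k" "\<not> real n <= F (Suc k)" using key[OF n1, of k] key[OF n1, of "Suc k"] n k by auto
   then show "n \<in> {nat \<lfloor>F (Suc k)\<rfloor> + 1..nat \<lfloor>F k\<rfloor>}" using Fpos[of "Suc k"] by (simp add: le_nat_floor) linarith
  next
   fix n assume n: "n \<in> {nat \<lfloor>F (Suc k)\<rfloor> + 1..nat \<lfloor>F k\<rfloor>}"
   then have n1: "n >= 1" by simp
   have a: "real n <= F k" using n Fpos[of k] by (simp add: le_nat_iff le_floor_iff)
   have b: "\<not> real n <= F (Suc k)" using n Fpos[of "Suc k"] by simp linarith
   have "k <= v n" "\<not> Suc k <= v n" using key[OF n1, of k] key[OF n1, of "Suc k"] a b k by auto
   then show "n \<in> {n\<in>{n\<in>A. v n <= M}. v n = k}" using inA[OF n1 _ a] k by auto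
  qed
  have "real (nat \<lfloor>F k\<rfloor> - nat \<lfloor>F (Suc k)\<rfloor>) = of_int \<lfloor>F k\<rfloor> - of_int \<lfloor>F (Suc k)\<rfloor>"
  proof -
   have "\<lfloor>F (Suc k)\<rfloor> <= \<lfloor>F k\<rfloor>" "0 <= \<lfloor>F (Suc k)\<rfloor>" "0 <= \<lfloor>F k\<rfloor>" using Fmono[of k] Fpos k by (auto intro: floor_mono)
   then show ?thesis by simp
  qed
  then have "real (card {n\<in>{n\<in>A. v n <= M}. v n = k}) = of_int \<lfloor>F k\<rfloor> - of_int \<lfloor>F (Suc k)\<rfloor>" unfolding set by simp
  moreover have "(\<Sum>n\<in>{n\<in>{n\<in>A. v n <= M}. v n = k}. real (divisor_count (v n))) = real (card {n\<in>{n\<in>A. v n <= M}. v n = k}) * real (divisor_count k)" by simp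
  ultimately show "(\<Sum>n\<in>{n\<in>{n\<in>A. v n <= M}. v n = k}. real (divisor_count (v n))) = real (divisor_count k) * (of_int \<lfloor>F k\<rfloor> - of_int \<lfloor>F (Suc k)\<rfloor>)"
   by (simp only: mult.commute)
 qed
 finally have eq: "S_dc c x - (\<Sum>k\<in>{1..M}. real (divisor_count k) * (of_int \<lfloor>F k\<rfloor> - of_int \<lfloor>F (Suc k)\<rfloor>)) = (\<Sum>n\<in>{n\<in>A. M < v n}. real (divisor_count (v n)))" by simp
 have "(\<Sum>n\<in>{n\<in>A. M < v n}. real (divisor_count (v n))) <= (\<Sum>n\<in>{n\<in>A. M < v n}. D)"
  using v1 vx D by (intro sum_mono) auto
 also have "... <= (\<Sum>n\<in>{1..nat \<lfloor>F (Suc M)\<rfloor>}. D)"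
 proof (rule sum_mono2)
  show "{n\<in>A. M < v n} \<subseteq> {1..nat \<lfloor>F (Suc M)\<rfloor>}"
  proof
   fix n assume n: "n \<in> {n\<in>A. M < v n}"
   then have n1: "n >= 1" by (simp add: A_def)
   then have "real n <= F (Suc M)" using key[OF n1, of "Suc M"] n by auto
   then show "n \<in> {1..nat \<lfloor>F (Suc M)\<rfloor>}" using n1 by (simp add: le_nat_floor)
  qed
 qed (use D in auto)
 also have "... = real (nat \<lfloor>F (Suc M)\<rfloor>) * D" by simp
 also have "... <= F (Suc M) * D" using D Fpos by (intro mult_right_mono of_nat_floor)
 finally have "(\<Sum>n\<in>{n\<in>A. M < v n}. real (divisor_count (v n))) <= D * F (Suc M)" by (simp only: mult.commute)
 moreover have "0 <= (\<Sum>n\<in>{n\<in>A. M < v n}. real (divisor_count (v n)))" by (intro sum_nonneg) auto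
 ultimately show ?thesis unfolding eq by simp
qed

text \<open>Both differences are derivatives at points of \<open>(k, k + 1)\<close> up to sign, so
  \<open>k powr \<eta>\<close> can be moved into the exponent at the cost of a constant; its power
  of 2 stems from \<open>s < k + 1 <= 2 * k\<close>. The point is that the right-hand side
  telescopes.\<close>

lemma powr_diff_compare:
 fixes k ga \<eta> :: real
 assumes k: "k >= 1" and g: "0 < \<eta>" "\<eta> < ga"
 shows "k powr \<eta> * (k powr (- ga) - (k + 1) powr (- ga)) <= ga / (ga - \<eta>) * 2 powr (ga - \<eta> + 1) * (k powr (- (ga - \<eta>)) - (k + 1) powr (- (ga - \<eta>)))"
proof -
 define \<beta> where "\<beta> = ga - \<eta>"
 have b: "\<beta> > 0" using g by (simp add: \<beta>_def)
 have mv: "\<exists>t>k. t < k + 1 \<and> k powr (- a) - (k + 1) powr (- a) = a * t powr (- (a + 1))" if "a > 0" for a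
 proof -
  have "\<exists>t>k. t < k + 1 \<and> (k + 1) powr (- a) - k powr (- a) = (k + 1 - k) * (- a * t powr (- (a + 1)))"
  proof (rule MVT2)
   fix t assume "k <= t" "t <= k + 1"
   then have "t > 0" using k by simp
   then show "((\<lambda>t. t powr (- a)) has_real_derivative - a * t powr (- (a + 1))) (at t)"
    using DERIV_fun_powr[OF DERIV_ident, of t "- a"] by simp
  qed simp
  then obtain t where "t > k" "t < k + 1" "(k + 1) powr (- a) - k powr (- a) = - a * t powr (- (a + 1))" by auto
  then show ?thesis by (intro exI[of _ t]) auto
 qed
 obtain t where t: "t > k" "k powr (- ga) - (k + 1) powr (- ga) = ga * t powr (- (ga + 1))" using mv[of ga] g by auto
 obtain s where s: "s > k" "s < k + 1" "k powr (- \<beta>) - (k + 1) powr (- \<beta>) = \<beta> * s powr (- (\<beta> + 1))" using mv[OF b] by auto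
 have "t powr (- (ga + 1)) <= k powr (- (ga + 1))" using t k g by (intro powr_mono2') auto
 then have "k powr \<eta> * (k powr (- ga) - (k + 1) powr (- ga)) <= k powr \<eta> * (ga * k powr (- (ga + 1)))"
  unfolding t(2) using g by (intro mult_left_mono) auto
 also have "... = ga * k powr (- (\<beta> + 1))" by (simp add: \<beta>_def algebra_simps flip: powr_add)
 also have "... <= ga * (2 powr (\<beta> + 1) * s powr (- (\<beta> + 1)))"
 proof (rule mult_left_mono)
  have "(2 * k) powr (- (\<beta> + 1)) <= s powr (- (\<beta> + 1))" using s k b by (intro powr_mono2') auto
  then have "2 powr (\<beta> + 1) * (2 * k) powr (- (\<beta> + 1)) <= 2 powr (\<beta> + 1) * s powr (- (\<beta> + 1))" by (intro mult_left_mono) auto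
  moreover have "2 powr (\<beta> + 1) * (2 * k) powr (- (\<beta> + 1)) = k powr (- (\<beta> + 1))"
  proof -
   have "2 powr (\<beta> + 1) * (2 * k) powr (- (\<beta> + 1)) = (2 powr (\<beta> + 1) * 2 powr (- (\<beta> + 1))) * k powr (- (\<beta> + 1))"
    using k by (simp only: powr_mult mult.assoc)
   also have "2 powr (\<beta> + 1) * 2 powr (- (\<beta> + 1)) = (1::real)" by (simp flip: powr_add)
   finally show ?thesis by simp
  qed
  ultimately show "k powr (- (\<beta> + 1)) <= 2 powr (\<beta> + 1) * s powr (- (\<beta> + 1))" by linarith
 qed (use g in simp)
 also have "... = ga / \<beta> * 2 powr (\<beta> + 1) * (k powr (- \<beta>) - (k + 1) powr (- \<beta>))" unfolding s(3) using b by simp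
 finally show ?thesis by (simp add: \<beta>_def)
qed

text \<open>The divisor bound and \<open>powr_diff_compare\<close> dominate the terms by a
  telescoping series, which gives convergence and the tail estimate together.
  \<open>\<eta> < 1/c\<close> lets the telescoping terms tend to 0.\<close>

lemma const_dc_tail:
 fixes c \<eta> C :: real and M :: nat
 assumes c: "c > 0" and e: "0 < \<eta>" "\<eta> < 1/c" and C: "C > 0" "\<And>n. n > 0 ==> real (divisor_count n) <= C * real n powr \<eta>"
 defines "ga \<equiv> 1/c"
 shows "\<bar>const_dc c - (\<Sum>k\<in>{1..M}. real (divisor_count k) * (real k powr (- ga) - real (Suc k) powr (- ga)))\<bar>
   <= C * (ga / (ga - \<eta>) * 2 powr (ga - \<eta> + 1)) * real (Suc M) powr (- (ga - \<eta>))"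
proof -
 define \<beta> where "\<beta> = ga - \<eta>"
 define C2 where "C2 = C * (ga / \<beta> * 2 powr (\<beta> + 1))"
 define a where "a k = real (divisor_count (Suc k)) * (real (Suc k) powr (- ga) - real (Suc (Suc k)) powr (- ga))" for k
 define G where "G k = real (Suc k) powr (- \<beta>)" for k
 have b: "\<beta> > 0" and gam: "ga > 0" using e c by (simp_all add: \<beta>_def ga_def)
 have a0: "a k >= 0" for k
 proof -
  have "real (Suc (Suc k)) powr (- ga) <= real (Suc k) powr (- ga)" using gam by (intro powr_mono2') auto
  then show ?thesis by (simp add: a_def)
 qed
 have aG: "a k <= C2 * (G k - G (Suc k))" for k
 proof -
  have d: "real (Suc (Suc k)) powr (- ga) <= real (Suc k) powr (- ga)" using gam by (intro powr_mono2') auto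
  have "a k <= (C * real (Suc k) powr \<eta>) * (real (Suc k) powr (- ga) - real (Suc (Suc k)) powr (- ga))"
   unfolding a_def using d by (intro mult_right_mono C) auto
  also have "... = C * (real (Suc k) powr \<eta> * (real (Suc k) powr (- ga) - (real (Suc k) + 1) powr (- ga)))" by (simp add: mult_ac add.commute)
  also have "... <= C * (ga / \<beta> * 2 powr (\<beta> + 1) * (real (Suc k) powr (- \<beta>) - (real (Suc k) + 1) powr (- \<beta>)))"
   unfolding \<beta>_def using C e by (intro mult_left_mono powr_diff_compare) (auto simp: ga_def)
  also have "... = C2 * (G k - G (Suc k))" by (simp add: C2_def G_def add.commute)
  finally show ?thesis .
 qed
 have G0: "G \<longlonglongrightarrow> 0"
 proof -
  have "(\<lambda>n. real n powr (- \<beta>)) \<longlonglongrightarrow> 0" using b by (intro tendsto_neg_powr filterlim_real_sequentially) auto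
  then show ?thesis unfolding G_def by (rule LIMSEQ_Suc)
 qed
 have tel: "(\<lambda>k. C2 * (G (k + m) - G (Suc (k + m)))) sums (C2 * G m)" for m
 proof -
  have "(\<lambda>k. G (k + m)) \<longlonglongrightarrow> 0" using G0 by (rule LIMSEQ_ignore_initial_segment)
  from telescope_sums'[OF this] have "(\<lambda>k. G (k + m) - G (Suc (k + m))) sums G m" by simp
  then show ?thesis by (rule sums_mult)
 qed
 have sm: "summable (\<lambda>k. a (k + m))" for m
  by (rule summable_comparison_test'[OF sums_summable[OF tel[of m]], of 0]) (use aG a0 in auto)
 have cst: "const_dc c = (\<Sum>k. a k)"
  unfolding const_dc_def a_def ga_def by (simp add: powr_minus divide_inverse add.commute)
 have "(\<Sum>k. a k) = (\<Sum>k. a (k + M)) + (\<Sum>k<M. a k)"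
  using sm[of 0] by (intro suminf_split_initial_segment) simp
 moreover have "(\<Sum>k<M. a k) = (\<Sum>k\<in>{1..M}. real (divisor_count k) * (real k powr (- ga) - real (Suc k) powr (- ga)))"
  by (rule sum.reindex_bij_witness[of _ "\<lambda>k. k - 1" Suc]) (auto simp: a_def)
 moreover have "(\<Sum>k. a (k + M)) <= C2 * G M"
  using suminf_le[OF _ sm[of M] sums_summable[OF tel[of M]]] aG sums_unique[OF tel[of M]] by simp
 moreover have "0 <= (\<Sum>k. a (k + M))" using a0 sm[of M] by (intro suminf_nonneg)
 ultimately have "\<bar>const_dc c - (\<Sum>k\<in>{1..M}. real (divisor_count k) * (real k powr (- ga) - real (Suc k) powr (- ga)))\<bar> <= C2 * G M"
  unfolding cst by simp
 then show ?thesis by (simp only: C2_def G_def \<beta>_def)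
qed

text \<open>Up to \<open>K0\<close>, of order \<open>N\<close>, the terms are bounded trivially.
  Beyond it dyadic blocks are used, where \<open>k\<close> lies between \<open>N\<close> and
  \<open>x powr p\<close> with \<open>p = 1 - c * \<theta>\<close>; the conditions of
  \<open>dyadic_psi\<close> are checked by comparison with the worse end of this range.\<close>

lemma psi_divisor_sum:
 fixes c x D \<delta> \<theta> :: real and M :: int
 defines "ga \<equiv> 1/c" and "N \<equiv> x powr \<theta>" and "L \<equiv> 1 + ln (50 * x)"
 assumes c: "c > 0" and t: "5 <= \<theta> * (5 * c + 6)" "2 <= \<theta> * (3 * c + 2)" "c * \<theta> < 1" "\<theta> > 0" and x: "x >= 1"
  and M: "M >= 1" "of_int M <= x powr (1 - c * \<theta>)" and D: "D >= 1" "\<And>n. 1 <= n ==> n <= M ==> real (divisor_count (nat n)) <= D"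
  and \<delta>: "\<delta> = 0 \<or> \<delta> = 1"
 shows "\<bar>\<Sum>n\<in>{1..M}. real (divisor_count (nat n)) * psi (x powr ga * (of_int n + \<delta>) powr (- ga))\<bar> <= (9 + 2 powr ga + 2 * CP ga) * (L^6 * (D * N))"
proof -
 define p where "p = 1 - c * \<theta>"
 define f where "f n = real (divisor_count (nat n)) * psi (x powr ga * (of_int n + \<delta>) powr (- ga))" for n :: int
 define K0 where "K0 = max 8 \<lceil>2 powr ga * N\<rceil>"
 have gam: "ga > 0" using c by (simp add: ga_def)
 have p: "0 < p" "p <= 1" using t c by (simp_all add: p_def)
 have pg: "p * ga = ga - \<theta>" unfolding p_def ga_def using c by (simp add: field_simps)
 have e1: "5 * p <= 6 * \<theta>" using t(1) by (simp add: p_def algebra_simps)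
 have e2: "ga <= \<theta> * (3/2 + ga)"
 proof -
  have "2 * c * ga <= 2 * c * (\<theta> * (3/2 + ga))" using t(2) c by (simp add: ga_def algebra_simps)
  then show ?thesis using c by simp
 qed
 have N1: "N >= 1" unfolding N_def using x t by (intro ge_one_powr_ge_zero) auto
 have p2: "2 powr ga >= 1" using gam by (intro ge_one_powr_ge_zero) auto
 have xp: "x powr p <= x" using x p powr_mono[of p 1 x] by simp
 have L1: "L >= 1" unfolding L_def using x by simp
 have K0: "K0 >= 8" "2 powr ga * N <= of_int K0" "of_int K0 <= (9 + 2 powr ga) * N"
 proof -
  show "K0 >= 8" by (simp add: K0_def)
  show "2 powr ga * N <= of_int K0" unfolding K0_def by linarith
  have "real_of_int K0 <= 9 + 2 powr ga * N" unfolding K0_def using N1 p2 by (simp add: max_def) linarith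
  also have "... <= 9 * N + 2 powr ga * N" using N1 by simp
  finally show "of_int K0 <= (9 + 2 powr ga) * N" by (simp add: distrib_right)
 qed
 interpret aux: phase ga 1 0 1 1 1 by unfold_locales (use gam in auto)
 have CP0: "CP ga >= 0" unfolding CP_def CM_def using aux.CD_bounds(4) gam by simp
 have triv: "\<bar>\<Sum>n\<in>{1..T}. f n\<bar> <= (9 + 2 powr ga) * (D * N)" if T: "T <= K0" "T <= M" for T
 proof -
  have "\<bar>\<Sum>n\<in>{1..T}. f n\<bar> <= (\<Sum>n\<in>{1..T}. D)"
  proof (rule order.trans[OF sum_abs], rule sum_mono)
   fix n assume n: "n \<in> {1..T}"
   have "\<bar>psi y\<bar> <= 1" for y unfolding psi_def using frac_ge_0[of y] frac_lt_1[of y] by linarith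
   then have "\<bar>f n\<bar> <= real (divisor_count (nat n)) * 1" unfolding f_def abs_mult by (intro mult_mono) auto
   also have "... <= D" using D(2)[of n] n T by simp
   finally show "\<bar>f n\<bar> <= D" .
  qed
  also have "... = real (nat T) * D" by simp
  also have "... <= of_int K0 * D" using T K0(1) D by (intro mult_right_mono) auto
  also have "... <= ((9 + 2 powr ga) * N) * D" using K0(3) D by (intro mult_right_mono) auto
  finally show ?thesis by (simp add: mult_ac)
 qed
 define E where "E = CP ga * L^5 * (D * N)"
 have E0: "E >= 0" unfolding E_def using CP0 L1 D N1 by simp
 have block: "\<bar>\<Sum>n\<in>{K+1..K'}. f n\<bar> <= E" if K: "K0 <= K" "K <= K'" "K' <= 2 * K" "K' <= M" for K K'
 proof -
  define k where "k = real_of_int K"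
  define Y where "Y = x powr ga * k powr (- ga)"
  have "real_of_int K0 <= k" "k <= of_int M" using K by (simp_all add: k_def)
  then have kb: "2 powr ga * N <= k" "k <= x powr p" "k >= 8" using K0 M by (auto simp: p_def)
  have "1 * N <= 2 powr ga * N" using p2 N1 by (intro mult_right_mono) auto
  then have Nk: "N <= k" using kb(1) by linarith
  have kx: "k <= x" using kb(2) xp by linarith
  have "\<bar>\<Sum>n\<in>{K+1..K'}. f n\<bar> <= CP ga * (1 + ln (50 * of_int K))^5 * (D * N)"
   unfolding f_def
  proof (rule dyadic_psi[OF gam _ \<delta> _ K(2,3)], unfold k_def[symmetric])
   show "x powr ga > 0" "8 <= K" "0 < N" using x K0 K N1 by auto
   show "1 <= D" "\<And>n. K < n ==> n <= K' ==> real (divisor_count (nat n)) <= D" using D K K0 by auto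
   show "2 powr ga * N <= k" by (rule kb)
   show c2: "k powr (5/6) <= N"
   proof -
    have "k powr (5/6) <= (x powr p) powr (5/6)" using kb by (intro powr_mono2) auto
    also have "... = x powr (5 * p / 6)" by (simp add: powr_powr mult.commute)
    also have "... <= x powr \<theta>" using x e1 by (intro powr_mono) auto
    finally show ?thesis by (simp add: N_def)
   qed
   show "k powr (5/2) * (x powr ga * k powr (- ga)) <= N^4"
   proof -
    have "k powr (5/2) * (x powr ga * k powr (- ga)) = x powr ga * k powr (5/2 - ga)"
    proof -
     have "k powr (5/2 - ga) = k powr (5/2 + - ga)" by simp
     also have "... = k powr (5/2) * k powr (- ga)" by (rule powr_add)
     finally show ?thesis by simp
    qed
    also have "... <= x powr (4 * \<theta>)"
    \<comment> \<open>The sign of the exponent \<open>5/2 - ga\<close> decides whether the upper or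
      the lower end of the range is the worst case.\<close>
    proof (cases "ga <= 5/2")
     case True
     have "k powr (5/2 - ga) <= (x powr p) powr (5/2 - ga)" using kb True by (intro powr_mono2) auto
     also have "... = x powr (p * (5/2 - ga))" by (simp add: powr_powr)
     finally have "x powr ga * k powr (5/2 - ga) <= x powr ga * x powr (p * (5/2 - ga))" by (intro mult_left_mono) auto
     also have "... = x powr (ga + p * (5/2 - ga))" by (rule powr_add[symmetric])
     also have "... <= x powr (4 * \<theta>)" using x e1 pg by (intro powr_mono) (auto simp: algebra_simps)
     finally show ?thesis .
    next
     case False
     have "k powr (5/2 - ga) <= N powr (5/2 - ga)" using Nk N1 False by (intro powr_mono2') auto
     also have "... = x powr (\<theta> * (5/2 - ga))" by (simp add: powr_powr N_def)
     finally have "x powr ga * k powr (5/2 - ga) <= x powr ga * x powr (\<theta> * (5/2 - ga))" by (intro mult_left_mono) auto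
     also have "... = x powr (ga + \<theta> * (5/2 - ga))" by (rule powr_add[symmetric])
     also have "... <= x powr (4 * \<theta>)" using x e2 by (intro powr_mono) (auto simp: algebra_simps)
     finally show ?thesis .
    qed
    also have "... = N^4" unfolding N_def using x by (simp add: powr_power mult.commute)
    finally show ?thesis .
   qed
   show "x powr ga * k powr (- ga) <= sqrt k * N"
   proof -
    have "x powr ga <= x powr (\<theta> * (ga + 1/2) + \<theta>)" using x e2 by (intro powr_mono) (auto simp: algebra_simps)
    also have "... = N powr (ga + 1/2) * N" unfolding N_def by (simp only: powr_add[of x _ \<theta>] powr_powr)
    also have "... <= k powr (ga + 1/2) * N" using Nk N1 gam by (intro mult_right_mono powr_mono2) auto
    finally have "x powr ga * k powr (- ga) <= (k powr (ga + 1/2) * N) * k powr (- ga)" by (intro mult_right_mono) auto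
    also have "... = (k powr (ga + 1/2) * k powr (- ga)) * N" by simp
    also have "k powr (ga + 1/2) * k powr (- ga) = k powr (1/2)" by (simp flip: powr_add)
    finally show ?thesis using kb by (simp add: powr_half_sqrt)
   qed
   show "k powr (5/6) <= x powr ga * k powr (- ga)"
   proof -
    \<comment> \<open>At the upper end of the range \<open>Y\<close> would equal exactly
      \<open>N\<close>, and it decreases in \<open>k\<close>; hence \<open>Y >= N\<close>
      throughout.\<close>
    have "N = x powr ga * x powr (- (p * ga))" unfolding N_def pg by (simp flip: powr_add)
    also have "x powr (- (p * ga)) = (x powr p) powr (- ga)" by (simp add: powr_powr)
    also have "x powr ga * (x powr p) powr (- ga) <= x powr ga * k powr (- ga)"
     using kb gam by (intro mult_left_mono powr_mono2') auto
    finally show ?thesis using c2 by linarith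
   qed
  qed
  also have "... <= E" unfolding E_def
  proof (intro mult_right_mono mult_left_mono power_mono)
   show "1 + ln (50 * of_int K) <= L" unfolding L_def using kx kb by (simp add: k_def)
   show "0 <= 1 + ln (50 * real_of_int K)" using kb by (simp add: k_def)
  qed (use CP0 D N1 in auto)
  finally show ?thesis .
 qed
 have LDN: "D * N <= L^6 * (D * N)"
 proof -
  have "1 * (D * N) <= L^6 * (D * N)" using L1 D N1 by (intro mult_right_mono) auto
  then show ?thesis by simp
 qed
 have triv': "(9 + 2 powr ga) * (D * N) <= (9 + 2 powr ga) * (L^6 * (D * N))" using LDN by (intro mult_left_mono) auto
 have CPL: "2 * CP ga * (L^6 * (D * N)) >= 0" using CP0 L1 D N1 by simp
 have "\<bar>\<Sum>n\<in>{1..M}. f n\<bar> <= (9 + 2 powr ga) * (L^6 * (D * N)) + 2 * CP ga * (L^6 * (D * N))"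
 proof (cases "M <= K0")
  case True
  then show ?thesis using triv[of M] triv' CPL by linarith
 next
  case False
  have "1 <= nat M" using M by simp
  then obtain j where j: "2 ^ j <= nat M" "nat M < 2 ^ (j + 1)" using ex_power_ivl1[of 2 "nat M"] by auto
  have j1: "2 ^ j <= x"
  proof -
   have "real (2 ^ j) <= real (nat M)" using j(1) by (simp only: of_nat_le_iff)
   also have "... <= x" using M xp by (simp add: p_def)
   finally show ?thesis by simp
  qed
  have j2: "M <= 2 ^ (j + 1) * K0"
  proof -
   have "int (nat M) < int (2 ^ (j + 1))" using j(2) by (simp only: of_nat_less_iff)
   then have "M * 1 <= 2 ^ (j + 1) * K0" using M K0 by (intro mult_mono) auto
   then show ?thesis by simp
  qed
  have jL: "real (j + 1) <= 2 * L"
  proof -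
   have "ln (2 ^ j) <= ln x" using j1 x by (subst ln_le_cancel_iff) auto
   then have "real j * ln 2 <= ln x" by (simp add: ln_realpow)
   moreover have "real j * (1/2) <= real j * ln 2" using ln2_ge_two_thirds by (intro mult_left_mono) auto
   moreover have "1 + ln x <= L" unfolding L_def using x by simp
   ultimately show ?thesis by simp
  qed
  have "{1..M} = {1..K0} \<union> {K0+1..M}" using False K0 by auto
  then have "(\<Sum>n\<in>{1..M}. f n) = (\<Sum>n\<in>{1..K0}. f n) + (\<Sum>n\<in>{K0+1..M}. f n)" by (simp add: sum.union_disjoint)
  moreover have "\<bar>\<Sum>n\<in>{1..K0}. f n\<bar> <= (9 + 2 powr ga) * (D * N)" using False by (intro triv) auto
  moreover have "\<bar>\<Sum>n\<in>{K0+1..M}. f n\<bar> <= real (j + 1) * E"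
   by (rule sum_doubling[where M = M, OF _ E0 block]) (use K0 False j2 in auto)
  moreover have "real (j + 1) * E <= (2 * L) * E" using jL E0 by (intro mult_right_mono)
  moreover have "(2 * L) * E = 2 * CP ga * (L^6 * (D * N))" unfolding E_def by (simp add: eval_nat_numeral)
  ultimately show ?thesis using triv' by linarith
 qed
 then show ?thesis unfolding f_def by (simp add: distrib_right)
qed

theorem theorem1p1:
  fixes c \<epsilon> :: real
  assumes "c > 0" and "\<epsilon> > 0"
  shows "(\<lambda>x. S_dc c x - x powr (1/c) * const_dc c) \<in> O[at_top](\<lambda>x. x powr (theta_c c + \<epsilon>))"
proof -
 define ga where "ga = 1 / c"
 define \<theta> where "\<theta> = theta_c c"
 \<comment> \<open>Half of \<open>\<epsilon>\<close> pays for the divisor bound, and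
   \<open>\<eta> <= ga/2 < 1/c\<close> keeps the tail of the constant under control. The other half
   pays for six logarithms, \<open>x powr a\<close> each.\<close>
 define \<eta> where "\<eta> = min (\<epsilon>/2) (ga/2)"
 define a where "a = \<epsilon> / 12"
 have gam: "ga > 0" using assms by (simp add: ga_def)
 have eta: "\<eta> > 0" "\<eta> < 1/c" "\<eta> <= \<epsilon>/2"
 proof -
  have "\<eta> <= ga/2" "\<eta> <= \<epsilon>/2" by (simp_all add: \<eta>_def)
  then show "\<eta> < 1/c" "\<eta> <= \<epsilon>/2" using gam unfolding ga_def[symmetric] by linarith+
  show "\<eta> > 0" using gam assms by (simp add: \<eta>_def)
 qed
 have ap: "a > 0" using assms by (simp add: a_def)
 note t = theta_c_bounds[OF assms(1), folded \<theta>_def]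
 obtain C0 where C0: "C0 > 0" "\<And>n. n > 0 ==> real (divisor_count n) <= C0 * real n powr \<eta>"
  using divisor_count_le_powr[OF eta(1)] by blast
 define C where "C = max C0 1"
 have C: "C >= 1" "C > 0" "\<And>n. n > 0 ==> real (divisor_count n) <= C * real n powr \<eta>"
 proof -
  show "C >= 1" "C > 0" by (simp_all add: C_def)
  fix n :: nat assume "n > 0"
  then have "real (divisor_count n) <= C0 * real n powr \<eta>" by (rule C0)
  also have "... <= C * real n powr \<eta>" by (intro mult_right_mono) (auto simp: C_def)
  finally show "real (divisor_count n) <= C * real n powr \<eta>" .
 qed
 define Ct where "Ct = C * (ga / (ga - \<eta>) * 2 powr (ga - \<eta> + 1))"
 define P where "P = 9 + 2 powr ga + 2 * CP ga"
 interpret aux: phase ga 1 0 1 1 1 by unfold_locales (use gam in auto)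
 have P0: "P >= 0" unfolding P_def CP_def CM_def using aux.CD_bounds(4) gam by (simp add: add_nonneg_nonneg)
 have Ct0: "Ct >= 0" unfolding Ct_def using C gam eta by (simp add: ga_def)
 define Ca where "Ca = 1 + 50 powr a / a"
 have bound: "\<bar>S_dc c x - x powr (1/c) * const_dc c\<bar> <= (C + Ct * 2 powr \<eta> + 2 * P * C) * Ca^6 * x powr (\<theta> + \<epsilon>)" if x: "x >= 1" for x
 proof -
  define p where "p = 1 - c * \<theta>"
  define N where "N = x powr \<theta>"
  define L where "L = 1 + ln (50 * x)"
  \<comment> \<open>The cut \<open>x powr (1 - c * \<theta>)\<close> is the point where
    \<open>F\<close> drops to \<open>N = x powr \<theta>\<close>, so that at most \<open>N\<close>
    values of \<open>n\<close> are treated trivially.\<close>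
  define M where "M = nat \<lfloor>x powr p\<rfloor>"
  define D where "D = C * x powr \<eta>"
  define F where "F k = x powr (1/c) * real k powr (- (1/c))" for k :: nat
  have p: "0 < p" "p <= 1" using t assms by (simp_all add: p_def)
  have pg: "p * ga = ga - \<theta>" unfolding p_def ga_def using assms by (simp add: field_simps)
  have xp: "1 <= x powr p" "x powr p <= x" using x p powr_mono[of p 1 x] by (simp_all add: ge_one_powr_ge_zero)
  have M: "M >= 1" "real M <= x powr p" "x powr p <= real (Suc M)" unfolding M_def using xp by linarith+
  have N1: "N >= 1" unfolding N_def using x t by (intro ge_one_powr_ge_zero) auto
  have L1: "L >= 1" unfolding L_def using x by simp
  have xe: "x powr \<eta> >= 1" using x eta by (intro ge_one_powr_ge_zero) auto
  have D1: "D >= 1" unfolding D_def using mult_mono[of 1 C 1 "x powr \<eta>"] C xe by simp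
  have D: "real (divisor_count n) <= D" if "n >= 1" "real n <= x" for n
  proof -
   have "real (divisor_count n) <= C * real n powr \<eta>" using that by (intro C) auto
   also have "... <= C * x powr \<eta>" using that C eta by (intro mult_left_mono powr_mono2) auto
   finally show ?thesis by (simp add: D_def)
  qed
  have FM: "F (Suc M) <= N"
  proof -
   have "F (Suc M) <= x powr ga * (x powr p) powr (- ga)"
    unfolding F_def ga_def using M xp assms by (intro mult_left_mono powr_mono2') auto
   also have "... = x powr (ga + - (p * ga))" by (simp only: powr_add powr_powr) simp
   also have "... = N" unfolding pg N_def by simp
   finally show ?thesis .
  qed
  have s1: "\<bar>S_dc c x - (\<Sum>k\<in>{1..M}. real (divisor_count k) * (of_int \<lfloor>F k\<rfloor> - of_int \<lfloor>F (Suc k)\<rfloor>))\<bar> <= D * N"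
  proof -
   have "\<bar>S_dc c x - (\<Sum>k\<in>{1..M}. real (divisor_count k) * (of_int \<lfloor>F k\<rfloor> - of_int \<lfloor>F (Suc k)\<rfloor>))\<bar> <= D * F (Suc M)"
    unfolding F_def by (rule divisor_value_sum[OF assms(1) x M(1)]) (use D D1 in auto)
   also have "... <= D * N" using FM D1 by (intro mult_left_mono) auto
   finally show ?thesis .
  qed
  have fl: "of_int \<lfloor>y\<rfloor> = y - psi y - 1/2" for y by (simp add: psi_def frac_def)
  have s2: "(\<Sum>k\<in>{1..M}. real (divisor_count k) * (of_int \<lfloor>F k\<rfloor> - of_int \<lfloor>F (Suc k)\<rfloor>))
   = (\<Sum>k\<in>{1..M}. real (divisor_count k) * (F k - F (Suc k))) - (\<Sum>k\<in>{1..M}. real (divisor_count k) * psi (F k)) + (\<Sum>k\<in>{1..M}. real (divisor_count k) * psi (F (Suc k)))"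
   unfolding fl by (simp add: algebra_simps sum.distrib sum_subtractf)
  have psib: "\<bar>\<Sum>k\<in>{1..M}. real (divisor_count k) * psi (x powr (1/c) * (real k + \<delta>) powr (- (1/c)))\<bar> <= P * (L^6 * (D * N))" if \<delta>: "\<delta> = 0 \<or> \<delta> = 1" for \<delta>
  proof -
   have "(\<Sum>k\<in>{1..M}. real (divisor_count k) * psi (x powr (1/c) * (real k + \<delta>) powr (- (1/c)))) = (\<Sum>n\<in>{1..int M}. real (divisor_count (nat n)) * psi (x powr (1/c) * (of_int n + \<delta>) powr (- (1/c))))"
    by (rule sum.reindex_bij_witness[of _ nat int]) auto
   moreover have "\<bar>\<Sum>n\<in>{1..int M}. real (divisor_count (nat n)) * psi (x powr (1/c) * (of_int n + \<delta>) powr (- (1/c)))\<bar> <= P * (L^6 * (D * N))"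
    unfolding P_def ga_def L_def N_def
   proof (rule psi_divisor_sum[OF assms(1) t x _ _ D1 _ \<delta>])
    show "1 <= int M" "of_int (int M) <= x powr (1 - c * \<theta>)" using M by (simp_all add: p_def)
    fix n assume n: "1 <= n" "n <= int M"
    then have "real (nat n) <= real M" by simp
    then show "real (divisor_count (nat n)) <= D" using n M xp by (intro D) auto
   qed
   ultimately show ?thesis by simp
  qed
  have q0: "\<bar>\<Sum>k\<in>{1..M}. real (divisor_count k) * psi (F k)\<bar> <= P * (L^6 * (D * N))" using psib[of 0] by (simp add: F_def)
  have q1: "\<bar>\<Sum>k\<in>{1..M}. real (divisor_count k) * psi (F (Suc k))\<bar> <= P * (L^6 * (D * N))" using psib[of 1] by (simp add: F_def add.commute)
  have s3: "\<bar>x powr (1/c) * const_dc c - (\<Sum>k\<in>{1..M}. real (divisor_count k) * (F k - F (Suc k)))\<bar> <= Ct * 2 powr \<eta> * (x powr \<eta> * N)"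
  proof -
   define R where "R = const_dc c - (\<Sum>k\<in>{1..M}. real (divisor_count k) * (real k powr (- (1/c)) - real (Suc k) powr (- (1/c))))"
   have "x powr (1/c) * const_dc c - (\<Sum>k\<in>{1..M}. real (divisor_count k) * (F k - F (Suc k))) = x powr (1/c) * R"
    unfolding R_def F_def by (simp add: right_diff_distrib sum_distrib_left sum_subtractf mult_ac)
   then have "\<bar>x powr (1/c) * const_dc c - (\<Sum>k\<in>{1..M}. real (divisor_count k) * (F k - F (Suc k)))\<bar> = x powr (1/c) * \<bar>R\<bar>" by (simp add: abs_mult)
   also have "... <= x powr (1/c) * (Ct * real (Suc M) powr (- (ga - \<eta>)))"
    unfolding R_def Ct_def ga_def by (intro mult_left_mono const_dc_tail[OF assms(1) eta(1,2) C(2,3)]) auto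
   also have "real (Suc M) powr (- (ga - \<eta>)) = real (Suc M) powr (- (1/c)) * real (Suc M) powr \<eta>"
    by (simp add: ga_def flip: powr_add)
   also have "x powr (1/c) * (Ct * (real (Suc M) powr (- (1/c)) * real (Suc M) powr \<eta>)) = Ct * (F (Suc M) * real (Suc M) powr \<eta>)" by (simp add: F_def)
   also have "... <= Ct * (N * (2 powr \<eta> * x powr \<eta>))"
   proof (intro mult_left_mono mult_mono FM Ct0)
    have "real (Suc M) <= 2 * x" using M xp x by simp
    then have "real (Suc M) powr \<eta> <= (2 * x) powr \<eta>" using eta by (intro powr_mono2) auto
    then show "real (Suc M) powr \<eta> <= 2 powr \<eta> * x powr \<eta>" using x by (simp add: powr_mult)
   qed (use N1 in auto)
   finally show ?thesis by (simp add: mult_ac)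
  qed
  define B where "B = L^6 * (x powr \<eta> * N)"
  have xN: "x powr \<eta> * N >= 1" using mult_mono[of 1 "x powr \<eta>" 1 N] xe N1 by simp
  have BxN: "x powr \<eta> * N <= B"
  proof -
   have "1 * (x powr \<eta> * N) <= L^6 * (x powr \<eta> * N)" using L1 xN by (intro mult_right_mono) auto
   then show ?thesis by (simp add: B_def)
  qed
  have b1: "D * N <= C * B" using mult_left_mono[OF BxN, of C] C by (simp add: D_def mult.assoc)
  have b2: "Ct * 2 powr \<eta> * (x powr \<eta> * N) <= Ct * 2 powr \<eta> * B" using BxN Ct0 by (intro mult_left_mono) auto
  have b3: "P * (L^6 * (D * N)) = P * C * B" by (simp add: B_def D_def)
  have "\<bar>S_dc c x - x powr (1/c) * const_dc c\<bar> <= C * B + Ct * 2 powr \<eta> * B + 2 * (P * C * B)"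
   using s1 s3 q0 q1 b1 b2 unfolding s2 b3 by linarith
  also have "... = (C + Ct * 2 powr \<eta> + 2 * P * C) * B" by (simp add: algebra_simps)
  also have "... <= (C + Ct * 2 powr \<eta> + 2 * P * C) * (Ca^6 * x powr (\<theta> + \<epsilon>))"
  proof (rule mult_left_mono)
   have "ln (50 * x) <= (50 * x) powr a / a" using x ap by (intro ln_powr_bound) auto
   also have "... = 50 powr a / a * x powr a" using x by (simp add: powr_mult)
   finally have "L <= 1 * x powr a + 50 powr a / a * x powr a"
    unfolding L_def using ge_one_powr_ge_zero[of x a] x ap by simp
   then have "L <= Ca * x powr a" by (simp add: Ca_def distrib_right)
   then have "L^6 <= (Ca * x powr a)^6" using L1 by (intro power_mono) auto
   also have "... = Ca^6 * x powr (\<epsilon>/2)" using x by (simp add: power_mult_distrib powr_power a_def)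
   finally have "B <= (Ca^6 * x powr (\<epsilon>/2)) * (x powr \<eta> * N)" unfolding B_def using xN by (intro mult_right_mono) auto
   also have "... = Ca^6 * x powr (\<epsilon>/2 + \<eta> + \<theta>)" by (simp add: N_def powr_add)
   also have "... <= Ca^6 * x powr (\<theta> + \<epsilon>)" using x eta by (intro mult_left_mono powr_mono) auto
   finally show "B <= Ca^6 * x powr (\<theta> + \<epsilon>)" .
  qed (use C Ct0 P0 in simp)
  finally show ?thesis by (simp add: mult.assoc)
 qed
 show ?thesis
 proof (rule bigoI)
  show "eventually (\<lambda>x. norm (S_dc c x - x powr (1/c) * const_dc c) <= ((C + Ct * 2 powr \<eta> + 2 * P * C) * Ca^6) * norm (x powr (theta_c c + \<epsilon>))) at_top"
   using eventually_ge_at_top[of 1] by eventually_elim (use bound in \<open>simp add: \<theta>_def\<close>)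
 qed
qed

end
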